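(* Let $L$ be a link in $S^3$ with link group $G_L=\pi_1(S^3-L)$. (1) If $L$ is two-tone $D_m$-colorable for some odd $m\ge 3$, then $G_L$ admits a surjective homomorphism to $D_n$ for every $n\ge 3$. (2) If $G_L$ admits a surjective homomorphism to $D_n$ for some $n\ge 3$, then $L$ contains a two-tone $D_n$-colorable sub-link or a Fox $n$-colorable sub-link (a sub-link may be $L$ itself).
   Context: Dihedral groups: $D_n=\langle a,b\mid a^2=b^n=(ab)^2=e\rangle$ is the dihedral group of degree $n$ (order $2n$). Put $a_i=ab^i$ ($0\le i\le n-1$, the reflections) and $b_j=b^j$ ($1\le j\le n-1$, the nontrivial rotations), so $D_n=\{e,a_0,\dots,a_{n-1},b_1,\dots,b_{n-1}\}$. Colorings: let $D$ be a diagram of an oriented link. A $D_n$-coloring on $D$ is a map $\Gamma:\{\text{arcs of }D\}\to D_n$ such that at each crossing, with over arc $x$, under arc $y$ before passing through the crossing and under arc $z$ after it, one has $\Gamma(x)\Gamma(z)=\Gamma(y)\Gamma(x)$ if the crossing is positive and $\Gamma(z)\Gamma(x)=\Gamma(x)\Gamma(y)$ if it is negative. The coloring $\Gamma$ is two-tone if $e\notin\mathrm{Im}(\Gamma)$ and $\mathrm{Im}(\Gamma)$ contains at least one $a_i$ and at least one $b_j$. A link is two-tone $D_n$-colorable if, with some orientation, it has a diagram admitting a two-tone $D_n$-coloring. A Fox $n$-coloring on a link diagram is a map $\Gamma$ from its arcs to $\{0,1,\dots,n-1\}$ with $2\Gamma(x)\equiv\Gamma(y)+\Gamma(z)\pmod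 n$ at each crossing with over arc $x$ and under arcs $y,z$. A link is Fox $n$-colorable if a diagram of it admits a Fox $n$-coloring using at least two colors. *)

theory Defs
  imports
    "HOL-Analysis.Analysis"
    "HOL-Algebra.Generated_Groups"
    "HOL-Number_Theory.Cong"
begin

section \<open>Dihedral groups\<close>

text \<open>The pair \<open>(s, k)\<close> stands for \<open>a\<^sup>s b\<^sup>k\<close>; the product uses \<open>b\<^sup>k a = a b\<^sup>-\<^sup>k\<close>.
  The lemmas below show that this is the group presented by
  \<open>a, b | a\<^sup>2 = b\<^sup>n = (ab)\<^sup>2 = e\<close> and that it has order \<open>2n\<close>.\<close>

definition dihedral :: "nat \<Rightarrow> (bool \<times> int) monoid" where
  "dihedral n =
     \<lparr>carrier = UNIV \<times> {0..<int n},
      mult = (\<lambda>(s, k) (t, l). (s \<noteq> t, ((if t then - k else k) + l) mod int n)),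
      one = (False, 0)\<rparr>"

definition dih_a :: "bool \<times> int" where
  "dih_a = (True, 0)"

definition dih_b :: "nat \<Rightarrow> bool \<times> int" where
  "dih_b n = (False, 1 mod int n)"

definition reflection :: "nat \<Rightarrow> nat \<Rightarrow> bool \<times> int" where
  "reflection n i = dih_a \<otimes>\<^bsub>dihedral n\<^esub> (dih_b n [^]\<^bsub>dihedral n\<^esub> i)"

definition rotation :: "nat \<Rightarrow> nat \<Rightarrow> bool \<times> int" where
  "rotation n j = dih_b n [^]\<^bsub>dihedral n\<^esub> j"

lemma carrier_dihedral: "carrier (dihedral n) = UNIV \<times> {0..<int n}"
  by (simp add: dihedral_def)

lemma one_dihedral: "\<one>\<^bsub>dihedral n\<^esub> = (False, 0)"
  by (simp add: dihedral_def)

lemma mult_dihedral: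
  "(s, k) \<otimes>\<^bsub>dihedral n\<^esub> (t, l) = (s \<noteq> t, ((if t then - k else k) + l) mod int n)"
  by (simp add: dihedral_def)

lemma group_dihedral:
  assumes "n \<ge> 1"
  shows "group (dihedral n)"
proof (rule groupI)
  fix x y z
  assume "x \<in> carrier (dihedral n)" "y \<in> carrier (dihedral n)" "z \<in> carrier (dihedral n)"
  obtain s k where x: "x = (s, k)" by fastforce
  obtain t l where y: "y = (t, l)" by fastforce
  obtain u m where z: "z = (u, m)" by fastforce
  show "x \<otimes>\<^bsub>dihedral n\<^esub> y \<otimes>\<^bsub>dihedral n\<^esub> z = x \<otimes>\<^bsub>dihedral n\<^esub> (y \<otimes>\<^bsub>dihedral n\<^esub> z)"
  proof -
    have m: "(a mod int n + b) mod int n = (a + b) mod int n"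
      "(a + b mod int n) mod int n = (a + b) mod int n"
      "(- (a mod int n) + b) mod int n = (- a + b) mod int n" for a b
      by (metis mod_add_left_eq, metis mod_add_right_eq, metis mod_add_left_eq mod_minus_eq)
    show ?thesis
      unfolding x y z mult_dihedral by (cases t; cases u) (simp_all only: m if_True if_False simp_thms, simp_all add: algebra_simps)
  qed
next
  fix x
  assume "x \<in> carrier (dihedral n)"
  then obtain s k where x: "x = (s, k)" and k: "0 \<le> k" "k < int n"
    by (auto simp: carrier_dihedral)
  show "\<exists>y\<in>carrier (dihedral n). y \<otimes>\<^bsub>dihedral n\<^esub> x = \<one>\<^bsub>dihedral n\<^esub>"
    by (rule bexI[of _ "(s, if s then k else (- k) mod int n)"])
      (use assms k in \<open>simp_all add: x mult_dihedral one_dihedral carrier_dihedral mod_add_left_eq\<close>)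
next
  fix x y
  show "x \<otimes>\<^bsub>dihedral n\<^esub> y \<in> carrier (dihedral n)"
    by (cases x; cases y) (use assms in \<open>simp add: carrier_dihedral mult_dihedral\<close>)
qed (use assms in \<open>auto simp: carrier_dihedral one_dihedral mult_dihedral\<close>)

lemma order_dihedral: "card (carrier (dihedral n)) = 2 * n"
  by (simp add: carrier_dihedral card_cartesian_product)

lemma rotation_eq: "rotation n j = (False, int j mod int n)"
proof (induction j)
  case 0
  show ?case by (simp add: rotation_def one_dihedral)
next
  case (Suc j)
  have "rotation n (Suc j) = rotation n j \<otimes>\<^bsub>dihedral n\<^esub> dih_b n"
    by (simp add: rotation_def)
  then show ?case
    by (simp add: Suc mult_dihedral dih_b_def mod_simps add.commute)
qed

lemma reflection_eq: "reflection n i = (True, int i mod int n)"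
  using rotation_eq[of n i] by (simp add: reflection_def rotation_def dih_a_def mult_dihedral)

lemma dihedral_relations:
  "dih_a \<otimes>\<^bsub>dihedral n\<^esub> dih_a = \<one>\<^bsub>dihedral n\<^esub>"
  "dih_b n [^]\<^bsub>dihedral n\<^esub> n = \<one>\<^bsub>dihedral n\<^esub>"
  "(dih_a \<otimes>\<^bsub>dihedral n\<^esub> dih_b n) \<otimes>\<^bsub>dihedral n\<^esub> (dih_a \<otimes>\<^bsub>dihedral n\<^esub> dih_b n) = \<one>\<^bsub>dihedral n\<^esub>"
  using rotation_eq[of n n]
  by (simp_all add: rotation_def dih_a_def dih_b_def mult_dihedral one_dihedral)

lemma carrier_dihedral_elements:
  assumes "n \<ge> 1"
  shows "carrier (dihedral n) = reflection n ` {..<n} \<union> rotation n ` {..<n}"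
proof -
  have I: "{0..<int n} = (\<lambda>i. int i mod int n) ` {..<n}"
  proof -
    have "(\<lambda>i. int i mod int n) ` {..<n} = int ` {..<n}"
      by (rule image_cong) (auto simp: mod_pos_pos_trivial)
    then show ?thesis by (simp add: image_int_atLeastLessThan lessThan_atLeast0)
  qed
  have "carrier (dihedral n) = Pair True ` {0..<int n} \<union> Pair False ` {0..<int n}"
    by (auto simp: carrier_dihedral)
  then show ?thesis unfolding I image_image by (simp add: reflection_eq rotation_eq)
qed

lemma generate_dihedral:
  assumes "n \<ge> 1"
  shows "generate (dihedral n) {dih_a, dih_b n} = carrier (dihedral n)"
proof
  interpret group "dihedral n" by (rule group_dihedral[OF assms])
  show "generate (dihedral n) {dih_a, dih_b n} \<subseteq> carrier (dihedral n)"
    by (rule generate_incl) (use assms in \<open>auto simp: carrier_dihedral dih_a_def dih_b_def\<close>)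
  have rot: "rotation n j \<in> generate (dihedral n) {dih_a, dih_b n}" for j
  proof (induction j)
    case (Suc j)
    then show ?case
      by (auto simp: rotation_def intro: generate.eng generate.incl)
  qed (simp add: rotation_def generate.one)
  have "reflection n i \<in> generate (dihedral n) {dih_a, dih_b n}" for i
    using rot[of i] by (auto simp: reflection_def rotation_def intro: generate.eng generate.incl)
  with rot show "carrier (dihedral n) \<subseteq> generate (dihedral n) {dih_a, dih_b n}"
    by (auto simp: carrier_dihedral_elements[OF assms])
qed

lemma dihedral_universal:
  assumes "n \<ge> 1" "group H" "x \<in> carrier H" "y \<in> carrier H"
    and xx: "x \<otimes>\<^bsub>H\<^esub> x = \<one>\<^bsub>H\<^esub>" and yn: "y [^]\<^bsub>H\<^esub> n = \<one>\<^bsub>H\<^esub>"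
    and xyxy: "(x \<otimes>\<^bsub>H\<^esub> y) \<otimes>\<^bsub>H\<^esub> (x \<otimes>\<^bsub>H\<^esub> y) = \<one>\<^bsub>H\<^esub>"
  shows "\<exists>f \<in> hom (dihedral n) H. f dih_a = x \<and> f (dih_b n) = y"
proof -
  interpret H: group H by fact
  note [simp] = \<open>x \<in> carrier H\<close> \<open>y \<in> carrier H\<close>
  have yper: "y [^]\<^bsub>H\<^esub> (k mod int n) = y [^]\<^bsub>H\<^esub> k" for k :: int
  proof -
    have "y [^]\<^bsub>H\<^esub> (int n * (k div int n)) = \<one>\<^bsub>H\<^esub>"
      using yn by (simp flip: H.int_pow_pow add: int_pow_int H.int_pow_one)
    moreover have "y [^]\<^bsub>H\<^esub> (int n * (k div int n) + k mod int n)
        = y [^]\<^bsub>H\<^esub> (int n * (k div int n)) \<otimes>\<^bsub>H\<^esub> y [^]\<^bsub>H\<^esub> (k mod int n)"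
      by (rule H.int_pow_mult) simp
    ultimately show ?thesis by simp
  qed
  have invx: "inv\<^bsub>H\<^esub> x = x" using xx by (simp add: H.inv_equality)
  have conj1: "x \<otimes>\<^bsub>H\<^esub> y \<otimes>\<^bsub>H\<^esub> x = inv\<^bsub>H\<^esub> y"
  proof -
    have "(x \<otimes>\<^bsub>H\<^esub> y \<otimes>\<^bsub>H\<^esub> x) \<otimes>\<^bsub>H\<^esub> y = \<one>\<^bsub>H\<^esub>"
      using xyxy by (simp add: H.m_assoc)
    then show ?thesis by (simp add: H.inv_equality)
  qed
  have xxz: "x \<otimes>\<^bsub>H\<^esub> (x \<otimes>\<^bsub>H\<^esub> z) = z" if "z \<in> carrier H" for z
    using that xx by (simp flip: H.m_assoc)
  have conjn: "x \<otimes>\<^bsub>H\<^esub> y [^]\<^bsub>H\<^esub> j \<otimes>\<^bsub>H\<^esub> x = inv\<^bsub>H\<^esub> (y [^]\<^bsub>H\<^esub> j)" for j :: nat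
  proof (induction j)
    case (Suc j)
    have "x \<otimes>\<^bsub>H\<^esub> y [^]\<^bsub>H\<^esub> Suc j \<otimes>\<^bsub>H\<^esub> x
        = (x \<otimes>\<^bsub>H\<^esub> y [^]\<^bsub>H\<^esub> j \<otimes>\<^bsub>H\<^esub> x) \<otimes>\<^bsub>H\<^esub> (x \<otimes>\<^bsub>H\<^esub> y \<otimes>\<^bsub>H\<^esub> x)"
      by (simp add: H.m_assoc xxz)
    also have "\<dots> = inv\<^bsub>H\<^esub> (y \<otimes>\<^bsub>H\<^esub> y [^]\<^bsub>H\<^esub> j)"
      by (simp add: Suc conj1 H.inv_mult_group)
    also have "\<dots> = inv\<^bsub>H\<^esub> (y [^]\<^bsub>H\<^esub> Suc j)"
      by (simp only: H.nat_pow_Suc2[OF \<open>y \<in> carrier H\<close>])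
    finally show ?case .
  qed (simp add: xx)
  have swap: "y [^]\<^bsub>H\<^esub> k \<otimes>\<^bsub>H\<^esub> x = x \<otimes>\<^bsub>H\<^esub> y [^]\<^bsub>H\<^esub> (- k)" for k :: int
  proof (cases "k \<ge> 0")
    case True
    then obtain j where k: "k = int j" by (metis nonneg_int_cases)
    have "x \<otimes>\<^bsub>H\<^esub> inv\<^bsub>H\<^esub> (y [^]\<^bsub>H\<^esub> j) = y [^]\<^bsub>H\<^esub> j \<otimes>\<^bsub>H\<^esub> x"
      by (simp add: conjn[symmetric] H.m_assoc xxz)
    then show ?thesis by (simp add: k H.int_pow_neg int_pow_int)
  next
    case False
    then obtain j where k: "k = - int j" by (metis int_cases4 linorder_not_le of_nat_0_le_iff)
    have "inv\<^bsub>H\<^esub> (y [^]\<^bsub>H\<^esub> j) \<otimes>\<^bsub>H\<^esub> x = x \<otimes>\<^bsub>H\<^esub> y [^]\<^bsub>H\<^esub> j"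
      by (simp add: conjn[symmetric] H.m_assoc xx)
    then show ?thesis by (simp add: k H.int_pow_neg int_pow_int)
  qed
  define f where "f = (\<lambda>(s, k). (if s then x else \<one>\<^bsub>H\<^esub>) \<otimes>\<^bsub>H\<^esub> y [^]\<^bsub>H\<^esub> (k :: int))"
  have "f (p \<otimes>\<^bsub>dihedral n\<^esub> q) = f p \<otimes>\<^bsub>H\<^esub> f q" for p q
  proof -
    obtain s k where p: "p = (s, k)" by fastforce
    obtain t l where q: "q = (t, l)" by fastforce
    show ?thesis
    proof (cases t)
      case True
      have "f p \<otimes>\<^bsub>H\<^esub> f q = (if s then x else \<one>\<^bsub>H\<^esub>) \<otimes>\<^bsub>H\<^esub> (y [^]\<^bsub>H\<^esub> k \<otimes>\<^bsub>H\<^esub> x) \<otimes>\<^bsub>H\<^esub> y [^]\<^bsub>H\<^esub> l"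
        by (simp add: f_def p q True H.m_assoc)
      also have "\<dots> = ((if s then x else \<one>\<^bsub>H\<^esub>) \<otimes>\<^bsub>H\<^esub> x) \<otimes>\<^bsub>H\<^esub> y [^]\<^bsub>H\<^esub> (- k + l)"
        unfolding swap by (simp only: H.int_pow_mult[OF \<open>y \<in> carrier H\<close>])
          (simp add: H.m_assoc)
      also have "\<dots> = f (p \<otimes>\<^bsub>dihedral n\<^esub> q)"
        using True xx by (simp add: f_def p q mult_dihedral yper)
      finally show ?thesis by simp
    next
      case False
      then show ?thesis
        by (simp add: f_def p q mult_dihedral yper H.int_pow_mult H.m_assoc)
    qed
  qed
  moreover have "f dih_a = x" "f (dih_b n) = y"
    using yper[of 1] by (simp_all add: f_def dih_a_def dih_b_def)
  moreover have "f p \<in> carrier H" for p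
    by (cases p) (simp add: f_def)
  ultimately show ?thesis by (intro bexI[of _ f]) (auto simp: hom_def)
qed


section \<open>The fundamental group\<close>

definition loops :: "'a::real_normed_vector set \<Rightarrow> 'a \<Rightarrow> (real \<Rightarrow> 'a) set" where
  "loops S x = {g. path g \<and> path_image g \<subseteq> S \<and> pathstart g = x \<and> pathfinish g = x}"

definition path_class :: "'a::real_normed_vector set \<Rightarrow> (real \<Rightarrow> 'a) \<Rightarrow> (real \<Rightarrow> 'a) set" where
  "path_class S g = {h. homotopic_paths S g h}"

definition fundamental_group ::
    "'a::real_normed_vector set \<Rightarrow> 'a \<Rightarrow> (real \<Rightarrow> 'a) set monoid" where
  "fundamental_group S x =
     \<lparr>carrier = path_class S ` loops S x,
      mult = (\<lambda>A B. \<Union>f\<in>A. \<Union>g\<in>B. path_class S (f +++ g)),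
      one = path_class S (linepath x x)\<rparr>"

lemma path_class_eq: "homotopic_paths S f g \<Longrightarrow> path_class S f = path_class S g"
  unfolding path_class_def by (blast intro: homotopic_paths_sym homotopic_paths_trans)

lemma fundamental_group_mult:
  assumes "f \<in> loops S x" "g \<in> loops S x"
  shows "path_class S f \<otimes>\<^bsub>fundamental_group S x\<^esub> path_class S g = path_class S (f +++ g)"
proof -
  have "path_class S (f' +++ g') = path_class S (f +++ g)"
    if "f' \<in> path_class S f" "g' \<in> path_class S g" for f' g'
  proof (rule path_class_eq[symmetric], rule homotopic_paths_join)
    show "homotopic_paths S f f'" "homotopic_paths S g g'"
      using that by (simp_all add: path_class_def)
    show "pathfinish f = pathstart g"
      using assms by (simp add: loops_def)
  qed
  moreover have "f \<in> path_class S f" "g \<in> path_class S g"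
    using assms by (auto simp: path_class_def loops_def)
  ultimately have "(\<Union>f'\<in>path_class S f. \<Union>g'\<in>path_class S g. path_class S (f' +++ g'))
      = path_class S (f +++ g)"
    by blast
  then show ?thesis by (simp add: fundamental_group_def)
qed

lemma group_fundamental_group:
  assumes "x \<in> S"
  shows "group (fundamental_group S x)"
proof -
  let ?G = "fundamental_group S x"
  have car: "carrier ?G = path_class S ` loops S x"
    and one: "\<one>\<^bsub>?G\<^esub> = path_class S (linepath x x)"
    by (simp_all add: fundamental_group_def)
  have join: "f +++ g \<in> loops S x" if "f \<in> loops S x" "g \<in> loops S x" for f g
    using that by (simp add: loops_def path_image_join)
  have const: "linepath x x \<in> loops S x"
    using assms by (simp add: loops_def)
  have rev: "reversepath f \<in> loops S x" if "f \<in> loops S x" for f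
    using that by (simp add: loops_def)
  show ?thesis
  proof (rule groupI)
    fix A B C assume "A \<in> carrier ?G" "B \<in> carrier ?G" "C \<in> carrier ?G"
    then obtain f g h where *: "f \<in> loops S x" "g \<in> loops S x" "h \<in> loops S x"
      "A = path_class S f" "B = path_class S g" "C = path_class S h" by (auto simp: car)
    have "path_class S (f +++ (g +++ h)) = path_class S ((f +++ g) +++ h)"
      by (rule path_class_eq, rule homotopic_paths_assoc) (use * in \<open>auto simp: loops_def\<close>)
    then show "A \<otimes>\<^bsub>?G\<^esub> B \<otimes>\<^bsub>?G\<^esub> C = A \<otimes>\<^bsub>?G\<^esub> (B \<otimes>\<^bsub>?G\<^esub> C)"
      by (simp add: * fundamental_group_mult join)
  next
    fix A assume "A \<in> carrier ?G"
    then obtain f where *: "f \<in> loops S x" "A = path_class S f" by (auto simp: car)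
    have "path_class S (linepath x x +++ f) = path_class S f"
      by (rule path_class_eq, rule homotopic_paths_lid') (use * in \<open>simp_all add: loops_def\<close>)
    then show "\<one>\<^bsub>?G\<^esub> \<otimes>\<^bsub>?G\<^esub> A = A" by (simp add: * one fundamental_group_mult const)
    have "path_class S (reversepath f +++ f) = path_class S (linepath x x)"
      by (rule path_class_eq) (use * homotopic_paths_linv[of f S] in \<open>auto simp: loops_def\<close>)
    then have "path_class S (reversepath f) \<otimes>\<^bsub>?G\<^esub> A = \<one>\<^bsub>?G\<^esub>"
      using * by (simp add: one fundamental_group_mult rev)
    moreover have "path_class S (reversepath f) \<in> carrier ?G"
      unfolding car using * by (intro imageI rev)
    ultimately show "\<exists>B\<in>carrier ?G. B \<otimes>\<^bsub>?G\<^esub> A = \<one>\<^bsub>?G\<^esub>" by blast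
  next
    fix A B assume "A \<in> carrier ?G" "B \<in> carrier ?G"
    then obtain f g where *: "f \<in> loops S x" "g \<in> loops S x"
      "A = path_class S f" "B = path_class S g" by (auto simp: car)
    show "A \<otimes>\<^bsub>?G\<^esub> B \<in> carrier ?G"
      unfolding * fundamental_group_mult[OF *(1,2)] car by (intro imageI join *)
  next
    show "\<one>\<^bsub>?G\<^esub> \<in> carrier ?G"
      unfolding car one by (intro imageI const)
  qed
qed


section \<open>Oriented polygonal links in space\<close>

text \<open>Space is \<open>\<real>\<^sup>3 = \<complex> \<times> \<real>\<close>: diagrams are drawn in the plane \<open>\<complex>\<close>, so \<open>fst\<close> is the
  projection and \<open>snd\<close> the height.  An oriented polygonal link is a finite set of closed
  polygons, each given by the list of its vertices; the order of the list is the
  orientation.\<close>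

type_synonym space = "complex \<times> real"

definition vertex :: "space list \<Rightarrow> nat \<Rightarrow> space" where
  "vertex vs i = vs ! (i mod length vs)"

definition edge :: "space list \<Rightarrow> nat \<Rightarrow> space set" where
  "edge vs i = closed_segment (vertex vs i) (vertex vs (Suc i))"

definition polygon_set :: "space list \<Rightarrow> space set" where
  "polygon_set vs = (\<Union>i<length vs. edge vs i)"

definition simple_polygon :: "space list \<Rightarrow> bool" where
  "simple_polygon vs \<longleftrightarrow>
     3 \<le> length vs \<and> distinct vs \<and>
     (\<forall>i<length vs. \<forall>j<length vs. i \<noteq> j \<longrightarrow>
        edge vs i \<inter> edge vs j =
          {v. (v = vertex vs j \<and> j = Suc i mod length vs) \<or>
              (v = vertex vs i \<and> i = Suc j mod length vs)})"

definition polygonal_link :: "space list set \<Rightarrow> bool" where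
  "polygonal_link P \<longleftrightarrow>
     finite P \<and> P \<noteq> {} \<and> (\<forall>vs\<in>P. simple_polygon vs) \<and>
     pairwise (\<lambda>vs ws. disjnt (polygon_set vs) (polygon_set ws)) P"

definition link_set :: "space list set \<Rightarrow> space set" where
  "link_set P = (\<Union>vs\<in>P. polygon_set vs)"


section \<open>Links in the three-sphere\<close>

definition S3 :: "(space \<times> real) set" where
  "S3 = sphere 0 1"

text \<open>Inverse stereographic projection, identifying \<open>\<real>\<^sup>3\<close> with \<open>S3 - {(0, 1)}\<close>.\<close>

definition to_S3 :: "space \<Rightarrow> space \<times> real" where
  "to_S3 x = ((2 / ((norm x)\<^sup>2 + 1)) *\<^sub>R x, ((norm x)\<^sup>2 - 1) / ((norm x)\<^sup>2 + 1))"

lemma to_S3_in_S3: "to_S3 x \<in> S3"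
proof -
  let ?r = "(norm x)\<^sup>2"
  have r: "?r + 1 > 0" by (simp add: add_nonneg_pos)
  have "(norm (to_S3 x))\<^sup>2 = (2 / (?r + 1) * norm x)\<^sup>2 + ((?r - 1) / (?r + 1))\<^sup>2"
    by (simp add: to_S3_def norm_Pair power_divide)
  also have "\<dots> = (4 * ?r + (?r - 1)\<^sup>2) / (?r + 1)\<^sup>2"
    by (simp add: power_mult_distrib power_divide add_divide_distrib)
  also have "\<dots> = 1"
  proof -
    have "4 * ?r + (?r - 1)\<^sup>2 = (?r + 1)\<^sup>2"
      by (simp add: power2_diff power2_sum)
    then show ?thesis using r by simp
  qed
  finally show ?thesis
    by (simp add: S3_def power2_eq_1_iff) (metis norm_ge_zero not_one_le_zero neg_0_le_iff_le)
qed

definition ambient_isotopic :: "(space \<times> real) set \<Rightarrow> (space \<times> real) set \<Rightarrow> bool" where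
  "ambient_isotopic K L \<longleftrightarrow>
     (\<exists>H :: real \<times> (space \<times> real) \<Rightarrow> space \<times> real.
        continuous_on ({0..1} \<times> S3) H \<and>
        (\<forall>t\<in>{0..1}. \<exists>g. homeomorphism S3 S3 (\<lambda>x. H (t, x)) g) \<and>
        (\<forall>x\<in>S3. H (0, x) = x) \<and>
        (\<lambda>x. H (1, x)) ` K = L)"

text \<open>Links are tame, as is implicit in speaking of their diagrams.\<close>

definition is_link :: "(space \<times> real) set \<Rightarrow> bool" where
  "is_link L \<longleftrightarrow> (\<exists>P. polygonal_link P \<and> ambient_isotopic (to_S3 ` link_set P) L)"

definition sublink :: "(space \<times> real) set \<Rightarrow> (space \<times> real) set \<Rightarrow> bool" where
  "sublink K L \<longleftrightarrow> (\<exists>C \<subseteq> components L. C \<noteq> {} \<and> K = \<Union>C)"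


section \<open>Diagrams\<close>

text \<open>A diagram is represented by an oriented polygonal link in regular position: the
  projection has only finitely many multiple points, these are double points, and no
  double point is the image of a vertex.  (Hence no edge is vertical and the strands meet
  transversally at every double point.)\<close>

definition fibre :: "space list set \<Rightarrow> complex \<Rightarrow> space set" where
  "fibre P z = {p \<in> link_set P. fst p = z}"

definition regular_position :: "space list set \<Rightarrow> bool" where
  "regular_position P \<longleftrightarrow>
     (\<forall>z. finite (fibre P z) \<and> card (fibre P z) \<le> 2) \<and>
     finite {z. card (fibre P z) = 2} \<and>
     (\<forall>vs\<in>P. \<forall>v\<in>set vs. fibre P (fst v) = {v})"

definition diagram :: "space list set \<Rightarrow> bool" where
  "diagram P \<longleftrightarrow> polygonal_link P \<and> regular_position P"

definition diagram_of :: "space list set \<Rightarrow> (space \<times> real) set \<Rightarrow> bool" where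
  "diagram_of P L \<longleftrightarrow> diagram P \<and> ambient_isotopic (to_S3 ` link_set P) L"

definition crossing :: "space list set \<Rightarrow> space \<Rightarrow> space \<Rightarrow> bool" where
  "crossing P p q \<longleftrightarrow>
     p \<in> link_set P \<and> q \<in> link_set P \<and> fst p = fst q \<and> snd q < snd p"

text \<open>The arcs of the diagram, as pieces of the link lying over them.  A closed component
  that never passes under is a single arc.\<close>

definition diagram_arcs :: "space list set \<Rightarrow> space set set" where
  "diagram_arcs P = components (link_set P - {q. \<exists>p. crossing P p q})"

text \<open>\<open>heading P p u\<close>: the oriented edge through \<open>p\<close> has direction \<open>u\<close>
  (unique unless \<open>p\<close> is a vertex, which a crossing point never is).\<close>

definition heading :: "space list set \<Rightarrow> space \<Rightarrow> space \<Rightarrow> bool" where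
  "heading P p u \<longleftrightarrow>
     (\<exists>vs\<in>P. \<exists>i<length vs. p \<in> edge vs i \<and> u = vertex vs (Suc i) - vertex vs i)"

text \<open>There is a crossing with over direction \<open>u\<close>, under direction \<open>v\<close>, over arc \<open>x\<close>,
  and under arcs \<open>y\<close> before and \<open>z\<close> after passing through the crossing.\<close>

definition crossing_arcs ::
    "space list set \<Rightarrow> space \<Rightarrow> space \<Rightarrow> space set \<Rightarrow> space set \<Rightarrow> space set \<Rightarrow> bool" where
  "crossing_arcs P u v x y z \<longleftrightarrow>
     x \<in> diagram_arcs P \<and> y \<in> diagram_arcs P \<and> z \<in> diagram_arcs P \<and>
     (\<exists>p q. crossing P p q \<and> heading P p u \<and> heading P q v \<and> p \<in> x \<and>
        (\<forall>\<^sub>F t in at_right 0. q - t *\<^sub>R v \<in> y) \<and>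
        (\<forall>\<^sub>F t in at_right 0. q + t *\<^sub>R v \<in> z))"

text \<open>\<open>Im (cnj u * v)\<close> is the determinant of the plane vectors \<open>u, v\<close>: a crossing is
  positive if the under strand passes from right to left of the over strand.\<close>

definition positive_crossing ::
    "space list set \<Rightarrow> space set \<Rightarrow> space set \<Rightarrow> space set \<Rightarrow> bool" where
  "positive_crossing P x y z \<longleftrightarrow>
     (\<exists>u v. crossing_arcs P u v x y z \<and> 0 < Im (cnj (fst u) * fst v))"

definition negative_crossing ::
    "space list set \<Rightarrow> space set \<Rightarrow> space set \<Rightarrow> space set \<Rightarrow> bool" where
  "negative_crossing P x y z \<longleftrightarrow>
     (\<exists>u v. crossing_arcs P u v x y z \<and> Im (cnj (fst u) * fst v) < 0)"


section \<open>Colorings\<close>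

definition dihedral_coloring ::
    "nat \<Rightarrow> space list set \<Rightarrow> (space set \<Rightarrow> bool \<times> int) \<Rightarrow> bool" where
  "dihedral_coloring n P \<Gamma> \<longleftrightarrow>
     \<Gamma> ` diagram_arcs P \<subseteq> carrier (dihedral n) \<and>
     (\<forall>x y z. positive_crossing P x y z \<longrightarrow>
        \<Gamma> x \<otimes>\<^bsub>dihedral n\<^esub> \<Gamma> z = \<Gamma> y \<otimes>\<^bsub>dihedral n\<^esub> \<Gamma> x) \<and>
     (\<forall>x y z. negative_crossing P x y z \<longrightarrow>
        \<Gamma> z \<otimes>\<^bsub>dihedral n\<^esub> \<Gamma> x = \<Gamma> x \<otimes>\<^bsub>dihedral n\<^esub> \<Gamma> y)"

definition two_tone :: "nat \<Rightarrow> space list set \<Rightarrow> (space set \<Rightarrow> bool \<times> int) \<Rightarrow> bool" where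
  "two_tone n P \<Gamma> \<longleftrightarrow>
     \<one>\<^bsub>dihedral n\<^esub> \<notin> \<Gamma> ` diagram_arcs P \<and>
     (\<exists>i\<in>{0..<n}. reflection n i \<in> \<Gamma> ` diagram_arcs P) \<and>
     (\<exists>j\<in>{1..<n}. rotation n j \<in> \<Gamma> ` diagram_arcs P)"

text \<open>The orientation of the link is part of \<open>P\<close>, so it is existentially quantified too.\<close>

definition two_tone_colorable :: "nat \<Rightarrow> (space \<times> real) set \<Rightarrow> bool" where
  "two_tone_colorable n L \<longleftrightarrow>
     (\<exists>P \<Gamma>. diagram_of P L \<and> dihedral_coloring n P \<Gamma> \<and> two_tone n P \<Gamma>)"

definition fox_coloring :: "nat \<Rightarrow> space list set \<Rightarrow> (space set \<Rightarrow> nat) \<Rightarrow> bool" where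
  "fox_coloring n P \<Gamma> \<longleftrightarrow>
     \<Gamma> ` diagram_arcs P \<subseteq> {0..<n} \<and>
     (\<forall>u v x y z. crossing_arcs P u v x y z \<longrightarrow> [2 * \<Gamma> x = \<Gamma> y + \<Gamma> z] (mod n))"

definition fox_colorable :: "nat \<Rightarrow> (space \<times> real) set \<Rightarrow> bool" where
  "fox_colorable n L \<longleftrightarrow>
     (\<exists>P \<Gamma>. diagram_of P L \<and> fox_coloring n P \<Gamma> \<and>
        (\<exists>\<alpha>\<in>diagram_arcs P. \<exists>\<beta>\<in>diagram_arcs P. \<Gamma> \<alpha> \<noteq> \<Gamma> \<beta>))"

end

theory Submission
 imports Defs
begin

section \<open>Representations of the fundamental groupoid\<close>

text \<open>The bridge between diagrams and link groups is the Wirtinger correspondence: coloring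
  the arcs of a diagram by elements of a group \<open>G\<close> so that the relation holds at every
  crossing amounts to giving a homomorphism from the link group to \<open>G\<close>. The color of an
  arc is the value of the meridian passing beneath it, and the colors generate the image. Instead of
  a presentation of the link group, the proof uses functions on paths that are multiplicative and
  invariant under homotopy (\<open>groupoid_rep\<close>); these can be built from local data,
  restricted, pulled back and conjugated pointwise. The points off the link with no part of the link
  above them form a simply connected set, \<open>top_region\<close>, which plays the role of a base
  point. A coloring gives local labels and thereby a representation that is trivial on
  \<open>top_region\<close> (\<open>coloring_label\<close>, \<open>coloring_rep\<close>).
  Conversely, a representation trivial there gives a coloring whose values generate all values of
  paths between points of \<open>top_region\<close> (\<open>crossing_sectors\<close>,
  \<open>coloring_of_rep\<close>). The point at infinity of the three-sphere has simply connected
  punctured neighbourhoods, so nothing is lost between space and sphere (\<open>extend_rep\<close>,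
  \<open>generation_S3\<close>).

  Part (1), in \<open>two_tone_lift\<close>: conjugation preserves the types reflection and
  rotation. A nontrivial rotation \<open>b^k\<close> turns into its inverse when it passes under a
  reflection and is unchanged otherwise. As \<open>m\<close> is odd, \<open>k\<close> and
  \<open>-k\<close> lie in different halves of the residues, so a sign survives that makes sense for
  every \<open>n\<close>. Rotations can therefore be recolored by \<open>b^s\<close> or its inverse
  with a single integer unknown \<open>s\<close>, and reflections by \<open>a b^x\<close> with an
  integer unknown \<open>x\<close> for each piece of strand. The crossing relations become
  homogeneous linear equations, one per reflection piece, in one unknown more. Weighted by the signs
  of a checkerboard coloring of the plane (\<open>parity\<close>), the equations add up to zero, so
  one of them can be traded for the normalization \<open>x = 0\<close> at one reflection. A nonzero
  integer solution divided by its gcd has coprime entries; modulo \<open>n\<close> it is a coloring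
  that contains \<open>a\<close> and generates \<open>D_n\<close>.

  Part (2), in \<open>epi_sublink\<close>: a surjection gives a coloring whose values generate
  \<open>D_n\<close>. Components colored by the identity are erased (\<open>coloring_erase\<close>).
  Among the remaining colors there is a reflection, since rotations generate only rotations. If a
  rotation occurs too, the coloring is two-tone. Otherwise all colors are reflections, the crossing
  relation is Fox's condition on the exponents, and at least two colors occur because one reflection
  generates a group of order two.

  That a tame link has a diagram in the required sense at all is \<open>link_has_diagram\<close>: a
  generic shear puts a polygonal link into regular position, and shears extend to ambient isotopies
  of the sphere.\<close>

locale groupoid_rep = group G for G (structure) +
 fixes X :: "'a::real_normed_vector set" and \<Phi> :: "(real => 'a) => 'b"
 assumes closed: "[|path g; path_image g \<subseteq> X|] ==> \<Phi> g \<in> carrier G"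
  and homotopic: "homotopic_paths X g h ==> \<Phi> g = \<Phi> h"
  and join: "[|path g; path_image g \<subseteq> X; path h; path_image h \<subseteq> X; pathfinish g = pathstart h|]
   ==> \<Phi> (g +++ h) = \<Phi> g \<otimes> \<Phi> h"
begin

lemma const: "x \<in> X ==> \<Phi> (linepath x x) = \<one>"
proof -
 assume x: "x \<in> X"
 have "homotopic_paths X (linepath x x +++ linepath x x) (linepath x x)" by (rule homotopic_paths_lid') (use x in auto)
 then have "\<Phi> (linepath x x) \<otimes> \<Phi> (linepath x x) = \<Phi> (linepath x x)"
  using x homotopic join[of "linepath x x" "linepath x x"] by simp
 moreover have "\<Phi> (linepath x x) \<in> carrier G" using x by (intro closed) auto
 ultimately show ?thesis using l_cancel_one by blast
qed

lemma reverse: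
 assumes "path g" "path_image g \<subseteq> X"
 shows "\<Phi> (reversepath g) = inv (\<Phi> g)"
proof -
 have "pathstart g \<in> X" using assms by auto
 then have "\<Phi> (reversepath g +++ g) = \<one>" using homotopic[OF homotopic_paths_linv[OF assms]] const[of "pathfinish g"] assms
  by (metis (no_types, lifting) in_mono pathfinish_in_path_image)
 then have "\<Phi> (reversepath g) \<otimes> \<Phi> g = \<one>" using assms by (simp add: join)
 then show ?thesis using assms by (metis closed inv_equality path_image_reversepath path_reversepath)
qed

text \<open>A gauge transformation: the factor \<open>k\<close> at the end of one path cancels
  against the factor at the start of the next. It serves to change base points and to make a
  representation trivial on a chosen set.\<close>

lemma gauge:
 assumes "\<And>x. x \<in> X ==> k x \<in> carrier G"
 shows "groupoid_rep G X (\<lambda>g. k (pathstart g) \<otimes> \<Phi> g \<otimes> inv (k (pathfinish g)))"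
proof
 fix g assume g: "path g" "path_image g \<subseteq> X"
 then have "pathstart g \<in> X" "pathfinish g \<in> X" by auto
 then show "k (pathstart g) \<otimes> \<Phi> g \<otimes> inv (k (pathfinish g)) \<in> carrier G" using assms closed g by simp
next
 fix g h assume h: "homotopic_paths X g h"
 then show "k (pathstart g) \<otimes> \<Phi> g \<otimes> inv (k (pathfinish g)) = k (pathstart h) \<otimes> \<Phi> h \<otimes> inv (k (pathfinish h))"
  using homotopic[OF h] homotopic_paths_imp_pathstart[OF h] homotopic_paths_imp_pathfinish[OF h] by simp
next
 fix g h assume gh: "path g" "path_image g \<subseteq> X" "path h" "path_image h \<subseteq> X" "pathfinish g = pathstart h"
 then have "pathstart g \<in> X" "pathfinish g \<in> X" "pathfinish h \<in> X" by auto
 then have c: "k (pathstart g) \<in> carrier G" "k (pathstart h) \<in> carrier G" "k (pathfinish h) \<in> carrier G"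
  "\<Phi> g \<in> carrier G" "\<Phi> h \<in> carrier G" using assms closed gh by auto
 show "k (pathstart (g +++ h)) \<otimes> \<Phi> (g +++ h) \<otimes> inv (k (pathfinish (g +++ h))) =
   (k (pathstart g) \<otimes> \<Phi> g \<otimes> inv (k (pathfinish g))) \<otimes> (k (pathstart h) \<otimes> \<Phi> h \<otimes> inv (k (pathfinish h)))"
  using gh c by (simp add: join m_assoc inv_solve_left' l_inv_ex)
   (metis (no_types, lifting) c inv_closed l_inv l_one m_assoc m_closed)
qed

lemma restrict:
 assumes "Y \<subseteq> X"
 shows "groupoid_rep G Y \<Phi>"
proof
 show "\<Phi> g \<in> carrier G" if "path g" "path_image g \<subseteq> Y" for g using that assms closed by blast
 show "\<Phi> g = \<Phi> h" if "homotopic_paths Y g h" for g h using that assms homotopic homotopic_paths_subset by blast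
 show "\<Phi> (g +++ h) = \<Phi> g \<otimes> \<Phi> h"
  if "path g" "path_image g \<subseteq> Y" "path h" "path_image h \<subseteq> Y" "pathfinish g = pathstart h" for g h
  using that assms by (intro join) auto
qed

lemma pullback:
 assumes "continuous_on Y f" "f \<in> Y \<rightarrow> X"
 shows "groupoid_rep G Y (\<lambda>g. \<Phi> (f \<circ> g))"
proof
 have P: "path (f \<circ> g)" "path_image (f \<circ> g) \<subseteq> X" if "path g" "path_image g \<subseteq> Y" for g
  using that assms by (auto simp: path_image_compose intro!: path_continuous_image continuous_on_subset[OF assms(1)])
 { fix g assume "path g" "path_image g \<subseteq> Y"
  then show "\<Phi> (f \<circ> g) \<in> carrier G" using P closed by blast }
 { fix g h assume "homotopic_paths Y g h"
  then show "\<Phi> (f \<circ> g) = \<Phi> (f \<circ> h)" using assms homotopic homotopic_paths_continuous_image by blast }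
 { fix g h assume gh: "path g" "path_image g \<subseteq> Y" "path h" "path_image h \<subseteq> Y" "pathfinish g = pathstart h"
  then show "\<Phi> (f \<circ> (g +++ h)) = \<Phi> (f \<circ> g) \<otimes> \<Phi> (f \<circ> h)"
   using P join[of "f \<circ> g" "f \<circ> h"] by (simp add: path_compose_join pathfinish_compose pathstart_compose) }
qed

lemma simply_connected_eq:
 assumes "simply_connected S" "S \<subseteq> X" "path g" "path_image g \<subseteq> S" "path h" "path_image h \<subseteq> S"
  "pathstart g = pathstart h" "pathfinish g = pathfinish h"
 shows "\<Phi> g = \<Phi> h"
proof -
 have "homotopic_paths S g h" using assms simply_connected_eq_homotopic_paths by metis
 then show ?thesis using assms homotopic homotopic_paths_subset by blast
qed

lemma convex_join:
 assumes "convex C" "C \<subseteq> X" "x \<in> C" "y \<in> C" "z \<in> C"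
 shows "\<Phi> (linepath x y) \<otimes> \<Phi> (linepath y z) = \<Phi> (linepath x z)"
proof -
 have *: "closed_segment a b \<subseteq> C" if "a \<in> C" "b \<in> C" for a b using assms that by (simp add: closed_segment_subset)
 have "\<Phi> (linepath x y +++ linepath y z) = \<Phi> (linepath x z)"
  by (rule simply_connected_eq[of C]) (use assms * in \<open>auto simp: convex_imp_simply_connected path_image_join\<close>)
 then show ?thesis using join[of "linepath x y" "linepath y z"] * assms by (metis (no_types, lifting) order_trans path_image_linepath
   path_linepath pathfinish_linepath pathstart_linepath)
qed

lemma linepath_closed:
 assumes "convex C" "C \<subseteq> X" "x \<in> C" "y \<in> C"
 shows "\<Phi> (linepath x y) \<in> carrier G" using assms by (intro closed) (auto dest: closed_segment_subset)

lemma linepath_reverse: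
 assumes "convex C" "C \<subseteq> X" "x \<in> C" "y \<in> C"
 shows "\<Phi> (linepath y x) = inv (\<Phi> (linepath x y))" using assms reverse[of "linepath x y"] by (auto dest: closed_segment_subset)

text \<open>On a simply connected set the value of a path depends on its end points only, so
  \<open>\<Phi>\<close> is a coboundary there: \<open>k x\<close> is the value of a chosen path in
  \<open>S\<close> from a fixed point to \<open>x\<close>.\<close>

lemma trivialize:
 assumes "simply_connected S" "S \<subseteq> X"
 obtains k where "\<And>x. k x \<in> carrier G"
  "\<And>g. [|path g; path_image g \<subseteq> S|] ==> k (pathstart g) \<otimes> \<Phi> g \<otimes> inv (k (pathfinish g)) = \<one>"
proof (cases "S = {}")
 case True
 then show ?thesis using that[of "\<lambda>_. \<one>"] by auto
next
 case False
 then obtain a where a: "a \<in> S" by auto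
 have pc: "path_connected S" using assms simply_connected_imp_path_connected by blast
 then have "\<forall>x. \<exists>g. x \<in> S --> path g \<and> path_image g \<subseteq> S \<and> pathstart g = a \<and> pathfinish g = x"
  using a unfolding path_connected_def by blast
 then obtain T where T: "\<And>x. x \<in> S ==> path (T x) \<and> path_image (T x) \<subseteq> S \<and> pathstart (T x) = a \<and> pathfinish (T x) = x"
  by metis
 have TX: "path_image (T x) \<subseteq> X" if "x \<in> S" for x using T[OF that] assms by blast
 define k where "k x = (if x \<in> S then \<Phi> (T x) else \<one>)" for x
 have "k (pathstart g) \<otimes> \<Phi> g \<otimes> inv (k (pathfinish g)) = \<one>" if g: "path g" "path_image g \<subseteq> S" for g
 proof -
  have s: "pathstart g \<in> S" "pathfinish g \<in> S" using g by auto
  have "\<Phi> (T (pathstart g) +++ g) = \<Phi> (T (pathfinish g))"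
   by (rule simply_connected_eq[OF assms]) (use T s g in \<open>auto simp: path_image_join\<close>)
  moreover have "\<Phi> (T (pathstart g) +++ g) = \<Phi> (T (pathstart g)) \<otimes> \<Phi> g" using T s g assms TX by (intro join) auto
  moreover have "\<Phi> (T (pathfinish g)) \<in> carrier G" using T s TX by (intro closed) auto
  ultimately show ?thesis using s by (simp add: k_def)
 qed
 moreover have "k x \<in> carrier G" for x by (simp add: k_def T TX closed)
 ultimately show ?thesis using that by blast
qed

lemma induced_hom:
 assumes "x \<in> X"
 obtains f where "f \<in> hom (fundamental_group X x) G" "\<And>g. g \<in> loops X x ==> f (path_class X g) = \<Phi> g"
proof -
 define f where "f A = \<Phi> (SOME g. g \<in> A)" for A
 have f: "f (path_class X g) = \<Phi> g" if "g \<in> loops X x" for g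
 proof -
  have "g \<in> path_class X g" using that by (auto simp: path_class_def loops_def)
  then have "(SOME h. h \<in> path_class X g) \<in> path_class X g" by (rule someI[of "\<lambda>h. h \<in> path_class X g"])
  then show ?thesis unfolding f_def using homotopic by (simp add: path_class_def)
 qed
 have "f \<in> hom (fundamental_group X x) G"
 proof (rule homI)
  fix A assume "A \<in> carrier (fundamental_group X x)"
  then show "f A \<in> carrier G" using f by (auto simp: fundamental_group_def loops_def closed)
 next
  fix A B assume "A \<in> carrier (fundamental_group X x)" "B \<in> carrier (fundamental_group X x)"
  then obtain g h where gh: "g \<in> loops X x" "h \<in> loops X x" "A = path_class X g" "B = path_class X h" by (auto simp: fundamental_group_def)
  then have "g +++ h \<in> loops X x" by (auto simp: loops_def path_image_join)
  with gh show "f (A \<otimes>\<^bsub>fundamental_group X x\<^esub> B) = f A \<otimes> f B"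
   by (simp add: fundamental_group_mult f) (simp add: loops_def join)
 qed
 with f show ?thesis using that by blast
qed

text \<open>Connecting paths from \<open>S\<close> to the division points of \<open>g\<close> turn \<open>\<Phi> g\<close> into a product of local terms.\<close>

lemma local_to_global:
 assumes H: "subgroup H G"
  and dense: "\<And>p W. [|p \<in> X; openin (top_of_set X) W; p \<in> W|] ==>
   \<exists>b. path b \<and> path_image b \<subseteq> W \<and> pathstart b \<in> S \<and> pathfinish b = p"
  and loc: "\<And>p. p \<in> X ==> \<exists>N. openin (top_of_set X) N \<and> p \<in> N \<and>
   (\<forall>g. path g --> path_image g \<subseteq> N --> pathstart g \<in> S --> pathfinish g \<in> S --> \<Phi> g \<in> H)"
  and g: "path g" "path_image g \<subseteq> X" "pathstart g \<in> S" "pathfinish g \<in> S"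
 shows "\<Phi> g \<in> H"
proof -
 interpret H: subgroup H G by fact
 have "\<forall>p. \<exists>N. p \<in> X --> openin (top_of_set X) N \<and> p \<in> N \<and>
   (\<forall>g. path g --> path_image g \<subseteq> N --> pathstart g \<in> S --> pathfinish g \<in> S --> \<Phi> g \<in> H)" using loc by blast
 then obtain N where N: "\<And>p. p \<in> X ==> openin (top_of_set X) (N p)" "\<And>p. p \<in> X ==> p \<in> N p"
  "\<And>p g. [|p \<in> X; path g; path_image g \<subseteq> N p; pathstart g \<in> S; pathfinish g \<in> S|] ==> \<Phi> g \<in> H" by metis
 have NX: "N p \<subseteq> X" if "p \<in> X" for p using N(1)[OF that] by (rule openin_imp_subset)
 have "\<forall>p. \<exists>b. p \<in> X --> path b \<and> path_image b \<subseteq> N p \<and> pathstart b \<in> S \<and> pathfinish b = p"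
  using dense N by blast
 then obtain \<alpha> where \<alpha>: "\<And>p. p \<in> X ==> path (\<alpha> p) \<and> path_image (\<alpha> p) \<subseteq> N p \<and> pathstart (\<alpha> p) \<in> S \<and> pathfinish (\<alpha> p) = p"
  by metis
 have \<alpha>c: "\<Phi> (\<alpha> p) \<in> carrier G" if "p \<in> X" for p using \<alpha>[OF that] NX[OF that] by (intro closed) auto
 \<comment> \<open>The chosen connecting path to \<open>q\<close> may be replaced by any other: both
   are compared with a path \<open>c\<close> in \<open>N p \<inter> N q\<close>, which can be joined
   to either one inside a single good neighbourhood.\<close>
 have key: "\<Phi> b \<otimes> inv (\<Phi> (\<alpha> q)) \<in> H"
  if pq: "p \<in> X" "q \<in> N p" and b: "path b" "path_image b \<subseteq> N p" "pathstart b \<in> S" "pathfinish b = q" for p q b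
 proof -
  have q: "q \<in> X" using pq NX by blast
  obtain c where c: "path c" "path_image c \<subseteq> N p \<inter> N q" "pathstart c \<in> S" "pathfinish c = q"
   using dense[of q "N p \<inter> N q"] N q pq by (meson IntI openin_Int)
  have im: "path_image b \<subseteq> X" "path_image c \<subseteq> X" "path_image (\<alpha> q) \<subseteq> X"
   using b c \<alpha>[OF q] NX pq q by blast+
  have "\<Phi> (b +++ reversepath c) \<in> H" by (rule N(3)[OF pq(1)]) (use b c in \<open>auto simp: path_image_join\<close>)
  then have 1: "\<Phi> b \<otimes> inv (\<Phi> c) \<in> H" using b c im by (simp add: join reverse)
  have "\<Phi> (c +++ reversepath (\<alpha> q)) \<in> H" by (rule N(3)[OF q]) (use \<alpha>[OF q] c in \<open>auto simp: path_image_join\<close>)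
  then have 2: "\<Phi> c \<otimes> inv (\<Phi> (\<alpha> q)) \<in> H" using c im \<alpha>[OF q] by (simp add: join reverse)
  have "\<Phi> b \<otimes> inv (\<Phi> (\<alpha> q)) = (\<Phi> b \<otimes> inv (\<Phi> c)) \<otimes> (\<Phi> c \<otimes> inv (\<Phi> (\<alpha> q)))"
   using closed[OF b(1) im(1)] closed[OF c(1) im(2)] \<alpha>c[OF q] by (simp add: m_assoc) (simp flip: m_assoc)
  then show ?thesis using 1 2 by simp
 qed
 \<comment> \<open>Flanked by connecting paths, the values over adjacent intervals multiply, so
   membership in \<open>H\<close> has to be checked on short intervals only; \<open>Bolzano\<close>
   does the subdivision.\<close>
 define P where "P u v \<longleftrightarrow> (0 \<le> u --> v \<le> 1 --> \<Phi> (\<alpha> (g u)) \<otimes> \<Phi> (subpath u v g) \<otimes> inv (\<Phi> (\<alpha> (g v))) \<in> H)" for u v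
 have gX: "g t \<in> X" if "t \<in> {0..1}" for t using g that by (auto simp: path_image_def)
 have sub: "path (subpath u v g)" "path_image (subpath u v g) \<subseteq> X" "\<Phi> (subpath u v g) \<in> carrier G"
  if "0 \<le> u" "u \<le> v" "v \<le> 1" for u v
 proof -
  show "path (subpath u v g)" using that g by (intro path_subpath) auto
  moreover show "path_image (subpath u v g) \<subseteq> X" using path_image_subpath_subset[of u v g] that g by auto
  ultimately show "\<Phi> (subpath u v g) \<in> carrier G" by (rule closed)
 qed
 have "P 0 1"
 proof (rule Bolzano)
  fix a b c assume trans: "P a b" "P b c" "a \<le> b" "b \<le> c"
  show "P a c" unfolding P_def
  proof (intro impI)
   assume "0 \<le> a" "c \<le> 1"
   with trans have h: "0 \<le> a" "a \<le> b" "b \<le> c" "c \<le> 1" "0 \<le> b" "b \<le> 1" "a \<le> 1" "0 \<le> c" by auto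
   have "homotopic_paths X (subpath a b g +++ subpath b c g) (subpath a c g)" using g h by (intro homotopic_join_subpaths) auto
   then have "\<Phi> (subpath a c g) = \<Phi> (subpath a b g) \<otimes> \<Phi> (subpath b c g)"
    using homotopic join sub h by (metis pathfinish_subpath pathstart_subpath)
   then have "\<Phi> (\<alpha> (g a)) \<otimes> \<Phi> (subpath a c g) \<otimes> inv (\<Phi> (\<alpha> (g c))) =
    (\<Phi> (\<alpha> (g a)) \<otimes> \<Phi> (subpath a b g) \<otimes> inv (\<Phi> (\<alpha> (g b)))) \<otimes>
    (\<Phi> (\<alpha> (g b)) \<otimes> \<Phi> (subpath b c g) \<otimes> inv (\<Phi> (\<alpha> (g c))))" using \<alpha>c gX h sub[of a b] sub[of b c]
    by (simp add: m_assoc) (simp flip: m_assoc)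
   then show "\<Phi> (\<alpha> (g a)) \<otimes> \<Phi> (subpath a c g) \<otimes> inv (\<Phi> (\<alpha> (g c))) \<in> H"
    using trans(1,2) h by (simp add: P_def)
  qed
 next
  fix x :: real assume local: "0 \<le> x" "x \<le> 1"
  have gx: "g x \<in> X" using gX local by auto
  obtain W where W: "open W" "N (g x) = X \<inter> W" using N(1)[OF gx] by (auto simp: openin_open)
  have "continuous_on {0..1} g" using g by (simp add: path_def)
  then have "\<exists>d>0. \<forall>t\<in>{0..1}. dist t x < d --> g t \<in> W" using local W N(2)[OF gx] unfolding continuous_on_topological
   by (metis (no_types, opaque_lifting) Int_iff atLeastAtMost_iff continuous_on_topological open_dist)
  then obtain d where d: "d > 0" "\<And>t. t \<in> {0..1} ==> dist t x < d ==> g t \<in> N (g x)" using W gX by (metis IntI)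
  show "\<exists>d>0. \<forall>a b. a \<le> x \<and> x \<le> b \<and> b - a < d --> P a b"
  proof (intro exI[of _ d] conjI d allI impI)
   fix a b assume ab: "a \<le> x \<and> x \<le> b \<and> b - a < d"
   show "P a b" unfolding P_def
   proof (intro impI)
    assume h: "0 \<le> a" "b \<le> 1"
    have N': "g t \<in> N (g x)" if "a \<le> t" "t \<le> b" for t using d that ab h by (auto simp: dist_real_def)
    obtain \<beta> where \<beta>: "path \<beta>" "path_image \<beta> \<subseteq> N (g x)" "pathstart \<beta> \<in> S" "pathfinish \<beta> = g a"
     using dense[of "g a" "N (g x)"] gX[of a] N(1)[OF gx] N'[of a] ab h by auto
    obtain \<gamma> where \<gamma>: "path \<gamma>" "path_image \<gamma> \<subseteq> N (g x)" "pathstart \<gamma> \<in> S" "pathfinish \<gamma> = g b"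
     using dense[of "g b" "N (g x)"] gX[of b] N(1)[OF gx] N'[of b] ab h by auto
    let ?s = "subpath a b g"
    have s: "path ?s" "path_image ?s \<subseteq> N (g x)" "\<Phi> ?s \<in> carrier G"
     using sub[of a b] ab h N' by (auto simp: path_image_subpath_gen closed_segment_eq_real_ivl)
    have im: "path_image \<beta> \<subseteq> X" "path_image \<gamma> \<subseteq> X" "path_image ?s \<subseteq> X"
     using \<beta> \<gamma> s NX[OF gx] by auto
    have cc: "\<Phi> \<beta> \<in> carrier G" "\<Phi> \<gamma> \<in> carrier G" using closed \<beta> \<gamma> im by auto
    have "\<Phi> ((\<beta> +++ ?s) +++ reversepath \<gamma>) \<in> H"
     by (rule N(3)[OF gx]) (use \<beta> \<gamma> s in \<open>auto simp: path_image_join\<close>)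
    then have 1: "\<Phi> \<beta> \<otimes> \<Phi> ?s \<otimes> inv (\<Phi> \<gamma>) \<in> H"
     using \<beta> \<gamma> s im by (simp add: join reverse path_image_join)
    have 2: "\<Phi> \<beta> \<otimes> inv (\<Phi> (\<alpha> (g a))) \<in> H" using key[OF gx _ \<beta>] N'[of a] ab by auto
    have 3: "\<Phi> \<gamma> \<otimes> inv (\<Phi> (\<alpha> (g b))) \<in> H" using key[OF gx _ \<gamma>] N'[of b] ab by auto
    have 4: "inv (\<Phi> \<beta> \<otimes> inv (\<Phi> (\<alpha> (g a)))) \<otimes> (\<Phi> \<beta> \<otimes> \<Phi> ?s \<otimes> inv (\<Phi> \<gamma>)) \<otimes> (\<Phi> \<gamma> \<otimes> inv (\<Phi> (\<alpha> (g b)))) \<in> H"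
     using 1 2 3 by simp
    have "g a \<in> X" "g b \<in> X" using gX ab h by auto
    then have c3: "\<Phi> (\<alpha> (g a)) \<in> carrier G" "\<Phi> (\<alpha> (g b)) \<in> carrier G" using \<alpha>c by auto
    have "inv (\<Phi> \<beta> \<otimes> inv (\<Phi> (\<alpha> (g a)))) \<otimes> (\<Phi> \<beta> \<otimes> \<Phi> ?s \<otimes> inv (\<Phi> \<gamma>)) \<otimes> (\<Phi> \<gamma> \<otimes> inv (\<Phi> (\<alpha> (g b))))
     = \<Phi> (\<alpha> (g a)) \<otimes> ((inv (\<Phi> \<beta>) \<otimes> \<Phi> \<beta>) \<otimes> \<Phi> ?s \<otimes> (inv (\<Phi> \<gamma>) \<otimes> \<Phi> \<gamma>) \<otimes> inv (\<Phi> (\<alpha> (g b))))"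
     using cc s(3) c3 by (simp only: inv_mult_group inv_closed inv_inv m_assoc m_closed)
    with 4 show "\<Phi> (\<alpha> (g a)) \<otimes> \<Phi> ?s \<otimes> inv (\<Phi> (\<alpha> (g b))) \<in> H" using cc s(3) c3 by (simp add: m_assoc)
   qed
  qed
 qed simp
 then have *: "\<Phi> (\<alpha> (g 0)) \<otimes> \<Phi> g \<otimes> inv (\<Phi> (\<alpha> (g 1))) \<in> H" by (simp add: P_def)
 have e: "g 0 \<in> S" "g 1 \<in> S" "g 0 \<in> X" "g 1 \<in> X" using g gX by (auto simp: pathstart_def pathfinish_def)
 \<comment> \<open>The connecting paths to the end points of \<open>g\<close> have both ends in
   \<open>S\<close> and stay in one good neighbourhood, so their own values are in \<open>H\<close>
   and can be divided out.\<close>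
 then have "\<Phi> (\<alpha> (g 0)) \<in> H" "\<Phi> (\<alpha> (g 1)) \<in> H" using \<alpha> N(3) by metis+
 then have "inv (\<Phi> (\<alpha> (g 0))) \<otimes> (\<Phi> (\<alpha> (g 0)) \<otimes> \<Phi> g \<otimes> inv (\<Phi> (\<alpha> (g 1)))) \<otimes> \<Phi> (\<alpha> (g 1)) \<in> H"
  using * by simp
 moreover have "inv (\<Phi> (\<alpha> (g 0))) \<otimes> (\<Phi> (\<alpha> (g 0)) \<otimes> \<Phi> g \<otimes> inv (\<Phi> (\<alpha> (g 1)))) \<otimes> \<Phi> (\<alpha> (g 1)) = \<Phi> g"
  using \<alpha>c[OF e(3)] \<alpha>c[OF e(4)] closed[OF g(1,2)] by (simp add: m_assoc) (simp flip: m_assoc)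
 ultimately show ?thesis by simp
qed

end

text \<open>Every path is closed up to a loop by chosen connecting paths from \<open>x0\<close>;
  when two paths are joined, the inner connecting paths cancel up to homotopy.\<close>

lemma hom_imp_groupoid_rep:
 fixes G (structure) and X :: "'a::real_normed_vector set"
 assumes "group G" "path_connected X" "x0 \<in> X" and f: "f \<in> hom (fundamental_group X x0) G"
 obtains \<Phi> where "groupoid_rep G X \<Phi>" "\<And>g. g \<in> loops X x0 ==> f (path_class X g) = \<Phi> g"
proof -
 interpret group G by fact
 have "\<forall>x. \<exists>g. x \<in> X --> path g \<and> path_image g \<subseteq> X \<and> pathstart g = x0 \<and> pathfinish g = x"
  using assms unfolding path_connected_def by blast
 then obtain T0 where T0: "\<And>x. x \<in> X ==> path (T0 x) \<and> path_image (T0 x) \<subseteq> X \<and> pathstart (T0 x) = x0 \<and> pathfinish (T0 x) = x"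
  by metis
 \<comment> \<open>With the constant path chosen at \<open>x0\<close> itself, the extension agrees
   with \<open>f\<close> on loops at \<open>x0\<close> without any conjugation.\<close>
 define T where "T x = (if x = x0 then linepath x0 x0 else T0 x)" for x
 have T: "path (T x)" "path_image (T x) \<subseteq> X" "pathstart (T x) = x0" "pathfinish (T x) = x" if "x \<in> X" for x
  using T0[OF that] assms by (auto simp: T_def)
 define L where "L g = (T (pathstart g) +++ g) +++ reversepath (T (pathfinish g))" for g
 have L: "L g \<in> loops X x0" if "path g" "path_image g \<subseteq> X" for g
 proof -
  have "pathstart g \<in> X" "pathfinish g \<in> X" using that by auto
  with T that show ?thesis by (auto simp: loops_def L_def path_image_join)
 qed
 define \<Phi> where "\<Phi> g = f (path_class X (L g))" for g
 have "groupoid_rep G X \<Phi>"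
 proof
  fix g assume "path g" "path_image g \<subseteq> X"
  then show "\<Phi> g \<in> carrier G" using L[of g] f by (auto simp: \<Phi>_def hom_def fundamental_group_def)
 next
  fix g h assume gh: "homotopic_paths X g h"
  then have se: "pathstart g = pathstart h" "pathfinish g = pathfinish h" by (auto simp: homotopic_paths_imp_pathstart homotopic_paths_imp_pathfinish)
  have "path g" "path_image g \<subseteq> X" using gh homotopic_paths_imp_path homotopic_paths_imp_subset by blast+
  then have "pathstart g \<in> X" "pathfinish g \<in> X" by auto
  then have "homotopic_paths X (L g) (L h)" unfolding L_def se[symmetric] using gh T by (intro homotopic_paths_join) auto
  then show "\<Phi> g = \<Phi> h" by (simp add: \<Phi>_def path_class_eq)
 next
  fix g h assume gh: "path g" "path_image g \<subseteq> X" "path h" "path_image h \<subseteq> X" "pathfinish g = pathstart h"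
  then have pX: "pathstart g \<in> X" "pathfinish h \<in> X" "pathstart h \<in> X" by auto
  let ?a = "T (pathstart g)" and ?b = "T (pathstart h)" and ?c = "reversepath (T (pathfinish h))"
  note [simp] = T[OF pX(1)] T[OF pX(2)] T[OF pX(3)] gh
  define q where "q = pathstart h"
  have [simp]: "q \<in> X" using pX by (simp add: q_def)
  define A where "A = ?a +++ g"
  define B where "B = h +++ ?c"
  have A[simp]: "path A" "path_image A \<subseteq> X" "pathfinish A = q" by (auto simp: A_def q_def path_image_join)
  have B[simp]: "path B" "path_image B \<subseteq> X" "pathstart B = q" by (auto simp: B_def q_def path_image_join)
  note [simp] = T[of q]
  have "homotopic_paths X ((A +++ reversepath (T q)) +++ ((T q +++ h) +++ ?c)) ((A +++ reversepath (T q)) +++ (T q +++ B))"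
   unfolding B_def by (intro homotopic_paths_join homotopic_paths_sym[OF homotopic_paths_assoc])
    (auto simp: path_image_join q_def)
  also have "homotopic_paths X \<dots> (A +++ (reversepath (T q) +++ (T q +++ B)))"
   by (intro homotopic_paths_sym[OF homotopic_paths_assoc]) (auto simp: path_image_join)
  also have "homotopic_paths X \<dots> (A +++ ((reversepath (T q) +++ T q) +++ B))"
   by (intro homotopic_paths_join homotopic_paths_assoc) (auto simp: path_image_join)
  also have "homotopic_paths X \<dots> (A +++ (linepath q q +++ B))"
   using homotopic_paths_linv[of "T q" X] by (intro homotopic_paths_join) (auto simp: path_image_join)
  also have "homotopic_paths X \<dots> (A +++ B)" by (intro homotopic_paths_join homotopic_paths_lid') auto
  also have "homotopic_paths X \<dots> ((A +++ h) +++ ?c)" unfolding B_def by (intro homotopic_paths_assoc) (auto simp: q_def)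
  also have "homotopic_paths X \<dots> ((?a +++ (g +++ h)) +++ ?c)"
   unfolding A_def by (intro homotopic_paths_join homotopic_paths_sym[OF homotopic_paths_assoc]) (auto simp: path_image_join)
  finally have "homotopic_paths X (L g +++ L h) (L (g +++ h))" unfolding L_def A_def by (simp add: q_def)
  then have "\<Phi> (g +++ h) = f (path_class X (L g +++ L h))" by (simp add: \<Phi>_def path_class_eq)
  also have "\<dots> = f (path_class X (L g) \<otimes>\<^bsub>fundamental_group X x0\<^esub> path_class X (L h))"
   using L gh by (simp add: fundamental_group_mult)
  also have "\<dots> = \<Phi> g \<otimes> \<Phi> h" using f L[of g] L[of h] gh by (auto simp: hom_def \<Phi>_def fundamental_group_def)
  finally show "\<Phi> (g +++ h) = \<Phi> g \<otimes> \<Phi> h" .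
 qed
 moreover have "f (path_class X g) = \<Phi> g" if "g \<in> loops X x0" for g
 proof -
  have g: "path g" "path_image g \<subseteq> X" "pathstart g = x0" "pathfinish g = x0" using that by (auto simp: loops_def)
  have "homotopic_paths X (L g) g"
  proof -
   have "homotopic_paths X ((linepath x0 x0 +++ g) +++ linepath x0 x0) (linepath x0 x0 +++ g)"
    using g assms homotopic_paths_rid'[of "linepath x0 x0 +++ g" X] by (auto simp: path_image_join)
   also have "homotopic_paths X \<dots> g" using g by (intro homotopic_paths_lid') auto
   finally show ?thesis using g by (simp add: L_def T_def)
  qed
  then show ?thesis by (simp add: \<Phi>_def path_class_eq)
 qed
 ultimately show ?thesis using that by blast
qed

section \<open>Monodromy of local cocycles\<close>

text \<open>Transition data of a flat bundle: \<open>m x y\<close> is the transport from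
  \<open>x\<close> to \<open>y\<close> and is meaningful only for points in a common small set.
  Representations arise from it by continuation along paths.\<close>

locale local_cocycle = group G for G (structure) +
 fixes X :: "'a::real_normed_vector set" and m :: "'a => 'a => 'b"
 assumes cocycle: "p \<in> X ==> \<exists>N. openin (top_of_set X) N \<and> p \<in> N \<and>
  (\<forall>x\<in>N. \<forall>y\<in>N. m x y \<in> carrier G) \<and> (\<forall>x\<in>N. \<forall>y\<in>N. \<forall>z\<in>N. m x y \<otimes> m y z = m x z)"
begin

text \<open>A parallel lift of \<open>k\<close>. The parameter set is arbitrary, so that paths and
  homotopies are covered by one notion.\<close>

definition flat :: "'p::topological_space set => ('p => 'a) => ('p => 'b) => bool" where
 "flat A k l \<longleftrightarrow> (\<forall>s\<in>A. l s \<in> carrier G \<and>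
   (\<exists>N. open N \<and> s \<in> N \<and> (\<forall>t\<in>N \<inter> A. l t = l s \<otimes> m (k s) (k t))))"

lemma flat_carrier: "flat A k l ==> s \<in> A ==> l s \<in> carrier G" by (simp add: flat_def)

lemma flat_nbhd:
 assumes "flat A k l" "s \<in> A"
 shows "\<exists>N. open N \<and> s \<in> N \<and> (\<forall>t\<in>N \<inter> A. l t = l s \<otimes> m (k s) (k t))"
 by (rule bspec[OF assms(1)[unfolded flat_def] assms(2), THEN conjunct2])

lemma flatE:
 assumes "flat A k l" "s \<in> A"
 obtains N where "open N" "s \<in> N" "\<And>t. t \<in> N ==> t \<in> A ==> l t = l s \<otimes> m (k s) (k t)"
proof -
 from flat_nbhd[OF assms] show ?thesis by (elim exE conjE) (rule that, assumption, assumption, erule bspec, rule IntI)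
qed

lemma flat_subset:
 assumes "flat A k l" "B \<subseteq> A"
 shows "flat B k l" unfolding flat_def
proof (intro ballI conjI)
 fix s assume "s \<in> B"
 with assms have s: "s \<in> A" by auto
 then show "l s \<in> carrier G" using assms flat_carrier by metis
 obtain N where "open N" "s \<in> N" "\<And>t. t \<in> N ==> t \<in> A ==> l t = l s \<otimes> m (k s) (k t)"
  by (rule flatE[OF assms(1) s]) (iprover intro: that)
 then show "\<exists>N. open N \<and> s \<in> N \<and> (\<forall>t\<in>N \<inter> B. l t = l s \<otimes> m (k s) (k t))"
  using assms(2) by (intro exI[of _ N] conjI ballI) auto
qed

lemma nbhd:
 assumes "continuous_on A k" "k \<in> A \<rightarrow> X" "s \<in> A"
 obtains N where "open N" "s \<in> N"
  "\<And>t u. [|t \<in> N \<inter> A; u \<in> N \<inter> A|] ==> m (k t) (k u) \<in> carrier G"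
  "\<And>t u v. [|t \<in> N \<inter> A; u \<in> N \<inter> A; v \<in> N \<inter> A|] ==> m (k t) (k u) \<otimes> m (k u) (k v) = m (k t) (k v)"
proof -
 have "k s \<in> X" using assms by auto
 then obtain M where M: "openin (top_of_set X) M" "k s \<in> M"
  "\<forall>x\<in>M. \<forall>y\<in>M. m x y \<in> carrier G" "\<forall>x\<in>M. \<forall>y\<in>M. \<forall>z\<in>M. m x y \<otimes> m y z = m x z"
  using cocycle[OF \<open>k s \<in> X\<close>] by (elim exE conjE) metis
 obtain W where W: "open W" "M = X \<inter> W" using M(1) by (auto simp: openin_open)
 obtain N where N: "open N" "s \<in> N" "\<And>t. t \<in> A ==> t \<in> N ==> k t \<in> W"
  using assms(1,3) M(2) W unfolding continuous_on_topological by (metis Int_iff)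
 have "k t \<in> M" if "t \<in> N \<inter> A" for t using that N(3)[of t] W(2) funcset_mem[OF assms(2), of t] by blast
 with M(3,4) show ?thesis by (intro that[OF N(1,2)]) blast+
qed

lemma flat_mult:
 assumes "flat A k l" "c \<in> carrier G" "continuous_on A k" "k \<in> A \<rightarrow> X"
 shows "flat A k (\<lambda>s. c \<otimes> l s)" unfolding flat_def
proof (intro ballI conjI)
 fix s assume s: "s \<in> A"
 then show "c \<otimes> l s \<in> carrier G" using assms by (simp add: flat_def)
 obtain N where N: "open N" "s \<in> N" "\<And>t u. [|t \<in> N \<inter> A; u \<in> N \<inter> A|] ==> m (k t) (k u) \<in> carrier G"
  by (rule nbhd[OF assms(3,4) s]) (iprover intro: that)
 obtain M where M: "open M" "s \<in> M" "\<And>t. t \<in> M ==> t \<in> A ==> l t = l s \<otimes> m (k s) (k t)"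
  by (rule flatE[OF assms(1) s]) (iprover intro: that)
 show "\<exists>N. open N \<and> s \<in> N \<and> (\<forall>t\<in>N \<inter> A. c \<otimes> l t = c \<otimes> l s \<otimes> m (k s) (k t))"
 proof (intro exI[of _ "N \<inter> M"] conjI ballI)
  fix t assume t: "t \<in> N \<inter> M \<inter> A"
  have "l t = l s \<otimes> m (k s) (k t)" using M(3)[of t] t by blast
  moreover have "m (k s) (k t) \<in> carrier G" using N(2) N(3)[of s t] t s by blast
  moreover have "l s \<in> carrier G" using s assms(1) by (simp add: flat_def)
  ultimately show "c \<otimes> l t = c \<otimes> l s \<otimes> m (k s) (k t)" using assms(2) by (simp add: m_assoc)
 qed (use N M in auto)
qed

text \<open>The quotient of two lifts is locally constant, because the common right factor given by
  \<open>m\<close> cancels.\<close>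

lemma flat_unique:
 assumes "connected A" "continuous_on A k" "k \<in> A \<rightarrow> X" "flat A k l" "flat A k l'"
 shows "\<exists>c\<in>carrier G. \<forall>s\<in>A. l' s = c \<otimes> l s"
proof (cases "A = {}")
 case True
 then show ?thesis by auto
next
 case False
 then obtain a where a: "a \<in> A" by auto
 have c: "l s \<in> carrier G" "l' s \<in> carrier G" if "s \<in> A" for s using assms that by (auto simp: flat_def)
 have "(\<lambda>s. l' s \<otimes> inv (l s)) constant_on A"
 proof (rule locally_constant_imp_constant[OF assms(1)])
  fix s assume s: "s \<in> A"
  obtain N where N: "open N" "s \<in> N" "\<And>t u. [|t \<in> N \<inter> A; u \<in> N \<inter> A|] ==> m (k t) (k u) \<in> carrier G"
   by (rule nbhd[OF assms(2,3) s]) (iprover intro: that)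
  obtain M where M: "open M" "s \<in> M" "\<And>t. t \<in> M ==> t \<in> A ==> l t = l s \<otimes> m (k s) (k t)"
   by (rule flatE[OF assms(4) s]) (iprover intro: that)
  obtain M' where M': "open M'" "s \<in> M'" "\<And>t. t \<in> M' ==> t \<in> A ==> l' t = l' s \<otimes> m (k s) (k t)"
   by (rule flatE[OF assms(5) s]) (iprover intro: that)
  have "l' t \<otimes> inv (l t) = l' s \<otimes> inv (l s)" if t: "t \<in> A \<inter> (N \<inter> M \<inter> M')" for t
  proof -
   have e: "m (k s) (k t) \<in> carrier G" "l t = l s \<otimes> m (k s) (k t)" "l' t = l' s \<otimes> m (k s) (k t)"
    using N(2) N(3)[of s t] M(3)[of t] M'(3)[of t] t s by blast+
   have "l' s \<otimes> m (k s) (k t) \<otimes> inv (l s \<otimes> m (k s) (k t)) = l' s \<otimes> (m (k s) (k t) \<otimes> inv (m (k s) (k t))) \<otimes> inv (l s)"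
    using e(1) c[OF s] by (simp only: inv_mult_group inv_closed m_closed m_assoc)
   then show ?thesis unfolding e(2,3) using e(1) c[OF s] by simp
  qed
  moreover have "openin (top_of_set A) (A \<inter> (N \<inter> M \<inter> M'))" using N(1) M(1) M'(1) by (simp add: openin_open_Int open_Int)
  moreover have "s \<in> A \<inter> (N \<inter> M \<inter> M')" using N(2) M(2) M'(2) s by blast
  ultimately show "\<exists>T. openin (top_of_set A) T \<and> s \<in> T \<and> (\<forall>t\<in>T. l' t \<otimes> inv (l t) = l' s \<otimes> inv (l s))"
   by blast
 qed
 then obtain d where d: "\<And>s. s \<in> A ==> l' s \<otimes> inv (l s) = d" by (auto simp: constant_on_def)
 have "d \<in> carrier G" using d[OF a] c[OF a] by auto
 moreover have "l' s = d \<otimes> l s" if "s \<in> A" for s using d[OF that] c[OF that] inv_solve_right' by (metis inv_closed inv_inv m_closed)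
 ultimately show ?thesis by blast
qed

text \<open>For \<open>s\<close> outside the closed set the complement serves as \<open>M\<close>
  and the claim is vacuous; this lets the gluing argument treat all points of a union alike.\<close>

lemma flat_nbhd_closed:
 assumes "flat A k l" "closed A"
 obtains M where "open M" "s \<in> M" "\<And>t. t \<in> M ==> t \<in> A ==> s \<in> A \<and> l t = l s \<otimes> m (k s) (k t)"
proof (cases "s \<in> A")
 case True
 then show ?thesis using flatE[OF assms(1) True] that by metis
next
 case False
 then show ?thesis using that[of "- A"] assms(2) by auto
qed

text \<open>On the connected overlap the two lifts differ by a constant left factor, which is
  absorbed into the second lift.\<close>

lemma flat_glue:
 assumes cl: "closed A" "closed B" and conn: "connected (A \<inter> B)"
  and k: "continuous_on (A \<union> B) k" "k \<in> A \<union> B \<rightarrow> X" and l: "flat A k l" and l0: "flat B k l0"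
 shows "\<exists>l. flat (A \<union> B) k l"
proof -
 have "continuous_on (A \<inter> B) k" "continuous_on B k" by (rule continuous_on_subset[OF k(1)]; blast)+
 then obtain c where c: "c \<in> carrier G" "\<forall>s\<in>A \<inter> B. l s = c \<otimes> l0 s"
  using flat_unique[OF conn, of k l0 l] flat_subset[OF l] flat_subset[OF l0] k(2) by auto
 define l' where "l' s = c \<otimes> l0 s" for s
 have l': "flat B k l'" unfolding l'_def by (rule flat_mult) (use l0 c k \<open>continuous_on B k\<close> in auto)
 have eq: "l s = l' s" if "s \<in> A" "s \<in> B" for s using c that by (simp add: l'_def)
 have "flat (A \<union> B) k (\<lambda>s. if s \<in> A then l s else l' s)" unfolding flat_def
 proof (intro ballI conjI)
  fix s assume s: "s \<in> A \<union> B"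
  then show "(if s \<in> A then l s else l' s) \<in> carrier G" using l l' by (auto simp: flat_def)
  obtain M where M: "open M" "s \<in> M" "\<And>t. t \<in> M ==> t \<in> A ==> s \<in> A \<and> l t = l s \<otimes> m (k s) (k t)"
   by (rule flat_nbhd_closed[OF l cl(1)]) (rule that; assumption)
  obtain M' where M': "open M'" "s \<in> M'" "\<And>t. t \<in> M' ==> t \<in> B ==> s \<in> B \<and> l' t = l' s \<otimes> m (k s) (k t)"
   by (rule flat_nbhd_closed[OF l' cl(2)]) (rule that; assumption)
  show "\<exists>N. open N \<and> s \<in> N \<and> (\<forall>t\<in>N \<inter> (A \<union> B). (if t \<in> A then l t else l' t) =
    (if s \<in> A then l s else l' s) \<otimes> m (k s) (k t))"
  proof (intro exI[of _ "M \<inter> M'"] conjI ballI)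
   fix t assume t: "t \<in> M \<inter> M' \<inter> (A \<union> B)"
   show "(if t \<in> A then l t else l' t) = (if s \<in> A then l s else l' s) \<otimes> m (k s) (k t)"
   proof (cases "t \<in> A")
    case True
    then show ?thesis using M(3)[of t] t by simp
   next
    case False
    then have "s \<in> B \<and> l' t = l' s \<otimes> m (k s) (k t)" using M'(3)[of t] t by blast
    then show ?thesis using False eq[of s] by simp
   qed
  qed (use M M' in auto)
 qed
 then show ?thesis by blast
qed

lemma flat_local:
 assumes "continuous_on A k" "k \<in> A \<rightarrow> X" "s \<in> A"
 shows "\<exists>N. open N \<and> s \<in> N \<and> (\<forall>B\<subseteq>N \<inter> A. \<exists>l. flat B k l)"
proof -
 obtain N where N: "open N" "s \<in> N"
  "\<And>t u. [|t \<in> N \<inter> A; u \<in> N \<inter> A|] ==> m (k t) (k u) \<in> carrier G"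
  "\<And>t u v. [|t \<in> N \<inter> A; u \<in> N \<inter> A; v \<in> N \<inter> A|] ==> m (k t) (k u) \<otimes> m (k u) (k v) = m (k t) (k v)"
  by (rule nbhd[OF assms]) (iprover intro: that)
 have "flat B k (\<lambda>t. m (k s) (k t))" if B: "B \<subseteq> N \<inter> A" for B unfolding flat_def
 proof (intro ballI conjI exI[of _ N])
  fix t assume t: "t \<in> B"
  show "m (k s) (k t) \<in> carrier G" by (rule N(3)) (use N(2) assms(3) B t in auto)
  show "t \<in> N" using B t by auto
  fix u assume "u \<in> N \<inter> B"
  then show "m (k s) (k u) = m (k s) (k t) \<otimes> m (k t) (k u)" by (intro N(4)[symmetric]) (use N(2) assms(3) B t in auto)
 qed (rule N(1))
 then show ?thesis using N(1,2) by (intro exI[of _ N] conjI allI impI exI)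
qed

text \<open>Lifting of homotopies by bisection: lifts over small rectangles are glued along the
  second coordinate to thin strips, and the strips along the first coordinate to the square.\<close>

lemma flat_square:
 fixes k :: "real \<times> real => 'a"
 assumes k: "continuous_on ({0..1} \<times> {0..1}) k" "k \<in> {0..1} \<times> {0..1} \<rightarrow> X"
 shows "\<exists>l. flat ({0..1} \<times> {0..1}) k l"
proof -
 let ?I = "{0..1::real}"
 have ks: "continuous_on A k" "k \<in> A \<rightarrow> X" if "A \<subseteq> ?I \<times> ?I" for A
  using continuous_on_subset[OF k(1) that] k(2) that by auto
 have conv: "connected ((S \<inter> ?I) \<times> (T \<inter> ?I))" if "convex S" "convex T" for S T :: "real set"
  using that by (intro convex_connected convex_Times convex_Int) auto
 have strip: "\<exists>d>0. \<exists>l. flat (({x-d..x+d} \<inter> ?I) \<times> (?I \<inter> ?I)) k l" if x: "x \<in> ?I" for x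
 proof -
  \<comment> \<open>The width of the strip shrinks at each gluing, which is why it is quantified
    inside \<open>Q\<close>.\<close>
  define Q where "Q c e \<longleftrightarrow> (\<exists>d>0. \<exists>l. flat (({x-d..x+d} \<inter> ?I) \<times> ({c..e} \<inter> ?I)) k l)" for c e
  have "Q 0 1"
  proof (rule Bolzano)
   fix a b c assume "Q a b" "Q b c" and ab: "a \<le> b" "b \<le> c"
   then obtain d d' l l' where d: "d > 0" "flat (({x-d..x+d} \<inter> ?I) \<times> ({a..b} \<inter> ?I)) k l"
    "d' > 0" "flat (({x-d'..x+d'} \<inter> ?I) \<times> ({b..c} \<inter> ?I)) k l'" unfolding Q_def by blast
   define D where "D = min d d'"
   have un: "{a..b} \<union> {b..c} = {a..c}" using ab by auto
   have "\<exists>l. flat ((({x-D..x+D} \<inter> ?I) \<times> ({a..b} \<inter> ?I)) \<union> (({x-D..x+D} \<inter> ?I) \<times> ({b..c} \<inter> ?I))) k l"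
   proof (rule flat_glue)
    have "(({x-D..x+D} \<inter> ?I) \<times> ({a..b} \<inter> ?I)) \<inter> (({x-D..x+D} \<inter> ?I) \<times> ({b..c} \<inter> ?I))
      = ({x-D..x+D} \<inter> ?I) \<times> (({a..b} \<inter> {b..c}) \<inter> ?I)" by auto
    then show "connected ((({x-D..x+D} \<inter> ?I) \<times> ({a..b} \<inter> ?I)) \<inter> (({x-D..x+D} \<inter> ?I) \<times> ({b..c} \<inter> ?I)))"
     using conv[of "{x-D..x+D}" "{a..b} \<inter> {b..c}"] by (simp add: convex_Int)
    show "flat (({x-D..x+D} \<inter> ?I) \<times> ({a..b} \<inter> ?I)) k l" by (rule flat_subset[OF d(2)]) (auto simp: D_def)
    show "flat (({x-D..x+D} \<inter> ?I) \<times> ({b..c} \<inter> ?I)) k l'" by (rule flat_subset[OF d(4)]) (auto simp: D_def)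
   qed (auto intro!: ks closed_Times closed_Int simp: Int_commute)
   then have "\<exists>l. flat (({x-D..x+D} \<inter> ?I) \<times> ({a..c} \<inter> ?I)) k l"
    by (simp only: Sigma_Un_distrib2[symmetric] Int_Un_distrib2[symmetric] un)
   moreover have "D > 0" using d by (simp add: D_def)
   ultimately show "Q a c" unfolding Q_def by blast
  next
   fix y :: real assume y: "0 \<le> y" "y \<le> 1"
   obtain N where N: "open N" "(x, y) \<in> N" "\<forall>B\<subseteq>N \<inter> (?I \<times> ?I). \<exists>l. flat B k l"
    using flat_local[OF k, of "(x, y)"] x y by auto
   obtain U V where UV: "open U" "open V" "x \<in> U" "y \<in> V" "U \<times> V \<subseteq> N"
    using open_prod_elim[OF N(1,2)] by (metis mem_Sigma_iff)
   obtain d e where de: "d > 0" "cball x d \<subseteq> U" "e > 0" "ball y e \<subseteq> V" using UV by (meson open_contains_ball open_contains_cball)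
   show "\<exists>d>0. \<forall>a b. a \<le> y \<and> y \<le> b \<and> b - a < d --> Q a b"
   proof (intro exI[of _ e] conjI allI impI)
    fix a b assume ab: "a \<le> y \<and> y \<le> b \<and> b - a < e"
    have "{x-d..x+d} \<subseteq> U" using de by (simp add: cball_eq_atLeastAtMost)
    moreover have "{a..b} \<subseteq> V" using ab de(4) by (force simp: subset_iff dist_real_def)
    ultimately have "({x-d..x+d} \<inter> ?I) \<times> ({a..b} \<inter> ?I) \<subseteq> N \<inter> (?I \<times> ?I)" using UV by blast
    then show "Q a b" unfolding Q_def using de N(3) by blast
   qed (rule de)
  qed simp
  then show ?thesis by (simp add: Q_def)
 qed
 define P where "P a b \<longleftrightarrow> (\<exists>l. flat (({a..b} \<inter> ?I) \<times> (?I \<inter> ?I)) k l)" for a b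
 have "P 0 1"
 proof (rule Bolzano)
  fix a b c assume "P a b" "P b c" and ab: "a \<le> b" "b \<le> c"
  then obtain l l' where d: "flat (({a..b} \<inter> ?I) \<times> (?I \<inter> ?I)) k l" "flat (({b..c} \<inter> ?I) \<times> (?I \<inter> ?I)) k l'"
   unfolding P_def by blast
  have un: "{a..b} \<union> {b..c} = {a..c}" using ab by auto
  have "\<exists>l. flat ((({a..b} \<inter> ?I) \<times> (?I \<inter> ?I)) \<union> (({b..c} \<inter> ?I) \<times> (?I \<inter> ?I))) k l"
  proof (rule flat_glue[OF _ _ _ _ _ d])
   have "(({a..b} \<inter> ?I) \<times> (?I \<inter> ?I)) \<inter> (({b..c} \<inter> ?I) \<times> (?I \<inter> ?I))
     = (({a..b} \<inter> {b..c}) \<inter> ?I) \<times> (?I \<inter> ?I)" by auto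
   then show "connected ((({a..b} \<inter> ?I) \<times> (?I \<inter> ?I)) \<inter> (({b..c} \<inter> ?I) \<times> (?I \<inter> ?I)))"
    using conv[of "{a..b} \<inter> {b..c}" ?I] by (simp add: convex_Int)
  qed (auto intro!: ks closed_Times closed_Int simp: Int_commute)
  then show "P a c" unfolding P_def by (simp only: Sigma_Un_distrib1[symmetric] Int_Un_distrib2[symmetric] un)
 next
  fix x :: real assume x: "0 \<le> x" "x \<le> 1"
  then obtain d l where d: "d > 0" "flat (({x-d..x+d} \<inter> ?I) \<times> (?I \<inter> ?I)) k l" using strip[of x] by auto
  show "\<exists>d>0. \<forall>a b. a \<le> x \<and> x \<le> b \<and> b - a < d --> P a b" by (intro exI[of _ d] conjI d allI impI)
    (auto simp: P_def intro!: exI[of _ l] flat_subset[OF d(2)])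
 qed simp
 then show ?thesis by (simp add: P_def)
qed

lemma flat_compose:
 assumes l: "flat A k l" and f: "continuous_on B f" "f \<in> B \<rightarrow> A" and k': "\<And>s. s \<in> B ==> k' s = k (f s)"
 shows "flat B k' (\<lambda>s. l (f s))" unfolding flat_def
proof (intro ballI conjI)
 fix s assume s: "s \<in> B"
 then have fs: "f s \<in> A" using f by auto
 then show "l (f s) \<in> carrier G" using l by (simp add: flat_def)
 obtain M where M: "open M" "f s \<in> M" "\<And>t. t \<in> M ==> t \<in> A ==> l t = l (f s) \<otimes> m (k (f s)) (k t)"
  by (rule flatE[OF l fs]) (iprover intro: that)
 obtain N where N: "open N" "s \<in> N" "\<And>t. t \<in> B ==> t \<in> N ==> f t \<in> M"
  using f(1) s M(1,2) unfolding continuous_on_topological by metis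
 show "\<exists>N. open N \<and> s \<in> N \<and> (\<forall>t\<in>N \<inter> B. l (f t) = l (f s) \<otimes> m (k' s) (k' t))"
 proof (intro exI[of _ N] conjI ballI)
  fix t assume t: "t \<in> N \<inter> B"
  then have "f t \<in> M" "f t \<in> A" using N(3)[of t] funcset_mem[OF f(2), of t] by blast+
  then show "l (f t) = l (f s) \<otimes> m (k' s) (k' t)" using M(3)[of "f t"] k'[of s] k'[of t] s t by simp
 qed (rule N)+
qed

lemma flat_path:
 assumes "path g" "path_image g \<subseteq> X"
 shows "\<exists>l. flat {0..1} g l"
proof -
 \<comment> \<open>The path is regarded as a homotopy that does not depend on the first
   coordinate.\<close>
 have "\<exists>l. flat ({0..1::real} \<times> {0..1}) (\<lambda>p. g (snd p)) l" using assms by (intro flat_square)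
   (auto simp: path_def path_image_def intro!: continuous_on_compose2[of "{0..1}" g] continuous_intros)
 then obtain l where "flat ({0..1::real} \<times> {0..1}) (\<lambda>p. g (snd p)) l" by blast
 then have "flat {0..1} g (\<lambda>t. l (0, t))" by (rule flat_compose[where f = "\<lambda>t. (0, t)"]) (auto intro!: continuous_intros)
 then show ?thesis by blast
qed

definition monodromy :: "(real => 'a) => 'b" where
 "monodromy g = (let l = SOME l. flat {0..1} g l in inv (l 0) \<otimes> l 1)"

lemma monodromy_eq:
 assumes "path g" "path_image g \<subseteq> X" "flat {0..1} g l"
 shows "monodromy g = inv (l 0) \<otimes> l 1"
proof -
 define l' where "l' = (SOME l. flat {0..1} g l)"
 have "flat {0..1} g l'" unfolding l'_def by (rule someI[of "\<lambda>l. flat {0..1} g l"]) (rule assms)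
 then obtain c where c: "c \<in> carrier G" "\<forall>s\<in>{0..1}. l' s = c \<otimes> l s"
  using flat_unique[of "{0..1}" g l l'] assms by (auto simp: path_def path_image_def)
 have "l 0 \<in> carrier G" "l 1 \<in> carrier G" using assms(3) by (auto simp: flat_def)
 then have "inv (l' 0) \<otimes> l' 1 = inv (l 0) \<otimes> l 1" using c by (simp add: inv_mult_group m_assoc) (simp flip: m_assoc)
 then show ?thesis by (simp add: monodromy_def l'_def[symmetric])
qed

lemma flat_const:
 assumes "x \<in> X" "flat {0..1::real} (\<lambda>_. x) l"
 shows "l 0 = l 1"
proof -
 obtain N where "x \<in> N" "\<forall>x\<in>N. \<forall>y\<in>N. m x y \<in> carrier G" "\<forall>x\<in>N. \<forall>y\<in>N. \<forall>z\<in>N. m x y \<otimes> m y z = m x z"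
  using cocycle[OF assms(1)] by blast
 then have "m x x = \<one>" using l_cancel_one by blast
 then have "flat {0..1::real} (\<lambda>_. x) (\<lambda>_. \<one>)" unfolding flat_def by auto
 then have "\<exists>c\<in>carrier G. \<forall>s\<in>{0..1}. l s = c \<otimes> \<one>"
  using assms by (intro flat_unique[of "{0..1::real}" "\<lambda>_. x" "\<lambda>_. \<one>" l]) auto
 then show ?thesis by auto
qed

text \<open>For homotopy invariance the whole square is lifted. Along the two sides on which the end
  points stand still, the lift has equal end values by \<open>flat_const\<close>.\<close>

lemma groupoid_rep_monodromy: "groupoid_rep G X monodromy"
proof
 fix g assume g: "path g" "path_image g \<subseteq> X"
 then obtain l where "flat {0..1} g l" using flat_path by blast
 with monodromy_eq[OF g this] show "monodromy g \<in> carrier G" by (auto simp: flat_def)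
next
 fix p q assume pq: "homotopic_paths X p q"
 then have pp: "path p" "path_image p \<subseteq> X" "path q" "path_image q \<subseteq> X"
  using homotopic_paths_imp_path homotopic_paths_imp_subset by blast+
 then have pX: "pathstart p \<in> X" "pathfinish p \<in> X" by auto
 obtain h where h: "continuous_on ({0..1} \<times> {0..1}) h" "h \<in> {0..1} \<times> {0..1} \<rightarrow> X"
  "\<forall>x\<in>{0..1}. h (0, x) = p x" "\<forall>x\<in>{0..1}. h (1, x) = q x"
  "\<forall>t\<in>{0..1::real}. pathstart (h \<circ> Pair t) = pathstart p \<and> pathfinish (h \<circ> Pair t) = pathfinish p"
  using pq unfolding homotopic_paths by blast
 obtain l where l: "flat ({0..1} \<times> {0..1}) h l" using flat_square[OF h(1,2)] by blast
 have 1: "flat {0..1} p (\<lambda>t. l (0, t))"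
  by (rule flat_compose[OF l, where f = "\<lambda>t. (0, t)"]) (use h in \<open>auto intro!: continuous_intros\<close>)
 have 2: "flat {0..1} q (\<lambda>t. l (1, t))"
  by (rule flat_compose[OF l, where f = "\<lambda>t. (1, t)"]) (use h in \<open>auto intro!: continuous_intros\<close>)
 have 3: "flat {0..1} (\<lambda>_. pathstart p) (\<lambda>t. l (t, 0))"
  by (rule flat_compose[OF l, where f = "\<lambda>t. (t, 0)"]) (use h in \<open>auto intro!: continuous_intros simp: pathstart_def\<close>)
 have 4: "flat {0..1} (\<lambda>_. pathfinish p) (\<lambda>t. l (t, 1))"
  by (rule flat_compose[OF l, where f = "\<lambda>t. (t, 1)"]) (use h in \<open>auto intro!: continuous_intros simp: pathfinish_def\<close>)
 show "monodromy p = monodromy q" using monodromy_eq[OF pp(1,2) 1] monodromy_eq[OF pp(3,4) 2] flat_const[OF pX(1) 3] flat_const[OF pX(2) 4] by simp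
next
 fix g h assume gh: "path g" "path_image g \<subseteq> X" "path h" "path_image h \<subseteq> X" "pathfinish g = pathstart h"
 then have j: "path (g +++ h)" "path_image (g +++ h) \<subseteq> X" by (auto simp: path_image_join)
 then obtain l where l: "flat {0..1} (g +++ h) l" using flat_path by blast
 have 1: "flat {0..1} g (\<lambda>t. l (t / 2))"
  by (rule flat_compose[OF l, where f = "\<lambda>t. t / 2"]) (auto intro!: continuous_intros simp: joinpaths_def)
 have h2: "h t = (g +++ h) ((t + 1) / 2)" if "t \<in> {0..1}" for t
  using that gh by (cases "t = 0") (auto simp: joinpaths_def pathfinish_def pathstart_def add_divide_distrib)
 have 2: "flat {0..1} h (\<lambda>t. l ((t + 1) / 2))" by (rule flat_compose[OF l, where f = "\<lambda>t. (t + 1) / 2"])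
   (use h2 in \<open>auto intro!: continuous_intros\<close>)
 have "l 0 \<in> carrier G" "l (1/2) \<in> carrier G" "l 1 \<in> carrier G" using l by (auto simp: flat_def)
 then show "monodromy (g +++ h) = monodromy g \<otimes> monodromy h" using monodromy_eq[OF j l] monodromy_eq[OF gh(1,2) 1] monodromy_eq[OF gh(3,4) 2]
  by (simp add: m_assoc) (simp flip: m_assoc)
qed

lemma monodromy_local:
 assumes "path g" "path_image g \<subseteq> X" "path_image g \<subseteq> N" "\<forall>x\<in>N. \<forall>y\<in>N. m x y \<in> carrier G"
  "\<forall>x\<in>N. \<forall>y\<in>N. \<forall>z\<in>N. m x y \<otimes> m y z = m x z"
 shows "monodromy g = m (pathstart g) (pathfinish g)"
proof -
 have gN: "g t \<in> N" if "t \<in> {0..1}" for t using assms that by (auto simp: path_image_def)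
 have "flat {0..1} g (\<lambda>t. m (g 0) (g t))" unfolding flat_def using gN assms(4,5) by (intro ballI conjI exI[of _ UNIV]) auto
 then have "monodromy g = inv (m (g 0) (g 0)) \<otimes> m (g 0) (g 1)" using monodromy_eq assms by blast
 moreover have "m (g 0) (g 0) \<otimes> m (g 0) (g 0) = m (g 0) (g 0)" "m (g 0) (g 0) \<in> carrier G" using gN[of 0] assms(4,5) by simp_all
 then have "m (g 0) (g 0) = \<one>" by simp
 moreover have "m (g 0) (g 1) \<in> carrier G" using gN[of 0] gN[of 1] assms(4) by simp
 ultimately show ?thesis by (simp add: pathstart_def pathfinish_def)
qed

end

text \<open>Labels \<open>lam p\<close> on convex neighbourhoods \<open>N p\<close> that agree locally up to left multiplication.\<close>

lemma groupoid_rep_of_labels: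
 fixes G (structure) and X :: "'a::real_normed_vector set" and lam :: "'a => 'a => 'b"
 assumes "group G"
  and N: "\<And>p. p \<in> X ==> open (N p) \<and> convex (N p) \<and> p \<in> N p \<and> N p \<subseteq> X"
  and lab: "\<And>p y. p \<in> X ==> lam p y \<in> carrier G"
  and compat: "\<And>p y. [|p \<in> X; y \<in> N p|] ==> \<exists>k\<in>carrier G. \<exists>W. open W \<and> y \<in> W \<and> (\<forall>w\<in>W. lam p w = k \<otimes> lam y w)"
 obtains \<Phi> where "groupoid_rep G X \<Phi>"
  "\<And>p g. [|p \<in> X; path g; path_image g \<subseteq> N p|] ==> \<Phi> g = inv (lam p (pathstart g)) \<otimes> lam p (pathfinish g)"
proof -
 interpret group G by fact
 \<comment> \<open>On the convex, hence connected, overlap of two neighbourhoods the quotient of the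
   two labellings is locally constant. So the difference of two labels does not depend on the
   neighbourhood in which it is taken.\<close>
 have agree: "inv (lam p y) \<otimes> lam p z = inv (lam q y) \<otimes> lam q z"
  if pq: "p \<in> X" "q \<in> X" and y: "y \<in> N p \<inter> N q" and z: "z \<in> N p \<inter> N q" for p q y z
 proof -
  have "(\<lambda>w. lam p w \<otimes> inv (lam q w)) constant_on (N p \<inter> N q)"
  proof (rule locally_constant_imp_constant)
   show "connected (N p \<inter> N q)" using N pq by (intro convex_connected convex_Int) auto
   fix x assume x: "x \<in> N p \<inter> N q"
   then have xX: "x \<in> X" using N[OF pq(1)] by blast
   obtain k W where k: "k \<in> carrier G" "open W" "x \<in> W" "\<And>w. w \<in> W ==> lam p w = k \<otimes> lam x w"
    using compat[OF pq(1) IntD1[OF x]] by (elim bexE exE conjE) metis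
   obtain k' W' where k': "k' \<in> carrier G" "open W'" "x \<in> W'" "\<And>w. w \<in> W' ==> lam q w = k' \<otimes> lam x w"
    using compat[OF pq(2) IntD2[OF x]] by (elim bexE exE conjE) metis
   have e: "lam p w \<otimes> inv (lam q w) = k \<otimes> inv k'" if w: "w \<in> W \<inter> W'" for w
   proof -
    have "k \<otimes> lam x w \<otimes> inv (k' \<otimes> lam x w) = k \<otimes> (lam x w \<otimes> inv (lam x w)) \<otimes> inv k'"
     using k(1) k'(1) lab[OF xX, of w] by (simp only: inv_mult_group inv_closed m_closed m_assoc)
    also have "\<dots> = k \<otimes> inv k'" using k(1) k'(1) lab[OF xX, of w] by simp
    finally show ?thesis unfolding k(4)[OF IntD1[OF w]] k'(4)[OF IntD2[OF w]] .
   qed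
   have "openin (top_of_set (N p \<inter> N q)) ((N p \<inter> N q) \<inter> (W \<inter> W'))"
    using k(2) k'(2) by (simp add: openin_open_Int open_Int)
   moreover have "x \<in> (N p \<inter> N q) \<inter> (W \<inter> W')" using k(3) k'(3) x by blast
   ultimately show "\<exists>T. openin (top_of_set (N p \<inter> N q)) T \<and> x \<in> T \<and>
     (\<forall>w\<in>T. lam p w \<otimes> inv (lam q w) = lam p x \<otimes> inv (lam q x))" using e by (metis IntE)
  qed
  then have "lam p y \<otimes> inv (lam q y) = lam p z \<otimes> inv (lam q z)" using y z by (auto simp: constant_on_def)
  moreover have "lam p y = (lam p y \<otimes> inv (lam q y)) \<otimes> lam q y" using lab[OF pq(1), of y] lab[OF pq(2), of y] by (simp add: m_assoc)
  ultimately have e: "lam p y = lam p z \<otimes> inv (lam q z) \<otimes> lam q y" by simp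
  have "inv (lam p y) \<otimes> lam p z = inv (lam q y) \<otimes> (lam q z \<otimes> (inv (lam p z) \<otimes> lam p z))"
   unfolding e using lab[OF pq(1), of z] lab[OF pq(2), of z] lab[OF pq(2), of y] by (simp only: inv_mult_group inv_closed m_closed inv_inv m_assoc)
  then show ?thesis using lab[OF pq(1), of z] lab[OF pq(2), of z] lab[OF pq(2), of y] by simp
 qed
 define m where "m y z = (let p = SOME p. p \<in> X \<and> y \<in> N p \<and> z \<in> N p in inv (lam p y) \<otimes> lam p z)" for y z
 have m: "m y z = inv (lam p y) \<otimes> lam p z" if "p \<in> X" "y \<in> N p" "z \<in> N p" for p y z
 proof -
  define q where "q = (SOME p. p \<in> X \<and> y \<in> N p \<and> z \<in> N p)"
  have "q \<in> X \<and> y \<in> N q \<and> z \<in> N q" unfolding q_def using that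
   by (intro someI[of "\<lambda>p. p \<in> X \<and> y \<in> N p \<and> z \<in> N p"]) auto
  then show ?thesis using agree[of q p y z] that by (simp add: m_def q_def[symmetric])
 qed
 have tri: "m x y \<otimes> m y z = m x z" "m x y \<in> carrier G" if "p \<in> X" "x \<in> N p" "y \<in> N p" "z \<in> N p" for p x y z
  using m[of p] that lab[of p] by (simp_all add: m_assoc) (simp flip: m_assoc)
 interpret local_cocycle G X m
 proof (unfold_locales, intro exI conjI)
  fix p assume p: "p \<in> X"
  show "openin (top_of_set X) (N p)" using N[OF p] by (simp add: open_subset)
  show "p \<in> N p" using N[OF p] by simp
  show "\<forall>x\<in>N p. \<forall>y\<in>N p. m x y \<in> carrier G" "\<forall>x\<in>N p. \<forall>y\<in>N p. \<forall>z\<in>N p. m x y \<otimes> m y z = m x z"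
   using tri[OF p] by auto
 qed
 show ?thesis
 proof (rule that[OF groupoid_rep_monodromy])
  fix p g assume p: "p \<in> X" and g: "path g" "path_image g \<subseteq> N p"
  have "monodromy g = m (pathstart g) (pathfinish g)" by (rule monodromy_local[of g "N p"]) (use N[OF p] g tri[OF p] in auto)
  then show "monodromy g = inv (lam p (pathstart g)) \<otimes> lam p (pathfinish g)"
   using m[OF p] g by (auto simp: pathstart_in_path_image pathfinish_in_path_image subset_iff)
 qed
qed

section \<open>Sides of a bent line in the plane\<close>

definition cross :: "complex => complex => real" where
 "cross a b = Re a * Im b - Im a * Re b"

lemma Im_cnj_mult: "Im (cnj a * b) = cross a b" by (simp add: cross_def)

lemma cross_simps [simp]:
 "cross a a = 0" "cross a 0 = 0" "cross 0 a = 0"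
 "cross a (- b) = - cross a b" "cross (- a) b = - cross a b"
 "cross a (r *\<^sub>R b) = r * cross a b" "cross (r *\<^sub>R a) b = r * cross a b" by (simp_all add: cross_def algebra_simps)

lemma cross_add: "cross a (b + c) = cross a b + cross a c" "cross (a + b) c = cross a c + cross b c"
 and cross_diff: "cross a (b - c) = cross a b - cross a c" "cross (a - b) c = cross a c - cross b c" by (simp_all add: cross_def algebra_simps)

lemma cross_commute: "cross b a = - cross a b" by (simp add: cross_def)

lemma continuous_on_cross [continuous_intros]:
 "continuous_on S f ==> continuous_on S g ==> continuous_on S (\<lambda>x. cross (f x) (g x))" unfolding cross_def by (intro continuous_intros)

lemma open_cross: "open {w. cross a w > 0}" "open {w. cross a w < 0}" by (intro open_Collect_less continuous_intros)+

lemma cross_eq_0_parallel: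
 assumes "cross a w = 0" "a \<noteq> 0"
 obtains s where "w = s *\<^sub>R a"
proof -
 have n: "(Re a)\<^sup>2 + (Im a)\<^sup>2 \<noteq> 0" using assms(2) by (simp add: complex_eq_iff sum_power2_eq_zero_iff)
 have e: "Re a * Im w = Im a * Re w" using assms(1) by (simp add: cross_def)
 define s where "s = (Re a * Re w + Im a * Im w) / ((Re a)\<^sup>2 + (Im a)\<^sup>2)"
 have "(Re a * Re w + Im a * Im w) * Re a = Re w * ((Re a)\<^sup>2 + (Im a)\<^sup>2)" using e by (simp add: algebra_simps power2_eq_square)
 moreover have "(Re a * Re w + Im a * Im w) * Im a = Im w * ((Re a)\<^sup>2 + (Im a)\<^sup>2)"
 proof -
  have "(Re a * Re w + Im a * Im w) * Im a = Re a * (Im a * Re w) + Im a * Im a * Im w" by (simp add: algebra_simps)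
  also have "\<dots> = Re a * (Re a * Im w) + Im a * Im a * Im w" using e by simp
  finally show ?thesis by (simp add: algebra_simps power2_eq_square)
 qed
 ultimately have "w = s *\<^sub>R a" using n by (simp add: complex_eq_iff s_def)
 then show ?thesis by (rule that)
qed

text \<open>Cramer's rule for the coordinates of \<open>w\<close> in the directions \<open>a\<close>
  and \<open>b\<close>.\<close>

lemma cross_decompose: "cross a b *\<^sub>R w = cross w b *\<^sub>R a + cross a w *\<^sub>R b" by (simp add: complex_eq_iff cross_def algebra_simps)

text \<open>\<open>a\<close> and \<open>b\<close> are the directions before and after a bend at \<open>0\<close>.  The convex side is an
 intersection of two half planes, the other side is a union.\<close>

definition bend_left :: "complex => complex => complex => bool" where
 "bend_left a b w \<longleftrightarrow> (if cross a b \<ge> 0 then cross a w > 0 \<and> cross b w > 0 else cross a w > 0 \<or> cross b w > 0)"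

definition bend_right :: "complex => complex => complex => bool" where
 "bend_right a b w \<longleftrightarrow> (if cross a b \<ge> 0 then cross a w < 0 \<or> cross b w < 0 else cross a w < 0 \<and> cross b w < 0)"

text \<open>Seen from the bend, the arriving strand is the ray spanned by \<open>- a\<close>. The
  condition excludes that the departing ray runs back over it, in which case the bend would not have
  two sides.\<close>

definition no_backtrack :: "complex => complex => bool" where
 "no_backtrack a b \<longleftrightarrow> a \<noteq> 0 \<and> b \<noteq> 0 \<and> (\<forall>r>0. a \<noteq> - (r *\<^sub>R b))"

lemma bend_straight [simp]:
 "bend_left d d w \<longleftrightarrow> cross d w > 0" "bend_right d d w \<longleftrightarrow> cross d w < 0"
 by (auto simp: bend_left_def bend_right_def)

lemma bend_exclusive: "bend_left a b w ==> \<not> bend_right a b w" by (auto simp: bend_left_def bend_right_def split: if_splits)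

lemma bend_ray:
 assumes "t \<ge> 0"
 shows "\<not> bend_left a b (t *\<^sub>R b)" "\<not> bend_right a b (t *\<^sub>R b)"
  "\<not> bend_left a b (- (t *\<^sub>R a))" "\<not> bend_right a b (- (t *\<^sub>R a))"
 using assms by (auto simp: bend_left_def bend_right_def cross_commute[of a b] not_less mult_le_0_iff zero_le_mult_iff mult_less_0_iff zero_less_mult_iff)

lemma no_backtrack_parallel:
 assumes "no_backtrack a b" "cross a b = 0"
 obtains r where "r > 0" "a = r *\<^sub>R b"
proof -
 have "b \<noteq> 0" "cross b a = 0" using assms by (auto simp: no_backtrack_def cross_commute[of a b])
 then obtain s where s: "a = s *\<^sub>R b" using cross_eq_0_parallel by blast
 have "s \<noteq> 0" using s assms(1) by (auto simp: no_backtrack_def)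
 moreover have "\<not> s < 0"
 proof
  assume "s < 0"
  then have "- s > 0" "a = - ((- s) *\<^sub>R b)" using s by auto
  then show False using assms(1) unfolding no_backtrack_def by blast
 qed
 ultimately have "s > 0" by linarith
 then show ?thesis using s by (rule that)
qed

lemma bend_cases:
 assumes "no_backtrack a b"
 shows "bend_left a b w \<or> bend_right a b w \<or> (\<exists>t\<ge>0. w = t *\<^sub>R b \<or> w = - (t *\<^sub>R a))"
proof (cases "cross a b = 0")
 case True
 then obtain r where r: "r > 0" "a = r *\<^sub>R b" using assms no_backtrack_parallel by blast
 show ?thesis
 proof (cases "cross b w = 0")
  case True
  moreover have "b \<noteq> 0" using assms by (simp add: no_backtrack_def)
  ultimately obtain s where s: "w = s *\<^sub>R b" by (rule cross_eq_0_parallel)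
  show ?thesis
  proof (cases "s \<ge> 0")
   case False
   then have "- s / r \<ge> 0" "w = - ((- s / r) *\<^sub>R a)" using r s by (auto simp: divide_nonpos_pos)
   then show ?thesis by blast
  qed (use s in blast)
 qed (use r in \<open>auto simp: bend_left_def bend_right_def mult_less_0_iff zero_less_mult_iff\<close>)
next
 case False
 let ?c = "cross a b"
 have d: "w = (cross w b / ?c) *\<^sub>R a + (cross a w / ?c) *\<^sub>R b"
 proof -
  have "w = (1 / ?c) *\<^sub>R (?c *\<^sub>R w)" using False by simp
  also have "\<dots> = (cross w b / ?c) *\<^sub>R a + (cross a w / ?c) *\<^sub>R b"
   unfolding cross_decompose[of a b w] by (simp add: scaleR_add_right)
  finally show ?thesis .
 qed
 show ?thesis
 proof (rule ccontr)
  assume n: "\<not> ?thesis"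
  consider "cross a w = 0" "cross b w * ?c \<ge> 0" | "cross b w = 0" "cross a w * ?c \<ge> 0" using n False by (cases "?c > 0")
    (auto simp: bend_left_def bend_right_def not_less mult_le_0_iff zero_le_mult_iff)
  then show False
  proof cases
   case 1
   have "w = - ((cross b w / ?c) *\<^sub>R a)" using d 1 by (simp add: cross_commute[of w b])
   moreover have "cross b w / ?c \<ge> 0" using 1 by (auto simp: zero_le_mult_iff zero_le_divide_iff)
   ultimately show False using n by blast
  next
   case 2
   have "w = (cross a w / ?c) *\<^sub>R b" using d 2 by (simp add: cross_commute[of w b])
   moreover have "cross a w / ?c \<ge> 0" using 2 by (auto simp: zero_le_mult_iff zero_le_divide_iff)
   ultimately show False using n by blast
  qed
 qed
qed

lemma open_bend: "open {w. bend_left a b w}" "open {w. bend_right a b w}"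
proof -
 have "{w. bend_left a b w} = (if cross a b \<ge> 0 then {w. cross a w > 0} \<inter> {w. cross b w > 0}
   else {w. cross a w > 0} \<union> {w. cross b w > 0})" by (auto simp: bend_left_def)
 then show "open {w. bend_left a b w}" using open_cross(1) by (auto intro!: open_Int open_Un)
 have "{w. bend_right a b w} = (if cross a b \<ge> 0 then {w. cross a w < 0} \<union> {w. cross b w < 0}
   else {w. cross a w < 0} \<inter> {w. cross b w < 0})" by (auto simp: bend_right_def)
 then show "open {w. bend_right a b w}" using open_cross(2) by (auto intro!: open_Int open_Un)
qed

text \<open>Away from its corner a bend looks like a straight line: near a point of the outgoing ray
  the sign of \<open>cross a w\<close> is fixed, unless \<open>a\<close> and \<open>b\<close> are
  parallel. \<open>bend_near_in\<close> is the counterpart for the incoming ray.\<close>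

lemma bend_near_out:
 assumes "no_backtrack a b" "t > 0"
 shows "\<exists>W. open W \<and> t *\<^sub>R b \<in> W \<and> (\<forall>w\<in>W. (bend_left a b w \<longleftrightarrow> cross b w > 0) \<and> (bend_right a b w \<longleftrightarrow> cross b w < 0))"
proof -
 consider "cross a b = 0" | "cross a b > 0" | "cross a b < 0" by linarith
 then show ?thesis
 proof cases
  case 1
  then obtain r where "r > 0" "a = r *\<^sub>R b" using assms no_backtrack_parallel by blast
  then show ?thesis by (intro exI[of _ UNIV]) (auto simp: bend_left_def bend_right_def mult_less_0_iff zero_less_mult_iff)
 next
  case 2
  then show ?thesis using open_cross(1)[of a] assms by (intro exI[of _ "{w. cross a w > 0}"]) (auto simp: bend_left_def bend_right_def)
 next
  case 3
  then show ?thesis using open_cross(2)[of a] assms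
   by (intro exI[of _ "{w. cross a w < 0}"]) (auto simp: bend_left_def bend_right_def mult_less_0_iff)
 qed
qed

lemma bend_near_in:
 assumes "no_backtrack a b" "t > 0"
 shows "\<exists>W. open W \<and> - (t *\<^sub>R a) \<in> W \<and> (\<forall>w\<in>W. (bend_left a b w \<longleftrightarrow> cross a w > 0) \<and> (bend_right a b w \<longleftrightarrow> cross a w < 0))"
proof -
 consider "cross a b = 0" | "cross a b > 0" | "cross a b < 0" by linarith
 then show ?thesis
 proof cases
  case 1
  then obtain r where "r > 0" "a = r *\<^sub>R b" using assms no_backtrack_parallel by blast
  then show ?thesis by (intro exI[of _ UNIV]) (auto simp: bend_left_def bend_right_def mult_less_0_iff zero_less_mult_iff)
 next
  case 2
  then show ?thesis using open_cross(1)[of b] assms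
   by (intro exI[of _ "{w. cross b w > 0}"]) (auto simp: bend_left_def bend_right_def cross_commute[of a b] mult_pos_neg)
 next
  case 3
  then show ?thesis using open_cross(2)[of b] assms
   by (intro exI[of _ "{w. cross b w < 0}"]) (auto simp: bend_left_def bend_right_def cross_commute[of a b] mult_less_0_iff)
 qed
qed

lemma common_left:
 assumes "no_backtrack a b"
 obtains n where "cross a n > 0" "cross b n > 0"
proof -
 have ab: "a \<noteq> 0" "b \<noteq> 0" using assms by (auto simp: no_backtrack_def)
 \<comment> \<open>The bisector of the two directions turned left by a right angle. Strictness in
   the Cauchy-Schwarz inequality, which is what the absence of backtracking gives, makes both cross
   products positive.\<close>
 define n where "n = \<i> * (norm b *\<^sub>R a + norm a *\<^sub>R b)"
 have c: "cross u (\<i> * v) = inner u v" for u v :: complex by (simp add: cross_def inner_complex_def)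
 have *: "inner a b > - (norm a * norm b)"
 proof (rule ccontr)
  assume "\<not> ?thesis"
  then have "inner a b = - (norm a * norm b)" using Cauchy_Schwarz_ineq2[of a b] by auto
  then have "inner a (- b) = norm a * norm (- b)" by simp
  then have "norm a *\<^sub>R (- b) = norm (- b) *\<^sub>R a" by (simp only: norm_cauchy_schwarz_eq)
  then have "norm b *\<^sub>R a = - (norm a *\<^sub>R b)" by simp
  then have "(1 / norm b) *\<^sub>R (norm b *\<^sub>R a) = (1 / norm b) *\<^sub>R (- (norm a *\<^sub>R b))" by simp
  then have "a = - ((norm a / norm b) *\<^sub>R b)" using ab by simp
  moreover have "norm a / norm b > 0" using ab by simp
  ultimately show False using assms unfolding no_backtrack_def by blast
 qed
 have "cross a n = norm a * (norm a * norm b + inner a b)"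
  by (simp add: n_def distrib_left cross_add c inner_add_right inner_scaleR_right dot_square_norm power2_eq_square algebra_simps)
 moreover have "cross b n = norm b * (norm a * norm b + inner a b)"
  by (simp add: n_def distrib_left cross_add c inner_add_right inner_scaleR_right dot_square_norm power2_eq_square inner_commute[of b a] algebra_simps)
 ultimately show ?thesis using that[of n] * ab by simp
qed

text \<open>A side is either an intersection of two convex half balls, or a union of two half balls
  sharing the point found with \<open>common_left\<close> or its mirror image in
  \<open>x\<close>.\<close>

lemma path_connected_bend:
 fixes x :: space
 assumes nb: "no_backtrack a b" and r: "r > 0"
 shows "path_connected {y \<in> ball x r. bend_left a b (fst y - fst x)}"
  "path_connected {y \<in> ball x r. bend_right a b (fst y - fst x)}"
proof -
 obtain n where n: "cross a n > 0" "cross b n > 0" using common_left[OF nb] by blast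
 then have "n \<noteq> 0" by auto
 define s where "s = r / (2 * norm n)"
 have s: "s > 0" "s * norm n < r" using r \<open>n \<noteq> 0\<close> by (auto simp: s_def field_simps)
 have pt: "x + (s *\<^sub>R n, 0) \<in> ball x r" "x + (- (s *\<^sub>R n), 0) \<in> ball x r" using s by (simp_all add: dist_norm norm_Pair)
 have cv: "convex {y \<in> ball x r. cross d (fst y - fst x) > 0}" "convex {y \<in> ball x r. cross d (fst y - fst x) < 0}" for d
 proof -
  have lin: "linear (\<lambda>y::space. cross d (fst y))" by (rule linearI) (simp_all add: cross_add)
  have e: "{y \<in> ball x r. cross d (fst y - fst x) > 0} = ball x r \<inter> (\<lambda>y. cross d (fst y)) -` {cross d (fst x)<..}"
   "{y \<in> ball x r. cross d (fst y - fst x) < 0} = ball x r \<inter> (\<lambda>y. cross d (fst y)) -` {..<cross d (fst x)}"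
   by (auto simp: cross_diff)
  show "convex {y \<in> ball x r. cross d (fst y - fst x) > 0}" "convex {y \<in> ball x r. cross d (fst y - fst x) < 0}"
   unfolding e using lin by (auto intro!: convex_Int convex_linear_vimage)
 qed
 show "path_connected {y \<in> ball x r. bend_left a b (fst y - fst x)}"
 proof (cases "cross a b \<ge> 0")
  case True
  then have "{y \<in> ball x r. bend_left a b (fst y - fst x)} =
   {y \<in> ball x r. cross a (fst y - fst x) > 0} \<inter> {y \<in> ball x r. cross b (fst y - fst x) > 0}" by (auto simp: bend_left_def)
  then show ?thesis using cv by (auto intro!: convex_imp_path_connected convex_Int)
 next
  case False
  then have e: "{y \<in> ball x r. bend_left a b (fst y - fst x)} =
   {y \<in> ball x r. cross a (fst y - fst x) > 0} \<union> {y \<in> ball x r. cross b (fst y - fst x) > 0}" by (auto simp: bend_left_def)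
  have "x + (s *\<^sub>R n, 0) \<in> {y \<in> ball x r. cross a (fst y - fst x) > 0} \<inter> {y \<in> ball x r. cross b (fst y - fst x) > 0}"
   using pt s n by simp
  then show ?thesis unfolding e using cv by (intro path_connected_Un convex_imp_path_connected) auto
 qed
 show "path_connected {y \<in> ball x r. bend_right a b (fst y - fst x)}"
 proof (cases "cross a b \<ge> 0")
  case False
  then have "{y \<in> ball x r. bend_right a b (fst y - fst x)} =
   {y \<in> ball x r. cross a (fst y - fst x) < 0} \<inter> {y \<in> ball x r. cross b (fst y - fst x) < 0}" by (auto simp: bend_right_def)
  then show ?thesis using cv by (auto intro!: convex_imp_path_connected convex_Int)
 next
  case True
  then have e: "{y \<in> ball x r. bend_right a b (fst y - fst x)} =
   {y \<in> ball x r. cross a (fst y - fst x) < 0} \<union> {y \<in> ball x r. cross b (fst y - fst x) < 0}" by (auto simp: bend_right_def)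
  have "x + (- (s *\<^sub>R n), 0) \<in> {y \<in> ball x r. cross a (fst y - fst x) < 0} \<inter> {y \<in> ball x r. cross b (fst y - fst x) < 0}"
   using pt s n by simp
  then show ?thesis unfolding e using cv by (intro path_connected_Un convex_imp_path_connected) auto
 qed
qed

lemma locally_constant_on_connected:
 fixes f :: "'a::metric_space => 'b"
 assumes S: "connected S" and loc: "\<And>a. a \<in> S ==> \<exists>e>0. \<forall>x\<in>S. dist x a < e --> f x = f a"
 shows "f constant_on S"
proof (rule locally_constant_imp_constant[OF S])
 fix a assume a: "a \<in> S"
 obtain e where e: "e > 0" "\<forall>x\<in>S. dist x a < e --> f x = f a" using loc[OF a] by (elim exE conjE) (rule that)
 show "\<exists>T. openin (top_of_set S) T \<and> a \<in> T \<and> (\<forall>x\<in>T. f x = f a)"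
 proof (intro exI[of _ "S \<inter> ball a e"] conjI ballI)
  show "openin (top_of_set S) (S \<inter> ball a e)" by (simp add: openin_open_Int)
  show "a \<in> S \<inter> ball a e" using a e by simp
  show "f x = f a" if "x \<in> S \<inter> ball a e" for x using e(2) that by (simp add: dist_commute)
 qed
qed

section \<open>Strands over a planar projection\<close>

lemma common_radius:
 assumes "finite F" "\<And>p. p \<in> F ==> \<exists>r>0. A p r" "\<And>p r s. A p r ==> 0 < s ==> s \<le> r ==> A p s"
 shows "\<exists>r>(0::real). \<forall>p\<in>F. A p r" using assms(1,2)
proof (induction F)
 case empty
 show ?case by (intro exI[of _ 1]) auto
next
 case (insert p F)
 obtain r s where "r > 0" "A p r" "s > 0" "\<forall>p\<in>F. A p s" using insert by (meson insertCI)
 then show ?case by (intro exI[of _ "min r s"]) (auto intro: assms(3))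
qed

text \<open>The local features of a diagram on which the topological argument rests: directions of
  departure and arrival at every point, straight germs, and finitely many transversal double points.
  Corners and inner points of edges are thereby treated alike.\<close>

locale strands =
 fixes K :: "space set" and dout din :: "space => space"
 assumes compact_K: "compact K"
  and germ_out: "p \<in> K ==> \<exists>e>0. \<forall>t. 0 < t \<and> t < e --> p + t *\<^sub>R dout p \<in> K \<and>
   dout (p + t *\<^sub>R dout p) = dout p \<and> din (p + t *\<^sub>R dout p) = dout p"
  and germ_in: "p \<in> K ==> \<exists>e>0. \<forall>t. 0 < t \<and> t < e --> p - t *\<^sub>R din p \<in> K \<and>
   dout (p - t *\<^sub>R din p) = din p \<and> din (p - t *\<^sub>R din p) = din p"
  and germ_nbhd: "p \<in> K ==> \<exists>e>0. \<forall>q\<in>K. dist q p < e --> (\<exists>t\<ge>0. q = p + t *\<^sub>R dout p \<or> q = p - t *\<^sub>R din p)"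
  and nb: "p \<in> K ==> no_backtrack (fst (din p)) (fst (dout p))"
  and fibre_le_2: "[|p \<in> K; q \<in> K; r \<in> K; fst p = fst q; fst q = fst r|] ==> p = q \<or> q = r \<or> p = r"
  and transversal: "[|p \<in> K; q \<in> K; fst p = fst q; p \<noteq> q|] ==>
   din p = dout p \<and> cross (fst (dout p)) (fst (dout q)) \<noteq> 0"
  and finite_double: "finite {p \<in> K. \<exists>q\<in>K. q \<noteq> p \<and> fst q = fst p}"
begin

definition over :: "space => space => bool" where
 "over p q \<longleftrightarrow> p \<in> K \<and> q \<in> K \<and> fst p = fst q \<and> snd q < snd p"

definition under :: "space => bool" where
 "under q \<longleftrightarrow> (\<exists>p. over p q)"

definition above :: "space => space set" where
 "above x = {p \<in> K. fst p = fst x \<and> snd x < snd p}"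

text \<open>Takes the role of the base point: it turns out to be contractible, and every point off
  the link can be reached from it by arbitrarily short paths (\<open>dense_top\<close>).\<close>

definition top_region :: "space set" where
 "top_region = {x. x \<notin> K \<and> above x = {}}"

abbreviation bl :: "space => space => bool" where
 "bl p y \<equiv> bend_left (fst (din p)) (fst (dout p)) (fst y - fst p)"

abbreviation br :: "space => space => bool" where
 "br p y \<equiv> bend_right (fst (din p)) (fst (dout p)) (fst y - fst p)"

definition good_germ :: "space => space => real => bool" where
 "good_germ x p r \<longleftrightarrow> (snd x < snd p --> snd x + r < snd p) \<and> (snd p < snd x --> snd p < snd x - r) \<and>
  (\<forall>t. 0 < t \<and> t * norm (fst (dout p)) < r -->
    p + t *\<^sub>R dout p \<in> K \<and> dout (p + t *\<^sub>R dout p) = dout p \<and> din (p + t *\<^sub>R dout p) = dout p \<and>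
    (snd x < snd p --> snd x + r < snd (p + t *\<^sub>R dout p)) \<and> (snd p < snd x --> snd (p + t *\<^sub>R dout p) < snd x - r)) \<and>
  (\<forall>t. 0 < t \<and> t * norm (fst (din p)) < r -->
    p - t *\<^sub>R din p \<in> K \<and> dout (p - t *\<^sub>R din p) = din p \<and> din (p - t *\<^sub>R din p) = din p \<and>
    (snd x < snd p --> snd x + r < snd (p - t *\<^sub>R din p)) \<and> (snd p < snd x --> snd (p - t *\<^sub>R din p) < snd x - r))"

text \<open>Over the disc of radius \<open>r\<close> the link then consists of straight germs whose
  heights avoid the slab of heights of \<open>ball x r\<close>. Hence, for \<open>y\<close> in the
  ball, which strands are above \<open>y\<close> is decided by the horizontal position of
  \<open>y\<close> alone.\<close>

definition picture :: "space => real => bool" where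
 "picture x r \<longleftrightarrow> 0 < r \<and> ball x r \<inter> K = {} \<and>
  (\<forall>q\<in>K. dist (fst q) (fst x) < r --> (\<exists>p\<in>K. fst p = fst x \<and> (\<exists>t\<ge>0. q = p + t *\<^sub>R dout p \<or> q = p - t *\<^sub>R din p))) \<and>
  (\<forall>p\<in>K. fst p = fst x --> good_germ x p r)"

lemma good_germ_mono: "good_germ x p r ==> s \<le> r ==> good_germ x p s" unfolding good_germ_def by (smt (verit, best))

lemma picture_mono: "picture x r ==> 0 < s ==> s \<le> r ==> picture x s"
 unfolding picture_def using good_germ_mono[of x _ r s] by (auto simp: disjoint_iff)

lemma dirs_nonzero: "p \<in> K ==> fst (dout p) \<noteq> 0" "p \<in> K ==> fst (din p) \<noteq> 0" using nb by (auto simp: no_backtrack_def)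

lemma good_germ_exists:
 assumes p: "p \<in> K" "fst p = fst x" and x: "x \<notin> K"
 shows "\<exists>r>0. good_germ x p r"
proof -
 have n: "fst (dout p) \<noteq> 0" "fst (din p) \<noteq> 0" using dirs_nonzero p by auto
 obtain e1 where e1: "e1 > 0" "\<And>t. 0 < t ==> t < e1 ==> p + t *\<^sub>R dout p \<in> K \<and>
   dout (p + t *\<^sub>R dout p) = dout p \<and> din (p + t *\<^sub>R dout p) = dout p" using germ_out[OF p(1)] by blast
 obtain e2 where e2: "e2 > 0" "\<And>t. 0 < t ==> t < e2 ==> p - t *\<^sub>R din p \<in> K \<and>
   dout (p - t *\<^sub>R din p) = din p \<and> din (p - t *\<^sub>R din p) = din p" using germ_in[OF p(1)] by blast
 define h where "h = \<bar>snd p - snd x\<bar>"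
 have "snd p \<noteq> snd x" using p x by (metis prod.expand)
 then have h: "h > 0" by (simp add: h_def)
 \<comment> \<open>\<open>M\<close> bounds the slopes, height per horizontal length. Within
   horizontal distance \<open>r\<close> the height changes by at most \<open>r * M\<close>, and
   \<open>r + r * M\<close> is kept below the height gap \<open>h\<close> between \<open>p\<close>
   and \<open>x\<close>.\<close>
 define M where "M = \<bar>snd (dout p)\<bar> / norm (fst (dout p)) + \<bar>snd (din p)\<bar> / norm (fst (din p))"
 have M: "M \<ge> 0" by (simp add: M_def)
 define r where "r = min (h / (2 * (1 + M))) (min (e1 * norm (fst (dout p))) (e2 * norm (fst (din p))))"
 have r: "r > 0" using h M e1 e2 n by (simp add: r_def)
 have "r * (1 + M) \<le> h / (2 * (1 + M)) * (1 + M)" using M by (intro mult_right_mono) (auto simp: r_def)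
 also have "\<dots> = h / 2" using M by (simp add: field_simps)
 finally have rM: "r + r * M < h" using h by (simp add: algebra_simps)
 have sl: "t * \<bar>snd d\<bar> \<le> r * M" if "0 < t" "t * norm (fst d) < r" "d = dout p \<or> d = din p" for t d
 proof -
  have d: "fst d \<noteq> 0" "\<bar>snd d\<bar> / norm (fst d) \<le> M" using that n by (auto simp: M_def)
  have "t * \<bar>snd d\<bar> = (t * norm (fst d)) * (\<bar>snd d\<bar> / norm (fst d))" using d by simp
  also have "\<dots> \<le> r * M" using that d r by (intro mult_mono) auto
  finally show ?thesis .
 qed
 have tl: "t < e1" if "t * norm (fst (dout p)) < r" for t
 proof -
  have "t * norm (fst (dout p)) < e1 * norm (fst (dout p))" using that by (simp add: r_def)
  then show ?thesis using n by simp
 qed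
 have tl': "t < e2" if "t * norm (fst (din p)) < r" for t
 proof -
  have "t * norm (fst (din p)) < e2 * norm (fst (din p))" using that by (simp add: r_def)
  then show ?thesis using n by simp
 qed
 have ab: "\<bar>t * snd d\<bar> \<le> r * M" if "0 < t" "t * norm (fst d) < r" "d = dout p \<or> d = din p" for t d
  using sl[OF that] that(1) by (simp add: abs_mult)
 have rM0: "r * M \<ge> 0" using r M by simp
 have "good_germ x p r" unfolding good_germ_def
 proof (intro conjI allI impI)
  show "snd x + r < snd p" if "snd x < snd p" using rM rM0 h_def that by linarith
  show "snd p < snd x - r" if "snd p < snd x" using rM rM0 h_def that by linarith
  fix t
  { assume t: "0 < t \<and> t * norm (fst (dout p)) < r"
   then show "p + t *\<^sub>R dout p \<in> K" "dout (p + t *\<^sub>R dout p) = dout p" "din (p + t *\<^sub>R dout p) = dout p" using e1(2) tl by auto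
   have "\<bar>t * snd (dout p)\<bar> \<le> r * M" using ab t by blast
   then show "snd x + r < snd (p + t *\<^sub>R dout p)" if "snd x < snd p" using rM h_def that by simp
   show "snd (p + t *\<^sub>R dout p) < snd x - r" if "snd p < snd x" using rM h_def that \<open>\<bar>t * snd (dout p)\<bar> \<le> r * M\<close> by simp }
  { assume t: "0 < t \<and> t * norm (fst (din p)) < r"
   then show "p - t *\<^sub>R din p \<in> K" "dout (p - t *\<^sub>R din p) = din p" "din (p - t *\<^sub>R din p) = din p" using e2(2) tl' by auto
   have "\<bar>t * snd (din p)\<bar> \<le> r * M" using ab t by blast
   then show "snd x + r < snd (p - t *\<^sub>R din p)" if "snd x < snd p" using rM h_def that by simp
   show "snd (p - t *\<^sub>R din p) < snd x - r" if "snd p < snd x" using rM h_def that \<open>\<bar>t * snd (din p)\<bar> \<le> r * M\<close> by simp }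
 qed
 then show ?thesis using r by blast
qed

lemma finite_fibre: "finite {p \<in> K. fst p = z}"
proof (rule ccontr)
 assume inf: "infinite {p \<in> K. fst p = z}"
 obtain T where "T \<subseteq> {p \<in> K. fst p = z}" "card T = 3" "finite T" using infinite_arbitrarily_large[OF inf, of 3] by blast
 then obtain p q r where "T = {p, q, r}" "p \<noteq> q" "q \<noteq> r" "p \<noteq> r" by (metis card_3_iff)
 then show False using fibre_le_2[of p q r] \<open>T \<subseteq> _\<close> by auto
qed

lemma picture_exists:
 assumes x: "x \<notin> K"
 shows "\<exists>r. picture x r"
proof -
 define F where "F = {p \<in> K. fst p = fst x}"
 have F: "finite F" unfolding F_def by (rule finite_fibre)
 have "\<exists>r>0. \<forall>p\<in>F. good_germ x p r"
  by (rule common_radius[OF F]) (use good_germ_exists x good_germ_mono in \<open>auto simp: F_def\<close>)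
 then obtain r1 where r1: "r1 > 0" "\<And>p. p \<in> F ==> good_germ x p r1" by blast
 have "\<forall>p. \<exists>e. p \<in> F --> e > 0 \<and> (\<forall>q\<in>K. dist q p < e --> (\<exists>t\<ge>0. q = p + t *\<^sub>R dout p \<or> q = p - t *\<^sub>R din p))"
  using germ_nbhd by (auto simp: F_def)
 then obtain e where e: "\<And>p. p \<in> F ==> e p > 0"
  "\<And>p q. [|p \<in> F; q \<in> K; dist q p < e p|] ==> \<exists>t\<ge>0. q = p + t *\<^sub>R dout p \<or> q = p - t *\<^sub>R din p" by metis
 \<comment> \<open>The part of the link away from the germs over \<open>fst x\<close> is compact and
   misses that fibre, so its projection keeps a positive distance from \<open>fst x\<close>.\<close>
 define K' where "K' = K - (\<Union>p\<in>F. ball p (e p))"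
 have "compact K'" unfolding K'_def by (intro compact_diff compact_K open_UN) auto
 then have "closed (fst ` K')" by (intro compact_imp_closed compact_continuous_image continuous_intros)
 moreover have "fst x \<notin> fst ` K'" using e(1) by (auto simp: K'_def F_def)
 ultimately obtain r2 where r2: "r2 > 0" "ball (fst x) r2 \<subseteq> - fst ` K'" by (meson open_Compl ComplI open_contains_ball)
 obtain r3 where r3: "r3 > 0" "ball x r3 \<subseteq> - K" using x compact_imp_closed[OF compact_K] by (meson open_Compl ComplI open_contains_ball)
 define r where "r = min r1 (min r2 r3)"
 have "picture x r" unfolding picture_def
 proof (intro conjI ballI impI)
  show "0 < r" using r1 r2 r3 by (simp add: r_def)
  show "ball x r \<inter> K = {}" using r3 by (auto simp: r_def subset_iff)
  fix q assume q: "q \<in> K"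
  { assume "dist (fst q) (fst x) < r"
   then have "fst q \<in> ball (fst x) r2" by (simp add: r_def dist_commute)
   then have "q \<notin> K'" using r2 by auto
   then obtain p where p: "p \<in> F" "dist q p < e p" using q by (auto simp: K'_def dist_commute)
   then show "\<exists>p\<in>K. fst p = fst x \<and> (\<exists>t\<ge>0. q = p + t *\<^sub>R dout p \<or> q = p - t *\<^sub>R din p)"
    using e(2)[OF p(1) q p(2)] by (auto simp: F_def) }
  { assume "fst q = fst x"
   then show "good_germ x q r" using q r1 good_germ_mono[of x q r1 r] by (simp add: F_def r_def) }
 qed
 then show ?thesis by blast
qed

end

section \<open>Local structure of a projection: the strands above points near a given point\<close>

context strands
begin

definition over_of :: "space => space" where
 "over_of q = (SOME p. over p q)"

text \<open>The under strand re-oriented so that it passes from the right to the left of the over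
  strand. With it a single relation serves crossings of both signs.\<close>

definition left_dir :: "space => space" where
 "left_dir q = (if cross (fst (dout (over_of q))) (fst (dout q)) > 0 then dout q else - dout q)"

lemma over_of_eq: "over p q ==> over_of q = p"
proof -
 assume o: "over p q"
 then have "over (over_of q) q" unfolding over_of_def by (rule someI)
 then have "over_of q \<in> K" "fst q = fst (over_of q)" "over_of q \<noteq> q" unfolding over_def by auto
 moreover have "p \<in> K" "q \<in> K" "fst p = fst q" "p \<noteq> q" using o unfolding over_def by auto
 ultimately show ?thesis using fibre_le_2[of p q "over_of q"] by metis
qed

lemma over_not_under: "over p q ==> \<not> under p" using fibre_le_2 unfolding over_def under_def by (metis less_irrefl less_trans)

lemma over_dirs:
 assumes "over p q"
 shows "din p = dout p" "din q = dout q" "cross (fst (dout p)) (fst (dout q)) \<noteq> 0"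
  "cross (fst (dout p)) (fst (left_dir q)) > 0" "fst p = fst q" "p \<in> K" "q \<in> K" "p \<noteq> q"
proof -
 have o: "p \<in> K" "q \<in> K" "fst p = fst q" "p \<noteq> q" using assms by (auto simp: over_def)
 then have "din p = dout p \<and> cross (fst (dout p)) (fst (dout q)) \<noteq> 0" "din q = dout q"
  using transversal[of p q] transversal[of q p] by auto
 then show "din p = dout p" "din q = dout q" "cross (fst (dout p)) (fst (dout q)) \<noteq> 0"
  "cross (fst (dout p)) (fst (left_dir q)) > 0" "fst p = fst q" "p \<in> K" "q \<in> K" "p \<noteq> q"
  using o by (auto simp: left_dir_def over_of_eq[OF assms] linorder_neq_iff)
qed

lemma above_cases:
 assumes "x \<notin> K"
 obtains (none) "above x = {}" | (one) p where "above x = {p}" "\<not> under p"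
 | (two) p q where "above x = {p, q}" "over p q"
proof (cases "above x = {}")
 case False
 then obtain p where p: "p \<in> above x" by blast
 show ?thesis
 proof (cases "above x = {p}")
  case True
  have "\<not> under p"
  proof
   assume "under p"
   then obtain q where "over q p" by (auto simp: under_def)
   then have "q \<in> above x" "q \<noteq> p" using p by (auto simp: over_def above_def)
   then show False using True by auto
  qed
  then show ?thesis using one True by blast
 next
  case False
  then obtain q where q: "q \<in> above x" "q \<noteq> p" using p by blast
  have "above x = {p, q}"
  proof -
   have "r = p \<or> r = q" if "r \<in> above x" for r using fibre_le_2[of p q r] that p q by (auto simp: above_def)
   then show ?thesis using p q by blast
  qed
  moreover have "snd p \<noteq> snd q" using p q by (metis (mono_tags, lifting) above_def mem_Collect_eq prod.expand)
  moreover have "over p q" if "snd q < snd p" using p q that by (auto simp: over_def above_def)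
  moreover have "over q p" if "snd p < snd q" using p q that by (auto simp: over_def above_def)
  ultimately show ?thesis using two[of p q] two[of q p] by (metis insert_commute linorder_neqE)
 qed
qed (rule none)

lemma open_bl: "open {y. bl p y}" and open_br: "open {y. br p y}"
proof -
 have "open ((\<lambda>y. fst y - fst p) -` {w. bend_left (fst (din p)) (fst (dout p)) w})"
  "open ((\<lambda>y. fst y - fst p) -` {w. bend_right (fst (din p)) (fst (dout p)) w})" by (intro open_vimage open_bend continuous_intros)+
 then show "open {y. bl p y}" "open {y. br p y}" by (simp_all add: vimage_def)
qed

lemma ball_fst: "y \<in> ball x r ==> norm (fst y - fst x) < r" "y \<in> ball x r ==> \<bar>snd y - snd x\<bar> < r"
 for x y :: space using dist_fst_le[of x y] dist_snd_le[of x y] by (auto simp: dist_norm norm_minus_commute abs_minus_commute)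

text \<open>The size is measured in the projection, to match \<open>picture\<close>.\<close>

definition germ :: "space => real => space set" where
 "germ p r = {p} \<union> {p + t *\<^sub>R dout p |t. 0 < t \<and> t * norm (fst (dout p)) < r}
   \<union> {p - t *\<^sub>R din p |t. 0 < t \<and> t * norm (fst (din p)) < r}"

lemma germ_cases:
 assumes "q \<in> germ p r"
 obtains "q = p" | t where "0 < t" "t * norm (fst (dout p)) < r" "q = p + t *\<^sub>R dout p"
 | t where "0 < t" "t * norm (fst (din p)) < r" "q = p - t *\<^sub>R din p" using assms by (auto simp: germ_def)

lemma germ_fst_inj:
 assumes p: "p \<in> K" and "q \<in> germ p r" "q' \<in> germ p s" "fst q = fst q'"
 shows "q = q'"
proof -
 have n: "fst (dout p) \<noteq> 0" "fst (din p) \<noteq> 0" using dirs_nonzero[OF p] by auto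
 have bt: False if "0 < t" "0 < t'" "t *\<^sub>R fst (dout p) = - (t' *\<^sub>R fst (din p))" for t t'
 proof -
  have "fst (din p) = (1 / t') *\<^sub>R (t' *\<^sub>R fst (din p))" using that by simp
  also have "\<dots> = (1 / t') *\<^sub>R (- (t *\<^sub>R fst (dout p)))" using that(3) by simp
  also have "\<dots> = - ((t / t') *\<^sub>R fst (dout p))" by simp
  finally have "fst (din p) = - ((t / t') *\<^sub>R fst (dout p))" .
  moreover have "t / t' > 0" using that by simp
  ultimately show False using nb[OF p] unfolding no_backtrack_def by blast
 qed
 show ?thesis using assms(2,3)
 proof (elim germ_cases)
  fix t t' assume t: "0 < t" "0 < t'" "q = p + t *\<^sub>R dout p" "q' = p - t' *\<^sub>R din p"
  then show ?thesis using assms(4) bt[of t t'] by simp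
 next
  fix t t' assume t: "0 < t" "0 < t'" "q = p - t *\<^sub>R din p" "q' = p + t' *\<^sub>R dout p"
  then have "t' *\<^sub>R fst (dout p) = - (t *\<^sub>R fst (din p))" using assms(4) by simp
  then show ?thesis using bt[of t' t] t by simp
 qed (use assms(4) n in auto)
qed

lemma picture_germ:
 assumes "picture x r" "p \<in> K" "fst p = fst x" "q \<in> germ p r"
 shows "q \<in> K" "snd x < snd p ==> snd x + r < snd q" "snd p < snd x ==> snd q < snd x - r"
  "q \<noteq> p ==> din q = dout q"
proof -
 have "good_germ x p r" using assms by (simp add: picture_def)
 then show "q \<in> K" "snd x < snd p ==> snd x + r < snd q" "snd p < snd x ==> snd q < snd x - r"
  "q \<noteq> p ==> din q = dout q" using assms(2,4) unfolding good_germ_def by (auto elim!: germ_cases)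
qed

text \<open>Because germs stay out of the slab of heights around \<open>x\<close>, the strands above
  a nearby \<open>y\<close> are exactly the continuations of strands above \<open>x\<close> whose
  projection runs through that of \<open>y\<close>.\<close>

lemma above_ball:
 assumes pic: "picture x r" and y: "y \<in> ball x r"
 shows "above y = {q. fst q = fst y \<and> (\<exists>p\<in>above x. q \<in> germ p r)}"
proof (intro equalityI subsetI)
 fix q assume q: "q \<in> above y"
 then have "q \<in> K" "fst q = fst y" "snd y < snd q" by (auto simp: above_def)
 moreover have fy: "norm (fst y - fst x) < r" "\<bar>snd y - snd x\<bar> < r" using ball_fst[OF y] by auto
 ultimately have d: "dist (fst q) (fst x) < r" by (simp add: dist_norm)
 then obtain p t where p: "p \<in> K" "fst p = fst x" "t \<ge> 0" "q = p + t *\<^sub>R dout p \<or> q = p - t *\<^sub>R din p"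
  using pic \<open>q \<in> K\<close> unfolding picture_def by blast
 have g: "q \<in> germ p r"
 proof (cases "t = 0")
  case False
  then show ?thesis using p d unfolding germ_def by (auto simp: dist_norm)
 qed (use p in \<open>auto simp: germ_def\<close>)
 have "x \<notin> K" using pic unfolding picture_def by (metis centre_in_ball disjoint_iff)
 then have "snd p \<noteq> snd x" using p by (metis prod.expand)
 moreover have "\<not> snd p < snd x" using picture_germ(3)[OF pic p(1,2) g] fy \<open>snd y < snd q\<close> by linarith
 ultimately have "p \<in> above x" using p by (auto simp: above_def)
 then show "q \<in> {q. fst q = fst y \<and> (\<exists>p\<in>above x. q \<in> germ p r)}" using g \<open>fst q = fst y\<close> by blast
next
 fix q assume "q \<in> {q. fst q = fst y \<and> (\<exists>p\<in>above x. q \<in> germ p r)}"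
 then obtain p where p: "p \<in> above x" "q \<in> germ p r" "fst q = fst y" by blast
 then have "q \<in> K" "snd x + r < snd q" using picture_germ[OF pic, of p q] by (auto simp: above_def)
 then show "q \<in> above y" using ball_fst[OF y] p by (auto simp: above_def)
qed

lemma picture_notin: "picture x r ==> y \<in> ball x r ==> y \<notin> K" unfolding picture_def by blast

lemma picture_pos: "picture x r ==> 0 < r" by (simp add: picture_def)

lemma germ_not_strict:
 assumes "q \<in> germ p r" "fst q = fst y"
 shows "\<not> bl p y \<and> \<not> br p y"
proof -
 consider t where "t \<ge> 0" "fst y - fst p = t *\<^sub>R fst (dout p)" | t where "t \<ge> 0" "fst y - fst p = - (t *\<^sub>R fst (din p))"
  using assms(1)
 proof (cases rule: germ_cases)
  case 1
  then show ?thesis using assms(2) that(1)[of 0] by simp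
 next
  case (2 t)
  then show ?thesis using assms(2)[symmetric] that(1)[of t] by simp
 next
  case (3 t)
  then show ?thesis using assms(2)[symmetric] that(2)[of t] by simp
 qed
 then show ?thesis by cases (use bend_ray in auto)
qed

lemma strict_top:
 assumes "picture x r" "y \<in> ball x r" "\<And>p. p \<in> above x ==> bl p y \<or> br p y"
 shows "y \<in> top_region"
proof -
 have "above y = {}" unfolding above_ball[OF assms(1,2)] using assms(3) germ_not_strict by fastforce
 then show ?thesis using assms by (simp add: top_region_def picture_notin)
qed

lemma strict_or_germ:
 assumes "picture x r" "y \<in> ball x r" "p \<in> above x"
 obtains "bl p y" | "br p y" | q where "q \<in> germ p r" "fst q = fst y" "q \<in> above y"
proof -
 have p: "p \<in> K" "fst p = fst x" using assms(3) by (auto simp: above_def)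
 have n: "norm (fst y - fst p) < r" using ball_fst[OF assms(2)] p by simp
 consider "bl p y" | "br p y" | t where "t \<ge> 0" "fst y - fst p = t *\<^sub>R fst (dout p) \<or> fst y - fst p = - (t *\<^sub>R fst (din p))"
  using bend_cases[OF nb[OF p(1)]] by blast
 then show ?thesis
 proof cases
  case 3
  have "\<exists>q. q \<in> germ p r \<and> fst q = fst y"
  proof (cases "t = 0")
   case True
   then show ?thesis using 3 by (intro exI[of _ p]) (auto simp: germ_def)
  next
   case False
   then have t: "t > 0" using 3 by simp
   from 3(2) show ?thesis
   proof
    assume e: "fst y - fst p = t *\<^sub>R fst (dout p)"
    then have "p + t *\<^sub>R dout p \<in> germ p r" using t n by (auto simp: germ_def)
    moreover have "fst (p + t *\<^sub>R dout p) = fst y" using e by (simp add: algebra_simps)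
    ultimately show ?thesis by blast
   next
    assume e: "fst y - fst p = - (t *\<^sub>R fst (din p))"
    then have "p - t *\<^sub>R din p \<in> germ p r" using t n by (auto simp: germ_def)
    moreover have "fst (p - t *\<^sub>R din p) = fst y" using e by (simp add: algebra_simps)
    ultimately show ?thesis by blast
   qed
  qed
  then obtain q where q: "q \<in> germ p r" "fst q = fst y" by blast
  then have "q \<in> above y" unfolding above_ball[OF assms(1,2)] using assms(3) by blast
  then show ?thesis using that(3) q by blast
 qed (use that in blast)+
qed

text \<open>A germ point \<open>q\<close> other than \<open>p\<close> knows only one of the two
  directions of the bend at \<open>p\<close>. Near \<open>q\<close> this gives the same sides, by
  \<open>bend_near_out\<close> and \<open>bend_near_in\<close>.\<close>

lemma germ_sides:
 assumes p: "p \<in> K" and q: "q \<in> germ p r" "q \<noteq> p" and d: "din q = dout q" "fst (dout q) = fst (dout p) \<and> q \<in> {p + t *\<^sub>R dout p |t. 0 < t} \<or> fst (dout q) = fst (din p) \<and> q \<in> {p - t *\<^sub>R din p |t. 0 < t}"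
  and y: "fst y = fst q"
 shows "\<exists>W. open W \<and> y \<in> W \<and> (\<forall>v\<in>W. (bl q v \<longleftrightarrow> bl p v) \<and> (br q v \<longleftrightarrow> br p v))"
 using d(2)
proof
 assume a: "fst (dout q) = fst (dout p) \<and> q \<in> {p + t *\<^sub>R dout p |t. 0 < t}"
 then obtain t where t: "t > 0" "q = p + t *\<^sub>R dout p" by blast
 obtain W where W: "open W" "t *\<^sub>R fst (dout p) \<in> W" "\<forall>w\<in>W. (bend_left (fst (din p)) (fst (dout p)) w \<longleftrightarrow> cross (fst (dout p)) w > 0) \<and>
   (bend_right (fst (din p)) (fst (dout p)) w \<longleftrightarrow> cross (fst (dout p)) w < 0)" using bend_near_out[OF nb[OF p] t(1)] by blast
 have e: "cross (fst (dout q)) (fst v - fst q) = cross (fst (dout p)) (fst v - fst p)" for v using a t by (simp add: cross_diff cross_add)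
 have s: "bl q v \<longleftrightarrow> cross (fst (dout p)) (fst v - fst p) > 0" "br q v \<longleftrightarrow> cross (fst (dout p)) (fst v - fst p) < 0" for v
  by (simp_all add: d(1) e)
 have "open ((\<lambda>y. fst y - fst p) -` W)" by (intro open_vimage W continuous_intros)
 moreover have "y \<in> (\<lambda>y. fst y - fst p) -` W" using W(2) t y by simp
 ultimately show ?thesis using W(3) unfolding s by blast
next
 assume a: "fst (dout q) = fst (din p) \<and> q \<in> {p - t *\<^sub>R din p |t. 0 < t}"
 then obtain t where t: "t > 0" "q = p - t *\<^sub>R din p" by blast
 obtain W where W: "open W" "- (t *\<^sub>R fst (din p)) \<in> W" "\<forall>w\<in>W. (bend_left (fst (din p)) (fst (dout p)) w \<longleftrightarrow> cross (fst (din p)) w > 0) \<and>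
   (bend_right (fst (din p)) (fst (dout p)) w \<longleftrightarrow> cross (fst (din p)) w < 0)" using bend_near_in[OF nb[OF p] t(1)] by blast
 have e: "cross (fst (dout q)) (fst v - fst q) = cross (fst (din p)) (fst v - fst p)" for v using a t by (simp add: cross_diff cross_add)
 have s: "bl q v \<longleftrightarrow> cross (fst (din p)) (fst v - fst p) > 0" "br q v \<longleftrightarrow> cross (fst (din p)) (fst v - fst p) < 0" for v
  by (simp_all add: d(1) e)
 have "open ((\<lambda>y. fst y - fst p) -` W)" by (intro open_vimage W continuous_intros)
 moreover have "y \<in> (\<lambda>y. fst y - fst p) -` W" using W(2) t y by simp
 ultimately show ?thesis using W(3) unfolding s by blast
qed

lemma picture_germ_sides:
 assumes pic: "picture x r" and p: "p \<in> K" "fst p = fst x" and q: "q \<in> germ p r" and y: "fst y = fst q"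
 shows "\<exists>W. open W \<and> y \<in> W \<and> (\<forall>v\<in>W. (bl q v \<longleftrightarrow> bl p v) \<and> (br q v \<longleftrightarrow> br p v))"
proof (cases "q = p")
 case True
 then show ?thesis by (intro exI[of _ UNIV]) auto
next
 case False
 have g: "good_germ x p r" using pic p by (simp add: picture_def)
 show ?thesis
 proof (rule germ_sides[OF p(1) q False])
  show "din q = dout q" by (rule picture_germ(4)[OF pic p q False])
  show "fst (dout q) = fst (dout p) \<and> q \<in> {p + t *\<^sub>R dout p |t. 0 < t} \<or> fst (dout q) = fst (din p) \<and> q \<in> {p - t *\<^sub>R din p |t. 0 < t}"
   using q False g unfolding good_germ_def by (elim germ_cases) auto
 qed (rule y)
qed

lemma below_point:
 assumes "p \<in> K" "\<not> under p"
 obtains x where "x \<notin> K" "above x = {p}" "fst x = fst p"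
proof -
 \<comment> \<open>Half the gap to the second point of the fibre, and 1 if there is no second
   point.\<close>
 define s where "s = (if \<exists>q\<in>K. fst q = fst p \<and> q \<noteq> p then (snd p - snd (SOME q. q \<in> K \<and> fst q = fst p \<and> q \<noteq> p)) / 2 else 1)"
 have *: "s > 0 \<and> (\<forall>q\<in>K. fst q = fst p --> q \<noteq> p --> snd q < snd p - s)"
 proof (cases "\<exists>q\<in>K. fst q = fst p \<and> q \<noteq> p")
  case True
  define q where "q = (SOME q. q \<in> K \<and> fst q = fst p \<and> q \<noteq> p)"
  have q: "q \<in> K" "fst q = fst p" "q \<noteq> p"
   using someI_ex[of "\<lambda>q. q \<in> K \<and> fst q = fst p \<and> q \<noteq> p"] True unfolding q_def by blast+
  have "snd q \<noteq> snd p" using q by (metis prod.expand)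
  moreover have "\<not> over q p" using assms unfolding under_def by blast
  then have "\<not> snd p < snd q" using assms q by (simp add: over_def)
  ultimately have "snd q < snd p" by linarith
  moreover have "s = (snd p - snd q) / 2" using True by (simp add: s_def q_def)
  moreover have "q' = q" if "q' \<in> K" "fst q' = fst p" "q' \<noteq> p" for q' using fibre_le_2[of p q q'] that q assms by auto
  ultimately show ?thesis by (metis (no_types, opaque_lifting) field_sum_of_halves add_diff_cancel_left' diff_gt_0_iff_gt half_gt_zero less_diff_eq add.commute diff_add_cancel)
 next
  case False
  then show ?thesis by (auto simp: s_def)
 qed
 define x where "x = (fst p, snd p - s)"
 have "x \<notin> K"
 proof
  assume "x \<in> K"
  moreover have "x \<noteq> p" using * by (auto simp: x_def prod_eq_iff)
  ultimately show False using * by (auto simp: x_def)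
 qed
 moreover have "above x = {p}"
 proof -
  have "q = p" if "q \<in> K" "fst q = fst p" "snd p - s < snd q" for q using * that by force
  then show ?thesis using * assms by (auto simp: above_def x_def)
 qed
 ultimately show ?thesis using that[of x] by (simp add: x_def)
qed

lemma side_points:
 assumes "p \<in> K" "r > 0" "fst x = fst p"
 obtains y z where "y \<in> ball x r" "z \<in> ball x r" "br p y" "bl p z"
proof -
 obtain n where n: "cross (fst (din p)) n > 0" "cross (fst (dout p)) n > 0" using common_left[OF nb[OF assms(1)]] by blast
 then have "n \<noteq> 0" by auto
 define s where "s = r / (2 * norm n)"
 have s: "s > 0" "s * norm n < r" using assms \<open>n \<noteq> 0\<close> by (auto simp: s_def field_simps)
 show ?thesis
 proof
  show "x + (- (s *\<^sub>R n), 0) \<in> ball x r" "x + (s *\<^sub>R n, 0) \<in> ball x r" using s by (simp_all add: dist_norm norm_Pair)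
  show "br p (x + (- (s *\<^sub>R n), 0))" "bl p (x + (s *\<^sub>R n, 0))" using n s assms(3) by (auto simp: bend_left_def bend_right_def)
 qed
qed

text \<open>Colors sit on points instead of arcs. At an under-crossing \<open>w0\<close> and
  \<open>w1\<close> are the colors of the under strand to the right and to the left of the over
  strand; the crossing point itself lies on no arc and may carry either of them.\<close>

definition coloring :: "('g, 'h) monoid_scheme => (space => 'g) => bool" where
 "coloring G c \<longleftrightarrow> (\<forall>p\<in>K. c p \<in> carrier G) \<and>
   (\<forall>p\<in>K. \<not> under p --> (\<exists>e>0. \<forall>q\<in>K. dist q p < e --> c q = c p)) \<and>
   (\<forall>q. under q --> (\<exists>e>0. \<exists>w0\<in>carrier G. \<exists>w1\<in>carrier G.
    c (over_of q) \<otimes>\<^bsub>G\<^esub> w1 = w0 \<otimes>\<^bsub>G\<^esub> c (over_of q) \<and> (c q = w0 \<or> c q = w1) \<and>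
    (\<forall>t. 0 < t \<and> t < e --> c (q + t *\<^sub>R left_dir q) = w1 \<and> c (q - t *\<^sub>R left_dir q) = w0)))"

lemma crossing_colorsI:
 fixes G (structure)
 assumes o: "over p q" and e: "e > 0" and w: "w \<in> carrier G" "w' \<in> carrier G" "c q = w'"
  and rel: "if cross (fst (dout p)) (fst (dout q)) > 0 then c p \<otimes> w' = w \<otimes> c p else w' \<otimes> c p = c p \<otimes> w"
  and near: "\<And>t. 0 < t ==> t < e ==> c (q + t *\<^sub>R dout q) = w' \<and> c (q - t *\<^sub>R dout q) = w"
 shows "\<exists>e>0. \<exists>w0\<in>carrier G. \<exists>w1\<in>carrier G. c (over_of q) \<otimes> w1 = w0 \<otimes> c (over_of q) \<and> (c q = w0 \<or> c q = w1) \<and>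
  (\<forall>t. 0 < t \<and> t < e --> c (q + t *\<^sub>R left_dir q) = w1 \<and> c (q - t *\<^sub>R left_dir q) = w0)"
proof (rule exI[of _ e], rule conjI[OF e], cases "cross (fst (dout p)) (fst (dout q)) > 0")
 case True
 then show "\<exists>w0\<in>carrier G. \<exists>w1\<in>carrier G. c (over_of q) \<otimes> w1 = w0 \<otimes> c (over_of q) \<and> (c q = w0 \<or> c q = w1) \<and>
  (\<forall>t. 0 < t \<and> t < e --> c (q + t *\<^sub>R left_dir q) = w1 \<and> c (q - t *\<^sub>R left_dir q) = w0)"
  using w rel near by (intro bexI[OF _ w(1)] bexI[OF _ w(2)]) (simp add: left_dir_def over_of_eq[OF o])
next
 case False
 then show "\<exists>w0\<in>carrier G. \<exists>w1\<in>carrier G. c (over_of q) \<otimes> w1 = w0 \<otimes> c (over_of q) \<and> (c q = w0 \<or> c q = w1) \<and>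
  (\<forall>t. 0 < t \<and> t < e --> c (q + t *\<^sub>R left_dir q) = w1 \<and> c (q - t *\<^sub>R left_dir q) = w0)"
  using w rel near by (intro bexI[OF _ w(2)] bexI[OF _ w(1)]) (simp add: left_dir_def over_of_eq[OF o])
qed

end

section \<open>From colorings to representations: labels of points below the strands\<close>

context strands
begin

text \<open>The Wirtinger word of a path that starts to the right of all strands above
  \<open>x\<close> and ends at \<open>y\<close>: it passes beneath the under strand first, still to
  the right of the over strand and hence with value \<open>w q\<close>, and then beneath the over
  strand. At most two strands lie above \<open>x\<close>.\<close>

definition lab :: "('g, 'h) monoid_scheme => (space => 'g) => (space => 'g) => space => space => 'g" where
 "lab G c w x y =
   (let q = SOME q. q \<in> above x \<and> under q; p = SOME p. p \<in> above x \<and> \<not> under p in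
   (if (\<exists>q\<in>above x. under q) \<and> bl q y then w q else \<one>\<^bsub>G\<^esub>) \<otimes>\<^bsub>G\<^esub>
   (if above x \<noteq> {} \<and> bl p y then c p else \<one>\<^bsub>G\<^esub>))"

lemma lab_one:
 assumes "above x = {p}" "\<not> under p"
 shows "lab G c w x y = \<one>\<^bsub>G\<^esub> \<otimes>\<^bsub>G\<^esub> (if bl p y then c p else \<one>\<^bsub>G\<^esub>)"
proof -
 have "(SOME p. p \<in> above x \<and> \<not> under p) = p" using assms by (intro some_equality) auto
 then show ?thesis using assms by (simp add: lab_def)
qed

lemma over_under: "over p q ==> under q" unfolding under_def by blast

lemma lab_two:
 assumes "above x = {p, q}" "over p q"
 shows "lab G c w x y = (if bl q y then w q else \<one>\<^bsub>G\<^esub>) \<otimes>\<^bsub>G\<^esub> (if bl p y then c p else \<one>\<^bsub>G\<^esub>)"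
proof -
 have u: "\<not> under p" "under q" using over_not_under[OF assms(2)] over_under[OF assms(2)] by auto
 have "(SOME p. p \<in> above x \<and> \<not> under p) = p" using assms u by (intro some_equality) auto
 moreover have "(SOME q. q \<in> above x \<and> under q) = q" using assms u by (intro some_equality) auto
 ultimately show ?thesis using assms u by (simp add: lab_def)
qed

lemma lab_none: "above x = {} ==> lab G c w x y = \<one>\<^bsub>G\<^esub> \<otimes>\<^bsub>G\<^esub> \<one>\<^bsub>G\<^esub>" by (simp add: lab_def)

lemma germ_cross:
 assumes o: "over p q" and a: "q' \<in> germ q r" "p' \<in> germ p r" "fst q' = fst p'"
 shows "q' = q \<and> p' = p"
proof -
 note o = over_dirs[OF o]
 obtain t where t: "q' = q + t *\<^sub>R dout q" using a(1) o(2) by (elim germ_cases) (auto intro: that[of 0] that[of "- _"] that)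
 obtain s where s: "p' = p + s *\<^sub>R dout p" using a(2) o(1) by (elim germ_cases) (auto intro: that[of 0] that[of "- _"] that)
 have e: "t *\<^sub>R fst (dout q) = s *\<^sub>R fst (dout p)" using a(3) t s o(5) by simp
 then have "t * cross (fst (dout p)) (fst (dout q)) = s * cross (fst (dout p)) (fst (dout p))" by (metis cross_simps(6))
 then have "t = 0" using o(3) by simp
 then have "s = 0" using e dirs_nonzero[OF o(6)] by simp
 then show ?thesis using t s \<open>t = 0\<close> by simp
qed

text \<open>Two strands above \<open>x\<close> project transversally, so apart from the crossing
  itself no point near \<open>x\<close> lies below both.\<close>

lemma above_at_germ:
 assumes pic: "picture x r" and y: "y \<in> ball x r" "fst y = fst s"
  and p: "p \<in> above x" "s \<in> germ p r" and s: "above x = {p} \<or> s \<noteq> p"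
 shows "above y = {s}"
proof -
 have pK: "p \<in> K" "fst p = fst x" "snd x < snd p" using p by (auto simp: above_def)
 have eq: "s' = s" if s': "fst s' = fst s" "p' \<in> above x" "s' \<in> germ p' r" for s' p'
 proof (cases "p' = p")
  case True
  then show ?thesis using germ_fst_inj[OF pK(1), of s' r s r] s' p by simp
 next
  case False
  then have sp: "s \<noteq> p" using s s' by blast
  have "p' \<in> K" "fst p' = fst p" using s' pK by (auto simp: above_def)
  moreover have "snd p' \<noteq> snd p" using False calculation by (metis prod.expand)
  ultimately have o: "over p p' \<or> over p' p" using pK unfolding over_def by auto
  then show ?thesis using sp germ_cross[of p p' s' r s] germ_cross[of p' p s r s'] s' p by metis
 qed
 show ?thesis unfolding above_ball[OF pic y(1)]
 proof (intro equalityI subsetI)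
  fix s' assume "s' \<in> {q. fst q = fst y \<and> (\<exists>p\<in>above x. q \<in> germ p r)}"
  then obtain p' where "fst s' = fst y" "p' \<in> above x" "s' \<in> germ p' r" by blast
  then show "s' \<in> {s}" using eq[of s' p'] y(2) by simp
 next
  fix s' assume "s' \<in> {s}"
  then show "s' \<in> {q. fst q = fst y \<and> (\<exists>p\<in>above x. q \<in> germ p r)}" using p y(2) by auto
 qed
qed

lemma germ_shadow:
 assumes "picture x r" "p \<in> above x" "s \<in> germ p r"
 shows "(fst s, snd x) \<in> ball x r"
proof -
 have pK: "fst p = fst x" using assms by (auto simp: above_def)
 have "norm (fst s - fst x) < r" using assms(3) picture_pos[OF assms(1)] by (elim germ_cases) (auto simp: pK[symmetric])
 then have "dist (fst x, snd x) (fst s, snd x) < r" by (simp only: dist_Pair_Pair dist_self) (simp add: dist_norm norm_minus_commute)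
 then show ?thesis by simp
qed

lemma strict_above_empty:
 assumes "picture x r" "y \<in> ball x r" "\<And>p. p \<in> above x ==> bl p y \<or> br p y"
 shows "above y = {}" using strict_top[OF assms] by (simp add: top_region_def)

lemma germ_mono: "s \<le> r ==> germ p s \<subseteq> germ p r" by (auto simp: germ_def)

lemma germ_dist:
 assumes "p \<in> K" "e > 0"
 shows "\<exists>r>0. \<forall>q\<in>germ p r. dist q p < e"
proof -
 have n: "fst (dout p) \<noteq> 0" "fst (din p) \<noteq> 0" using dirs_nonzero assms by auto
 define M where "M = 1 + norm (dout p) / norm (fst (dout p)) + norm (din p) / norm (fst (din p))"
 have M: "M > 0" "norm (dout p) / norm (fst (dout p)) \<le> M" "norm (din p) / norm (fst (din p)) \<le> M" by (auto simp: M_def add_pos_nonneg)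
 have sl: "t * norm d < e" if "0 < t" "t * norm (fst d) < e / M" "norm d / norm (fst d) \<le> M" "fst d \<noteq> 0" for t d
 proof -
  have "t * norm d = (t * norm (fst d)) * (norm d / norm (fst d))" using that by simp
  also have "\<dots> \<le> (t * norm (fst d)) * M" using that by (intro mult_left_mono) auto
  also have "\<dots> < e" using that(2) M by (simp add: field_simps)
  finally show ?thesis .
 qed
 have "dist q p < e" if "q \<in> germ p (e / M)" for q using that assms(2)
 proof (cases rule: germ_cases)
  case (2 t)
  then show ?thesis using sl[of t "dout p"] M n by (simp add: dist_norm)
 next
  case (3 t)
  then show ?thesis using sl[of t "din p"] M n by (simp add: dist_norm)
 qed (use assms in simp)
 then show ?thesis using M assms by (intro exI[of _ "e / M"]) auto
qed

text \<open>\<open>w q\<close> is the color of the under strand at \<open>q\<close> to the right of the over strand.\<close>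

lemma strict_nbhd:
 assumes "bl s y \<or> br s y"
 obtains W where "open W" "y \<in> W" "\<And>v. v \<in> W ==> bl s v = bl s y"
proof (cases "bl s y")
 case True
 show ?thesis by (rule that[of "{y. bl s y}"]) (use True open_bl[of s] in simp_all)
next
 case False
 show ?thesis by (rule that[of "{y. br s y}"]) (use False assms open_br[of s] bend_exclusive in auto)
qed

text \<open>The strands above a nearby \<open>y\<close> are among those above \<open>x\<close>, so
  passing from the labels of \<open>x\<close> to those of \<open>y\<close> drops at most the factors
  of strands that no longer lie above. A dropped factor is constant near \<open>y\<close> and stands
  on the left, except when \<open>y\<close> lies beneath the under strand to the left of the over
  strand; there the crossing relation moves it to the left. Then
  \<open>groupoid_rep_of_labels\<close> applies.\<close>

lemma coloring_label:
 fixes G (structure)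
 assumes "group G" and col: "coloring G c"
 obtains \<Phi> w R where "groupoid_rep G (- K) \<Phi>"
  "\<And>x. x \<notin> K ==> picture x (R x)"
  "\<And>x g. [|x \<notin> K; path g; path_image g \<subseteq> ball x (R x)|] ==>
    \<Phi> g = inv (lab G c w x (pathstart g)) \<otimes> lab G c w x (pathfinish g)"
  "\<And>q. under q ==> w q \<in> carrier G \<and> (\<exists>e>0. \<forall>t. 0 < t \<and> t < e --> c (q - t *\<^sub>R left_dir q) = w q)"
proof -
 interpret group G by fact
 have cc: "c p \<in> carrier G" if "p \<in> K" for p using col that by (simp add: coloring_def)
 have cl: "\<exists>e>0. \<forall>q\<in>K. dist q p < e --> c q = c p" if "p \<in> K" "\<not> under p" for p
  using col that by (simp add: coloring_def)
 have "\<forall>q. \<exists>e w0 w1. under q --> e > 0 \<and> w0 \<in> carrier G \<and> w1 \<in> carrier G \<and>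
   c (over_of q) \<otimes> w1 = w0 \<otimes> c (over_of q) \<and>
   (\<forall>t. 0 < t \<and> t < e --> c (q + t *\<^sub>R left_dir q) = w1 \<and> c (q - t *\<^sub>R left_dir q) = w0)"
  using col unfolding coloring_def by meson
 then obtain e w w' where w: "\<And>q. under q ==> e q > 0 \<and> w q \<in> carrier G \<and> w' q \<in> carrier G \<and>
   c (over_of q) \<otimes> w' q = w q \<otimes> c (over_of q) \<and>
   (\<forall>t. 0 < t \<and> t < e q --> c (q + t *\<^sub>R left_dir q) = w' q \<and> c (q - t *\<^sub>R left_dir q) = w q)" by metis
 define A where "A p r \<longleftrightarrow> (\<not> under p --> (\<forall>q\<in>germ p r \<inter> K. c q = c p)) \<and>
   (under p --> (\<forall>t. 0 < t \<and> t * norm (fst (dout p)) < r --> c (p + t *\<^sub>R left_dir p) = w' p \<and> c (p - t *\<^sub>R left_dir p) = w p))" for p r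
 have A_ex: "\<exists>r>0. A p r" if p: "p \<in> K" for p
 proof (cases "under p")
  case True
  have n: "norm (fst (dout p)) > 0" using dirs_nonzero p by simp
  have "A p (e p * norm (fst (dout p)))" using True w[OF True] n by (simp add: A_def)
  then show ?thesis using w[OF True] n by (intro exI[of _ "e p * norm (fst (dout p))"]) simp
 next
  case False
  obtain d where d: "d > 0" "\<forall>q\<in>K. dist q p < d --> c q = c p" using cl[OF p False] by blast
  obtain r where "r > 0" "\<forall>q\<in>germ p r. dist q p < d" using germ_dist[OF p d(1)] by blast
  then show ?thesis using False d by (intro exI[of _ r]) (auto simp: A_def)
 qed
 have A_mono: "A p s" if "A p r" "0 < s" "s \<le> r" for p r s using that germ_mono[of s r p] unfolding A_def by (auto simp: subset_iff)
 have "\<exists>r. picture x r \<and> (\<forall>p\<in>above x. A p r)" if x: "x \<notin> K" for x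
 proof -
  have fin: "finite (above x)" by (rule finite_subset[OF _ finite_fibre[of "fst x"]]) (auto simp: above_def)
  have "\<exists>r>0. \<forall>p\<in>above x. A p r" by (rule common_radius[OF fin]) (use A_ex A_mono in \<open>auto simp: above_def\<close>)
  then obtain r where r: "r > 0" "\<forall>p\<in>above x. A p r" by blast
  obtain s where s: "picture x s" using picture_exists[OF x] by blast
  then show ?thesis using r picture_pos[OF s] picture_mono[OF s, of "min r s"] A_mono[of _ r "min r s"] by (intro exI[of _ "min r s"]) auto
 qed
 then obtain R where R: "\<And>x. x \<notin> K ==> picture x (R x)" "\<And>x p. [|x \<notin> K; p \<in> above x|] ==> A p (R x)" by metis
 let ?l = "lab G c w"
 have lc: "?l x y \<in> carrier G" if "x \<notin> K" for x y using that
 proof (cases rule: above_cases)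
  case none
  then show ?thesis by (simp add: lab_none)
 next
  case (one p)
  then have "p \<in> K" by (auto simp: above_def)
  then show ?thesis using one by (simp add: lab_one cc)
 next
  case (two p q)
  then have "p \<in> K" "under q" using over_under by (auto simp: above_def)
  then show ?thesis using two by (simp add: lab_two cc w)
 qed
 have compat: "\<exists>k\<in>carrier G. \<exists>W. open W \<and> y \<in> W \<and> (\<forall>v\<in>W. ?l x v = k \<otimes> ?l y v)"
  if x: "x \<notin> K" and y: "y \<in> ball x (R x)" for x y
 proof -
  note pic = R(1)[OF x]
  have yK: "y \<notin> K" using picture_notin[OF pic y] .
  have ab: "above y = {q. fst q = fst y \<and> (\<exists>p\<in>above x. q \<in> germ p (R x))}" by (rule above_ball[OF pic y])
  show ?thesis using x
  proof (cases rule: above_cases)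
   case none
   then have "above y = {}" using ab by auto
   then show ?thesis using none by (intro bexI[of _ \<one>] exI[of _ UNIV]) (auto simp: lab_none)
  next
   case (one p)
   have p: "p \<in> above x" "p \<in> K" "fst p = fst x" using one by (auto simp: above_def)
   show ?thesis
   proof (cases "bl p y \<or> br p y")
    case True
    then have "above y = {}" by (intro strict_above_empty[OF pic y]) (use one in auto)
    then have ly: "?l y v = \<one>" for v by (simp add: lab_none)
    obtain W where W: "open W" "y \<in> W" "\<And>v. v \<in> W ==> bl p v = bl p y" by (rule strict_nbhd[OF True]) (rule that; assumption)
    show ?thesis
    proof (intro bexI[of _ "?l x y"] exI[of _ W] conjI ballI W(1,2) lc[OF x])
     fix v assume "v \<in> W"
     from W(3)[OF this] have "?l x v = ?l x y" unfolding lab_one[OF one] by simp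
     then show "?l x v = ?l x y \<otimes> ?l y v" unfolding ly r_one[OF lc[OF x]] .
    qed
   next
    case False
    then obtain q where q: "q \<in> germ p (R x)" "fst q = fst y" "q \<in> above y" using strict_or_germ[OF pic y p(1)] by metis
    have "above y = {q}" by (rule above_at_germ[OF pic y _ p(1) q(1)]) (use q one in simp_all)
    moreover have "\<not> under q" using yK \<open>above y = {q}\<close> by (cases rule: above_cases) (auto simp: over_def)
    moreover have "c q = c p" using R(2)[OF x p(1)] one q(1,3) by (auto simp: A_def above_def)
    moreover obtain W where W: "open W" "y \<in> W" "\<forall>v\<in>W. (bl q v \<longleftrightarrow> bl p v) \<and> (br q v \<longleftrightarrow> br p v)"
     using picture_germ_sides[OF pic p(2,3) q(1)] q(2) by metis
    ultimately show ?thesis using one cc[OF p(2)] by (intro bexI[of _ \<one>] exI[of _ W]) (auto simp: lab_one)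
   qed
  next
   case (two p q)
   note o = over_dirs[OF two(2)]
   have uq: "under q" "\<not> under p" "over_of q = p" using two over_not_under over_of_eq over_under by auto
   have p: "p \<in> above x" "fst p = fst x" and q: "q \<in> above x" "fst q = fst x" using two by (auto simp: above_def)
   show ?thesis
   proof (cases "bl q y \<or> br q y")
    case bq: True
    obtain V where V: "open V" "y \<in> V" "\<And>v. v \<in> V ==> bl q v = bl q y" by (rule strict_nbhd[OF bq]) (rule that; assumption)
    show ?thesis
    proof (cases "bl p y \<or> br p y")
     case True
     then have "above y = {}" by (intro strict_above_empty[OF pic y]) (use two bq in auto)
     then have ly: "?l y v = \<one>" for v by (simp add: lab_none)
     obtain W where W: "open W" "y \<in> W" "\<And>v. v \<in> W ==> bl p v = bl p y" by (rule strict_nbhd[OF True]) (rule that; assumption)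
     show ?thesis
     proof (intro bexI[of _ "?l x y"] exI[of _ "V \<inter> W"] conjI ballI lc[OF x] open_Int V(1) W(1) IntI V(2) W(2))
      fix v assume v: "v \<in> V \<inter> W"
      from V(3)[OF IntD1[OF v]] W(3)[OF IntD2[OF v]] have "?l x v = ?l x y" unfolding lab_two[OF two] by simp
      then show "?l x v = ?l x y \<otimes> ?l y v" unfolding ly r_one[OF lc[OF x]] .
     qed
    next
     case False
     then obtain r where r: "r \<in> germ p (R x)" "fst r = fst y" "r \<in> above y" using strict_or_germ[OF pic y p(1)] by metis
     have "r \<noteq> p"
     proof
      assume "r = p"
      then have "fst y = fst q" using r(2) o(5) by simp
      then show False using bq bend_ray(1,2)[of 0] by simp
     qed
     then have a: "above y = {r}" by (intro above_at_germ[OF pic y _ p(1) r(1)]) (use r in simp_all)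
     have u: "\<not> under r" using yK a by (cases rule: above_cases) (auto simp: over_def)
     have cr: "c r = c p" using R(2)[OF x p(1)] uq r(1,3) by (auto simp: A_def above_def)
     obtain W where W: "open W" "y \<in> W" "\<forall>v\<in>W. (bl r v \<longleftrightarrow> bl p v) \<and> (br r v \<longleftrightarrow> br p v)"
      using picture_germ_sides[OF pic o(6) p(2) r(1)] r(2) by metis
     show ?thesis
     proof (intro bexI[of _ "if bl q y then w q else \<one>"] exI[of _ "V \<inter> W"] conjI ballI open_Int V(1) W(1) IntI V(2) W(2))
      show "?l x v = (if bl q y then w q else \<one>) \<otimes> ?l y v" if "v \<in> V \<inter> W" for v
       unfolding lab_two[OF two] lab_one[OF a u] V(3)[OF IntD1[OF that]] cr using W(3)[rule_format, OF IntD2[OF that]] cc[OF o(6)] by simp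
     qed (use w[OF uq(1)] in simp)
    qed
   next
    case False
    then obtain r where r: "r \<in> germ q (R x)" "fst r = fst y" "r \<in> above y" using strict_or_germ[OF pic y q(1)] by metis
    show ?thesis
    proof (cases "r = q")
     case True
     have "r' \<in> {p, q} \<longleftrightarrow> fst r' = fst y \<and> (r' \<in> germ p (R x) \<or> r' \<in> germ q (R x))" for r'
     proof -
      have "p \<in> germ p (R x)" "q \<in> germ q (R x)" by (auto simp: germ_def)
      then show ?thesis using True r(2) o(5) germ_fst_inj[OF o(6), of r' "R x" p "R x"] germ_fst_inj[OF o(7), of r' "R x" q "R x"] by auto
     qed
     then have "above y = {p, q}" unfolding ab two(1) by auto
     then show ?thesis using two cc[OF o(6)] w[OF uq(1)] by (intro bexI[of _ \<one>] exI[of _ UNIV]) (auto simp: lab_two)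
    next
     case False
     have a: "above y = {r}" by (rule above_at_germ[OF pic y _ q(1) r(1)]) (use r False in simp_all)
     have u: "\<not> under r" using yK a by (cases rule: above_cases) (auto simp: over_def)
     obtain W where W: "open W" "y \<in> W" "\<forall>v\<in>W. (bl r v \<longleftrightarrow> bl q v) \<and> (br r v \<longleftrightarrow> br q v)"
      using picture_germ_sides[OF pic o(7) q(2) r(1)] r(2) by metis
     have rr: "\<exists>t. 0 < t \<and> t * norm (fst (dout q)) < R x \<and> (r = q + t *\<^sub>R left_dir q \<or> r = q - t *\<^sub>R left_dir q)"
      using r(1) False o(2) by (elim germ_cases) (auto simp: left_dir_def)
     then obtain t where t: "0 < t" "t * norm (fst (dout q)) < R x" "r = q + t *\<^sub>R left_dir q \<or> r = q - t *\<^sub>R left_dir q" by blast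
     have fr: "fst y - fst p = fst r - fst q" using r(2) o(5) by simp
     have Aq: "c (q + t *\<^sub>R left_dir q) = w' q" "c (q - t *\<^sub>R left_dir q) = w q" using R(2)[OF x q(1)] uq(1) t by (auto simp: A_def)
     have rel: "c p \<otimes> w' q = w q \<otimes> c p" "w q \<in> carrier G" "w' q \<in> carrier G" using w[OF uq(1)] uq(3) by auto
     from t(3) show ?thesis
     proof
      \<comment> \<open>Beneath the left part of the under strand the over strand contributes
        \<open>c p\<close> throughout, and \<open>c p \<otimes> w' q = w q \<otimes> c p\<close>
        moves this factor to the left. Beneath the right part, treated afterwards, it contributes
        nothing.\<close>
      assume rl: "r = q + t *\<^sub>R left_dir q"
      have b: "bl p y" unfolding o(1) fr using rl t o(4) by simp
      show ?thesis using two a u W b open_bl[of p] cc[OF o(6)] rel rl Aq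
       by (intro bexI[of _ "c p"] exI[of _ "W \<inter> {y. bl p y}"]) (auto simp: lab_one lab_two)
     next
      assume rl: "r = q - t *\<^sub>R left_dir q"
      have b: "br p y" unfolding o(1) fr using rl t o(4) by simp
      have "\<not> bl p v" if "br p v" for v using that bend_exclusive by blast
      then show ?thesis using two a u W b open_br[of p] rel rl Aq
       by (intro bexI[of _ \<one>] exI[of _ "W \<inter> {y. br p y}"]) (auto simp: lab_one lab_two)
     qed
    qed
   qed
  qed
 qed
 obtain \<Phi> where \<Phi>: "groupoid_rep G (- K) \<Phi>"
  "\<And>x g. [|x \<in> - K; path g; path_image g \<subseteq> ball x (R x)|] ==> \<Phi> g = inv (?l x (pathstart g)) \<otimes> ?l x (pathfinish g)"
 proof (rule groupoid_rep_of_labels[OF \<open>group G\<close>, of "- K" "\<lambda>x. ball x (R x)" ?l])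
  show "open (ball p (R p)) \<and> convex (ball p (R p)) \<and> p \<in> ball p (R p) \<and> ball p (R p) \<subseteq> - K" if "p \<in> - K" for p
   using picture_notin[OF R(1)[of p]] picture_pos[OF R(1)[of p]] that by (auto simp del: mem_ball)
  show "?l p y \<in> carrier G" if "p \<in> - K" for p y using lc that by auto
  show "\<exists>k\<in>carrier G. \<exists>W. open W \<and> y \<in> W \<and> (\<forall>v\<in>W. ?l p v = k \<otimes> ?l y v)" if "p \<in> - K" "y \<in> ball p (R p)" for p y
   using compat[of p y] that by auto
 qed blast
 show ?thesis
 proof (rule that[of \<Phi> R w, OF \<Phi>(1) R(1)])
  show "\<Phi> g = inv (?l x (pathstart g)) \<otimes> ?l x (pathfinish g)"
   if "x \<notin> K" "path g" "path_image g \<subseteq> ball x (R x)" for x g using \<Phi>(2)[of x g] that by simp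
  show "w q \<in> carrier G \<and> (\<exists>e>0. \<forall>t. 0 < t \<and> t < e --> c (q - t *\<^sub>R left_dir q) = w q)" if "under q" for q
   using w[OF that] by blast
 qed
qed

end

section \<open>The top region, and the values of the representation of a coloring\<close>

context strands
begin

lemma height_bound:
 obtains H where "\<And>p. p \<in> K ==> \<bar>snd p\<bar> < H"
proof -
 obtain B where B: "\<And>p. p \<in> K ==> norm p \<le> B" using compact_imp_bounded[OF compact_K] by (auto simp: bounded_iff)
 have "\<bar>snd p\<bar> < B + 1" if "p \<in> K" for p using B[OF that] norm_snd_le[of "snd p" "fst p"] by simp
 then show ?thesis using that by blast
qed

text \<open>A point with nothing above it can be raised freely. So the region deforms into a half
  space above the link, which is convex.\<close>

lemma simply_connected_top_region: "simply_connected top_region"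
proof -
 obtain H where H': "\<And>p. p \<in> K ==> \<bar>snd p\<bar> < H" using height_bound by blast
 then have H: "snd p < H" if "p \<in> K" for p using that by fastforce
 have up: "y \<in> top_region" if "x \<in> top_region" "fst y = fst x" "snd x \<le> snd y" for x y
 proof -
  have "y \<notin> K"
  proof
   assume "y \<in> K"
   then have "y \<in> above x \<or> y = x" using that by (auto simp: above_def prod_eq_iff)
   then show False using that \<open>y \<in> K\<close> by (auto simp: top_region_def)
  qed
  moreover have "above y \<subseteq> above x" using that by (auto simp: above_def)
  ultimately show ?thesis using that by (auto simp: top_region_def)
 qed
 have high: "y \<in> top_region" if "snd y \<ge> H" for y
 proof -
  have "\<not> snd y < snd p" if "p \<in> K" for p using H[OF that] \<open>snd y \<ge> H\<close> by linarith
  then have "above y = {}" unfolding above_def by blast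
  moreover have "y \<notin> K" using H[of y] that by linarith
  ultimately show ?thesis by (simp add: top_region_def)
 qed
 define g where "g x = (fst x, max (snd x) H)" for x :: space
 have g: "continuous_on top_region g" unfolding g_def by (intro continuous_intros)
 have "homotopic_with_canon (\<lambda>x. True) top_region top_region id g"
 proof (rule homotopic_with_linear[OF continuous_on_id' g, folded id_def])
  fix x assume x: "x \<in> top_region"
  show "closed_segment (id x) (g x) \<subseteq> top_region"
  proof
   fix y assume "y \<in> closed_segment (id x) (g x)"
   then obtain u where u: "0 \<le> u" "u \<le> 1" "y = (1 - u) *\<^sub>R x + u *\<^sub>R g x" by (auto simp: in_segment)
   have "fst y = fst x" unfolding u(3) by (simp add: g_def scaleR_left_diff_distrib)
   moreover have "snd y = snd x + u * (max (snd x) H - snd x)" unfolding u(3) by (simp add: g_def algebra_simps)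
   then have "snd x \<le> snd y" using u by simp
   ultimately show "y \<in> top_region" using up x by blast
  qed
 qed
 moreover have "homotopic_with_canon (\<lambda>x. True) top_region top_region g (\<lambda>x. (0, H))"
 proof (rule homotopic_with_linear[OF g])
  fix x assume x: "x \<in> top_region"
  have "closed_segment (g x) (0, H) \<subseteq> {y. snd y \<ge> H}"
  proof (rule closed_segment_subset)
   have "{y::space. snd y \<ge> H} = snd -` {H..}" by auto
   then show "convex {y::space. snd y \<ge> H}" by (simp add: convex_linear_vimage linear_snd)
  qed (auto simp: g_def)
  then show "closed_segment (g x) (0, H) \<subseteq> top_region" using high by auto
 qed auto
 ultimately have "homotopic_with_canon (\<lambda>x. True) top_region top_region id (\<lambda>x. (0, H))" by (rule homotopic_with_trans)
 then have "contractible top_region" unfolding contractible_def by blast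
 then show ?thesis by (rule contractible_imp_simply_connected)
qed

lemma top_region_nonempty: "top_region \<noteq> {}"
proof -
 obtain H where "\<And>p. p \<in> K ==> \<bar>snd p\<bar> < H" using height_bound by blast
 then have "(0, H) \<in> top_region" by (force simp: top_region_def above_def)
 then show ?thesis by blast
qed

lemma top_region_subset: "top_region \<subseteq> - K" by (auto simp: top_region_def)

lemma near_not_under:
 assumes "p \<in> K"
 obtains e where "e > 0" "\<And>q. [|q \<in> K; q \<noteq> p; dist q p < e|] ==> \<not> under q"
proof -
 obtain e where e: "e > 0" "\<forall>q\<in>{p \<in> K. \<exists>q\<in>K. q \<noteq> p \<and> fst q = fst p}. q \<noteq> p --> e \<le> dist p q"
  using finite_set_avoid[OF finite_double] by blast
 have "\<not> under q" if "q \<in> K" "q \<noteq> p" "dist q p < e" for q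
 proof
  assume "under q"
  then obtain s where "over s q" unfolding under_def by blast
  then have "s \<in> K" "s \<noteq> q" "fst s = fst q" unfolding over_def by auto
  then have "q \<in> {p \<in> K. \<exists>q\<in>K. q \<noteq> p \<and> fst q = fst p}" using that(1) by blast
  then have "e \<le> dist p q" using e(2) that(2) by blast
  then show False using that(3) by (simp add: dist_commute)
 qed
 then show ?thesis using that e(1) by blast
qed

lemma germ_left_dir:
 assumes "over p q" "0 < t" "t * norm (fst (dout q)) < r"
 shows "q + t *\<^sub>R left_dir q \<in> germ q r" "q - t *\<^sub>R left_dir q \<in> germ q r"
  "q + t *\<^sub>R left_dir q \<noteq> q" "q - t *\<^sub>R left_dir q \<noteq> q"
 using assms over_dirs[OF assms(1)] dirs_nonzero[of q] by (auto simp: germ_def left_dir_def)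

lemma germ_in_K:
 assumes "p \<in> K"
 obtains e where "e > 0" "\<And>q. q \<in> germ p e ==> q \<in> K"
proof -
 obtain x where x: "x \<notin> K" "fst x = fst p"
 proof -
  obtain H where "\<And>p. p \<in> K ==> \<bar>snd p\<bar> < H" using height_bound by blast
  then have "(fst p, H) \<notin> K" by force
  then show ?thesis using that[of "(fst p, H)"] by simp
 qed
 obtain r where "picture x r" using picture_exists[OF x(1)] by blast
 then show ?thesis using that[of r] picture_germ(1)[of x r p] picture_pos[of x r] assms x by auto
qed

text \<open>The color of \<open>p\<close> is the value of a short segment beneath \<open>p\<close>
  from its right side, where the label is 1, to its left side, where the label is
  \<open>c p\<close>. Both ends of the segment lie in the top region.\<close>

lemma coloring_rep:
 fixes G (structure)
 assumes "group G" and col: "coloring G c"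
 obtains \<Phi> where "groupoid_rep G (- K) \<Phi>"
  "\<And>g. [|path g; path_image g \<subseteq> top_region|] ==> \<Phi> g = \<one>"
  "\<And>p. p \<in> K ==> \<exists>g. path g \<and> path_image g \<subseteq> - K \<and> pathstart g \<in> top_region \<and> pathfinish g \<in> top_region \<and> \<Phi> g = c p"
proof -
 interpret group G by fact
 obtain \<Phi> w R where \<Phi>: "groupoid_rep G (- K) \<Phi>" and R: "\<And>x. x \<notin> K ==> picture x (R x)"
  and lab: "\<And>x g. [|x \<notin> K; path g; path_image g \<subseteq> ball x (R x)|] ==>
    \<Phi> g = inv (lab G c w x (pathstart g)) \<otimes> lab G c w x (pathfinish g)" using coloring_label[OF assms] by metis
 interpret rep: groupoid_rep G "- K" \<Phi> by (rule \<Phi>)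
 interpret top: groupoid_rep G top_region \<Phi> by (rule rep.restrict) (rule top_region_subset)
 \<comment> \<open>\<open>local_to_global\<close> is used with the trivial subgroup: around a point
   with nothing above it all labels are 1.\<close>
 have triv: "\<Phi> g = \<one>" if g: "path g" "path_image g \<subseteq> top_region" for g
 proof -
  have "\<Phi> g \<in> {\<one>}"
  proof (rule top.local_to_global[where S = top_region])
   show "subgroup {\<one>} G" by (rule triv_subgroup)
   show "\<exists>b. path b \<and> path_image b \<subseteq> W \<and> pathstart b \<in> top_region \<and> pathfinish b = p"
    if "p \<in> top_region" "p \<in> W" for p W using that by (intro exI[of _ "linepath p p"]) auto
   show "\<exists>N. openin (top_of_set top_region) N \<and> p \<in> N \<and>
     (\<forall>g. path g --> path_image g \<subseteq> N --> pathstart g \<in> top_region --> pathfinish g \<in> top_region --> \<Phi> g \<in> {\<one>})"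
    if p: "p \<in> top_region" for p
   proof (intro exI[of _ "top_region \<inter> ball p (R p)"] conjI allI impI)
    have pK: "p \<notin> K" "above p = {}" using p by (auto simp: top_region_def)
    show "openin (top_of_set top_region) (top_region \<inter> ball p (R p))" by (simp add: openin_open_Int)
    show "p \<in> top_region \<inter> ball p (R p)" using p picture_pos[OF R[OF pK(1)]] by simp
    fix g assume "path g" "path_image g \<subseteq> top_region \<inter> ball p (R p)"
    then show "\<Phi> g \<in> {\<one>}" using lab[OF pK(1), of g] pK(2) by (simp add: lab_none)
   qed
  qed (use g in auto)
  then show ?thesis by simp
 qed
 have main: "\<exists>g. path g \<and> path_image g \<subseteq> - K \<and> pathstart g \<in> top_region \<and> pathfinish g \<in> top_region \<and> \<Phi> g = c p"
  if p: "p \<in> K" "\<not> under p" for p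
 proof -
  obtain x where x: "x \<notin> K" "above x = {p}" "fst x = fst p" using below_point[OF p] by blast
  note pic = R[OF x(1)]
  obtain y z where yz: "y \<in> ball x (R x)" "z \<in> ball x (R x)" "br p y" "bl p z" using side_points[OF p(1) picture_pos[OF pic] x(3)] by blast
  have s: "closed_segment y z \<subseteq> ball x (R x)" using yz by (simp add: closed_segment_subset)
  have "\<Phi> (linepath y z) = inv (lab G c w x y) \<otimes> lab G c w x z" using lab[OF x(1), of "linepath y z"] s by simp
  also have "\<dots> = c p" using yz x p bend_exclusive[of _ _ "fst y - fst p"] col by (auto simp: lab_one coloring_def)
  finally have "\<Phi> (linepath y z) = c p" .
  moreover have "y \<in> top_region" "z \<in> top_region" using strict_top[OF pic] yz x(2) by auto
  moreover have "path_image (linepath y z) \<subseteq> - K" using s picture_notin[OF pic] by auto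
  ultimately show ?thesis by (intro exI[of _ "linepath y z"]) simp
 qed
 have "\<exists>g. path g \<and> path_image g \<subseteq> - K \<and> pathstart g \<in> top_region \<and> pathfinish g \<in> top_region \<and> \<Phi> g = c p"
  if p: "p \<in> K" for p
 proof (cases "under p")
  case True
  then obtain p0 where o: "over p0 p" unfolding under_def by blast
  obtain e w0 w1 where e: "e > 0" "c p = w0 \<or> c p = w1"
   "\<forall>t. 0 < t \<and> t < e --> c (p + t *\<^sub>R left_dir p) = w1 \<and> c (p - t *\<^sub>R left_dir p) = w0"
   using col[unfolded coloring_def, THEN conjunct2, THEN conjunct2, rule_format, OF True] by (elim exE bexE conjE) (rule that; assumption)
  obtain e1 where e1: "e1 > 0" "\<And>q. [|q \<in> K; q \<noteq> p; dist q p < e1|] ==> \<not> under q" using near_not_under[OF p] by blast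
  obtain e2 where e2: "e2 > 0" "\<And>q. q \<in> germ p e2 ==> q \<in> K" using germ_in_K[OF p] by blast
  obtain e3 where e3: "e3 > 0" "\<forall>q\<in>germ p e3. dist q p < e1" using germ_dist[OF p e1(1)] by blast
  have n: "norm (fst (dout p)) > 0" using dirs_nonzero[OF p] by simp
  define t where "t = min e (min e2 e3 / norm (fst (dout p))) / 2"
  have t0: "t > 0" using e(1) e2(1) e3(1) n by (simp add: t_def)
  have te: "t < e" using t0 e(1) by (simp add: t_def min_def split: if_splits)
  have "t < min e2 e3 / norm (fst (dout p))" using t0 e2 e3 n by (auto simp: t_def min_def divide_simps split: if_splits)
  then have tn: "t * norm (fst (dout p)) < e2" "t * norm (fst (dout p)) < e3" using n by (auto simp: field_simps)
  \<comment> \<open>An under-crossing carries the color of one of its two sides. A nearby point on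
    that side has the same color and is not under anything, so the segment found for it can be
    used.\<close>
  define q where "q = (if c p = w1 then p + t *\<^sub>R left_dir p else p - t *\<^sub>R left_dir p)"
  have "q \<in> germ p e2" "q \<in> germ p e3" "q \<noteq> p" using germ_left_dir[OF o t0 tn(1)] germ_left_dir[OF o t0 tn(2)] by (auto simp: q_def)
  then have "q \<in> K" "\<not> under q" using e2 e3 e1 by auto
  moreover have "c q = c p" using e te t0 by (auto simp: q_def)
  ultimately show ?thesis using main[of q] by metis
 qed (use main p in blast)
 then show ?thesis using that[of \<Phi>] \<Phi> triv by blast
qed

end

section \<open>From representations to colorings: the value of passing beneath a strand\<close>

context strands
begin

lemma above_singleton: "above x = {p} ==> p \<in> K \<and> fst x = fst p" unfolding above_def by (drule equalityD2) simp

lemma small_picture: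
 assumes "x' \<notin> K" "open U" "x' \<in> U"
 obtains r where "picture x' r" "ball x' r \<subseteq> U"
proof -
 obtain r1 where r1: "picture x' r1" using picture_exists[OF assms(1)] by blast
 obtain r2 where r2: "r2 > 0" "ball x' r2 \<subseteq> U" using assms(2,3) open_contains_ball by blast
 have "picture x' (min r1 r2)" by (rule picture_mono[OF r1]) (use r2 picture_pos[OF r1] in auto)
 moreover have "ball x' (min r1 r2) \<subseteq> U" using r2 by auto
 ultimately show ?thesis by (rule that)
qed

lemma strict_point:
 assumes pic: "picture x r"
 obtains y where "y \<in> ball x r" "y \<in> top_region"
proof -
 have x: "x \<in> ball x r" "x \<notin> K" using picture_pos[OF pic] picture_notin[OF pic] by auto
 from x(2) show ?thesis
 proof (cases rule: above_cases)
  case none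
  then show ?thesis using that[of x] x by (simp add: top_region_def)
 next
  case (one p)
  have p: "p \<in> K" "fst x = fst p" using above_singleton[of x p] one by simp_all
  obtain y z where y: "y \<in> ball x r" "z \<in> ball x r" "br p y" "bl p z" by (rule side_points[OF p(1) picture_pos[OF pic] p(2)])
  have "y \<in> top_region" by (rule strict_top[OF pic y(1)]) (use one y(3) in simp)
  then show ?thesis using that y(1) by blast
 next
  case (two p q)
  note o = over_dirs[OF two(2)]
  have f: "fst p = fst x" "fst q = fst x" using two(1) by (auto simp: above_def)
  have "fst (dout p) \<noteq> - (s *\<^sub>R fst (dout q))" for s
  proof
   assume e: "fst (dout p) = - (s *\<^sub>R fst (dout q))"
   show False using o(3) unfolding e by simp
  qed
  then have "no_backtrack (fst (dout p)) (fst (dout q))" using dirs_nonzero[OF o(6)] dirs_nonzero[OF o(7)] by (simp add: no_backtrack_def)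
  then obtain n where n: "cross (fst (dout p)) n > 0" "cross (fst (dout q)) n > 0" using common_left by blast
  then have "n \<noteq> 0" by auto
  define s where "s = r / (2 * norm n)"
  have s: "s > 0" "s * norm n < r" using picture_pos[OF pic] \<open>n \<noteq> 0\<close> by (auto simp: s_def field_simps)
  define y where "y = x + (s *\<^sub>R n, 0)"
  have y: "y \<in> ball x r" using s by (simp add: y_def dist_norm norm_Pair)
  have "bl p y" "bl q y" using n s f o(1,2) by (auto simp: y_def)
  then have "y \<in> top_region" by (intro strict_top[OF pic y]) (use two(1) in auto)
  then show ?thesis using that y by blast
 qed
qed

text \<open>Supplies the density assumption of \<open>local_to_global\<close>: within a small ball,
  a slight horizontal move away from the strands above \<open>p\<close> leads into the top
  region.\<close>

lemma dense_top:
 assumes p: "p \<in> - K" and W: "openin (top_of_set (- K)) W" "p \<in> W"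
 shows "\<exists>b. path b \<and> path_image b \<subseteq> W \<and> pathstart b \<in> top_region \<and> pathfinish b = p"
proof -
 obtain U where U: "open U" "W = - K \<inter> U" using W(1) by (auto simp: openin_open)
 obtain r where r: "picture p r" "ball p r \<subseteq> U" using small_picture[of p U] p W U by blast
 obtain y where y: "y \<in> ball p r" "y \<in> top_region" using strict_point[OF r(1)] by blast
 have "closed_segment y p \<subseteq> ball p r" using y picture_pos[OF r(1)] by (intro closed_segment_subset) auto
 also have "ball p r \<subseteq> W" using r picture_notin U by blast
 finally show ?thesis using y by (intro exI[of _ "linepath y p"]) auto
qed

lemma path_connected_complement: "path_connected (- K)" unfolding path_connected_component
proof (intro ballI)
 fix x y assume "x \<in> - K" "y \<in> - K"
 then obtain a b where "path a" "path_image a \<subseteq> - K" "pathstart a \<in> top_region" "pathfinish a = x"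
  "path b" "path_image b \<subseteq> - K" "pathstart b \<in> top_region" "pathfinish b = y" using dense_top[of x "- K"] dense_top[of y "- K"] by auto
 then have xy: "path_component (- K) (pathstart a) x" "path_component (- K) (pathstart b) y" unfolding path_component_def by blast+
 have "path_component top_region (pathstart a) (pathstart b)"
  using simply_connected_imp_path_connected[OF simply_connected_top_region] \<open>pathstart a \<in> top_region\<close> \<open>pathstart b \<in> top_region\<close>
  unfolding path_connected_component by blast
 then have "path_component (- K) (pathstart a) (pathstart b)" using path_component_of_subset[OF top_region_subset] by blast
 then show "path_component (- K) x y" using xy by (meson path_component_sym path_component_trans)
qed

end

text \<open>Triviality on the top region is a normalization that a gauge transformation can achieve.
  It makes the value of a meridian well defined and not just its conjugacy class.\<close>

locale strand_rep = strands K dout din + groupoid_rep G "- K" \<Phi>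
 for K dout din and G :: "('g, 'h) monoid_scheme" (structure) and \<Phi> :: "(real => space) => 'g" +
 assumes top_trivial: "[|path g; path_image g \<subseteq> top_region|] ==> \<Phi> g = \<one>"
begin

abbreviation F :: "space => space => 'g" where
 "F y z \<equiv> \<Phi> (linepath y z)"

lemma ball_sub: "picture x r ==> ball x r \<subseteq> - K" using picture_notin by blast

lemma F_join: "[|picture x r; y \<in> ball x r; z \<in> ball x r; v \<in> ball x r|] ==> F y z \<otimes> F z v = F y v"
 using convex_join[OF convex_ball ball_sub] by blast

lemma F_closed: "[|picture x r; y \<in> ball x r; z \<in> ball x r|] ==> F y z \<in> carrier G"
 using linepath_closed[OF convex_ball ball_sub] by blast

lemma F_path: "[|picture x r; path g; path_image g \<subseteq> ball x r|] ==> \<Phi> g = F (pathstart g) (pathfinish g)"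
proof -
 assume a: "picture x r" "path g" "path_image g \<subseteq> ball x r"
 have "pathstart g \<in> ball x r" "pathfinish g \<in> ball x r" using a(3) by auto
 then have "closed_segment (pathstart g) (pathfinish g) \<subseteq> ball x r" by (intro closed_segment_subset) auto
 then show ?thesis by (intro simply_connected_eq[OF convex_imp_simply_connected[OF convex_ball] ball_sub[OF a(1)]]) (use a in auto)
qed

lemma F_top:
 assumes "picture x r" "S \<subseteq> ball x r \<inter> top_region" "path_connected S" "y \<in> S" "z \<in> S"
 shows "F y z = \<one>"
proof -
 obtain g where g: "path g" "path_image g \<subseteq> S" "pathstart g = y" "pathfinish g = z" using assms(3-5) unfolding path_connected_def by blast
 have "\<Phi> g = F y z" using F_path[OF assms(1) g(1)] g assms(2) by auto
 moreover have "\<Phi> g = \<one>" using top_trivial[OF g(1)] g(2) assms(2) by blast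
 ultimately show ?thesis by simp
qed

lemma F_same_side:
 assumes pic: "picture x r" and a: "above x = {p}" and yz: "y \<in> ball x r" "z \<in> ball x r"
 shows "[|bl p y; bl p z|] ==> F y z = \<one>" "[|br p y; br p z|] ==> F y z = \<one>"
proof -
 have p: "p \<in> K" "fst p = fst x" using a by (auto simp: above_def)
 let ?L = "{y \<in> ball x r. bend_left (fst (din p)) (fst (dout p)) (fst y - fst x)}"
 let ?R = "{y \<in> ball x r. bend_right (fst (din p)) (fst (dout p)) (fst y - fst x)}"
 have sub: "?L \<subseteq> ball x r \<inter> top_region" "?R \<subseteq> ball x r \<inter> top_region" using strict_top[OF pic] a p(2) by auto
 note pc = path_connected_bend[OF nb[OF p(1)] picture_pos[OF pic], of x]
 show "F y z = \<one>" if "bl p y" "bl p z" by (rule F_top[OF pic sub(1) pc(1)]) (use that yz p(2) in simp_all)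
 show "F y z = \<one>" if "br p y" "br p z" by (rule F_top[OF pic sub(2) pc(2)]) (use that yz p(2) in simp_all)
qed

lemma F_wall:
 assumes pic: "picture x r" and a: "above x = {p}"
  and b: "y \<in> ball x r" "z \<in> ball x r" "y' \<in> ball x r" "z' \<in> ball x r" "br p y" "bl p z" "br p y'" "bl p z'"
 shows "F y z = F y' z'"
proof -
 have "F y z = F y y' \<otimes> F y' z" using F_join[OF pic b(1,3,2)] by simp
 also have "F y' z = F y' z' \<otimes> F z' z" using F_join[OF pic b(3,4,2)] by simp
 finally show ?thesis using F_same_side(2)[OF pic a b(1,3,5,7)] F_same_side(1)[OF pic a b(4,2,8,6)] F_closed[OF pic b(3,4)] by simp
qed

text \<open>The color of \<open>p\<close> as seen from the point \<open>x\<close> below it; it is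
  later shown not to depend on \<open>x\<close>.\<close>

definition wall_at :: "space => space => 'g => bool" where
 "wall_at x p g \<longleftrightarrow> x \<notin> K \<and> above x = {p} \<and>
   (\<exists>r. picture x r \<and> (\<forall>y\<in>ball x r. \<forall>z\<in>ball x r. br p y --> bl p z --> F y z = g))"

lemma wall_atD: "wall_at x p g ==> above x = {p}" "wall_at x p g ==> x \<notin> K" by (simp_all add: wall_at_def)

lemma wall_at_exists:
 assumes "x \<notin> K" "above x = {p}"
 shows "\<exists>g\<in>carrier G. wall_at x p g"
proof -
 obtain r where r: "picture x r" using picture_exists[OF assms(1)] by blast
 have p: "p \<in> K" "fst x = fst p" using above_singleton[of x p] assms(2) by simp_all
 obtain y z where yz: "y \<in> ball x r" "z \<in> ball x r" "br p y" "bl p z" by (rule side_points[OF p(1) picture_pos[OF r] p(2)])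
 have "F y' z' = F y z" if "y' \<in> ball x r" "z' \<in> ball x r" "br p y'" "bl p z'" for y' z'
  by (rule F_wall[OF r assms(2) that(1,2) yz(1,2) that(3,4) yz(3,4)])
 then have "wall_at x p (F y z)" unfolding wall_at_def by (intro conjI assms exI[of _ r] r ballI impI)
 then show ?thesis using F_closed[OF r yz(1,2)] by (rule bexI)
qed

lemma wall_at_eq:
 assumes w: "wall_at x p g" and pic: "picture x r" and yz: "y \<in> ball x r" "z \<in> ball x r" "br p y" "bl p z"
 shows "F y z = g"
proof -
 have a: "above x = {p}" using wall_atD(1)[OF w] .
 obtain s where s: "picture x s" "\<forall>y\<in>ball x s. \<forall>z\<in>ball x s. br p y --> bl p z --> F y z = g"
  using w unfolding wall_at_def by (elim conjE exE)
 have p: "p \<in> K" "fst x = fst p" using above_singleton[of x p] a by simp_all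
 have "min r s > 0" using picture_pos[OF pic] picture_pos[OF s(1)] by simp
 then obtain y' z' where y': "y' \<in> ball x (min r s)" "z' \<in> ball x (min r s)" "br p y'" "bl p z'" by (rule side_points[OF p(1) _ p(2)])
 then have "F y' z' = g" using s(2) by simp
 moreover have "F y z = F y' z'" by (rule F_wall[OF pic a]) (use yz y' in auto)
 ultimately show ?thesis by simp
qed

lemma wall_at_unique: "wall_at x p g ==> wall_at x p h ==> g = h"
proof -
 assume w: "wall_at x p g" "wall_at x p h"
 have a: "above x = {p}" "x \<notin> K" using wall_atD[OF w(1)] by simp_all
 obtain r where r: "picture x r" using picture_exists[OF a(2)] by (elim exE)
 have p: "p \<in> K" "fst x = fst p" using above_singleton[of x p] a by simp_all
 obtain y z where "y \<in> ball x r" "z \<in> ball x r" "br p y" "bl p z" by (rule side_points[OF p(1) picture_pos[OF r] p(2)])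
 then show ?thesis using wall_at_eq[OF w(1) r] wall_at_eq[OF w(2) r] by metis
qed

lemma wall_at_move:
 assumes w: "wall_at x p g" and pic: "picture x r" and x': "x' \<in> ball x r" "s \<in> germ p r" "fst x' = fst s"
 shows "wall_at x' s g"
proof -
 have a: "above x = {p}" using wall_atD(1)[OF w] .
 have p: "p \<in> K" "fst p = fst x" "p \<in> above x" using a by (auto simp: above_def)
 have a': "above x' = {s}" by (rule above_at_germ[OF pic x'(1,3) p(3) x'(2)]) (use a in simp)
 have K': "x' \<notin> K" by (rule picture_notin[OF pic x'(1)])
 obtain W where W: "open W" "x' \<in> W" "\<forall>v\<in>W. (bl s v \<longleftrightarrow> bl p v) \<and> (br s v \<longleftrightarrow> br p v)"
  using picture_germ_sides[OF pic p(1,2) x'(2,3)] by blast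
 obtain r' where r': "picture x' r'" "ball x' r' \<subseteq> W \<inter> ball x r"
  using small_picture[OF K', of "W \<inter> ball x r"] W x'(1) by blast
 have "F y z = g" if "y \<in> ball x' r'" "z \<in> ball x' r'" "br s y" "bl s z" for y z
  by (rule wall_at_eq[OF w pic]) (use that r'(2) W(3) in blast)+
 then show ?thesis unfolding wall_at_def by (intro conjI K' a' exI[of _ r'] r'(1) ballI impI)
qed

text \<open>The heights from which \<open>p\<close> is the only strand point above form an interval,
  and the value seen from there is locally constant in the height by
  \<open>wall_at_move\<close>.\<close>

lemma wall_at_vertical:
 assumes w: "wall_at x p g" and x': "x' \<notin> K" "above x' = {p}"
 shows "wall_at x' p g"
proof -
 define S where "S = {h. (fst p, h) \<notin> K \<and> above (fst p, h) = {p}}"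
 define f where "f h = (THE g. wall_at (fst p, h) p g)" for h
 have f: "f h = g" if "wall_at (fst p, h) p g" for h g unfolding f_def using that wall_at_unique by blast
 have "is_interval S" unfolding is_interval_1
 proof (intro ballI allI impI)
  fix a b h assume ab: "a \<in> S" "b \<in> S" "a \<le> h \<and> h \<le> b"
  have pa: "snd b' < snd p" if "above b' = {p}" for b' using that by (auto simp: above_def)
  have lt: "h < snd p" using ab pa[of "(fst p, b)"] by (auto simp: S_def)
  have "p \<in> K" using ab by (auto simp: S_def above_def)
  have "above (fst p, h) \<subseteq> above (fst p, a)" using ab by (auto simp: above_def)
  moreover have "p \<in> above (fst p, h)" using lt \<open>p \<in> K\<close> by (simp add: above_def)
  ultimately have 1: "above (fst p, h) = {p}" using ab by (auto simp: S_def)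
  have "(fst p, h) \<notin> K"
  proof
   assume k: "(fst p, h) \<in> K"
   have "a \<noteq> h" using k ab by (auto simp: S_def)
   then have "(fst p, h) \<in> above (fst p, a)" using k ab by (auto simp: above_def)
   then have "(fst p, h) = p" using ab by (auto simp: S_def)
   then show False using lt by (metis less_irrefl snd_conv)
  qed
  then show "h \<in> S" using 1 by (simp add: S_def)
 qed
 then have "connected S" by (simp add: is_interval_connected_1)
 then have "f constant_on S"
 proof (rule locally_constant_imp_constant)
  fix h assume h: "h \<in> S"
  then have hK: "(fst p, h) \<notin> K" "above (fst p, h) = {p}" by (auto simp: S_def)
  obtain g where g: "wall_at (fst p, h) p g" using wall_at_exists[OF hK] by blast
  obtain r where r: "picture (fst p, h) r" using picture_exists[OF hK(1)] by (elim exE)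
  have near: "f h' = f h" if "h' \<in> S" "dist h h' < r" for h'
  proof -
   have "wall_at (fst p, h') p g" by (rule wall_at_move[OF g r]) (use that in \<open>auto simp: dist_Pair_Pair germ_def\<close>)
   then show ?thesis using f g by simp
  qed
  show "\<exists>T. openin (top_of_set S) T \<and> h \<in> T \<and> (\<forall>y\<in>T. f y = f h)"
  proof (intro exI[of _ "S \<inter> ball h r"] conjI ballI)
   show "openin (top_of_set S) (S \<inter> ball h r)" by (simp add: openin_open_Int)
   show "h \<in> S \<inter> ball h r" using h picture_pos[OF r] by simp
   show "f y = f h" if "y \<in> S \<inter> ball h r" for y by (rule near) (use that in auto)
  qed
 qed
 moreover have "above x = {p}" "x \<notin> K" using wall_atD[OF w] by simp_all
 then have xS: "fst x = fst p" "fst x' = fst p" "x \<notin> K" "above x = {p}" using above_singleton[of x p] above_singleton[OF x'(2)] by simp_all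
 then have fx: "(fst p, snd x) = x" "(fst p, snd x') = x'" by (auto simp: prod_eq_iff)
 moreover have "snd x \<in> S" "snd x' \<in> S" using xS x' unfolding S_def by (simp_all add: fx)
 ultimately have "f (snd x) = f (snd x')" by (auto simp: constant_on_def)
 moreover have "f (snd x) = g" using f[of "snd x" g] w fx by simp
 moreover obtain g' where g': "wall_at x' p g'" using wall_at_exists[OF x'] by blast
 moreover have "f (snd x') = g'" using f[of "snd x'" g'] g' fx by simp
 ultimately show ?thesis by simp
qed

definition col :: "space => 'g" where
 "col p = (THE g. \<exists>x. wall_at x p g)"

lemma col_eq: "wall_at x p g ==> col p = g" unfolding col_def
proof (rule the_equality)
 fix h assume w: "wall_at x p g" "\<exists>x. wall_at x p h"
 then obtain x' where x': "wall_at x' p h" by blast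
 then have "x' \<notin> K" "above x' = {p}" using wall_atD by blast+
 then have "wall_at x' p g" by (rule wall_at_vertical[OF w(1)])
 then show "h = g" using wall_at_unique x' by blast
qed blast

lemma wall_col: "x \<notin> K ==> above x = {p} ==> wall_at x p (col p) \<and> col p \<in> carrier G" using wall_at_exists col_eq by metis

lemma col_germ:
 assumes pic: "picture x r" and a: "above x = {p}" and s: "s \<in> germ p r"
 shows "col s = col p"
proof -
 have p: "p \<in> above x" "x \<notin> K" using a picture_notin[OF pic] picture_pos[OF pic] by auto
 have "wall_at (fst s, snd x) s (col p)"
  using wall_at_move[of x p "col p" r "(fst s, snd x)" s] wall_col[OF p(2) a] pic germ_shadow[OF pic p(1) s] s by simp
 then show ?thesis by (rule col_eq)
qed

lemma col_locally_constant:
 assumes p: "p \<in> K" "\<not> under p"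
 shows "\<exists>e>0. \<forall>q\<in>K. dist q p < e --> col q = col p"
proof -
 obtain x where x: "x \<notin> K" "above x = {p}" using below_point[OF p] by blast
 obtain r where r: "picture x r" using picture_exists[OF x(1)] by blast
 obtain e where e: "e > 0" "\<forall>q\<in>K. dist q p < e --> (\<exists>t\<ge>0. q = p + t *\<^sub>R dout p \<or> q = p - t *\<^sub>R din p)"
  using germ_nbhd[OF p(1)] by blast
 have "col q = col p" if q: "q \<in> K" "dist q p < min e r" for q
 proof (rule col_germ[OF r x(2)])
  obtain t where t: "t \<ge> 0" "q = p + t *\<^sub>R dout p \<or> q = p - t *\<^sub>R din p" using e q by auto
  have "norm (fst q - fst p) < r" using dist_fst_le[of q p] q by (simp add: dist_norm)
  then show "q \<in> germ p r" using t by (cases "t = 0") (auto simp: germ_def)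
 qed
 then show ?thesis using e picture_pos[OF r] by (intro exI[of _ "min e r"]) auto
qed

text \<open>Crossing the wall under a germ point close to \<open>x\<close>, inside any neighbourhood \<open>U\<close> of its shadow.\<close>

lemma germ_wall:
 assumes pic: "picture x r" and p: "p \<in> above x" "s \<in> germ p r" "above x = {p} \<or> s \<noteq> p"
  and U: "open U" "(fst s, snd x) \<in> U"
 obtains y z where "y \<in> ball x r \<inter> U" "z \<in> ball x r \<inter> U" "br p y" "bl p z" "F y z = col s"
proof -
 define x' where "x' = (fst s, snd x)"
 have x': "x' \<in> ball x r" unfolding x'_def by (rule germ_shadow[OF pic p(1,2)])
 have pK: "p \<in> K" "fst p = fst x" using p by (auto simp: above_def)
 have a': "above x' = {s}" by (rule above_at_germ[OF pic x' _ p(1,2)]) (use p x'_def in auto)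
 have K': "x' \<notin> K" by (rule picture_notin[OF pic x'])
 obtain W where W: "open W" "x' \<in> W" "\<forall>v\<in>W. (bl s v \<longleftrightarrow> bl p v) \<and> (br s v \<longleftrightarrow> br p v)"
  using picture_germ_sides[OF pic pK p(2), of x'] by (auto simp: x'_def)
 obtain r' where r': "picture x' r'" "ball x' r' \<subseteq> W \<inter> ball x r \<inter> U"
  using small_picture[OF K', of "W \<inter> ball x r \<inter> U"] W x' U x'_def by blast
 have s: "s \<in> K" "fst x' = fst s" using a' by (auto simp: above_def x'_def)
 obtain y z where yz: "y \<in> ball x' r'" "z \<in> ball x' r'" "br s y" "bl s z" by (rule side_points[OF s(1) picture_pos[OF r'(1)] s(2)])
 have "F y z = col s" using wall_at_eq[OF conjunct1[OF wall_col[OF K' a']] r'(1) yz] .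
 moreover have "br p y" "bl p z" using yz r'(2) W(3) by blast+
 moreover have "y \<in> ball x r \<inter> U" "z \<in> ball x r \<inter> U" using yz r'(2) by blast+
 ultimately show ?thesis using that by blast
qed

end

section \<open>The crossing relation, and generation by the colors\<close>

context strand_rep
begin

text \<open>The two strands cut the ball into four sectors lying in the top region, so the value of
  a segment depends only on the sectors of its ends. Going from right of both strands to left of
  both can pass beneath either strand first; equating the two ways gives the crossing relation. All
  values between sectors are products of the colors involved and their inverses.\<close>

lemma crossing_sectors:
 assumes pic: "picture x r" and a: "above x = {p, q}" and o: "over p q"
 obtains w0 w1 where "w0 \<in> carrier G" "w1 \<in> carrier G" "col p \<otimes> w1 = w0 \<otimes> col p"
  "\<And>t. [|0 < t; t * norm (fst (dout q)) < r|] ==> col (q + t *\<^sub>R left_dir q) = w1 \<and> col (q - t *\<^sub>R left_dir q) = w0"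
  "\<And>H y z. [|subgroup H G; col p \<in> H; w0 \<in> H; w1 \<in> H; y \<in> ball x r \<inter> top_region; z \<in> ball x r \<inter> top_region|] ==> F y z \<in> H"
proof -
 note od = over_dirs[OF o]
 define u where "u = fst (dout p)"
 define v where "v = fst (left_dir q)"
 \<comment> \<open>Records whether the under strand is oriented from right to left, so that its
   sides can be expressed by the direction \<open>v\<close>, which always points to the left of the
   over strand.\<close>
 define \<epsilon> :: real where "\<epsilon> = (if left_dir q = dout q then 1 else -1)"
 have \<epsilon>: "\<epsilon> = 1 \<or> \<epsilon> = -1" "left_dir q = \<epsilon> *\<^sub>R dout q" by (auto simp: \<epsilon>_def left_dir_def)
 have v\<epsilon>: "v = \<epsilon> *\<^sub>R fst (dout q)" by (simp add: v_def \<epsilon>(2))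
 have dq: "fst (dout q) = \<epsilon> *\<^sub>R v" using \<epsilon>(1) by (auto simp: v\<epsilon>)
 have c: "cross u v > 0" using od by (simp add: u_def v_def)
 have pa: "p \<in> above x" "q \<in> above x" "fst p = fst x" "fst q = fst x" using a by (auto simp: above_def)
 have r: "r > 0" by (rule picture_pos[OF pic])
 have nv: "norm (fst (dout q)) > 0" using dirs_nonzero[OF od(7)] by simp
 have nu: "norm (fst (dout p)) > 0" using dirs_nonzero[OF od(6)] by simp
 have blp: "bl p y \<longleftrightarrow> cross u (fst y - fst x) > 0" "br p y \<longleftrightarrow> cross u (fst y - fst x) < 0" for y
  by (simp_all add: od(1) u_def pa)
 have blq: "bl q y \<longleftrightarrow> 0 < \<epsilon> * cross v (fst y - fst x)" "br q y \<longleftrightarrow> 0 < (- \<epsilon>) * cross v (fst y - fst x)" for y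
  by (simp_all add: od(2) dq pa mult_less_0_iff)
 \<comment> \<open>The signs \<open>s\<close> and \<open>t\<close> select sides:
   \<open>s = 1\<close> is left of the over strand, \<open>t = \<epsilon>\<close> is left of the
   under strand.\<close>
 define sec where "sec s t = {y \<in> ball x r. 0 < s * cross u (fst y - fst x) \<and> 0 < t * cross v (fst y - fst x)}" for s t :: real
 have half: "convex {y::space. 0 < s * cross d (fst y - fst x)}" "open {y::space. 0 < s * cross d (fst y - fst x)}" for s d
 proof -
  have lin: "linear (\<lambda>y::space. s * cross d (fst y))" by (rule linearI) (simp_all add: cross_add algebra_simps)
  have e: "{y::space. 0 < s * cross d (fst y - fst x)} = (\<lambda>y. s * cross d (fst y)) -` {s * cross d (fst x)<..}"
   by (auto simp: cross_diff algebra_simps)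
  show "convex {y::space. 0 < s * cross d (fst y - fst x)}" unfolding e using lin by (intro convex_linear_vimage) auto
  show "open {y::space. 0 < s * cross d (fst y - fst x)}" unfolding e by (intro open_vimage continuous_intros)
 qed
 have sec_eq: "sec s t = ball x r \<inter> ({y. 0 < s * cross u (fst y - fst x)} \<inter> {y. 0 < t * cross v (fst y - fst x)})" for s t
  by (auto simp: sec_def)
 have sec_pc: "path_connected (sec s t)" for s t unfolding sec_eq by (intro convex_imp_path_connected convex_Int convex_ball half)
 have sec_top: "sec s t \<subseteq> ball x r \<inter> top_region" for s t
 proof
  fix y assume y: "y \<in> sec s t"
  have "y \<in> top_region"
  proof (rule strict_top[OF pic])
   show "y \<in> ball x r" using y by (simp add: sec_def)
   have "cross u (fst y - fst x) \<noteq> 0" "cross v (fst y - fst x) \<noteq> 0" using y by (auto simp: sec_def)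
   then have "bl p y \<or> br p y" "bl q y \<or> br q y" unfolding blp blq using \<epsilon>(1) by auto
   then show "bl p' y \<or> br p' y" if "p' \<in> above x" for p' using that a by auto
  qed
  then show "y \<in> ball x r \<inter> top_region" using y by (simp add: sec_def)
 qed
 have sec_ball: "y \<in> ball x r" if "y \<in> sec s t" for y s t using that by (simp add: sec_def)
 have Fsec: "F y z = \<one>" if "y \<in> sec s t" "z \<in> sec s t" for y z s t by (rule F_top[OF pic sec_top sec_pc that])
 have Ftrans: "F y z = F y' z'" if "y \<in> sec s t" "y' \<in> sec s t" "z \<in> sec s' t'" "z' \<in> sec s' t'" for y z y' z' s t s' t'
 proof -
  have b: "y \<in> ball x r" "y' \<in> ball x r" "z \<in> ball x r" "z' \<in> ball x r" using that sec_ball by blast+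
  have "F y z = F y y' \<otimes> F y' z" using F_join[OF pic b(1,2,3)] by simp
  also have "F y' z = F y' z' \<otimes> F z' z" using F_join[OF pic b(2,4,3)] by simp
  finally show ?thesis using Fsec[OF that(1,2)] Fsec[OF that(4,3)] F_closed[OF pic b(2,4)] by simp
 qed
 have Wq: "\<exists>y\<in>sec \<sigma> (- \<epsilon>). \<exists>z\<in>sec \<sigma> \<epsilon>. F y z = col (q + (\<sigma> * t) *\<^sub>R left_dir q)"
  if \<sigma>: "\<sigma> = 1 \<or> \<sigma> = -1" and t: "0 < t" "t * norm (fst (dout q)) < r" for \<sigma> t
 proof -
  define s where "s = q + (\<sigma> * t) *\<^sub>R left_dir q"
  have g: "s \<in> germ q r" "s \<noteq> q" using germ_left_dir[OF o t] \<sigma> by (auto simp: s_def)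
  let ?U = "{y::space. 0 < \<sigma> * cross u (fst y - fst x)}"
  have "\<sigma> * cross u (fst s - fst x) = (\<sigma> * \<sigma>) * (t * cross u v)" by (simp add: s_def pa(4) v_def)
  also have "\<dots> = t * cross u v" using \<sigma> by auto
  finally have sU: "(fst s, snd x) \<in> ?U" using t c by simp
  obtain y z where yz: "y \<in> ball x r \<inter> ?U" "z \<in> ball x r \<inter> ?U" "br q y" "bl q z" "F y z = col s"
   by (rule germ_wall[OF pic pa(2) g(1) disjI2[OF g(2)] half(2) sU])
  have "y \<in> sec \<sigma> (- \<epsilon>)" "z \<in> sec \<sigma> \<epsilon>" using yz(1-4) unfolding blq sec_def by auto
  then show ?thesis using yz(5) unfolding s_def by blast
 qed
 have Wp: "\<exists>y\<in>sec (-1) \<tau>. \<exists>z\<in>sec 1 \<tau>. F y z = col p" if \<tau>: "\<tau> = 1 \<or> \<tau> = -1" for \<tau>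
 proof -
  obtain e where e: "e > 0" "\<forall>q\<in>K. dist q p < e --> col q = col p" using col_locally_constant[OF od(6) over_not_under[OF o]] by blast
  obtain e' where e': "e' > 0" "\<forall>s\<in>germ p e'. dist s p < e" using germ_dist[OF od(6) e(1)] by blast
  define t where "t = min e' r / (2 * norm (fst (dout p)))"
  have t: "t > 0" "t * norm (fst (dout p)) < e'" "t * norm (fst (dout p)) < r" using e' r nu by (auto simp: t_def field_simps min_def)
  define s where "s = p - (\<tau> * t) *\<^sub>R dout p"
  have g: "s \<in> germ p r" "s \<in> germ p e'" "s \<noteq> p" using t \<tau> od(1) nu by (auto simp: s_def germ_def)
  have "s \<in> K" by (rule picture_germ(1)[OF pic od(6) pa(3) g(1)])
  then have cs: "col s = col p" using e e' g(2) by blast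
  let ?U = "{y::space. 0 < \<tau> * cross v (fst y - fst x)}"
  have "\<tau> * cross v (fst s - fst x) = - (\<tau> * \<tau>) * t * cross v u" by (simp add: s_def pa(3) u_def)
  also have "\<dots> = t * cross u v" using \<tau> by (auto simp: cross_commute[of v u])
  finally have sU: "(fst s, snd x) \<in> ?U" using t c by simp
  obtain y z where yz: "y \<in> ball x r \<inter> ?U" "z \<in> ball x r \<inter> ?U" "br p y" "bl p z" "F y z = col s"
   by (rule germ_wall[OF pic pa(1) g(1) disjI2[OF g(3)] half(2) sU])
  have "y \<in> sec (-1) \<tau>" "z \<in> sec 1 \<tau>" using yz(1-4) unfolding blp sec_def by auto
  then show ?thesis using yz(5) cs by (intro bexI[of _ y] bexI[of _ z]) simp_all
 qed
 define t0 where "t0 = r / (2 * norm (fst (dout q)))"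
 have t0: "0 < t0" "t0 * norm (fst (dout q)) < r" using r nv by (auto simp: t0_def field_simps)
 define w1 where "w1 = col (q + t0 *\<^sub>R left_dir q)"
 define w0 where "w0 = col (q - t0 *\<^sub>R left_dir q)"
 obtain y1 z1 where 1: "y1 \<in> sec 1 (- \<epsilon>)" "z1 \<in> sec 1 \<epsilon>" "F y1 z1 = w1" using Wq[of 1, OF _ t0] by (auto simp: w1_def)
 obtain y2 z2 where 2: "y2 \<in> sec (-1) (- \<epsilon>)" "z2 \<in> sec (-1) \<epsilon>" "F y2 z2 = w0"
  using Wq[of "-1", OF _ t0] by (auto simp: w0_def)
 have P: "F y z = col p" if "y \<in> sec (-1) \<tau>" "z \<in> sec 1 \<tau>" "\<tau> = 1 \<or> \<tau> = -1" for y z \<tau>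
  using Wp[OF that(3)] Ftrans that(1,2) by metis
 have e1: "F y2 y1 = col p" using P[OF 2(1) 1(1)] \<epsilon>(1) by auto
 have e2: "F z2 z1 = col p" using P[OF 2(2) 1(2)] \<epsilon>(1) by auto
 note y2 = 2(1)
 note b = sec_ball[OF 1(1)] sec_ball[OF 1(2)] sec_ball[OF 2(1)] sec_ball[OF 2(2)]
 have cw: "w0 \<in> carrier G" "w1 \<in> carrier G" "col p \<in> carrier G"
  using F_closed[OF pic b(3,4)] F_closed[OF pic b(1,2)] F_closed[OF pic b(3,1)] 1 2 e1 by auto
 \<comment> \<open>Two ways from \<open>y2\<close>, right of both strands, to \<open>z1\<close>,
   left of both: over strand first and then the left part of the under strand, or the right part of
   the under strand first.\<close>
 have rel: "col p \<otimes> w1 = w0 \<otimes> col p" using F_join[OF pic b(3,1,2)] F_join[OF pic b(3,4,2)] e1 e2 1(3) 2(3) by simp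
 have all: "col (q + t *\<^sub>R left_dir q) = w1 \<and> col (q - t *\<^sub>R left_dir q) = w0"
  if t: "0 < t" "t * norm (fst (dout q)) < r" for t
 proof -
  obtain y z where "y \<in> sec 1 (- \<epsilon>)" "z \<in> sec 1 \<epsilon>" "F y z = col (q + t *\<^sub>R left_dir q)" using Wq[of 1, OF _ t] by auto
  moreover obtain y' z' where "y' \<in> sec (-1) (- \<epsilon>)" "z' \<in> sec (-1) \<epsilon>" "F y' z' = col (q - t *\<^sub>R left_dir q)"
   using Wq[of "-1", OF _ t] by auto
  ultimately show ?thesis using Ftrans 1 2 by metis
 qed
 have gen: "F y z \<in> H"
  if H: "subgroup H G" "col p \<in> H" "w0 \<in> H" "w1 \<in> H" and y: "y \<in> ball x r \<inter> top_region" and z: "z \<in> ball x r \<inter> top_region" for H y z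
 proof -
  interpret H: subgroup H G by (rule H)
  have *: "F y2 y \<in> H" if y: "y \<in> ball x r \<inter> top_region" for y
  proof -
   have yb: "y \<in> ball x r" "above y = {}" using y by (auto simp: top_region_def)
   have "bl p y \<or> br p y" by (rule strict_or_germ[OF pic yb(1) pa(1)]) (use yb in auto)
   moreover have "bl q y \<or> br q y" by (rule strict_or_germ[OF pic yb(1) pa(2)]) (use yb in auto)
   ultimately consider "y \<in> sec 1 \<epsilon>" | "y \<in> sec 1 (- \<epsilon>)" | "y \<in> sec (-1) \<epsilon>" | "y \<in> sec (-1) (- \<epsilon>)"
    unfolding blp blq using yb(1) unfolding sec_def by auto
   then show ?thesis
   proof cases
    case 1
    have "F y2 y = F y2 z2 \<otimes> F z2 y" using F_join[OF pic b(3,4) yb(1)] by simp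
    also have "F z2 y = col p" using P[OF 2(2) 1] \<epsilon>(1) by auto
    finally show ?thesis using 2(3) H by simp
   next
    case 2
    then show ?thesis using P[OF y2 2] \<epsilon>(1) H by auto
   next
    case 3
    then show ?thesis using Ftrans[OF 2(1) 2(1) 3 2(2)] 2(3) H by simp
   next
    case 4
    then show ?thesis using Fsec[OF 2(1) 4] by simp
   qed
  qed
  have "F y z = inv (F y2 y) \<otimes> F y2 z"
   using F_join[OF pic b(3), of y z] F_closed[OF pic b(3), of y] F_closed[OF pic b(3), of z] F_closed[OF pic, of y z] y z
   by (metis IntE inv_solve_left)
  then show ?thesis using *[OF y] *[OF z] by simp
 qed
 show ?thesis by (rule that[OF cw(1,2) rel all gen])
qed

lemma crossing_relation:
 assumes "under q"
 obtains e w0 w1 where "e > 0" "w0 \<in> carrier G" "w1 \<in> carrier G" "col (over_of q) \<otimes> w1 = w0 \<otimes> col (over_of q)"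
  "\<And>t. [|0 < t; t < e|] ==> col (q + t *\<^sub>R left_dir q) = w1 \<and> col (q - t *\<^sub>R left_dir q) = w0"
proof -
 obtain p where o: "over p q" using assms unfolding under_def by blast
 then have po: "over_of q = p" by (rule over_of_eq)
 have pq: "p \<in> K" "q \<in> K" "fst p = fst q" "snd q < snd p" "p \<noteq> q" using o unfolding over_def by auto
 \<comment> \<open>Any point below \<open>q\<close> would do: the fibre contains only the two
   crossing points, and both are above.\<close>
 define x where "x = (fst q, snd q - 1)"
 have third: "s = p \<or> s = q" if "s \<in> K" "fst s = fst q" for s using fibre_le_2[OF pq(1,2) that(1) pq(3) that(2)[symmetric]] pq(5) by blast
 have fx: "fst x = fst q" "snd x = snd q - 1" by (simp_all add: x_def)
 have xK: "x \<notin> K"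
 proof
  assume "x \<in> K"
  then have "snd x = snd p \<or> snd x = snd q" using third[of x] fx(1) by metis
  then show False using fx(2) pq(4) by linarith
 qed
 have "s \<in> above x \<longleftrightarrow> s = p \<or> s = q" for s unfolding above_def mem_Collect_eq fx using third[of s] pq by auto
 then have a: "above x = {p, q}" by blast
 obtain r where r: "picture x r" using picture_exists[OF xK] by blast
 have nv: "norm (fst (dout q)) > 0" using dirs_nonzero[OF pq(2)] by simp
 obtain w0 w1 where w: "w0 \<in> carrier G" "w1 \<in> carrier G" "col p \<otimes> w1 = w0 \<otimes> col p"
  "\<And>t. [|0 < t; t * norm (fst (dout q)) < r|] ==> col (q + t *\<^sub>R left_dir q) = w1 \<and> col (q - t *\<^sub>R left_dir q) = w0"
  by (rule crossing_sectors[OF r a o]) blast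
 show ?thesis
 proof (rule that[of "r / norm (fst (dout q))" w0 w1])
  show "col (q + t *\<^sub>R left_dir q) = w1 \<and> col (q - t *\<^sub>R left_dir q) = w0" if "0 < t" "t < r / norm (fst (dout q))" for t
   using w(4)[OF that(1)] that(2) nv by (simp add: field_simps)
 qed (use w po picture_pos[OF r] nv in auto)
qed

text \<open>For the second claim \<open>local_to_global\<close> reduces to short paths between
  points of the top region. With no strand above, the value is 1; with one strand it is 1, its color
  or the inverse color; with two it is covered by \<open>crossing_sectors\<close>.\<close>

lemma coloring_of_rep:
 obtains c where "coloring G c"
  "\<And>H g. [|subgroup H G; c ` K \<subseteq> H; path g; path_image g \<subseteq> - K; pathstart g \<in> top_region; pathfinish g \<in> top_region|]
   ==> \<Phi> g \<in> H"
proof -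
 have "\<exists>e w0 w1. under q --> e > 0 \<and> w0 \<in> carrier G \<and> w1 \<in> carrier G \<and> col (over_of q) \<otimes> w1 = w0 \<otimes> col (over_of q) \<and>
  (\<forall>t. 0 < t \<and> t < e --> col (q + t *\<^sub>R left_dir q) = w1 \<and> col (q - t *\<^sub>R left_dir q) = w0)" for q
 proof (cases "under q")
  case True
  show ?thesis by (rule crossing_relation[OF True]) blast
 qed blast
 then obtain e w0 w1 where w: "\<And>q. under q ==> e q > 0 \<and> w0 q \<in> carrier G \<and> w1 q \<in> carrier G \<and>
  col (over_of q) \<otimes> w1 q = w0 q \<otimes> col (over_of q) \<and>
  (\<forall>t. 0 < t \<and> t < e q --> col (q + t *\<^sub>R left_dir q) = w1 q \<and> col (q - t *\<^sub>R left_dir q) = w0 q)" by metis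
 \<comment> \<open>At an under-crossing \<open>col\<close> has no meaning, since no point has only
   \<open>q\<close> above it. The color on the left of the over strand is taken instead.\<close>
 define c where "c p = (if under p then w1 p else col p)" for p
 have carr: "col p \<in> carrier G" if p: "p \<in> K" "\<not> under p" for p using below_point[OF p] wall_col by metis
 have near: "\<exists>d>0. \<forall>t. 0 < t \<and> t < d --> q + t *\<^sub>R left_dir q \<in> K \<and> q - t *\<^sub>R left_dir q \<in> K \<and>
   \<not> under (q + t *\<^sub>R left_dir q) \<and> \<not> under (q - t *\<^sub>R left_dir q)" if uq: "under q" for q
 proof -
  obtain p where o: "over p q" using uq unfolding under_def by blast
  have q: "q \<in> K" using over_dirs[OF o] by simp
  have nv: "norm (fst (dout q)) > 0" using dirs_nonzero[OF q] by simp
  obtain e1 where e1: "e1 > 0" "\<And>s. [|s \<in> K; s \<noteq> q; dist s q < e1|] ==> \<not> under s" using near_not_under[OF q] by blast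
  obtain e2 where e2: "e2 > 0" "\<And>s. s \<in> germ q e2 ==> s \<in> K" using germ_in_K[OF q] by blast
  obtain e3 where e3: "e3 > 0" "\<forall>s\<in>germ q e3. dist s q < e1" using germ_dist[OF q e1(1)] by blast
  show ?thesis
  proof (intro exI[of _ "min e2 e3 / norm (fst (dout q))"] conjI allI impI)
   show "0 < min e2 e3 / norm (fst (dout q))" using e2 e3 nv by simp
   fix t assume t: "0 < t \<and> t < min e2 e3 / norm (fst (dout q))"
   then have tn: "t * norm (fst (dout q)) < e2" "t * norm (fst (dout q)) < e3" using nv by (auto simp: field_simps)
   note g = germ_left_dir[OF o conjunct1[OF t] tn(1)] germ_left_dir[OF o conjunct1[OF t] tn(2)]
   show "q + t *\<^sub>R left_dir q \<in> K" "q - t *\<^sub>R left_dir q \<in> K" using e2(2) g by auto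
   then show "\<not> under (q + t *\<^sub>R left_dir q)" "\<not> under (q - t *\<^sub>R left_dir q)"
    using e1(2)[of "q + t *\<^sub>R left_dir q"] e1(2)[of "q - t *\<^sub>R left_dir q"] e3(2) g by blast+
  qed
 qed
 have "coloring G c" unfolding coloring_def
 proof (intro conjI ballI allI impI)
  show "c p \<in> carrier G" if "p \<in> K" for p using that carr w by (simp add: c_def)
 next
  fix p assume p: "p \<in> K" "\<not> under p"
  obtain d where d: "d > 0" "\<forall>q\<in>K. dist q p < d --> col q = col p" using col_locally_constant[OF p] by blast
  obtain d' where d': "d' > 0" "\<And>q. [|q \<in> K; q \<noteq> p; dist q p < d'|] ==> \<not> under q" using near_not_under[OF p(1)] by blast
  show "\<exists>e>0. \<forall>q\<in>K. dist q p < e --> c q = c p"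
  proof (intro exI[of _ "min d d'"] conjI ballI impI)
   show "0 < min d d'" using d(1) d'(1) by simp
   fix q assume q: "q \<in> K" "dist q p < min d d'"
   then have "col q = col p" using d(2) by simp
   moreover have "\<not> under q" using d'(2)[of q] q p(2) by (cases "q = p") simp_all
   ultimately show "c q = c p" using p(2) by (simp add: c_def)
  qed
 next
  fix q assume q: "under q"
  obtain d where d: "d > 0" "\<forall>t. 0 < t \<and> t < d --> \<not> under (q + t *\<^sub>R left_dir q) \<and> \<not> under (q - t *\<^sub>R left_dir q)"
   using near[OF q] by blast
  have "over (over_of q) q" using q over_of_eq unfolding under_def by blast
  then have nu: "\<not> under (over_of q)" by (rule over_not_under)
  show "\<exists>e>0. \<exists>v0\<in>carrier G. \<exists>v1\<in>carrier G. c (over_of q) \<otimes> v1 = v0 \<otimes> c (over_of q) \<and> (c q = v0 \<or> c q = v1) \<and>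
    (\<forall>t. 0 < t \<and> t < e --> c (q + t *\<^sub>R left_dir q) = v1 \<and> c (q - t *\<^sub>R left_dir q) = v0)"
  proof (rule exI[of _ "min d (e q)"], rule conjI)
   show "0 < min d (e q)" using w[OF q] d(1) by simp
   show "\<exists>v0\<in>carrier G. \<exists>v1\<in>carrier G. c (over_of q) \<otimes> v1 = v0 \<otimes> c (over_of q) \<and> (c q = v0 \<or> c q = v1) \<and>
    (\<forall>t. 0 < t \<and> t < min d (e q) --> c (q + t *\<^sub>R left_dir q) = v1 \<and> c (q - t *\<^sub>R left_dir q) = v0)"
   proof (rule bexI[of _ "w0 q"], rule bexI[of _ "w1 q"], intro conjI allI impI)
   show "w0 q \<in> carrier G" "w1 q \<in> carrier G" using w[OF q] by simp_all
   show "c (over_of q) \<otimes> w1 q = w0 q \<otimes> c (over_of q)" using w[OF q] nu by (simp add: c_def)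
   show "c q = w0 q \<or> c q = w1 q" using q by (simp add: c_def)
   fix t assume t: "0 < t \<and> t < min d (e q)"
   then have "col (q + t *\<^sub>R left_dir q) = w1 q \<and> col (q - t *\<^sub>R left_dir q) = w0 q" using w[OF q] by simp
   then show "c (q + t *\<^sub>R left_dir q) = w1 q" "c (q - t *\<^sub>R left_dir q) = w0 q" using d(2) t by (simp_all add: c_def)
   qed
  qed
 qed
 moreover have "\<Phi> g \<in> H"
  if H: "subgroup H G" "c ` K \<subseteq> H" and g: "path g" "path_image g \<subseteq> - K" "pathstart g \<in> top_region" "pathfinish g \<in> top_region" for H g
 proof (rule local_to_global[OF H(1) _ _ g])
  interpret H: subgroup H G by (rule H)
  have cH: "col p \<in> H" if "p \<in> K" "\<not> under p" for p using H(2) that by (auto simp: c_def)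
  have FH: "F y z \<in> H" if x: "x \<notin> K" and pic: "picture x r" and yz: "y \<in> ball x r" "z \<in> ball x r" "y \<in> top_region" "z \<in> top_region" for x r y z
   using x
  proof (cases rule: above_cases)
   case none
   have "ball x r \<subseteq> ball x r \<inter> top_region" using strict_top[OF pic] none by auto
   then show ?thesis using F_top[OF pic _ convex_imp_path_connected[OF convex_ball] yz(1,2)] by simp
  next
   case (one p)
   have p: "p \<in> above x" "p \<in> K" using one by (auto simp: above_def)
   have pH: "col p \<in> H" by (rule cH[OF p(2) one(2)])
   have "above y = {}" "above z = {}" using yz by (auto simp: top_region_def)
   then have "bl p y \<or> br p y" "bl p z \<or> br p z"
    using strict_or_germ[OF pic yz(1) p(1)] strict_or_germ[OF pic yz(2) p(1)] by (metis empty_iff)+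
   moreover have W: "F y' z' = col p" if "y' \<in> ball x r" "z' \<in> ball x r" "br p y'" "bl p z'" for y' z'
    by (rule wall_at_eq[OF conjunct1[OF wall_col[OF x one(1)]] pic that])
   moreover have "F y z = inv (F z y)" using yz(1,2) by (intro linepath_reverse[OF convex_ball ball_sub[OF pic]])
   ultimately show ?thesis using F_same_side[OF pic one(1) yz(1,2)] W[OF yz(1,2)] W[OF yz(2,1)] pH by auto
  next
   case (two p q)
   have q: "under q" "\<not> under p" "p \<in> K" "q \<in> K" using over_under[OF two(2)] over_not_under[OF two(2)] over_dirs[OF two(2)] by auto
   obtain v0 v1 where v: "\<And>t. [|0 < t; t * norm (fst (dout q)) < r|] ==> col (q + t *\<^sub>R left_dir q) = v1 \<and> col (q - t *\<^sub>R left_dir q) = v0"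
    "\<And>H y z. [|subgroup H G; col p \<in> H; v0 \<in> H; v1 \<in> H; y \<in> ball x r \<inter> top_region; z \<in> ball x r \<inter> top_region|] ==> F y z \<in> H"
    by (rule crossing_sectors[OF pic two]) blast
   obtain d where d: "d > 0" "\<forall>t. 0 < t \<and> t < d --> q + t *\<^sub>R left_dir q \<in> K \<and> q - t *\<^sub>R left_dir q \<in> K \<and>
    \<not> under (q + t *\<^sub>R left_dir q) \<and> \<not> under (q - t *\<^sub>R left_dir q)" using near[OF q(1)] by blast
   have nv: "norm (fst (dout q)) > 0" using dirs_nonzero[OF q(4)] by simp
   define t where "t = min d (r / norm (fst (dout q))) / 2"
   have "0 < t" "t < d" "t < r / norm (fst (dout q))" using d(1) picture_pos[OF pic] nv by (auto simp: t_def min_def divide_simps)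
   then have t: "0 < t" "t < d" "t * norm (fst (dout q)) < r" using nv by (auto simp: field_simps)
   have "col (q + t *\<^sub>R left_dir q) \<in> H" "col (q - t *\<^sub>R left_dir q) \<in> H" using d(2) t(1,2) cH by blast+
   then have "v1 \<in> H" "v0 \<in> H" using v(1)[OF t(1,3)] by simp_all
   then show ?thesis using v(2)[OF H(1) cH[OF q(3,2)]] yz by blast
  qed
  show "\<exists>N. openin (top_of_set (- K)) N \<and> p \<in> N \<and>
     (\<forall>g. path g --> path_image g \<subseteq> N --> pathstart g \<in> top_region --> pathfinish g \<in> top_region --> \<Phi> g \<in> H)"
   if p: "p \<in> - K" for p
  proof -
   obtain r where r: "picture p r" using picture_exists[of p] p by blast
   show ?thesis
   proof (intro exI[of _ "ball p r"] conjI allI impI)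
    show "openin (top_of_set (- K)) (ball p r)" using ball_sub[OF r] by (simp add: open_subset)
    show "p \<in> ball p r" using picture_pos[OF r] by simp
    fix g assume g: "path g" "path_image g \<subseteq> ball p r" "pathstart g \<in> top_region" "pathfinish g \<in> top_region"
    then have "pathstart g \<in> ball p r" "pathfinish g \<in> ball p r" by (auto simp del: mem_ball)
    then show "\<Phi> g \<in> H" using FH[OF _ r _ _ g(3,4)] F_path[OF r g(1,2)] p by simp
   qed
  qed
  show "\<exists>b. path b \<and> path_image b \<subseteq> W \<and> pathstart b \<in> top_region \<and> pathfinish b = p"
   if p: "p \<in> - K" and W: "openin (top_of_set (- K)) W" "p \<in> W" for p W using dense_top[OF p W] .
 qed
 ultimately show ?thesis by (rule that)
qed

end

section \<open>Polygonal links as strands\<close>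

definition edge_dir :: "space list => nat => space" where
 "edge_dir vs i = vertex vs (Suc i) - vertex vs i"

definition on_edge :: "space list set => space list => nat => real => space => bool" where
 "on_edge P vs i t p \<longleftrightarrow> vs \<in> P \<and> i < length vs \<and> p = vertex vs i + t *\<^sub>R edge_dir vs i"

text \<open>The half-open range of \<open>t\<close> assigns a vertex to the edge that leaves it.
  \<open>in_dir\<close> uses the opposite range and assigns it to the edge that arrives; at inner
  points of edges both agree.\<close>

definition out_dir :: "space list set => space => space" where
 "out_dir P p = (SOME u. \<exists>vs i t. on_edge P vs i t p \<and> 0 \<le> t \<and> t < 1 \<and> u = edge_dir vs i)"

definition in_dir :: "space list set => space => space" where
 "in_dir P p = (SOME u. \<exists>vs i t. on_edge P vs i t p \<and> 0 < t \<and> t \<le> 1 \<and> u = edge_dir vs i)"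

lemma vertex_mod: "vertex vs (i mod length vs) = vertex vs i" by (simp add: vertex_def)

lemma vertex_in_set: "vs \<noteq> [] ==> vertex vs i \<in> set vs" by (simp add: vertex_def)

lemma edge_alt: "edge vs i = {vertex vs i + t *\<^sub>R edge_dir vs i |t. 0 \<le> t \<and> t \<le> 1}"
proof -
 have "(1 - t) *\<^sub>R vertex vs i + t *\<^sub>R vertex vs (Suc i) = vertex vs i + t *\<^sub>R edge_dir vs i" for t
  by (simp add: edge_dir_def algebra_simps)
 then show ?thesis unfolding edge_def closed_segment_def by auto
qed

lemma on_edge_mem:
 assumes "on_edge P vs i t p" "0 \<le> t" "t \<le> 1"
 shows "p \<in> edge vs i" "p \<in> polygon_set vs" "p \<in> link_set P" using assms by (auto simp: on_edge_def edge_alt polygon_set_def link_set_def)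

lemma on_edge_shift: "on_edge P vs i t p ==> q = p + s *\<^sub>R edge_dir vs i ==> on_edge P vs i (t + s) q"
 by (simp add: on_edge_def scaleR_add_left)

context
 fixes P assumes P: "polygonal_link P"
begin

lemma poly_props:
 assumes "vs \<in> P"
 shows "3 \<le> length vs" "distinct vs" "vs \<noteq> []"
  "\<And>i j. [|i < length vs; j < length vs; i \<noteq> j|] ==> edge vs i \<inter> edge vs j =
     {v. (v = vertex vs j \<and> j = Suc i mod length vs) \<or> (v = vertex vs i \<and> i = Suc j mod length vs)}"
 using P assms unfolding polygonal_link_def simple_polygon_def by auto

lemma edge_dir_nonzero:
 assumes "vs \<in> P"
 shows "edge_dir vs i \<noteq> 0"
proof
 assume "edge_dir vs i = 0"
 then have "vs ! (Suc i mod length vs) = vs ! (i mod length vs)" by (simp add: edge_dir_def vertex_def)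
 then have "Suc i mod length vs = i mod length vs" using poly_props[OF assms] by (simp add: nth_eq_iff_index_eq)
 then show False using poly_props(1)[OF assms] by (metis mod_Suc n_not_Suc_n numeral_3_eq_3 Suc_le_D Suc_inject nat.distinct(1) not_less_eq_eq le0)
qed

lemma on_edge_out_exists:
 assumes "p \<in> link_set P"
 obtains vs i t where "on_edge P vs i t p" "0 \<le> t" "t < 1"
proof -
 obtain vs i t where h: "vs \<in> P" "i < length vs" "0 \<le> t" "t \<le> 1" "p = vertex vs i + t *\<^sub>R edge_dir vs i"
  using assms unfolding link_set_def polygon_set_def edge_alt by auto
 show ?thesis
 proof (cases "t = 1")
  case True
  have "Suc i mod length vs < length vs" using h(2) by (intro mod_less_divisor) linarith
  then have "on_edge P vs (Suc i mod length vs) 0 p" using h True by (auto simp: on_edge_def vertex_mod edge_dir_def)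
  then show ?thesis using that[of vs "Suc i mod length vs" 0] by simp
 next
  case False
  then show ?thesis using that[of vs i t] h by (simp add: on_edge_def)
 qed
qed

lemma on_edge_in_exists:
 assumes "p \<in> link_set P"
 obtains vs i t where "on_edge P vs i t p" "0 < t" "t \<le> 1"
proof -
 obtain vs i t where h: "vs \<in> P" "i < length vs" "0 \<le> t" "t \<le> 1" "p = vertex vs i + t *\<^sub>R edge_dir vs i"
  using assms unfolding link_set_def polygon_set_def edge_alt by auto
 show ?thesis
 proof (cases "t = 0")
  case True
  define j where "j = (i + (length vs - 1)) mod length vs"
  have "Suc j mod length vs = Suc (i + (length vs - 1)) mod length vs" by (simp add: j_def mod_Suc_eq)
  also have "Suc (i + (length vs - 1)) = i + length vs" using h(2) by linarith
  also have "(i + length vs) mod length vs = i" using h(2) by simp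
  finally have "Suc j mod length vs = i" .
  then have "vertex vs (Suc j) = vertex vs i" using vertex_mod[of vs "Suc j"] by simp
  then have "on_edge P vs j 1 p" using h True poly_props(3)[OF h(1)] by (auto simp: on_edge_def edge_dir_def j_def)
  then show ?thesis using that[of vs j 1] by simp
 next
  case False
  then show ?thesis using that[of vs i t] h by (simp add: on_edge_def)
 qed
qed

lemma same_polygon:
 assumes "p \<in> polygon_set vs" "p \<in> polygon_set ws" "vs \<in> P" "ws \<in> P"
 shows "vs = ws" using P assms unfolding polygonal_link_def pairwise_def disjnt_def by blast

text \<open>The condition \<open>c\<close> rules out the one ambiguity of a simple polygon, a vertex
  read both as the end of one edge and as the start of the next.\<close>

lemma on_edge_unique:
 assumes a: "on_edge P vs i t p" "on_edge P ws j s p" and ts: "0 \<le> t" "t \<le> 1" "0 \<le> s" "s \<le> 1"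
  and c: "t < 1 \<and> s < 1 \<or> 0 < t \<and> 0 < s"
 shows "vs = ws" "i = j" "t = s"
proof -
 have vs: "vs \<in> P" "i < length vs" "j < length ws" "ws \<in> P" using a by (auto simp: on_edge_def)
 show vw: "vs = ws" using same_polygon on_edge_mem a ts vs by metis
 have nz: "edge_dir vs k \<noteq> 0" for k by (rule edge_dir_nonzero[OF vs(1)])
 show ij: "i = j"
 proof (rule ccontr)
  assume "i \<noteq> j"
  then have "p \<in> {v. (v = vertex vs j \<and> j = Suc i mod length vs) \<or> (v = vertex vs i \<and> i = Suc j mod length vs)}"
   using poly_props(4)[OF vs(1), of i j] vs vw on_edge_mem[OF a(1) ts(1,2)] on_edge_mem[OF a(2) ts(3,4)] by blast
  then consider "p = vertex vs j" "j = Suc i mod length vs" | "p = vertex vs i" "i = Suc j mod length vs" by blast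
  then show False
  proof cases
   case 1
   have "p = vertex vs i + t *\<^sub>R edge_dir vs i" "p = vertex vs i + 1 *\<^sub>R edge_dir vs i"
    using 1 a(1) by (auto simp: on_edge_def edge_dir_def vertex_mod)
   then have "t = 1" using nz by (metis add_left_cancel scaleR_right_imp_eq)
   moreover have "s = 0" using 1(1) a(2) vw nz by (auto simp: on_edge_def)
   ultimately show False using c by auto
  next
   case 2
   have "p = vertex vs j + s *\<^sub>R edge_dir vs j" "p = vertex vs j + 1 *\<^sub>R edge_dir vs j"
    using 2 a(2) vw by (auto simp: on_edge_def edge_dir_def vertex_mod)
   then have "s = 1" using nz by (metis add_left_cancel scaleR_right_imp_eq)
   moreover have "t = 0" using 2(1) a(1) nz by (auto simp: on_edge_def)
   ultimately show False using c by auto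
  qed
 qed
 have "t *\<^sub>R edge_dir vs i = s *\<^sub>R edge_dir vs i" using a vw ij by (auto simp: on_edge_def)
 then show "t = s" using nz by simp
qed

lemma out_dir_eq:
 assumes "on_edge P vs i t p" "0 \<le> t" "t < 1"
 shows "out_dir P p = edge_dir vs i" unfolding out_dir_def
proof (rule some_equality)
 show "\<exists>vs' i' t. on_edge P vs' i' t p \<and> 0 \<le> t \<and> t < 1 \<and> edge_dir vs i = edge_dir vs' i'" using assms by blast
 fix u assume "\<exists>vs i t. on_edge P vs i t p \<and> 0 \<le> t \<and> t < 1 \<and> u = edge_dir vs i"
 then obtain ws j s where h: "on_edge P ws j s p" "0 \<le> s" "s < 1" "u = edge_dir ws j" by blast
 have "vs = ws" "i = j" using on_edge_unique(1,2)[OF assms(1) h(1)] assms h by auto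
 then show "u = edge_dir vs i" using h by simp
qed

lemma in_dir_eq:
 assumes "on_edge P vs i t p" "0 < t" "t \<le> 1"
 shows "in_dir P p = edge_dir vs i" unfolding in_dir_def
proof (rule some_equality)
 show "\<exists>vs' i' t. on_edge P vs' i' t p \<and> 0 < t \<and> t \<le> 1 \<and> edge_dir vs i = edge_dir vs' i'" using assms by blast
 fix u assume "\<exists>vs i t. on_edge P vs i t p \<and> 0 < t \<and> t \<le> 1 \<and> u = edge_dir vs i"
 then obtain ws j s where h: "on_edge P ws j s p" "0 < s" "s \<le> 1" "u = edge_dir ws j" by blast
 have "vs = ws" "i = j" using on_edge_unique(1,2)[OF assms(1) h(1)] assms h by auto
 then show "u = edge_dir vs i" using h by simp
qed

lemma heading_cases: "heading P p u ==> u = out_dir P p \<or> u = in_dir P p"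
proof -
 assume "heading P p u"
 then obtain vs i where h: "vs \<in> P" "i < length vs" "p \<in> edge vs i" "u = edge_dir vs i" unfolding heading_def edge_dir_def by blast
 then obtain t where "0 \<le> t" "t \<le> 1" "on_edge P vs i t p" by (auto simp: edge_alt on_edge_def)
 then show ?thesis using out_dir_eq[of vs i t p] in_dir_eq[of vs i t p] h(4) by (cases "t < 1") auto
qed

lemma heading_out_dir: "p \<in> link_set P ==> heading P p (out_dir P p)"
proof -
 assume "p \<in> link_set P"
 then obtain vs i t where h: "on_edge P vs i t p" "0 \<le> t" "t < 1" by (rule on_edge_out_exists)
 have "p \<in> edge vs i" "vs \<in> P" "i < length vs" using on_edge_mem(1)[OF h(1,2)] h by (auto simp: on_edge_def)
 then show ?thesis unfolding heading_def out_dir_eq[OF h] edge_dir_def by blast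
qed

lemma closed_polygon_set: "closed (polygon_set vs)" and compact_link_set: "compact (link_set P)"
proof -
 have "compact (polygon_set vs)" for vs unfolding polygon_set_def edge_def by (intro compact_UN) auto
 then show "closed (polygon_set vs)" "compact (link_set P)"
  using P unfolding link_set_def polygonal_link_def by (auto intro: compact_imp_closed compact_UN)
qed

lemma link_germ_out:
 assumes "p \<in> link_set P"
 shows "\<exists>e>0. \<forall>t. 0 < t \<and> t < e --> p + t *\<^sub>R out_dir P p \<in> link_set P \<and>
   out_dir P (p + t *\<^sub>R out_dir P p) = out_dir P p \<and> in_dir P (p + t *\<^sub>R out_dir P p) = out_dir P p"
proof -
 obtain vs i t where h: "on_edge P vs i t p" "0 \<le> t" "t < 1" using assms by (rule on_edge_out_exists)
 note o = out_dir_eq[OF h]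
 show ?thesis unfolding o
 proof (intro exI[of _ "1 - t"] conjI allI impI)
  fix s assume s: "0 < s \<and> s < 1 - t"
  have "on_edge P vs i (t + s) (p + s *\<^sub>R edge_dir vs i)" by (rule on_edge_shift[OF h(1)]) simp
  then show "p + s *\<^sub>R edge_dir vs i \<in> link_set P" "out_dir P (p + s *\<^sub>R edge_dir vs i) = edge_dir vs i"
   "in_dir P (p + s *\<^sub>R edge_dir vs i) = edge_dir vs i"
   using s h on_edge_mem(3) out_dir_eq in_dir_eq by (metis add_nonneg_pos less_diff_eq add.commute less_imp_le)+
 qed (use h in simp)
qed

lemma link_germ_in:
 assumes "p \<in> link_set P"
 shows "\<exists>e>0. \<forall>t. 0 < t \<and> t < e --> p - t *\<^sub>R in_dir P p \<in> link_set P \<and>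
   out_dir P (p - t *\<^sub>R in_dir P p) = in_dir P p \<and> in_dir P (p - t *\<^sub>R in_dir P p) = in_dir P p"
proof -
 obtain vs i t where h: "on_edge P vs i t p" "0 < t" "t \<le> 1" using assms by (rule on_edge_in_exists)
 note o = in_dir_eq[OF h]
 show ?thesis unfolding o
 proof (intro exI[of _ t] conjI allI impI)
  fix s assume s: "0 < s \<and> s < t"
  have "on_edge P vs i (t + - s) (p - s *\<^sub>R edge_dir vs i)" by (rule on_edge_shift[OF h(1)]) simp
  moreover have "0 < t + - s" "t + - s < 1" using s h by auto
  ultimately show "p - s *\<^sub>R edge_dir vs i \<in> link_set P" "out_dir P (p - s *\<^sub>R edge_dir vs i) = edge_dir vs i"
   "in_dir P (p - s *\<^sub>R edge_dir vs i) = edge_dir vs i" using on_edge_mem(3) out_dir_eq in_dir_eq by (metis less_imp_le)+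
 qed (use h in simp)
qed

text \<open>The finitely many edges that miss \<open>p\<close> form a closed set, so near
  \<open>p\<close> only edges through \<open>p\<close> are met.\<close>

lemma link_germ_nbhd:
 assumes "p \<in> link_set P"
 shows "\<exists>e>0. \<forall>q\<in>link_set P. dist q p < e --> (\<exists>t\<ge>0. q = p + t *\<^sub>R out_dir P p \<or> q = p - t *\<^sub>R in_dir P p)"
proof -
 define Z where "Z = (\<Union>(vs, i)\<in>{(vs, i). vs \<in> P \<and> i < length vs \<and> p \<notin> edge vs i}. edge vs i)"
 have fin: "finite {(vs, i). vs \<in> P \<and> i < length vs \<and> p \<notin> edge vs i}"
  by (rule finite_subset[of _ "SIGMA vs:P. {..<length vs}"]) (use P in \<open>auto simp: polygonal_link_def\<close>)
 have "closed Z" unfolding Z_def by (intro closed_UN fin ballI) (auto simp: edge_def)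
 moreover have "p \<notin> Z" by (auto simp: Z_def)
 ultimately obtain e where e: "e > 0" "ball p e \<subseteq> - Z" by (meson open_Compl ComplI open_contains_ball)
 have "\<exists>t\<ge>0. q = p + t *\<^sub>R out_dir P p \<or> q = p - t *\<^sub>R in_dir P p" if q: "q \<in> link_set P" "dist q p < e" for q
 proof -
  obtain vs i where vi: "vs \<in> P" "i < length vs" "q \<in> edge vs i" using q(1) by (auto simp: link_set_def polygon_set_def)
  have "q \<notin> Z" using e q(2) by (auto simp: dist_commute)
  then have "p \<in> edge vs i" using vi by (auto simp: Z_def)
  then obtain t s where ts: "0 \<le> t" "t \<le> 1" "on_edge P vs i t p" "0 \<le> s" "s \<le> 1" "on_edge P vs i s q"
   using vi by (auto simp: edge_alt on_edge_def)
  have qp: "q = p + (s - t) *\<^sub>R edge_dir vs i" using ts(3,6) by (simp add: on_edge_def algebra_simps)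
  consider "s = t" | "s > t" | "s < t" by linarith
  then show ?thesis
  proof cases
   case 1
   then show ?thesis using qp by (intro exI[of _ 0]) simp
  next
   case 2
   then have "out_dir P p = edge_dir vs i" using ts by (intro out_dir_eq) auto
   then show ?thesis using 2 qp by (intro exI[of _ "s - t"]) simp
  next
   case 3
   then have "in_dir P p = edge_dir vs i" using ts by (intro in_dir_eq) auto
   then show ?thesis using 3 qp by (intro exI[of _ "t - s"]) (simp add: algebra_simps)
  qed
 qed
 then show ?thesis using e(1) by blast
qed

end

text \<open>The conditions on directions follow from regular position by counting: a corner that
  turns back over itself, or parallel strands at a double point, would make two strands coincide in
  projection along an interval and give infinitely many double points. A vertical edge would put a
  second point over a vertex.\<close>

lemma strands_diagram:
 assumes "diagram P"
 shows "strands (link_set P) (out_dir P) (in_dir P)"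
proof -
 have P: "polygonal_link P" and R: "regular_position P" using assms by (auto simp: diagram_def)
 note germ_out = link_germ_out[OF P] and germ_in = link_germ_in[OF P]
 let ?K = "link_set P"
 have fib: "finite (fibre P z)" "card (fibre P z) \<le> 2" for z using R by (auto simp: regular_position_def)
 have fin2: "finite {z. card (fibre P z) = 2}" using R by (simp add: regular_position_def)
 have vert: "fibre P (fst v) = {v}" if "vs \<in> P" "v \<in> set vs" for vs v using R that by (simp add: regular_position_def)
 have card2: "card (fibre P (fst p)) = 2" if "p \<in> ?K" "q \<in> ?K" "fst p = fst q" "p \<noteq> q" for p q
 proof -
  have "{p, q} \<subseteq> fibre P (fst p)" using that by (auto simp: fibre_def)
  then have "card {p, q} \<le> card (fibre P (fst p))" by (rule card_mono[OF fib(1)])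
  then show ?thesis using that fib(2)[of "fst p"] by simp
 qed
 have inf: False if "e > 0" "d \<noteq> 0" "\<And>y. [|0 < y; y < e|] ==> card (fibre P (z + y *\<^sub>R d)) = 2" for e d z
 proof -
  have "inj_on (\<lambda>y. z + y *\<^sub>R d) {0<..<e}" using that(2) by (auto simp: inj_on_def)
  moreover have "infinite {0<..<e}" using that(1) by simp
  ultimately have "infinite ((\<lambda>y. z + y *\<^sub>R d) ` {0<..<e})" using finite_imageD by blast
  moreover have "(\<lambda>y. z + y *\<^sub>R d) ` {0<..<e} \<subseteq> {z. card (fibre P z) = 2}" using that(3) by auto
  ultimately show False using fin2 finite_subset by blast
 qed
 have fD: "fst (edge_dir vs i) \<noteq> 0" if "vs \<in> P" "i < length vs" for vs i
 proof
  assume z: "fst (edge_dir vs i) = 0"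
  have ne: "vs \<noteq> []" using that by auto
  have o: "on_edge P vs i 0 (vertex vs i)" "on_edge P vs i 1 (vertex vs (Suc i))" using that by (auto simp: on_edge_def edge_dir_def)
  have "vertex vs (Suc i) \<in> fibre P (fst (vertex vs i))" using on_edge_mem(3)[OF o(2)] z by (simp add: fibre_def edge_dir_def)
  then show False using vert[OF that(1) vertex_in_set[OF ne, of i]] edge_dir_nonzero[OF P that(1), of i] by (simp add: edge_dir_def)
 qed
 have fo: "fst (out_dir P p) \<noteq> 0" "fst (in_dir P p) \<noteq> 0" if "p \<in> ?K" for p
  using on_edge_out_exists[OF P that] on_edge_in_exists[OF P that] out_dir_eq[OF P] in_dir_eq[OF P] fD by (metis on_edge_def)+
 have interior: "in_dir P p = out_dir P p" if p: "p \<in> ?K" and nv: "\<And>vs v. vs \<in> P ==> v \<in> set vs ==> p \<noteq> v" for p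
 proof -
  obtain vs i t where h: "on_edge P vs i t p" "0 \<le> t" "t < 1" using on_edge_out_exists[OF P p] by blast
  have "t \<noteq> 0"
  proof
   assume "t = 0"
   then have "p = vertex vs i" "vs \<in> P" "vs \<noteq> []" using h by (auto simp: on_edge_def)
   then show False using nv vertex_in_set by blast
  qed
  then show ?thesis using in_dir_eq[OF P h(1)] out_dir_eq[OF P h] h by simp
 qed
 show ?thesis
 proof
  show "compact ?K" by (rule compact_link_set[OF P])
 next
  fix p assume p: "p \<in> ?K"
  show "\<exists>e>0. \<forall>t. 0 < t \<and> t < e --> p + t *\<^sub>R out_dir P p \<in> ?K \<and>
   out_dir P (p + t *\<^sub>R out_dir P p) = out_dir P p \<and> in_dir P (p + t *\<^sub>R out_dir P p) = out_dir P p" by (rule germ_out[OF p])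
  show "\<exists>e>0. \<forall>t. 0 < t \<and> t < e --> p - t *\<^sub>R in_dir P p \<in> ?K \<and>
   out_dir P (p - t *\<^sub>R in_dir P p) = in_dir P p \<and> in_dir P (p - t *\<^sub>R in_dir P p) = in_dir P p" by (rule germ_in[OF p])
  show "\<exists>e>0. \<forall>q\<in>?K. dist q p < e --> (\<exists>t\<ge>0. q = p + t *\<^sub>R out_dir P p \<or> q = p - t *\<^sub>R in_dir P p)"
   by (rule link_germ_nbhd[OF P p])
  show "no_backtrack (fst (in_dir P p)) (fst (out_dir P p))" unfolding no_backtrack_def
  proof (intro conjI allI impI notI fo[OF p])
   fix r :: real assume r: "r > 0" and bt: "fst (in_dir P p) = - (r *\<^sub>R fst (out_dir P p))"
   obtain e1 where e1: "e1 > 0" "\<And>t. 0 < t ==> t < e1 ==> p + t *\<^sub>R out_dir P p \<in> ?K \<and>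
    out_dir P (p + t *\<^sub>R out_dir P p) = out_dir P p" using germ_out[OF p] by blast
   obtain e2 where e2: "e2 > 0" "\<And>t. 0 < t ==> t < e2 ==> p - t *\<^sub>R in_dir P p \<in> ?K \<and>
    out_dir P (p - t *\<^sub>R in_dir P p) = in_dir P p" using germ_in[OF p] by blast
   show False
   proof (rule inf[of "min e1 (r * e2)" "fst (out_dir P p)" "fst p"])
    show "min e1 (r * e2) > 0" using e1 e2 r by simp
    fix y assume y: "0 < y" "y < min e1 (r * e2)"
    then have y': "0 < y / r" "y / r < e2" using r by (auto simp: field_simps)
    have a: "p + y *\<^sub>R out_dir P p \<in> ?K" "out_dir P (p + y *\<^sub>R out_dir P p) = out_dir P p" using e1(2)[of y] y by auto
    have b: "p - (y / r) *\<^sub>R in_dir P p \<in> ?K" "out_dir P (p - (y / r) *\<^sub>R in_dir P p) = in_dir P p" using e2(2)[OF y'] by auto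
    have "fst (p - (y / r) *\<^sub>R in_dir P p) = fst p + y *\<^sub>R fst (out_dir P p)" using bt r by simp
    moreover have "p + y *\<^sub>R out_dir P p \<noteq> p - (y / r) *\<^sub>R in_dir P p"
    proof
     assume "p + y *\<^sub>R out_dir P p = p - (y / r) *\<^sub>R in_dir P p"
     then have "out_dir P p = in_dir P p" using a(2) b(2) by metis
     moreover have "fst (in_dir P p) + r *\<^sub>R fst (out_dir P p) = 0" using bt by simp
     ultimately have "(1 + r) *\<^sub>R fst (out_dir P p) = 0" by (simp add: scaleR_add_left)
     then show False using fo[OF p] r by auto
    qed
    ultimately show "card (fibre P (fst p + y *\<^sub>R fst (out_dir P p))) = 2" using card2[OF a(1) b(1)] by simp
   qed (rule fo[OF p])
  qed (use fo[OF p] in auto)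
  show "p = q \<or> q = r \<or> p = r" if "q \<in> ?K" "r \<in> ?K" "fst p = fst q" "fst q = fst r" for q r
  proof (rule ccontr)
   assume "\<not> ?thesis"
   moreover have "{p, q, r} \<subseteq> fibre P (fst p)" using that p by (auto simp: fibre_def)
   ultimately have "3 \<le> card (fibre P (fst p))" using card_mono[OF fib(1), of "{p, q, r}" "fst p"] by auto
   then show False using fib(2)[of "fst p"] by simp
  qed
  fix q assume q: "q \<in> ?K" "fst p = fst q" "p \<noteq> q"
  have nv: "s \<noteq> v" if "s \<in> {p, q}" "vs \<in> P" "v \<in> set vs" for s vs v
  proof
   assume "s = v"
   have "fst s = fst p" using that(1) q(2) by (elim insertE) simp_all
   then have "fibre P (fst p) = {v}" using vert[OF that(2,3)] \<open>s = v\<close> by simp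
   moreover have "p \<in> fibre P (fst p)" "q \<in> fibre P (fst p)" using p q by (auto simp: fibre_def)
   ultimately show False using q(3) by auto
  qed
  have "in_dir P p = out_dir P p" by (rule interior[OF p], rule nv) simp_all
  moreover have "in_dir P q = out_dir P q" by (rule interior[OF q(1)], rule nv) simp_all
  ultimately have st: "in_dir P p = out_dir P p" "in_dir P q = out_dir P q" by simp_all
  have "cross (fst (out_dir P p)) (fst (out_dir P q)) \<noteq> 0"
  proof
   assume "cross (fst (out_dir P p)) (fst (out_dir P q)) = 0"
   then obtain s where s: "fst (out_dir P q) = s *\<^sub>R fst (out_dir P p)" using cross_eq_0_parallel fo[OF p] by blast
   then have s0: "s \<noteq> 0" using fo[OF q(1)] by auto
   obtain e1 where e1: "e1 > 0" "\<And>t. 0 < t ==> t < e1 ==> p + t *\<^sub>R out_dir P p \<in> ?K \<and>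
    out_dir P (p + t *\<^sub>R out_dir P p) = out_dir P p" using germ_out[OF p] by blast
   obtain e2 where e2: "e2 > 0" "\<And>t. 0 < t ==> t < e2 ==> p - t *\<^sub>R out_dir P p \<in> ?K \<and>
    out_dir P (p - t *\<^sub>R out_dir P p) = out_dir P p" using germ_in[OF p] unfolding st by blast
   obtain e3 where e3: "e3 > 0" "\<And>t. 0 < t ==> t < e3 ==> q + t *\<^sub>R out_dir P q \<in> ?K \<and>
    out_dir P (q + t *\<^sub>R out_dir P q) = out_dir P q" using germ_out[OF q(1)] by blast
   show False
   proof (rule inf[of "min e3 (min e1 e2 / \<bar>s\<bar>)" "fst (out_dir P q)" "fst q"])
    show "min e3 (min e1 e2 / \<bar>s\<bar>) > 0" using e1 e2 e3 s0 by simp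
    fix y assume y: "0 < y" "y < min e3 (min e1 e2 / \<bar>s\<bar>)"
    then have ys: "y * \<bar>s\<bar> < e1" "y * \<bar>s\<bar> < e2" using s0 by (auto simp: field_simps)
    have a: "p + (y * s) *\<^sub>R out_dir P p \<in> ?K \<and> out_dir P (p + (y * s) *\<^sub>R out_dir P p) = out_dir P p"
    proof (cases "s > 0")
     case True
     then show ?thesis using e1(2)[of "y * s"] y ys by simp
    next
     case False
     then have "s < 0" using s0 by simp
     then have "0 < y * (- s)" "y * (- s) < e2" using y ys by (auto intro: mult_pos_pos simp: mult_pos_neg)
     then show ?thesis using e2(2)[of "y * (- s)"] by simp
    qed
    have b: "q + y *\<^sub>R out_dir P q \<in> ?K" "out_dir P (q + y *\<^sub>R out_dir P q) = out_dir P q" using e3(2)[of y] y by auto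
    have fe: "fst (p + (y * s) *\<^sub>R out_dir P p) = fst q + y *\<^sub>R fst (out_dir P q)" using s q(2) by simp
    have "p + (y * s) *\<^sub>R out_dir P p \<noteq> q + y *\<^sub>R out_dir P q"
    proof
     assume eq: "p + (y * s) *\<^sub>R out_dir P p = q + y *\<^sub>R out_dir P q"
     then have d: "out_dir P p = out_dir P q" using a b(2) by metis
     then have "(1 - s) *\<^sub>R fst (out_dir P p) = 0" using s by (simp add: scaleR_diff_left)
     then have "s = 1" using fo[OF p] by simp
     then show False using eq d q(3) by simp
    qed
    then show "card (fibre P (fst q + y *\<^sub>R fst (out_dir P q))) = 2" using card2[OF b(1) conjunct1[OF a]] fe by simp
   qed (rule fo[OF q(1)])
  qed
  then show "in_dir P p = out_dir P p \<and> cross (fst (out_dir P p)) (fst (out_dir P q)) \<noteq> 0" using st by simp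
 next
  have "{p \<in> ?K. \<exists>q\<in>?K. q \<noteq> p \<and> fst q = fst p} \<subseteq> (\<Union>z\<in>{z. card (fibre P z) = 2}. fibre P z)"
  proof
   fix p assume "p \<in> {p \<in> ?K. \<exists>q\<in>?K. q \<noteq> p \<and> fst q = fst p}"
   then obtain q where "p \<in> ?K" "q \<in> ?K" "q \<noteq> p" "fst q = fst p" by blast
   then have "card (fibre P (fst p)) = 2" "p \<in> fibre P (fst p)" using card2[of p q] by (auto simp: fibre_def)
   then show "p \<in> (\<Union>z\<in>{z. card (fibre P z) = 2}. fibre P z)" by blast
  qed
  then show "finite {p \<in> ?K. \<exists>q\<in>?K. q \<noteq> p \<and> fst q = fst p}" by (rule finite_subset) (use fin2 fib in blast)
 qed
qed

section \<open>Passing from space to the three-sphere\<close>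

definition infty :: "space \<times> real" where "infty = (0, 1)"

definition from_S3 :: "space \<times> real => space" where
 "from_S3 x = (1 / (1 - snd x)) *\<^sub>R fst x"

lemma norm_sq_pos: "(norm (y::space))\<^sup>2 + 1 > 0" by (simp add: add_nonneg_pos)

lemma S3_iff: "x \<in> S3 \<longleftrightarrow> (norm (fst x))\<^sup>2 + (snd x)\<^sup>2 = 1"
 by (cases x) (simp add: S3_def norm_Pair real_sqrt_eq_1_iff)

lemma snd_to_S3: "1 - snd (to_S3 y) = 2 / ((norm y)\<^sup>2 + 1)" using norm_sq_pos[of y] by (simp add: to_S3_def field_simps)

lemma to_S3_ne_infty: "to_S3 y \<noteq> infty"
proof
 assume "to_S3 y = infty"
 then have "2 / ((norm y)\<^sup>2 + 1) = 0" using snd_to_S3[of y] by (simp add: infty_def)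
 then show False using norm_sq_pos[of y] by simp
qed

lemma from_to_S3 [simp]: "from_S3 (to_S3 y) = y"
proof -
 define c where "c = 2 / ((norm y)\<^sup>2 + 1)"
 have "c \<noteq> 0" using norm_sq_pos[of y] by (simp add: c_def)
 moreover have "fst (to_S3 y) = c *\<^sub>R y" by (simp add: to_S3_def c_def)
 ultimately show ?thesis unfolding from_S3_def snd_to_S3 c_def[symmetric] by simp
qed

lemma snd_ne_1:
 assumes "x \<in> S3" "x \<noteq> infty"
 shows "snd x \<noteq> 1"
proof
 assume "snd x = 1"
 then have "(norm (fst x))\<^sup>2 = 0" using assms(1) by (simp add: S3_iff)
 then show False using assms(2) \<open>snd x = 1\<close> by (simp add: infty_def prod_eq_iff)
qed

lemma to_from_S3:
 assumes "x \<in> S3" "x \<noteq> infty"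
 shows "to_S3 (from_S3 x) = x"
proof -
 obtain v s where x: "x = (v, s)" by fastforce
 have s: "s \<noteq> 1" using snd_ne_1[OF assms] x by simp
 have n: "(norm v)\<^sup>2 = 1 - s\<^sup>2" using assms(1) x by (simp add: S3_iff)
 have "(norm (from_S3 x))\<^sup>2 = (norm v)\<^sup>2 / (1 - s)\<^sup>2" by (simp add: from_S3_def x power_divide)
 also have "\<dots> = (1 + s) / (1 - s)"
 proof -
  have "1 - s\<^sup>2 = (1 + s) * (1 - s)" by (simp add: algebra_simps power2_eq_square)
  then show ?thesis unfolding n using s by (simp add: power2_eq_square)
 qed
 finally have r: "(norm (from_S3 x))\<^sup>2 = (1 + s) / (1 - s)" .
 then have r1: "(norm (from_S3 x))\<^sup>2 + 1 = 2 / (1 - s)" "(norm (from_S3 x))\<^sup>2 - 1 = 2 * s / (1 - s)" using s by (simp_all add: field_simps)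
 show ?thesis unfolding to_S3_def r1 using s by (simp add: from_S3_def x)
qed

lemma continuous_to_S3: "continuous_on A to_S3"
 unfolding to_S3_def using norm_sq_pos by (intro continuous_intros) (simp_all add: less_imp_neq[symmetric])

lemma continuous_from_S3: "continuous_on (S3 - {infty}) from_S3" unfolding from_S3_def using snd_ne_1 by (intro continuous_intros) auto

lemma homeomorphism_to_S3: "homeomorphism UNIV (S3 - {infty}) to_S3 from_S3" unfolding homeomorphism_def
proof (intro conjI ballI)
 show "to_S3 ` UNIV = S3 - {infty}"
 proof (intro equalityI subsetI)
  fix x assume "x \<in> S3 - {infty}"
  then show "x \<in> to_S3 ` UNIV" by (intro image_eqI[of _ _ "from_S3 x"]) (simp_all add: to_from_S3)
 next
  fix x assume "x \<in> to_S3 ` UNIV"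
  then show "x \<in> S3 - {infty}" using to_S3_in_S3 to_S3_ne_infty by (elim imageE) simp
 qed
 then have "from_S3 ` (S3 - {infty}) = from_S3 ` to_S3 ` UNIV" by simp
 then show "from_S3 ` (S3 - {infty}) = UNIV" by (simp only: image_image from_to_S3 image_ident)
qed (use to_from_S3 continuous_to_S3 continuous_from_S3 in auto)

lemma openin_to_S3: "open U ==> openin (top_of_set S3) (to_S3 ` U)"
proof -
 assume "open U"
 then have "openin (top_of_set (S3 - {infty})) (to_S3 ` U)" using homeomorphism_imp_open_map[OF homeomorphism_to_S3, of U] by simp
 then show ?thesis by (rule openin_trans) (rule openin_delete, simp)
qed

lemma dist_infty: "(dist (to_S3 y) infty)\<^sup>2 = 4 / ((norm y)\<^sup>2 + 1)"
proof -
 have "(norm (fst (to_S3 y)))\<^sup>2 + (snd (to_S3 y))\<^sup>2 = 1" using to_S3_in_S3 S3_iff by blast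
 moreover have "(dist (to_S3 y) infty)\<^sup>2 = (norm (fst (to_S3 y)))\<^sup>2 + (snd (to_S3 y) - 1)\<^sup>2"
  unfolding infty_def by (cases "to_S3 y") (simp only: dist_Pair_Pair dist_norm fst_conv snd_conv diff_zero, simp add: norm_Pair)
 ultimately have "(dist (to_S3 y) infty)\<^sup>2 = 2 * (1 - snd (to_S3 y))" by (simp add: power2_eq_square algebra_simps)
 then show ?thesis unfolding snd_to_S3 by simp
qed

definition flip :: "space \<times> real => space \<times> real" where "flip x = (fst x, - snd x)"

text \<open>The chart of the sphere centred at \<open>infty\<close>, that is, stereographic
  coordinates from the opposite pole.\<close>

definition south :: "space => space \<times> real" where "south y = flip (to_S3 y)"

lemma flip_flip [simp]: "flip (flip x) = x" by (simp add: flip_def)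

lemma flip_S3: "flip x \<in> S3 \<longleftrightarrow> x \<in> S3" by (simp add: S3_iff flip_def)

lemma continuous_flip: "continuous_on A flip" unfolding flip_def by (intro continuous_intros)

lemma homeomorphism_south: "homeomorphism UNIV (S3 - {flip infty}) south (from_S3 \<circ> flip)"
proof -
 have "homeomorphism (S3 - {infty}) (S3 - {flip infty}) flip flip"
 proof (rule homeomorphismI[OF continuous_flip continuous_flip])
  show "flip ` (S3 - {infty}) \<subseteq> S3 - {flip infty}" "flip ` (S3 - {flip infty}) \<subseteq> S3 - {infty}"
   by (auto simp: flip_S3 simp del: split_paired_All) (metis flip_flip)+
 qed simp_all
 from homeomorphism_compose[OF homeomorphism_to_S3 this] show ?thesis by (simp add: south_def[abs_def] comp_def)
qed

lemma south_0: "south 0 = infty" by (simp add: south_def to_S3_def flip_def infty_def)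

lemma south_S3: "south y \<in> S3" by (simp add: south_def flip_S3 to_S3_in_S3)

lemma inj_south: "inj south" by (rule inj_on_inverseI[of _ "from_S3 \<circ> flip"]) (rule homeomorphism_apply1[OF homeomorphism_south])

lemma south_eq_infty: "south y = infty \<longleftrightarrow> y = 0" using inj_south south_0 by (metis injD)

lemma openin_south: "open U ==> openin (top_of_set S3) (south ` U)"
proof -
 assume "open U"
 then have "openin (top_of_set (S3 - {flip infty})) (south ` U)" using homeomorphism_imp_open_map[OF homeomorphism_south, of U] by simp
 then show ?thesis by (rule openin_trans) (rule openin_delete, simp)
qed

lemma continuous_south: "continuous_on A south" using homeomorphism_south continuous_on_subset unfolding homeomorphism_def by blast

lemma south_homeomorphic: "A homeomorphic south ` A"
proof -
 have "homeomorphism A (south ` A) south (from_S3 \<circ> flip)"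
  by (rule homeomorphism_of_subsets[OF homeomorphism_south subset_UNIV empty_subsetI refl])
 then show ?thesis unfolding homeomorphic_def by blast
qed

section \<open>Filling in the point at infinity\<close>

context
 fixes K :: "space set" assumes K: "compact K"
begin

lemma infty_nbhd:
 assumes "openin (top_of_set S3) W" "infty \<in> W"
 obtains d where "d > 0" "south ` ball 0 d \<subseteq> W"
proof -
 obtain U where U: "open U" "W = S3 \<inter> U" using assms(1) by (auto simp: openin_open)
 have "open (south -` U)" using continuous_south[of UNIV] U(1) open_vimage by blast
 moreover have "0 \<in> south -` U" using assms(2) U south_0 by auto
 ultimately obtain d where "d > 0" "ball 0 d \<subseteq> south -` U" by (meson open_contains_ball)
 then show ?thesis using that[of d] U south_S3 by blast
qed

lemma openin_complement: "openin (top_of_set S3) (S3 - to_S3 ` K)"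
proof -
 have "closed (to_S3 ` K)" using K by (intro compact_imp_closed compact_continuous_image continuous_to_S3)
 then show ?thesis by (simp add: Diff_eq openin_open_Int open_Compl)
qed

lemma infty_in_complement: "infty \<in> S3 - to_S3 ` K"
proof
 show "infty \<in> S3" by (simp add: S3_iff infty_def)
 show "infty \<notin> to_S3 ` K"
 proof
  assume "infty \<in> to_S3 ` K"
  then obtain y where "infty = to_S3 y" by (rule imageE)
  then show False using to_S3_ne_infty[of y] by simp
 qed
qed

lemma small_nonzero: "d > 0 ==> \<exists>y::space. y \<in> ball 0 d \<and> y \<noteq> 0"
 by (rule exI[of _ "(complex_of_real (d / 2), 0)"]) (unfold mem_ball_0, simp add: norm_Pair zero_prod_def)

lemma complement_minus_infty: "S3 - to_S3 ` K - {infty} = to_S3 ` (- K)"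
proof -
 have "to_S3 ` UNIV = S3 - {infty}" using homeomorphism_to_S3 by (simp add: homeomorphism_def)
 moreover have "inj to_S3" by (metis from_to_S3 injI)
 then have "to_S3 ` (- K) = to_S3 ` UNIV - to_S3 ` K" by (simp add: image_set_diff Compl_eq_Diff_UNIV)
 ultimately show ?thesis by auto
qed

lemma openin_to_S3_complement: "open U ==> U \<subseteq> - K ==> openin (top_of_set (S3 - to_S3 ` K)) (to_S3 ` U)"
proof -
 assume "open U" "U \<subseteq> - K"
 then have "openin (top_of_set S3) (to_S3 ` U)" "to_S3 ` U \<subseteq> S3 - to_S3 ` K" using openin_to_S3 complement_minus_infty by blast+
 then show ?thesis using openin_subset_trans by blast
qed

lemma cap_exists:
 obtains d where "d > 0" "south ` ball 0 d \<subseteq> S3 - to_S3 ` K" using infty_nbhd[OF openin_complement infty_in_complement] by blast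

lemma openin_cap: "south ` ball 0 d \<subseteq> S3 - to_S3 ` K ==> openin (top_of_set (S3 - to_S3 ` K)) (south ` ball 0 d)"
 using openin_south[OF open_ball] openin_subset_trans openin_imp_subset by blast

lemma cap_minus_infty: "south ` ball 0 d - {infty} = south ` (ball 0 d - {0})"
 using south_eq_infty by (auto simp: south_0[symmetric]) (metis inj_south injD)+

text \<open>A punctured ball in dimension three is simply connected; this is why adding the point at
  infinity does not affect representations.\<close>

lemma punctured_cap:
 assumes "d > 0"
 shows "simply_connected (south ` (ball 0 d - {0}))" "simply_connected (south ` ball 0 d)"
proof -
 have "aff_dim (ball (0::space) d) = 3" using assms by (simp add: aff_dim_open)
 then have "simply_connected (ball (0::space) d - {0})" by (intro simply_connected_punctured_convex) auto
 then show "simply_connected (south ` (ball 0 d - {0}))" using homeomorphic_simply_connected_eq[OF south_homeomorphic] by blast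
 show "simply_connected (south ` ball 0 d)"
  using homeomorphic_simply_connected_eq[OF south_homeomorphic] convex_imp_simply_connected[OF convex_ball] by blast
qed

lemma from_S3_path:
 assumes "path g" "path_image g \<subseteq> S3 - to_S3 ` K - {infty}"
 shows "path (from_S3 \<circ> g)" "path_image (from_S3 \<circ> g) \<subseteq> - K" "path_image g \<subseteq> S3"
  "\<And>t. t \<in> {0..1} ==> to_S3 ((from_S3 \<circ> g) t) = g t"
proof -
 have im: "path_image g \<subseteq> S3 - {infty}" using assms(2) by blast
 show "path (from_S3 \<circ> g)" by (rule path_continuous_image[OF assms(1) continuous_on_subset[OF continuous_from_S3 im]])
 show "path_image (from_S3 \<circ> g) \<subseteq> - K" using assms(2) unfolding complement_minus_infty path_image_compose by auto
 show "path_image g \<subseteq> S3" using im by blast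
 show "to_S3 ((from_S3 \<circ> g) t) = g t" if "t \<in> {0..1}" for t
 proof -
  have "g t \<in> path_image g" using that by (simp add: path_image_def)
  then show ?thesis using im to_from_S3[of "g t"] by auto
 qed
qed

lemma path_connected_complement_S3:
 assumes "path_connected (- K)"
 shows "path_connected (S3 - to_S3 ` K)"
proof -
 obtain d where d: "d > 0" "south ` ball 0 d \<subseteq> S3 - to_S3 ` K" by (rule cap_exists)
 have e: "S3 - to_S3 ` K = to_S3 ` (- K) \<union> south ` ball 0 d"
  using d complement_minus_infty south_0 by (auto simp del: mem_ball) (metis DiffI centre_in_ball image_eqI singletonD)+
 obtain y :: space where y: "y \<in> ball 0 d - {0}" using small_nonzero[OF d(1)] by blast
 then have "south y \<in> south ` ball 0 d - {infty}" unfolding cap_minus_infty by blast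
 then have "south y \<in> to_S3 ` (- K) \<inter> south ` ball 0 d" using d(2) complement_minus_infty by blast
 then have "to_S3 ` (- K) \<inter> south ` ball 0 d \<noteq> {}" by blast
 then show ?thesis unfolding e by (intro path_connected_Un path_connected_continuous_image[OF continuous_to_S3 assms]
   simply_connected_imp_path_connected[OF punctured_cap(2)[OF d(1)]])
qed

text \<open>Near infinity \<open>\<Phi>\<close> is the coboundary of a function \<open>k\<close>,
  because the punctured cap is simply connected. The transport given by \<open>k\<close> makes sense
  at infinity too, so together with the transport by \<open>\<Phi>\<close> along short segments it
  forms a local cocycle on the whole complement, whose monodromy is the extension.\<close>

lemma extend_rep:
 fixes G (structure)
 assumes rep: "groupoid_rep G (- K) \<Phi>"
 obtains \<Psi> where "groupoid_rep G (S3 - to_S3 ` K) \<Psi>"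
  "\<And>g. [|path g; path_image g \<subseteq> - K|] ==> \<Psi> (to_S3 \<circ> g) = \<Phi> g"
proof -
 interpret groupoid_rep G "- K" \<Phi> by (rule rep)
 let ?Y = "S3 - to_S3 ` K"
 obtain d where d: "d > 0" "south ` ball 0 d \<subseteq> ?Y" by (rule cap_exists)
 define V where "V = south ` ball 0 d"
 \<comment> \<open>A cap of half the radius. On all of \<open>Z\<close> the two formulas for
   transport agree, and a point outside \<open>Z\<close> has a neighbourhood that misses
   \<open>V'\<close>; so around every finite point the transport is that of
   \<open>\<Phi>\<close>.\<close>
 define V' where "V' = south ` ball 0 (d / 2)"
 define Z where "Z = to_S3 -` V"
 have VV: "V' \<subseteq> V" unfolding V_def V'_def using d(1) by (intro image_mono) auto
 have im: "to_S3 ` Z = V - {infty}" unfolding Z_def image_vimage_eq homeomorphism_image1[OF homeomorphism_to_S3] using d(2) V_def by blast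
 have "homeomorphism Z (V - {infty}) to_S3 from_S3" by (rule homeomorphism_of_subsets[OF homeomorphism_to_S3 subset_UNIV empty_subsetI im])
 then have "Z homeomorphic (V - {infty})" unfolding homeomorphic_def by blast
 moreover have "simply_connected (V - {infty})" unfolding V_def cap_minus_infty by (rule punctured_cap(1)[OF d(1)])
 ultimately have Zs: "simply_connected Z" using homeomorphic_simply_connected_eq by blast
 have "to_S3 ` Z \<subseteq> to_S3 ` (- K)" unfolding im complement_minus_infty[symmetric] using d(2) V_def by blast
 then have ZK: "Z \<subseteq> - K" using inj_image_subset_iff[of to_S3 Z "- K"] from_to_S3 by (metis injI)
 have toZ: "to_S3 q \<in> V \<longleftrightarrow> q \<in> Z" for q by (simp add: Z_def)
 have Zo: "open Z"
 proof -
  have "openin (top_of_set S3) V" unfolding V_def by (rule openin_south[OF open_ball])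
  then obtain U where U: "open U" "V = S3 \<inter> U" by (auto simp: openin_open)
  then have "Z = to_S3 -` U" unfolding Z_def using to_S3_in_S3 by blast
  then show ?thesis using U(1) continuous_to_S3[of UNIV] open_vimage by blast
 qed
 obtain k where k: "\<And>x. k x \<in> carrier G"
  "\<And>g. [|path g; path_image g \<subseteq> Z|] ==> k (pathstart g) \<otimes> \<Phi> g \<otimes> inv (k (pathfinish g)) = \<one>"
  using trivialize[OF Zs ZK] by blast
 have kZ: "inv (k (pathstart g)) \<otimes> k (pathfinish g) = \<Phi> g" if g: "path g" "path_image g \<subseteq> Z" for g
 proof -
  have c: "\<Phi> g \<in> carrier G" using closed g ZK by blast
  have "k (pathstart g) \<otimes> \<Phi> g = k (pathfinish g)" using k(2)[OF g] k(1) c by (metis inv_closed inv_equality inv_inv m_closed)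
  then show ?thesis using k(1)[of "pathstart g"] c by (metis inv_solve_left k(1))
 qed
 \<comment> \<open>At infinity \<open>from_S3\<close> takes the default value 0 through division by
   zero, so \<open>m\<close> uses \<open>k 0\<close> there. Any value would give a cocycle on
   \<open>V'\<close>, because only differences of \<open>k\<close> enter.\<close>
 define m where "m x y = (if x \<in> V' \<and> y \<in> V' then inv (k (from_S3 x)) \<otimes> k (from_S3 y) else \<Phi> (linepath (from_S3 x) (from_S3 y)))" for x y
 have loc: "\<exists>r>0. ball q r \<subseteq> - K \<and> (\<forall>x\<in>ball q r. \<forall>y\<in>ball q r. m (to_S3 x) (to_S3 y) = \<Phi> (linepath x y))"
  if q: "q \<in> - K" for q
 proof -
  have oK: "open (- K)" using K by (simp add: compact_imp_closed open_Compl)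
  show ?thesis
  proof (cases "q \<in> Z")
   case True
   obtain r where r: "r > 0" "ball q r \<subseteq> Z" using Zo True by (meson open_contains_ball)
   have "m (to_S3 x) (to_S3 y) = \<Phi> (linepath x y)" if "x \<in> ball q r" "y \<in> ball q r" for x y
   proof -
    have "closed_segment x y \<subseteq> Z" using r(2) that closed_segment_subset[OF _ _ convex_ball] by blast
    then show ?thesis using kZ[of "linepath x y"] by (simp add: m_def)
   qed
   then show ?thesis using r ZK by blast
  next
   case False
   have "closed (south ` cball 0 (d / 2))" by (intro compact_imp_closed compact_continuous_image continuous_south) auto
   then have "open (to_S3 -` (- (south ` cball 0 (d / 2))))" using continuous_to_S3[of UNIV] by (intro open_vimage) auto
   moreover have "south ` cball 0 (d / 2) \<subseteq> V" unfolding V_def using d(1) by (intro image_mono) auto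
   then have "q \<in> to_S3 -` (- (south ` cball 0 (d / 2)))" using False toZ by blast
   ultimately obtain r where r: "r > 0" "ball q r \<subseteq> to_S3 -` (- (south ` cball 0 (d / 2)))" by (meson open_contains_ball)
   obtain s where s: "s > 0" "ball q s \<subseteq> - K" using oK q by (meson open_contains_ball)
   have "V' \<subseteq> south ` cball 0 (d / 2)" unfolding V'_def by (intro image_mono) auto
   then have "to_S3 x \<notin> V'" if "x \<in> ball q r" for x using r(2) that by blast
   then have "m (to_S3 x) (to_S3 y) = \<Phi> (linepath x y)" if "x \<in> ball q (min r s)" for x y using that by (simp add: m_def)
   moreover have "ball q (min r s) \<subseteq> - K" using s by auto
   ultimately show ?thesis using r(1) s(1) by (intro exI[of _ "min r s"]) auto
  qed
 qed
 interpret c: local_cocycle G ?Y m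
 proof unfold_locales
  fix p assume p: "p \<in> ?Y"
  show "\<exists>N. openin (top_of_set ?Y) N \<and> p \<in> N \<and> (\<forall>x\<in>N. \<forall>y\<in>N. m x y \<in> carrier G) \<and>
   (\<forall>x\<in>N. \<forall>y\<in>N. \<forall>z\<in>N. m x y \<otimes> m y z = m x z)"
  proof (cases "p = infty")
   case True
   have V'Y: "V' \<subseteq> ?Y" using VV d V_def by blast
   have mV: "m x y = inv (k (from_S3 x)) \<otimes> k (from_S3 y)" if "x \<in> V'" "y \<in> V'" for x y using that by (simp add: m_def)
   show ?thesis
   proof (intro exI[of _ V'] conjI ballI)
    show "openin (top_of_set ?Y) V'" unfolding V'_def by (rule openin_cap) (use V'Y V'_def in simp)
    show "p \<in> V'" unfolding V'_def True south_0[symmetric] using d(1) by (intro imageI) simp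
    fix x y z assume xyz: "x \<in> V'" "y \<in> V'"
    show "m x y \<in> carrier G" using mV[OF xyz] k(1) by simp
    assume "z \<in> V'"
    then have "m x y \<otimes> m y z = inv (k (from_S3 x)) \<otimes> (k (from_S3 y) \<otimes> inv (k (from_S3 y))) \<otimes> k (from_S3 z)"
     using mV xyz k(1) by (simp only: m_assoc inv_closed m_closed)
    then show "m x y \<otimes> m y z = m x z" using mV[OF xyz(1) \<open>z \<in> V'\<close>] k(1) by simp
   qed
  next
   case False
   then have "p \<in> to_S3 ` (- K)" using p complement_minus_infty by blast
   then obtain q where q: "q \<in> - K" "p = to_S3 q" by blast
   obtain r where r: "r > 0" "ball q r \<subseteq> - K" "\<And>x y. [|x \<in> ball q r; y \<in> ball q r|] ==> m (to_S3 x) (to_S3 y) = \<Phi> (linepath x y)"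
    using loc[OF q(1)] by (elim exE conjE) (rule that, assumption, assumption, blast)
   show ?thesis
   proof (intro exI[of _ "to_S3 ` ball q r"] conjI ballI)
    show "openin (top_of_set ?Y) (to_S3 ` ball q r)" by (rule openin_to_S3_complement[OF open_ball r(2)])
    show "p \<in> to_S3 ` ball q r" using q r(1) by simp
    fix x y z assume "x \<in> to_S3 ` ball q r" "y \<in> to_S3 ` ball q r"
    then obtain x' y' where xy: "x' \<in> ball q r" "y' \<in> ball q r" "x = to_S3 x'" "y = to_S3 y'" by (elim imageE)
    show "m x y \<in> carrier G" unfolding xy(3,4) r(3)[OF xy(1,2)] by (rule linepath_closed[OF convex_ball r(2) xy(1,2)])
    assume "z \<in> to_S3 ` ball q r"
    then obtain z' where z: "z' \<in> ball q r" "z = to_S3 z'" by (elim imageE)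
    show "m x y \<otimes> m y z = m x z" unfolding xy(3,4) z(2) r(3)[OF xy(1,2)] r(3)[OF xy(2) z(1)] r(3)[OF xy(1) z(1)]
     by (rule convex_join[OF convex_ball r(2) xy(1,2) z(1)])
   qed
  qed
 qed
 show ?thesis
 proof (rule that[OF c.groupoid_rep_monodromy])
  fix g assume g: "path g" "path_image g \<subseteq> - K"
  have gK: "g t \<in> - K" if "t \<in> {0..1}" for t using g(2) that unfolding path_image_def by blast
  have sp: "path (subpath u v g)" "path_image (subpath u v g) \<subseteq> - K" "\<Phi> (subpath u v g) \<in> carrier G"
   if "u \<in> {0..1}" "v \<in> {0..1}" for u v
  proof -
   show 1: "path (subpath u v g)" by (rule path_subpath[OF g(1) that])
   show 2: "path_image (subpath u v g) \<subseteq> - K" using path_image_subpath_subset[OF that, of g] g by blast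
   show "\<Phi> (subpath u v g) \<in> carrier G" by (rule closed[OF 1 2])
  qed
  \<comment> \<open>The lift along a path that avoids infinity is the value of \<open>\<Phi>\<close>
    on its initial parts, so its monodromy is \<open>\<Phi> g\<close>.\<close>
  have "c.flat {0..1} (to_S3 \<circ> g) (\<lambda>t. \<Phi> (subpath 0 t g))" unfolding c.flat_def
  proof (intro ballI conjI)
   fix s :: real assume s: "s \<in> {0..1}"
   show "\<Phi> (subpath 0 s g) \<in> carrier G" using sp[of 0 s] s by simp
   obtain r where r: "r > 0" "ball (g s) r \<subseteq> - K" "\<And>x y. [|x \<in> ball (g s) r; y \<in> ball (g s) r|] ==> m (to_S3 x) (to_S3 y) = \<Phi> (linepath x y)"
    using loc[OF gK[OF s]] by (elim exE conjE) (rule that, assumption, assumption, blast)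
   obtain e where e: "e > 0" "\<And>t. [|t \<in> {0..1}; dist t s < e|] ==> dist (g t) (g s) < r"
    using g(1) s r(1) unfolding path_def continuous_on_iff by metis
   have "\<Phi> (subpath 0 t g) = \<Phi> (subpath 0 s g) \<otimes> m ((to_S3 \<circ> g) s) ((to_S3 \<circ> g) t)" if t: "t \<in> ball s e \<inter> {0..1}" for t
   proof -
    have t01: "t \<in> {0..1}" using t by blast
    have "homotopic_paths (- K) (subpath 0 s g +++ subpath s t g) (subpath 0 t g)" using g s t01 by (intro homotopic_join_subpaths) auto
    then have "\<Phi> (subpath 0 t g) = \<Phi> (subpath 0 s g) \<otimes> \<Phi> (subpath s t g)"
     using homotopic join[OF sp(1,2)[of 0 s] sp(1,2)[OF s t01]] s by simp
    moreover have "path_image (subpath s t g) \<subseteq> ball (g s) r"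
    proof -
     have "u \<in> {0..1} \<and> dist u s < e" if "u \<in> closed_segment s t" for u
     proof -
      have "closed_segment s t \<subseteq> ball s e \<inter> {0..1}" using s t e(1) by (intro closed_segment_subset convex_Int) auto
      then show ?thesis using that by (auto simp: dist_commute)
     qed
     then show ?thesis using e(2) unfolding path_image_subpath_gen by (auto simp: dist_commute)
    qed
    then have "\<Phi> (subpath s t g) = \<Phi> (linepath (g s) (g t))"
     using r(1,2) e(2)[OF t01] t closed_segment_subset[OF _ _ convex_ball[of "g s" r], of "g s" "g t"]
     by (intro simply_connected_eq[OF convex_imp_simply_connected[OF convex_ball] r(2)] sp(1)[OF s t01])
      (auto simp: dist_commute)
    moreover have "m (to_S3 (g s)) (to_S3 (g t)) = \<Phi> (linepath (g s) (g t))" using r(1) e(2)[OF t01] t by (intro r(3)) (auto simp: dist_commute)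
    ultimately show ?thesis by simp
   qed
   then show "\<exists>N. open N \<and> s \<in> N \<and> (\<forall>t\<in>N \<inter> {0..1}. \<Phi> (subpath 0 t g) = \<Phi> (subpath 0 s g) \<otimes> m ((to_S3 \<circ> g) s) ((to_S3 \<circ> g) t))"
    by (intro exI[of _ "ball s e"] conjI ballI) (use e(1) in simp_all)
  qed
  moreover have "path (to_S3 \<circ> g)" by (rule path_continuous_image[OF g(1) continuous_to_S3])
  moreover have "path_image (to_S3 \<circ> g) \<subseteq> ?Y" using g(2) complement_minus_infty unfolding path_image_compose by blast
  ultimately have "c.monodromy (to_S3 \<circ> g) = inv (\<Phi> (subpath 0 0 g)) \<otimes> \<Phi> (subpath 0 1 g)" by (rule c.monodromy_eq[rotated 2])
  moreover have "\<Phi> (subpath 0 0 g) = \<one>" using const[of "g 0"] gK[of 0] by (simp add: subpath_refl)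
  ultimately show "c.monodromy (to_S3 \<circ> g) = \<Phi> g" using closed[OF g] by simp
 qed
qed

text \<open>Again \<open>local_to_global\<close>. Near infinity a path inside the simply connected
  cap is replaced by one in the punctured cap with the same ends, which is the image of a path in
  space.\<close>

lemma generation_S3:
 fixes G (structure)
 assumes rep: "groupoid_rep G (S3 - to_S3 ` K) \<Psi>" and H: "subgroup H G"
  and S: "S \<subseteq> - K"
  and dense: "\<And>p W. [|p \<in> - K; openin (top_of_set (- K)) W; p \<in> W|] ==>
   \<exists>b. path b \<and> path_image b \<subseteq> W \<and> pathstart b \<in> S \<and> pathfinish b = p"
  and gen: "\<And>g. [|path g; path_image g \<subseteq> - K; pathstart g \<in> S; pathfinish g \<in> S|] ==> \<Psi> (to_S3 \<circ> g) \<in> H"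
  and g: "path g" "path_image g \<subseteq> S3 - to_S3 ` K" "pathstart g \<in> to_S3 ` S" "pathfinish g \<in> to_S3 ` S"
 shows "\<Psi> g \<in> H"
proof -
 interpret groupoid_rep G "S3 - to_S3 ` K" \<Psi> by (rule rep)
 let ?Y = "S3 - to_S3 ` K"
 have gen': "\<Psi> g \<in> H" if g: "path g" "path_image g \<subseteq> ?Y - {infty}" "pathstart g \<in> to_S3 ` S" "pathfinish g \<in> to_S3 ` S" for g
 proof -
  note f = from_S3_path[OF g(1,2)]
  have "path (to_S3 \<circ> (from_S3 \<circ> g))" by (rule path_continuous_image[OF f(1) continuous_to_S3])
  have "homotopic_paths ?Y g (to_S3 \<circ> (from_S3 \<circ> g))" by (rule homotopic_paths_eq[OF g(1)]) (use g(2) f(4) in auto)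
  then have "\<Psi> g = \<Psi> (to_S3 \<circ> (from_S3 \<circ> g))" by (rule homotopic)
  moreover have "\<Psi> (to_S3 \<circ> (from_S3 \<circ> g)) \<in> H"
   by (rule gen[OF f(1,2)]) (use g(3,4) in \<open>auto simp: pathstart_compose pathfinish_compose\<close>)
  ultimately show ?thesis by simp
 qed
 have dense1: "\<exists>b. path b \<and> path_image b \<subseteq> W \<and> pathstart b \<in> to_S3 ` S \<and> pathfinish b = p"
  if p: "p \<in> ?Y" "p \<noteq> infty" and W: "openin (top_of_set ?Y) W" "p \<in> W" for p W
 proof -
  have "p \<in> to_S3 ` (- K)" using p complement_minus_infty by blast
  then obtain q where q: "q \<in> - K" "p = to_S3 q" by blast
  obtain U where U: "open U" "W = ?Y \<inter> U" using W(1) by (auto simp: openin_open)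
  have "open (to_S3 -` U)" using continuous_to_S3[of UNIV] U(1) open_vimage by blast
  then have "openin (top_of_set (- K)) (- K \<inter> to_S3 -` U)" by (simp add: openin_open_Int)
  moreover have "q \<in> - K \<inter> to_S3 -` U" using q U W(2) by auto
  ultimately obtain b where b: "path b" "path_image b \<subseteq> - K \<inter> to_S3 -` U" "pathstart b \<in> S" "pathfinish b = q"
   using dense[OF q(1)] by blast
  have "path_image (to_S3 \<circ> b) \<subseteq> W" using b(2) U(2) complement_minus_infty unfolding path_image_compose by blast
  moreover have "path (to_S3 \<circ> b)" by (rule path_continuous_image[OF b(1) continuous_to_S3])
  ultimately show ?thesis using b(3,4) q(2) by (intro exI[of _ "to_S3 \<circ> b"]) (simp add: pathstart_compose pathfinish_compose)
 qed
 show ?thesis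
 proof (rule local_to_global[OF H _ _ g])
  fix p W assume p: "p \<in> ?Y" "openin (top_of_set ?Y) W" "p \<in> W"
  show "\<exists>b. path b \<and> path_image b \<subseteq> W \<and> pathstart b \<in> to_S3 ` S \<and> pathfinish b = p"
  proof (cases "p = infty")
   case True
   have "openin (top_of_set S3) W" using p(2) openin_complement openin_trans by blast
   then obtain d where d: "d > 0" "south ` ball 0 d \<subseteq> W" using infty_nbhd p(3) True by blast
   obtain y :: space where y: "y \<in> ball 0 d" "y \<noteq> 0" using small_nonzero[OF d(1)] by blast
   have sy: "south y \<in> W" "south y \<noteq> infty" using d(2) y south_eq_infty by auto
   then obtain b where b: "path b" "path_image b \<subseteq> W" "pathstart b \<in> to_S3 ` S" "pathfinish b = south y"
    using dense1[OF _ _ p(2)] openin_imp_subset[OF p(2)] by blast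
   let ?l = "south \<circ> linepath y 0"
   have "path ?l" by (rule path_continuous_image[OF path_linepath continuous_south])
   moreover have "path_image ?l \<subseteq> W" using d closed_segment_subset[OF y(1) _ convex_ball, of 0] unfolding path_image_compose by auto
   ultimately show ?thesis using b True south_0 by (intro exI[of _ "b +++ ?l"]) (auto simp: path_image_join pathstart_compose pathfinish_compose)
  qed (use dense1 p in blast)
 next
  fix p assume p: "p \<in> ?Y"
  show "\<exists>N. openin (top_of_set ?Y) N \<and> p \<in> N \<and>
     (\<forall>g. path g --> path_image g \<subseteq> N --> pathstart g \<in> to_S3 ` S --> pathfinish g \<in> to_S3 ` S --> \<Psi> g \<in> H)"
  proof (cases "p = infty")
   case False
   then show ?thesis using p gen' by (intro exI[of _ "?Y - {infty}"] conjI allI impI openin_delete) auto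
  next
   case True
   obtain d where d: "d > 0" "south ` ball 0 d \<subseteq> ?Y" by (rule cap_exists)
   show ?thesis
   proof (intro exI[of _ "south ` ball 0 d"] conjI allI impI)
    show "openin (top_of_set ?Y) (south ` ball 0 d)" by (rule openin_cap[OF d(2)])
    show "p \<in> south ` ball 0 d" unfolding True south_0[symmetric] using d(1) by simp
    fix h assume h: "path h" "path_image h \<subseteq> south ` ball 0 d" "pathstart h \<in> to_S3 ` S" "pathfinish h \<in> to_S3 ` S"
    have "pathstart h \<in> south ` ball 0 d - {infty}" "pathfinish h \<in> south ` ball 0 d - {infty}"
     using h to_S3_ne_infty by (auto simp del: mem_ball) (metis to_S3_ne_infty)+
    then obtain h' where h': "path h'" "path_image h' \<subseteq> south ` ball 0 d - {infty}" "pathstart h' = pathstart h" "pathfinish h' = pathfinish h"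
     using simply_connected_imp_path_connected[OF punctured_cap(1)[OF d(1)]] unfolding cap_minus_infty path_connected_def by blast
    have "\<Psi> h = \<Psi> h'" by (rule simply_connected_eq[OF punctured_cap(2)[OF d(1)] d(2)]) (use h h' in auto)
    moreover have "\<Psi> h' \<in> H" by (rule gen'[OF h'(1)]) (use h h' d(2) in auto)
    ultimately show "\<Psi> h \<in> H" by simp
   qed
  qed
 qed
qed

end

section \<open>Integer linear systems and generators of dihedral groups\<close>

definition sign_group :: "int monoid" where
 "sign_group = \<lparr>carrier = {1, -1}, mult = (*), one = 1\<rparr>"

lemma group_sign_group: "group sign_group" by (rule groupI) (auto simp: sign_group_def)

lemma inv_sign_group: "x \<in> carrier sign_group ==> inv\<^bsub>sign_group\<^esub> x = x"
 by (rule group.inv_equality[OF group_sign_group]) (auto simp: sign_group_def)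

text \<open>Gaussian elimination without fractions, by induction on the number of equations.\<close>

lemma int_linear_system:
 fixes a :: "'i => 'j => int"
 assumes "finite I" "finite J" "card I < card J"
 shows "\<exists>x. (\<exists>j\<in>J. x j \<noteq> 0) \<and> (\<forall>i\<in>I. (\<Sum>j\<in>J. a i j * x j) = 0)" using assms
proof (induction I arbitrary: J a rule: finite_induct)
 case empty
 then obtain j where "j \<in> J" by (metis card.empty card_gt_0_iff ex_in_conv)
 then show ?case by (intro exI[of _ "\<lambda>_. 1"]) auto
next
 case (insert i I)
 show ?case
 proof (cases "\<forall>j\<in>J. a i j = 0")
  case True
  have "card I < card J" using insert by simp
  then obtain x where "\<exists>j\<in>J. x j \<noteq> 0" "\<forall>i\<in>I. (\<Sum>j\<in>J. a i j * x j) = 0" using insert.IH[OF insert.prems(1), of a] by blast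
  then show ?thesis using True by (intro exI[of _ x]) auto
 next
  case False
  then obtain k where k: "k \<in> J" "a i k \<noteq> 0" by blast
  have "card I < card (J - {k})" using insert k by simp
  then obtain y where y: "\<exists>j\<in>J - {k}. y j \<noteq> 0"
   "\<forall>l\<in>I. (\<Sum>j\<in>J - {k}. (a i k * a l j - a l k * a i j) * y j) = 0"
   using insert.IH[of "J - {k}" "\<lambda>l j. a i k * a l j - a l k * a i j"] insert.prems(1) by auto
  define s where "s = (\<Sum>j\<in>J - {k}. a i j * y j)"
  \<comment> \<open>Back substitution for the eliminated unknown \<open>k\<close>. Scaling the other
    unknowns by the pivot \<open>a i k\<close> avoids a division.\<close>
  define x where "x j = (if j = k then - s else a i k * y j)" for j
  have sum: "(\<Sum>j\<in>J. a l j * x j) = a i k * (\<Sum>j\<in>J - {k}. a l j * y j) - a l k * s" for l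
  proof -
   have "(\<Sum>j\<in>J - {k}. a l j * x j) = (\<Sum>j\<in>J - {k}. a i k * (a l j * y j))" by (rule sum.cong) (auto simp: x_def)
   then show ?thesis using sum.remove[OF insert.prems(1) k(1), of "\<lambda>j. a l j * x j"] by (simp add: x_def sum_distrib_left)
  qed
  have "(\<Sum>j\<in>J. a l j * x j) = 0" if "l \<in> I" for l using y(2)[rule_format, OF that] unfolding sum s_def
   by (simp add: left_diff_distrib sum_subtractf sum_distrib_left mult.assoc)
  moreover have "(\<Sum>j\<in>J. a i j * x j) = 0" unfolding sum s_def by simp
  moreover have "\<exists>j\<in>J. x j \<noteq> 0" using y(1) k by (auto simp: x_def)
  ultimately show ?thesis by (intro exI[of _ x]) auto
 qed
qed

text \<open>Coprime entries are demanded, not merely a nonzero solution, because they survive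
  reduction modulo every \<open>n\<close> as a set of exponents generating all residues.\<close>

lemma int_functionals_kernel:
 fixes L :: "'i => ('j => int) => int"
 assumes fin: "finite I" "finite J" "card I < card J"
  and lin: "\<And>i u v r. L i (\<lambda>j. r * u j + v j) = r * L i u + L i v"
 obtains x where "\<And>i. i \<in> I ==> L i x = 0" "Gcd (x ` J) = 1"
proof -
 have L0: "L i (\<lambda>j. 0) = 0" for i using lin[of i 1 "\<lambda>_. 0" "\<lambda>_. 0"] by simp
 have expand: "L i (\<lambda>j. if j \<in> F then x j else 0) = (\<Sum>j\<in>F. L i (\<lambda>k. if k = j then 1 else 0) * x j)" if "finite F" for F i x
  using that
 proof (induction F rule: finite_induct)
  case empty
  then show ?case by (simp add: L0)
 next
  case (insert f F)
  have "(\<lambda>j. if j \<in> insert f F then x j else 0) = (\<lambda>j. x f * (if j = f then 1 else 0) + (if j \<in> F then x j else 0))"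
   using insert by auto
  then show ?case using insert by (simp add: lin)
 qed
 obtain z where z: "\<exists>j\<in>J. z j \<noteq> 0" "\<And>i. i \<in> I ==> (\<Sum>j\<in>J. L i (\<lambda>k. if k = j then 1 else 0) * z j) = 0"
  using int_linear_system[OF fin, of "\<lambda>i j. L i (\<lambda>k. if k = j then 1 else 0)"] by blast
 \<comment> \<open>Extending the solution by zero outside \<open>J\<close> allows \<open>L\<close>
   to be expanded in the finitely many unknowns of \<open>J\<close>. Dividing by the gcd then makes
   the entries coprime.\<close>
 define y where "y j = (if j \<in> J then z j else 0)" for j
 have y: "L i y = 0" if "i \<in> I" for i using expand[OF fin(2), of i z] z(2)[OF that] unfolding y_def by simp
 define d where "d = Gcd (z ` J)"
 have d: "d \<noteq> 0" using z(1) by (auto simp: d_def)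
 define x where "x j = y j div d" for j
 have dx: "y j = d * x j + 0" for j unfolding x_def y_def d_def by auto
 have "Gcd (z ` J) = Gcd ((*) d ` x ` J)" unfolding image_image using dx unfolding y_def
  by (intro arg_cong[of _ _ Gcd] image_cong refl) (metis add.right_neutral)
 then have "d = normalize (d * Gcd (x ` J))" unfolding d_def[symmetric] using Gcd_mult[of d "x ` J"] by simp
 then have "d * 1 = d * Gcd (x ` J)" using d by (simp add: d_def abs_mult)
 then have "Gcd (x ` J) = 1" using d by (metis mult_left_cancel)
 moreover have "L i x = 0" if "i \<in> I" for i
 proof -
  have "y = (\<lambda>j. d * x j + 0)" by (rule ext) (rule dx)
  then have "L i y = d * L i x + L i (\<lambda>j. 0)" using lin[of i d x "\<lambda>j. 0"] by simp
  then show ?thesis using y[OF that] L0 d by simp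
 qed
 ultimately show ?thesis using that by blast
qed

lemma Gcd_in_additive_subgroup:
 fixes Z :: "int set"
 assumes "finite F" "F \<subseteq> Z" "0 \<in> Z" and add: "\<And>a b. a \<in> Z ==> b \<in> Z ==> a - b \<in> Z"
 shows "Gcd F \<in> Z"
proof -
 have neg: "- a \<in> Z" if "a \<in> Z" for a using add[OF assms(3) that] by simp
 have plus: "a + b \<in> Z" if "a \<in> Z" "b \<in> Z" for a b using add[OF that(1) neg[OF that(2)]] by simp
 have "int k * a \<in> Z" if "a \<in> Z" for k a by (induction k) (use that assms(3) plus in \<open>auto simp: algebra_simps\<close>)
 then have mult: "k * a \<in> Z" if "a \<in> Z" for k a using that neg by (cases k rule: int_cases2) auto
 show ?thesis using assms(1,2)
 proof (induction F rule: finite_induct)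
  case (insert a F)
  obtain u v where "u * a + v * Gcd F = gcd a (Gcd F)" using bezout_int by blast
  then show ?case using insert plus[OF mult mult, of a "Gcd F" u v] by simp
 qed (use assms(3) in simp)
qed

lemma mult_dihedral_mod:
 "(s, k mod int n) \<otimes>\<^bsub>dihedral n\<^esub> (t, l mod int n) = (s \<noteq> t, ((if t then - k else k) + l) mod int n)"
 by (cases t) (simp_all add: mult_dihedral mod_simps)

text \<open>In the presence of the reflection \<open>a\<close> the exponents of the generated
  rotations form an additive group of integers, and a reflection \<open>a b^k\<close> contributes
  \<open>k\<close> after multiplication by \<open>a\<close>. An additive group containing
  \<open>F\<close> contains its gcd 1.\<close>

lemma generate_dihedral_rotations:
 assumes n: "n \<ge> 1" and S: "S \<subseteq> carrier (dihedral n)" "(True, 0) \<in> S" and F: "finite F" "Gcd F = (1 :: int)"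
  and k: "\<And>k. k \<in> F ==> (True, k mod int n) \<in> S \<or> (False, k mod int n) \<in> S"
 shows "generate (dihedral n) S = carrier (dihedral n)"
proof -
 let ?G = "dihedral n"
 interpret group ?G by (rule group_dihedral[OF n])
 define Z where "Z = {k. (False, k mod int n) \<in> generate ?G S}"
 have H: "subgroup (generate ?G S) ?G" by (rule generate_is_subgroup[OF S(1)])
 have T0: "(True, 0) \<in> generate ?G S" using S(2) by (rule generate.incl)
 have "a - b \<in> Z" if "a \<in> Z" "b \<in> Z" for a b
 proof -
  have "(True, 0) \<otimes>\<^bsub>?G\<^esub> (False, b mod int n) \<otimes>\<^bsub>?G\<^esub> ((True, 0) \<otimes>\<^bsub>?G\<^esub> (False, a mod int n)) \<in> generate ?G S"
   using that T0 by (auto simp: Z_def intro!: subgroup.m_closed[OF H])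
  then show ?thesis by (simp add: Z_def mult_dihedral mod_simps)
 qed
 moreover have "F \<subseteq> Z"
 proof
  fix a assume "a \<in> F"
  from k[OF this] show "a \<in> Z"
  proof
   assume "(True, a mod int n) \<in> S"
   then have "(True, 0) \<otimes>\<^bsub>?G\<^esub> (True, a mod int n) \<in> generate ?G S" by (intro subgroup.m_closed[OF H T0] generate.incl)
   then show ?thesis by (simp add: Z_def mult_dihedral)
  qed (auto simp: Z_def intro: generate.incl)
 qed
 moreover have "0 \<in> Z" using subgroup.one_closed[OF H] by (simp add: Z_def one_dihedral)
 ultimately have "1 \<in> Z" using Gcd_in_additive_subgroup[OF F(1), of Z] F(2) by auto
 then have "generate ?G {dih_a, dih_b n} \<subseteq> generate ?G S"
  using T0 by (intro generate_subgroup_incl[OF _ H]) (auto simp: dih_a_def dih_b_def Z_def)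
 then show ?thesis using generate_dihedral[OF n] subgroup.subset[OF H] by auto
qed

section \<open>Colorings of arcs and colorings of points\<close>

context
 fixes P :: "space list set" assumes D: "diagram P"
begin

interpretation strands "link_set P" "out_dir P" "in_dir P" by (rule strands_diagram[OF D])

abbreviation (input) K where "K \<equiv> link_set P"

abbreviation (input) dout where "dout \<equiv> out_dir P"

abbreviation (input) din where "din \<equiv> in_dir P"

lemma poly: "polygonal_link P" using D by (simp add: diagram_def)

lemma crossing_over: "crossing P p q \<longleftrightarrow> over p q" by (simp add: crossing_def over_def)

lemma diagram_arcs_eq: "diagram_arcs P = components (K - Collect under)" by (simp only: diagram_arcs_def crossing_over under_def[symmetric])

definition arc_at :: "space => space set" where
 "arc_at p = connected_component_set (K - Collect under) p"

lemma arc_at_mem: "p \<in> K ==> \<not> under p ==> p \<in> arc_at p" "p \<in> K ==> \<not> under p ==> arc_at p \<in> diagram_arcs P"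
 by (auto simp: arc_at_def diagram_arcs_eq components_def)

lemma arc_at_eq: "A \<in> diagram_arcs P ==> p \<in> A ==> arc_at p = A" unfolding arc_at_def diagram_arcs_eq
 by (metis components_iff connected_component_eq)

lemma arc_subset: "A \<in> diagram_arcs P ==> A \<subseteq> K - Collect under" unfolding diagram_arcs_eq by (rule in_components_subset)

lemma arc_at_connected:
 assumes "connected S" "S \<subseteq> K - Collect under" "p \<in> S" "q \<in> S"
 shows "arc_at p = arc_at q" unfolding arc_at_def using assms by (intro connected_component_eq) (auto simp: connected_component_def)

lemma segment_connected: "connected ((\<lambda>t. p + t *\<^sub>R u) ` {a<..<b})" "connected ((\<lambda>t. p + t *\<^sub>R u) ` {a..<b})"
 for p u :: space and a b :: real by (intro connected_continuous_image continuous_intros; simp)+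

lemma strand_segments:
 assumes p: "p \<in> K"
 obtains e where "e > 0" "\<And>t. [|0 < t; t < e|] ==> p + t *\<^sub>R dout p \<in> K - Collect under"
  "\<And>t. [|0 < t; t < e|] ==> p - t *\<^sub>R din p \<in> K - Collect under"
proof -
 obtain d where d: "d > 0" "\<And>q. [|q \<in> K; q \<noteq> p; dist q p < d|] ==> \<not> under q" using near_not_under[OF p] by blast
 obtain e1 where e1: "e1 > 0" "\<forall>t. 0 < t \<and> t < e1 --> p + t *\<^sub>R dout p \<in> K" using germ_out[OF p] by blast
 obtain e2 where e2: "e2 > 0" "\<forall>t. 0 < t \<and> t < e2 --> p - t *\<^sub>R din p \<in> K" using germ_in[OF p] by blast
 have n: "dout p \<noteq> 0" "din p \<noteq> 0" using dirs_nonzero[OF p] by auto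
 define e where "e = min (min e1 e2) (min (d / norm (dout p)) (d / norm (din p)))"
 show ?thesis
 proof (rule that[of e])
  show "e > 0" using d e1 e2 n by (simp add: e_def)
  fix t assume t: "0 < t" "t < e"
  then have "t * norm (dout p) < d" "t * norm (din p) < d" using n by (auto simp: e_def field_simps)
  then have ds: "dist (p + t *\<^sub>R dout p) p < d" "dist (p - t *\<^sub>R din p) p < d" using t by (auto simp: dist_norm)
  have k: "p + t *\<^sub>R dout p \<in> K" "p - t *\<^sub>R din p \<in> K" using e1 e2 t by (auto simp: e_def)
  have "p + t *\<^sub>R dout p \<noteq> p" "p - t *\<^sub>R din p \<noteq> p" using t n by auto
  then show "p + t *\<^sub>R dout p \<in> K - Collect under" "p - t *\<^sub>R din p \<in> K - Collect under"
   using d(2)[OF k(1)] d(2)[OF k(2)] ds k by blast+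
 qed
qed

lemma coloring_of_arcs:
 assumes \<Gamma>: "dihedral_coloring n P \<Gamma>"
 obtains c where "coloring (dihedral n) c" "c ` K = \<Gamma> ` diagram_arcs P"
proof -
 let ?D = "dihedral n"
 have car: "\<Gamma> A \<in> carrier ?D" if "A \<in> diagram_arcs P" for A using \<Gamma> that by (auto simp: dihedral_coloring_def)
 have const: "\<exists>y z e. under q --> e > 0 \<and> y \<in> diagram_arcs P \<and> z \<in> diagram_arcs P \<and>
   (\<forall>t. 0 < t \<and> t < e --> q + t *\<^sub>R dout q \<in> z \<and> q - t *\<^sub>R dout q \<in> y)" for q
 proof (cases "under q")
  case True
  then obtain p where "over p q" unfolding under_def by blast
  note o = over_dirs[OF this]
  obtain e where e: "e > 0" "\<And>t. [|0 < t; t < e|] ==> q + t *\<^sub>R dout q \<in> K - Collect under"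
   "\<And>t. [|0 < t; t < e|] ==> q - t *\<^sub>R din q \<in> K - Collect under" using strand_segments[OF o(7)] by blast
  define z where "z = arc_at (q + (e / 2) *\<^sub>R dout q)"
  define y where "y = arc_at (q - (e / 2) *\<^sub>R dout q)"
  have h: "q + (e / 2) *\<^sub>R dout q \<in> K - Collect under" "q - (e / 2) *\<^sub>R dout q \<in> K - Collect under" using e o(2) by auto
  have "q + t *\<^sub>R dout q \<in> z" if t: "0 < t" "t < e" for t
  proof -
   have "arc_at (q + (e / 2) *\<^sub>R dout q) = arc_at (q + t *\<^sub>R dout q)"
    by (rule arc_at_connected[OF segment_connected(1)[of q "dout q" 0 e]]) (use e t in auto)
   then show ?thesis using arc_at_mem(1)[of "q + t *\<^sub>R dout q"] e(2)[OF t] by (simp add: z_def)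
  qed
  moreover have "q - t *\<^sub>R dout q \<in> y" if t: "0 < t" "t < e" for t
  proof -
   have "arc_at (q - (e / 2) *\<^sub>R dout q) = arc_at (q - t *\<^sub>R dout q)"
    by (rule arc_at_connected[OF segment_connected(1)[of q "- dout q" 0 e]]) (use e o(2) t in auto)
   then show ?thesis using arc_at_mem(1)[of "q - t *\<^sub>R dout q"] e(3)[OF t] o(2) by (simp add: y_def)
  qed
  moreover have "z \<in> diagram_arcs P" "y \<in> diagram_arcs P" using arc_at_mem(2) h by (auto simp: z_def y_def)
  ultimately show ?thesis using e(1) by blast
 qed blast
 then obtain Y Z E where f: "\<And>q. under q ==> E q > 0 \<and> Y q \<in> diagram_arcs P \<and> Z q \<in> diagram_arcs P \<and>
   (\<forall>t. 0 < t \<and> t < E q --> q + t *\<^sub>R dout q \<in> Z q \<and> q - t *\<^sub>R dout q \<in> Y q)" by metis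
 \<comment> \<open>An under-crossing point lies on no arc; it gets the color of the arc that leaves
   it.\<close>
 define c where "c p = \<Gamma> (if under p then Z p else arc_at p)" for p
 have arcs: "(if under p then Z p else arc_at p) \<in> diagram_arcs P" if "p \<in> K" for p using f[of p] arc_at_mem(2)[OF that] by simp
 have cA: "c p = \<Gamma> A" if "A \<in> diagram_arcs P" "p \<in> A" for A p
  using arc_subset[OF that(1)] that(2) arc_at_eq[OF that] by (auto simp: c_def)
 have "coloring ?D c" unfolding coloring_def
 proof (intro conjI ballI allI impI)
  show "c p \<in> carrier ?D" if "p \<in> K" for p unfolding c_def by (rule car[OF arcs[OF that]])
 next
  fix p assume p: "p \<in> K" "\<not> under p"
  obtain e where e: "e > 0" "\<And>t. [|0 < t; t < e|] ==> p + t *\<^sub>R dout p \<in> K - Collect under"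
   "\<And>t. [|0 < t; t < e|] ==> p - t *\<^sub>R din p \<in> K - Collect under" using strand_segments[OF p(1)] by blast
  obtain d where d: "d > 0" "\<forall>q\<in>K. dist q p < d --> (\<exists>t\<ge>0. q = p + t *\<^sub>R dout p \<or> q = p - t *\<^sub>R din p)"
   using germ_nbhd[OF p(1)] by blast
  have n: "norm (dout p) > 0" "norm (din p) > 0" using dirs_nonzero[OF p(1)] by auto
  define r where "r = min d (min (e * norm (dout p)) (e * norm (din p)))"
  have seg: "p + t *\<^sub>R dout p \<in> K - Collect under" "p - t *\<^sub>R din p \<in> K - Collect under"
   if "0 \<le> t" "t < e" for t using e(2,3)[of t] that p by (cases "t = 0"; simp)+
  show "\<exists>r>0. \<forall>q\<in>K. dist q p < r --> c q = c p"
  proof (intro exI[of _ r] conjI ballI impI)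
   show "r > 0" using d(1) e(1) n by (simp add: r_def)
   fix q assume q: "q \<in> K" "dist q p < r"
   then have "dist q p < d" by (simp add: r_def)
   then obtain t where t: "t \<ge> 0" "q = p + t *\<^sub>R dout p \<or> q = p - t *\<^sub>R din p" using d(2) q(1) by blast
   have te: "t < e"
   proof (rule ccontr)
    assume "\<not> t < e"
    then have "e * norm (dout p) \<le> t * norm (dout p)" "e * norm (din p) \<le> t * norm (din p)" using n by (auto intro: mult_right_mono)
    then show False using t q(2) by (auto simp: dist_norm r_def)
   qed
   have "arc_at p = arc_at q" using t(2)
   proof
    assume "q = p + t *\<^sub>R dout p"
    then show ?thesis using seg(1) t(1) te e(1)
     by (intro arc_at_connected[OF segment_connected(2)[of p "dout p" 0 e]] image_eqI[of p _ 0] image_eqI[of q _ t]) auto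
   next
    assume "q = p - t *\<^sub>R din p"
    then show ?thesis using seg(2) t(1) te e(1)
     by (intro arc_at_connected[OF segment_connected(2)[of p "- din p" 0 e]] image_eqI[of p _ 0] image_eqI[of q _ t]) auto
   qed
   moreover have "\<not> under q" using t te seg by auto
   ultimately show "c q = c p" using p(2) by (simp add: c_def)
  qed
 next
  fix q assume q: "under q"
  then obtain p where o: "over p q" unfolding under_def by blast
  note od = over_dirs[OF o]
  have np: "\<not> under p" by (rule over_not_under[OF o])
  define y z e where yze: "y = Y q" "z = Z q" "e = E q"
  have e: "e > 0" "y \<in> diagram_arcs P" "z \<in> diagram_arcs P"
   "\<And>t. [|0 < t; t < e|] ==> q + t *\<^sub>R dout q \<in> z" "\<And>t. [|0 < t; t < e|] ==> q - t *\<^sub>R dout q \<in> y"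
   using f[OF q] by (simp_all add: yze)
  have ca: "crossing_arcs P (dout p) (dout q) (arc_at p) y z" unfolding crossing_arcs_def
  proof (intro conjI exI)
   show "arc_at p \<in> diagram_arcs P" "p \<in> arc_at p" using arc_at_mem od(6) np by auto
   show "crossing P p q" using o by (simp add: crossing_over)
   show "heading P p (dout p)" "heading P q (dout q)" using heading_out_dir[OF poly] od by auto
   show "\<forall>\<^sub>F t in at_right 0. q - t *\<^sub>R dout q \<in> y" "\<forall>\<^sub>F t in at_right 0. q + t *\<^sub>R dout q \<in> z"
    unfolding eventually_at_right_field using e(1,4,5) by blast+
  qed (use e in auto)
  have cp: "c p = \<Gamma> (arc_at p)" using np by (simp add: c_def)
  have cq: "c q = \<Gamma> z" using q by (simp add: c_def yze)
  show "\<exists>e>0. \<exists>w0\<in>carrier ?D. \<exists>w1\<in>carrier ?D. c (over_of q) \<otimes>\<^bsub>?D\<^esub> w1 = w0 \<otimes>\<^bsub>?D\<^esub> c (over_of q) \<and> (c q = w0 \<or> c q = w1) \<and>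
    (\<forall>t. 0 < t \<and> t < e --> c (q + t *\<^sub>R left_dir q) = w1 \<and> c (q - t *\<^sub>R left_dir q) = w0)"
  proof (rule crossing_colorsI[where c = c, OF o e(1) car[OF e(2)] car[OF e(3)] cq])
   have "cross (fst (dout p)) (fst (dout q)) > 0 ==> positive_crossing P (arc_at p) y z"
    "cross (fst (dout p)) (fst (dout q)) < 0 ==> negative_crossing P (arc_at p) y z"
    using ca unfolding positive_crossing_def negative_crossing_def Im_cnj_mult by blast+
   then show "if cross (fst (dout p)) (fst (dout q)) > 0 then c p \<otimes>\<^bsub>?D\<^esub> \<Gamma> z = \<Gamma> y \<otimes>\<^bsub>?D\<^esub> c p
     else \<Gamma> z \<otimes>\<^bsub>?D\<^esub> c p = c p \<otimes>\<^bsub>?D\<^esub> \<Gamma> y"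
    using \<Gamma> od(3) unfolding cp dihedral_coloring_def by (auto simp: linorder_neq_iff)
   show "c (q + t *\<^sub>R dout q) = \<Gamma> z \<and> c (q - t *\<^sub>R dout q) = \<Gamma> y" if t: "0 < t" "t < e" for t
    using cA[OF e(3) e(4)[OF t]] cA[OF e(2) e(5)[OF t]] by simp
  qed
 qed
 moreover have "c ` K = \<Gamma> ` diagram_arcs P"
 proof (intro equalityI subsetI)
  fix g assume "g \<in> c ` K"
  then obtain p where "p \<in> K" "g = c p" by blast
  then show "g \<in> \<Gamma> ` diagram_arcs P" unfolding c_def using arcs[of p] by (metis image_eqI)
 next
  fix g assume "g \<in> \<Gamma> ` diagram_arcs P"
  then obtain A where A: "A \<in> diagram_arcs P" "g = \<Gamma> A" by blast
  then obtain p where "p \<in> A" using in_components_nonempty unfolding diagram_arcs_eq by blast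
  then have "g = c p" "p \<in> K" using cA[OF A(1)] A arc_subset[OF A(1)] by auto
  then show "g \<in> c ` K" by blast
 qed
 ultimately show ?thesis by (rule that)
qed

lemma coloring_const_on_arc:
 assumes c: "coloring G c" and A: "A \<in> diagram_arcs P" and pq: "p \<in> A" "q \<in> A"
 shows "c p = c q"
proof -
 have "c constant_on A"
 proof (rule locally_constant_on_connected)
  show "connected A" using A in_components_connected unfolding diagram_arcs_eq by blast
  fix a assume a: "a \<in> A"
  then have "a \<in> K" "\<not> under a" using arc_subset[OF A] by auto
  then obtain e where "e > 0" "\<forall>q\<in>K. dist q a < e --> c q = c a" using c unfolding coloring_def by blast
  then show "\<exists>e>0. \<forall>x\<in>A. dist x a < e --> c x = c a" using arc_subset[OF A] by (intro exI[of _ e]) auto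
 qed
 then obtain d where "\<And>x. x \<in> A ==> c x = d" unfolding constant_on_def by blast
 then show ?thesis using pq by metis
qed

definition arc_color :: "(space => 'g) => space set => 'g" where
 "arc_color c A = c (SOME p. p \<in> A)"

lemma arc_color_eq: "coloring G c ==> A \<in> diagram_arcs P ==> p \<in> A ==> arc_color c A = c p"
 unfolding arc_color_def by (rule coloring_const_on_arc) (auto intro: someI)

lemma arc_color_image:
 assumes "coloring G c"
 shows "arc_color c ` diagram_arcs P \<subseteq> c ` K"
proof
 fix g assume "g \<in> arc_color c ` diagram_arcs P"
 then obtain A where A: "A \<in> diagram_arcs P" "g = arc_color c A" by blast
 then obtain p where p: "p \<in> A" using in_components_nonempty unfolding diagram_arcs_eq by blast
 then have "g = c p" using arc_color_eq[OF assms A(1) p] A(2) by simp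
 then show "g \<in> c ` K" using p arc_subset[OF A(1)] by blast
qed

lemma arc_color_image_not_under:
 assumes "coloring G c" "p \<in> K" "\<not> under p"
 shows "c p \<in> arc_color c ` diagram_arcs P"
 using arc_color_eq[OF assms(1) arc_at_mem(2)[OF assms(2,3)] arc_at_mem(1)[OF assms(2,3)]] arc_at_mem(2)[OF assms(2,3)] by (metis image_eqI)

lemma crossing_arcs_color:
 fixes G (structure)
 assumes c: "coloring G c" and ca: "crossing_arcs P u v x y z"
 shows "cross (fst u) (fst v) > 0 \<and> arc_color c x \<otimes> arc_color c z = arc_color c y \<otimes> arc_color c x \<or>
  cross (fst u) (fst v) < 0 \<and> arc_color c z \<otimes> arc_color c x = arc_color c x \<otimes> arc_color c y"
proof -
 obtain p q where h: "x \<in> diagram_arcs P" "y \<in> diagram_arcs P" "z \<in> diagram_arcs P" "over p q" "heading P p u" "heading P q v" "p \<in> x"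
  "\<forall>\<^sub>F t in at_right 0. q - t *\<^sub>R v \<in> y" "\<forall>\<^sub>F t in at_right 0. q + t *\<^sub>R v \<in> z"
  using ca unfolding crossing_arcs_def crossing_over by (elim conjE exE) (rule that; assumption)
 note o = over_dirs[OF h(4)]
 have uv: "u = dout p" "v = dout q" using heading_cases[OF poly h(5)] heading_cases[OF poly h(6)] o(1,2) by auto
 have uq: "under q" using h(4) unfolding under_def by blast
 obtain e w0 w1 where w: "e > 0" "c (over_of q) \<otimes> w1 = w0 \<otimes> c (over_of q)"
  "\<forall>t. 0 < t \<and> t < e --> c (q + t *\<^sub>R left_dir q) = w1 \<and> c (q - t *\<^sub>R left_dir q) = w0"
  using c uq unfolding coloring_def by meson
 obtain b where b: "b > 0" "\<And>t. 0 < t ==> t < b ==> q - t *\<^sub>R v \<in> y" using h(8) unfolding eventually_at_right_field by blast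
 obtain b' where b': "b' > 0" "\<And>t. 0 < t ==> t < b' ==> q + t *\<^sub>R v \<in> z" using h(9) unfolding eventually_at_right_field by blast
 define t where "t = min e (min b b') / 2"
 have "0 < t" "t < e" "t < b" "t < b'" using w(1) b(1) b'(1) by (auto simp: t_def min_def)
 then have yz: "arc_color c y = c (q - t *\<^sub>R v)" "arc_color c z = c (q + t *\<^sub>R v)" and cw: "c (q + t *\<^sub>R left_dir q) = w1" "c (q - t *\<^sub>R left_dir q) = w0"
  using arc_color_eq[OF c h(2) b(2)] arc_color_eq[OF c h(3) b'(2)] w(3) by auto
 have x: "arc_color c x = c (over_of q)" using arc_color_eq[OF c h(1,7)] over_of_eq[OF h(4)] by simp
 show ?thesis
 proof (cases "cross (fst u) (fst v) > 0")
  case True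
  then have "left_dir q = v" using uv by (simp add: left_dir_def over_of_eq[OF h(4)])
  then show ?thesis using True w(2) cw by (simp add: x yz)
 next
  case False
  then have "left_dir q = - v" using uv by (simp add: left_dir_def over_of_eq[OF h(4)])
  then show ?thesis using False w(2) cw o(3) uv by (simp add: x yz)
 qed
qed

lemma dihedral_coloring_arc_color:
 assumes c: "coloring (dihedral n) c"
 shows "dihedral_coloring n P (arc_color c)" unfolding dihedral_coloring_def
proof (intro conjI allI impI)
 show "arc_color c ` diagram_arcs P \<subseteq> carrier (dihedral n)"
 proof
  fix g assume "g \<in> arc_color c ` diagram_arcs P"
  then have "g \<in> c ` K" using arc_color_image[OF c] by (rule subsetD[rotated])
  then obtain p where "p \<in> K" "g = c p" by (rule imageE)
  then show "g \<in> carrier (dihedral n)" using c by (simp add: coloring_def)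
 qed
 fix x y z
 show "arc_color c x \<otimes>\<^bsub>dihedral n\<^esub> arc_color c z = arc_color c y \<otimes>\<^bsub>dihedral n\<^esub> arc_color c x" if "positive_crossing P x y z"
  using that crossing_arcs_color[OF c] unfolding positive_crossing_def Im_cnj_mult by (metis less_asym)
 show "arc_color c z \<otimes>\<^bsub>dihedral n\<^esub> arc_color c x = arc_color c x \<otimes>\<^bsub>dihedral n\<^esub> arc_color c y" if "negative_crossing P x y z"
  using that crossing_arcs_color[OF c] unfolding negative_crossing_def Im_cnj_mult by (metis less_asym)
qed

section \<open>Breakpoints of a diagram\<close>

text \<open>Vertices are included, so that the pieces between consecutive breakpoints are straight
  and every component has breakpoints even if it takes part in no crossing. Both points of a
  crossing are breakpoints.\<close>

definition brk :: "space set" where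
 "brk = {p \<in> K. (\<exists>vs\<in>P. p \<in> set vs) \<or> (\<exists>q\<in>K. q \<noteq> p \<and> fst q = fst p)}"

definition pt :: "space list => nat => real => space" where
 "pt vs i t = vertex vs i + t *\<^sub>R edge_dir vs i"

definition is_prev :: "space => space => bool" where
 "is_prev a p \<longleftrightarrow> (\<exists>vs i s t. on_edge P vs i s a \<and> on_edge P vs i t p \<and> 0 \<le> s \<and> s < t \<and> t \<le> 1 \<and> a \<in> brk \<and>
   (\<forall>r. s < r \<and> r < t --> pt vs i r \<notin> brk))"

text \<open>A piece of strand is named by the breakpoint at which it starts: \<open>prev p\<close>
  names the piece arriving at \<open>p\<close>. On breakpoints this is the cyclic predecessor, a
  permutation (\<open>prev_image\<close>).\<close>

definition prev :: "space => space" where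
 "prev p = (SOME a. is_prev a p)"

lemma finite_brk: "finite brk"
proof -
 have "finite (\<Union>vs\<in>P. set vs)" using poly by (auto simp: polygonal_link_def)
 moreover have "brk \<subseteq> (\<Union>vs\<in>P. set vs) \<union> {p \<in> K. \<exists>q\<in>K. q \<noteq> p \<and> fst q = fst p}" by (auto simp: brk_def)
 ultimately show ?thesis using finite_double finite_subset by blast
qed

lemma brk_K: "b \<in> brk ==> b \<in> K" by (simp add: brk_def)

lemma over_brk: "over p q ==> p \<in> brk \<and> q \<in> brk"
proof -
 assume o: "over p q"
 then have "p \<in> K" "q \<in> K" "fst p = fst q" "p \<noteq> q" by (auto simp: over_def)
 then show ?thesis unfolding brk_def by (metis (mono_tags, lifting) mem_Collect_eq)
qed

lemma under_brk: "under q ==> q \<in> brk" using over_brk unfolding under_def by blast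

lemma on_edge_pt: "on_edge P vs i t p ==> p = pt vs i t" "on_edge P vs i t p ==> on_edge P vs i r (pt vs i r)" by (auto simp: on_edge_def pt_def)

lemma pt_inj: "on_edge P vs i t p ==> pt vs i r = pt vs i s ==> r = s" using edge_dir_nonzero[OF poly] by (auto simp: on_edge_def pt_def)

lemma vertex_brk: "vs \<in> P ==> i < length vs ==> pt vs i 0 \<in> brk"
proof -
 assume a: "vs \<in> P" "i < length vs"
 then have "on_edge P vs i 0 (pt vs i 0)" by (simp add: on_edge_def pt_def)
 then have "pt vs i 0 \<in> K" by (rule on_edge_mem(3)) auto
 moreover have "pt vs i 0 \<in> set vs" using a by (auto simp: pt_def intro: vertex_in_set)
 ultimately show ?thesis using a by (auto simp: brk_def)
qed

lemma is_prev_exists: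
 assumes "p \<in> K"
 shows "\<exists>a. is_prev a p"
proof -
 obtain vs i t where h: "on_edge P vs i t p" "0 < t" "t \<le> 1" using assms by (rule on_edge_in_exists[OF poly])
 have vi: "vs \<in> P" "i < length vs" using h by (auto simp: on_edge_def)
 define S where "S = {s. 0 \<le> s \<and> s < t \<and> pt vs i s \<in> brk}"
 have "pt vs i ` S \<subseteq> brk" by (auto simp: S_def)
 moreover have "inj_on (pt vs i) S" using pt_inj[OF h(1)] by (auto simp: inj_on_def)
 ultimately have fin: "finite S" using finite_brk inj_on_finite by blast
 have ne: "S \<noteq> {}" using h(2) vertex_brk[OF vi] by (auto simp: S_def)
 define s where "s = Max S"
 have s: "s \<in> S" unfolding s_def by (rule Max_in[OF fin ne])
 have "pt vs i r \<notin> brk" if "s < r \<and> r < t" for r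
 proof
  assume "pt vs i r \<in> brk"
  then have "r \<in> S" using that s by (auto simp: S_def)
  then have "r \<le> s" unfolding s_def by (rule Max_ge[OF fin])
  then show False using that by simp
 qed
 then have "is_prev (pt vs i s) p"
  unfolding is_prev_def using s h on_edge_pt(2)[OF h(1)] by (intro exI[of _ vs] exI[of _ i] exI[of _ s] exI[of _ t]) (auto simp: S_def)
 then show ?thesis by blast
qed

lemma is_prev_unique:
 assumes "is_prev a p" "is_prev b p"
 shows "a = b"
proof -
 obtain vs i s t where 1: "on_edge P vs i s a" "on_edge P vs i t p" "0 \<le> s" "s < t" "t \<le> 1" "a \<in> brk" "\<forall>r. s < r \<and> r < t --> pt vs i r \<notin> brk"
  using assms(1) unfolding is_prev_def by (elim exE conjE) (rule that; assumption)
 obtain ws j s' t' where 2: "on_edge P ws j s' b" "on_edge P ws j t' p" "0 \<le> s'" "s' < t'" "t' \<le> 1" "b \<in> brk" "\<forall>r. s' < r \<and> r < t' --> pt ws j r \<notin> brk"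
  using assms(2) unfolding is_prev_def by (elim exE conjE) (rule that; assumption)
 have e: "vs = ws" "i = j" "t = t'" using on_edge_unique[OF poly 1(2) 2(2)] 1 2 by auto
 have ab: "a = pt vs i s" "b = pt vs i s'" using on_edge_pt(1)[OF 1(1)] on_edge_pt(1)[OF 2(1)] e by auto
 have "\<not> s < s'" using 1(7) 2(4,6) ab e by auto
 moreover have "\<not> s' < s" using 2(7) 1(4,6) ab e by auto
 ultimately show ?thesis using ab by simp
qed

lemma is_prev_inj:
 assumes "is_prev a b" "is_prev a b'" "b \<in> brk" "b' \<in> brk"
 shows "b = b'"
proof -
 obtain vs i s t where 1: "on_edge P vs i s a" "on_edge P vs i t b" "0 \<le> s" "s < t" "t \<le> 1" "a \<in> brk" "\<forall>r. s < r \<and> r < t --> pt vs i r \<notin> brk"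
  using assms(1) unfolding is_prev_def by (elim exE conjE) (rule that; assumption)
 obtain ws j s' t' where 2: "on_edge P ws j s' a" "on_edge P ws j t' b'" "0 \<le> s'" "s' < t'" "t' \<le> 1" "a \<in> brk" "\<forall>r. s' < r \<and> r < t' --> pt ws j r \<notin> brk"
  using assms(2) unfolding is_prev_def by (elim exE conjE) (rule that; assumption)
 have e: "vs = ws" "i = j" "s = s'" using on_edge_unique[OF poly 1(1) 2(1)] 1 2 by auto
 have bb: "b = pt vs i t" "b' = pt vs i t'" using on_edge_pt(1)[OF 1(2)] on_edge_pt(1)[OF 2(2)] e by auto
 have "\<not> t < t'" using 2(7) 1(4) assms(3) bb e by auto
 moreover have "\<not> t' < t" using 1(7) 2(4) assms(4) bb e by auto
 ultimately show ?thesis using bb by simp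
qed

lemma prev_eq: "is_prev a p ==> prev p = a" unfolding prev_def using is_prev_unique by (metis someI)

lemma is_prev_prev: "p \<in> K ==> is_prev (prev p) p" using is_prev_exists prev_eq by metis

lemma prev_brk: "p \<in> K ==> prev p \<in> brk" by (drule is_prev_prev, unfold is_prev_def, elim exE conjE)

lemma prev_inj_on: "inj_on prev brk"
proof (rule inj_onI)
 fix b b' assume b: "b \<in> brk" "b' \<in> brk" "prev b = prev b'"
 then show "b = b'" using is_prev_inj[OF _ _ b(1,2), of "prev b"] is_prev_prev brk_K by metis
qed

lemma prev_image: "prev ` brk = brk" using endo_inj_surj[OF finite_brk _ prev_inj_on] prev_brk brk_K by blast

lemma prev_out:
 assumes p: "p \<in> K"
 shows "\<exists>e>0. \<forall>t. 0 < t \<and> t < e --> p + t *\<^sub>R dout p \<notin> brk \<and>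
  prev (p + t *\<^sub>R dout p) = (if p \<in> brk then p else prev p)"
proof -
 obtain vs i t0 where h: "on_edge P vs i t0 p" "0 \<le> t0" "t0 < 1" using p by (rule on_edge_out_exists[OF poly])
 note o = out_dir_eq[OF poly h]
 have nz: "norm (edge_dir vs i) > 0" using edge_dir_nonzero[OF poly] h by (simp add: on_edge_def)
 obtain d where d: "d > 0" "\<forall>x\<in>brk. x \<noteq> p --> d \<le> dist p x" using finite_set_avoid[OF finite_brk] by blast
 define e where "e = min (1 - t0) (d / norm (edge_dir vs i))"
 have sh: "pt vs i (t0 + t) = p + t *\<^sub>R edge_dir vs i" for t using on_edge_pt(1)[OF h(1)] by (simp add: pt_def scaleR_add_left)
 have nb: "pt vs i (t0 + t) \<notin> brk" if t: "0 < t" "t < e" for t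
 proof
  assume b: "pt vs i (t0 + t) \<in> brk"
  have "t * norm (edge_dir vs i) < d" using t nz by (auto simp: e_def field_simps)
  then have "dist p (pt vs i (t0 + t)) < d" unfolding sh using t by (simp add: dist_norm)
  moreover have "pt vs i (t0 + t) \<noteq> p" unfolding sh using t nz by simp
  ultimately show False using d(2) b by (metis not_le)
 qed
 show ?thesis
 proof (intro exI[of _ e] conjI allI impI)
  show "e > 0" using h(3) d(1) nz by (simp add: e_def)
  fix t assume t: "0 < t \<and> t < e"
  show "p + t *\<^sub>R dout p \<notin> brk" unfolding o sh[symmetric] using nb t by blast
  have oe: "on_edge P vs i (t0 + t) (p + t *\<^sub>R edge_dir vs i)" using on_edge_pt(2)[OF h(1), of "t0 + t"] sh by simp
  have le: "t0 + t \<le> 1" using t by (simp add: e_def)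
  have nb': "pt vs i r \<notin> brk" if "t0 < r \<and> r < t0 + t" for r using nb[of "r - t0"] that t by simp
  show "prev (p + t *\<^sub>R dout p) = (if p \<in> brk then p else prev p)"
  proof (cases "p \<in> brk")
   case True
   have "is_prev p (p + t *\<^sub>R edge_dir vs i)" unfolding is_prev_def using h oe le t True nb'
    by (intro exI[of _ vs] exI[of _ i] exI[of _ t0] exI[of _ "t0 + t"]) simp
   then show ?thesis using True o prev_eq by simp
  next
   case False
   have "vs \<in> P" "i < length vs" using h(1) by (simp_all add: on_edge_def)
   then have "t0 \<noteq> 0" using False vertex_brk[of vs i] on_edge_pt(1)[OF h(1)] by metis
   then have t00: "0 < t0" using h by simp
   obtain ws j s r where q: "on_edge P ws j s (prev p)" "on_edge P ws j r p" "0 \<le> s" "s < r" "r \<le> 1" "prev p \<in> brk" "\<forall>u. s < u \<and> u < r --> pt ws j u \<notin> brk"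
    using is_prev_prev[OF p] unfolding is_prev_def by (elim exE conjE) (rule that; assumption)
   have e: "ws = vs" "j = i" "r = t0" using on_edge_unique[OF poly q(2) h(1)] q h t00 by auto
   have "pt vs i u \<notin> brk" if "s < u \<and> u < t0 + t" for u
    using that q(7) nb'[of u] False on_edge_pt(1)[OF h(1)] unfolding e by (metis linorder_less_linear)
   then have "is_prev (prev p) (p + t *\<^sub>R edge_dir vs i)" unfolding is_prev_def using q oe le t unfolding e
    by (intro exI[of _ vs] exI[of _ i] exI[of _ s] exI[of _ "t0 + t"]) simp
   then show ?thesis using False o prev_eq by simp
  qed
 qed
qed

lemma prev_in:
 assumes p: "p \<in> K"
 shows "\<exists>e>0. \<forall>t. 0 < t \<and> t < e --> p - t *\<^sub>R din p \<notin> brk \<and> prev (p - t *\<^sub>R din p) = prev p"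
proof -
 obtain vs i s r where q: "on_edge P vs i s (prev p)" "on_edge P vs i r p" "0 \<le> s" "s < r" "r \<le> 1" "prev p \<in> brk" "\<forall>u. s < u \<and> u < r --> pt vs i u \<notin> brk"
  using is_prev_prev[OF p] unfolding is_prev_def by (elim exE conjE) (rule that; assumption)
 have o: "din p = edge_dir vs i" using q by (intro in_dir_eq[OF poly q(2)]) auto
 have sh: "pt vs i (r - t) = p - t *\<^sub>R edge_dir vs i" for t using on_edge_pt(1)[OF q(2)] by (simp add: pt_def scaleR_diff_left)
 show ?thesis unfolding o
 proof (intro exI[of _ "r - s"] conjI allI impI)
  show "r - s > 0" using q by simp
  fix t assume t: "0 < t \<and> t < r - s"
  show "p - t *\<^sub>R edge_dir vs i \<notin> brk" unfolding sh[symmetric] using q(7) t by simp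
  have "on_edge P vs i (r - t) (p - t *\<^sub>R edge_dir vs i)" using on_edge_pt(2)[OF q(2), of "r - t"] sh by simp
  then have "is_prev (prev p) (p - t *\<^sub>R edge_dir vs i)" unfolding is_prev_def using q t
   by (intro exI[of _ vs] exI[of _ i] exI[of _ s] exI[of _ "r - t"]) simp
  then show "prev (p - t *\<^sub>R edge_dir vs i) = prev p" by (rule prev_eq)
 qed
qed

lemma prev_near:
 assumes p: "p \<in> K"
 obtains e where "e > 0" "\<And>t. 0 < t ==> t < e ==> p + t *\<^sub>R dout p \<in> K - brk \<and> p - t *\<^sub>R din p \<in> K - brk \<and>
  prev (p + t *\<^sub>R dout p) = (if p \<in> brk then p else prev p) \<and> prev (p - t *\<^sub>R din p) = prev p"
proof -
 obtain e1 where e1: "e1 > 0" "\<forall>t. 0 < t \<and> t < e1 --> p + t *\<^sub>R dout p \<notin> brk \<and>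
  prev (p + t *\<^sub>R dout p) = (if p \<in> brk then p else prev p)" using prev_out[OF p] by (elim exE conjE) (rule that)
 obtain e2 where e2: "e2 > 0" "\<forall>t. 0 < t \<and> t < e2 --> p - t *\<^sub>R din p \<notin> brk \<and> prev (p - t *\<^sub>R din p) = prev p"
  using prev_in[OF p] by (elim exE conjE) (rule that)
 obtain e3 where e3: "e3 > 0" "\<forall>t. 0 < t \<and> t < e3 --> p + t *\<^sub>R dout p \<in> K" using germ_out[OF p] by blast
 obtain e4 where e4: "e4 > 0" "\<forall>t. 0 < t \<and> t < e4 --> p - t *\<^sub>R din p \<in> K" using germ_in[OF p] by blast
 show ?thesis by (rule that[of "min (min e1 e2) (min e3 e4)"]) (use e1 e2 e3 e4 in simp_all)
qed

definition piecewise :: "(space => 'g) => bool" where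
 "piecewise f \<longleftrightarrow> (\<forall>p\<in>K - brk. \<exists>e>0. \<forall>q\<in>K. dist q p < e --> f q = f p)"

definition piece_val :: "(space => 'g) => space => 'g" where
 "piece_val f a = f (SOME p. p \<in> K - brk \<and> prev p = a)"

lemma piecewise_const:
 assumes f: "piecewise f" and p: "p \<in> K - brk" "p' \<in> K - brk" "prev p = prev p'"
 shows "f p = f p'"
proof -
 obtain vs i s t where 1: "on_edge P vs i s (prev p)" "on_edge P vs i t p" "0 \<le> s" "s < t" "t \<le> 1" "prev p \<in> brk" "\<forall>r. s < r \<and> r < t --> pt vs i r \<notin> brk"
  using is_prev_prev[OF DiffD1[OF p(1)]] unfolding is_prev_def by (elim exE conjE) (rule that; assumption)
 have "is_prev (prev p) p'" using is_prev_prev[OF DiffD1[OF p(2)]] p(3) by simp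
 then obtain ws j s' t' where 2: "on_edge P ws j s' (prev p)" "on_edge P ws j t' p'" "0 \<le> s'" "s' < t'" "t' \<le> 1" "\<forall>r. s' < r \<and> r < t' --> pt ws j r \<notin> brk"
  unfolding is_prev_def by (elim exE conjE) (rule that; assumption)
 have e: "ws = vs" "j = i" "s' = s" using on_edge_unique[OF poly 2(1) 1(1)] 1 2 by auto
 have pp: "p = pt vs i t" "p' = pt vs i t'" using on_edge_pt(1)[OF 1(2)] on_edge_pt(1)[OF 2(2)] e by auto
 define S where "S = pt vs i ` {s<..max t t'}"
 have SK: "S \<subseteq> K - brk"
 proof
  fix x assume "x \<in> S"
  then obtain r where r: "x = pt vs i r" "s < r" "r \<le> max t t'" by (auto simp: S_def)
  have "on_edge P vs i r x" using on_edge_pt(2)[OF 1(1)] r by simp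
  then have "x \<in> K" by (rule on_edge_mem(3)) (use r 1 2 in auto)
  moreover have "x \<notin> brk"
  proof -
   consider "r < t" | "r < t'" | "r = t" | "r = t'" using r(3) by linarith
   then show ?thesis by cases (use 1(7) 2(6) r p pp in \<open>simp_all add: e\<close>)
  qed
  ultimately show "x \<in> K - brk" by simp
 qed
 have "f constant_on S"
 proof (rule locally_constant_on_connected)
  show "connected S" unfolding S_def pt_def by (intro connected_continuous_image continuous_intros) simp
  fix a assume "a \<in> S"
  then obtain e where "e > 0" "\<forall>q\<in>K. dist q a < e --> f q = f a" using f SK unfolding piecewise_def by blast
  then show "\<exists>e>0. \<forall>x\<in>S. dist x a < e --> f x = f a" using SK by (intro exI[of _ e]) blast
 qed
 moreover have "p \<in> S" "p' \<in> S" unfolding S_def pp using 1 2 by (auto simp: e)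
 ultimately show ?thesis unfolding constant_on_def by metis
qed

lemma piece_val_eq:
 assumes "piecewise f" "p \<in> K - brk"
 shows "piece_val f (prev p) = f p"
proof -
 have "(SOME q. q \<in> K - brk \<and> prev q = prev p) \<in> K - brk \<and> prev (SOME q. q \<in> K - brk \<and> prev q = prev p) = prev p"
  by (rule someI[of "\<lambda>q. q \<in> K - brk \<and> prev q = prev p" p]) (use assms in simp)
 then show ?thesis unfolding piece_val_def by (intro piecewise_const[OF assms(1)]) (use assms in auto)
qed

text \<open>Values just before and just after a breakpoint.\<close>

lemma piece_val_near:
 assumes f: "piecewise f" and p: "p \<in> brk"
 shows "\<exists>e>0. \<forall>t. 0 < t \<and> t < e --> p + t *\<^sub>R dout p \<in> K - brk \<and> p - t *\<^sub>R din p \<in> K - brk \<and>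
  f (p + t *\<^sub>R dout p) = piece_val f p \<and> f (p - t *\<^sub>R din p) = piece_val f (prev p)"
proof -
 obtain e where e: "e > 0" "\<And>t. 0 < t ==> t < e ==> p + t *\<^sub>R dout p \<in> K - brk \<and> p - t *\<^sub>R din p \<in> K - brk \<and>
  prev (p + t *\<^sub>R dout p) = (if p \<in> brk then p else prev p) \<and> prev (p - t *\<^sub>R din p) = prev p"
  by (rule prev_near[OF brk_K[OF p]]) (rule that; assumption)
 show ?thesis
 proof (intro exI[of _ e] conjI[OF e(1)] allI impI)
  fix t assume t: "0 < t \<and> t < e"
  note h = e(2)[OF conjunct1[OF t] conjunct2[OF t]]
  show "p + t *\<^sub>R dout p \<in> K - brk \<and> p - t *\<^sub>R din p \<in> K - brk \<and>
   f (p + t *\<^sub>R dout p) = piece_val f p \<and> f (p - t *\<^sub>R din p) = piece_val f (prev p)"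
   using h p piece_val_eq[OF f conjunct1[OF h]] piece_val_eq[OF f conjunct1[OF conjunct2[OF h]]] by simp
 qed
qed

lemma piece_point:
 assumes "b \<in> brk"
 obtains p where "p \<in> K - brk" "prev p = b"
proof -
 obtain e where e: "e > 0" "\<And>t. 0 < t ==> t < e ==> b + t *\<^sub>R dout b \<in> K - brk \<and> b - t *\<^sub>R din b \<in> K - brk \<and>
  prev (b + t *\<^sub>R dout b) = (if b \<in> brk then b else prev b) \<and> prev (b - t *\<^sub>R din b) = prev b"
  by (rule prev_near[OF brk_K[OF assms]]) (rule that; assumption)
 show ?thesis using e(2)[of "e / 2"] e(1) assms by (intro that[of "b + (e / 2) *\<^sub>R dout b"]) simp_all
qed

lemma coloring_piecewise: "coloring G c ==> piecewise c" unfolding piecewise_def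
proof (intro ballI)
 fix p assume c: "coloring G c" and "p \<in> K - brk"
 then have "p \<in> K" "\<not> under p" using under_brk by blast+
 then show "\<exists>e>0. \<forall>q\<in>K. dist q p < e --> c q = c p" using c by (simp add: coloring_def)
qed

definition positive :: "space => bool" where
 "positive q \<longleftrightarrow> cross (fst (dout (over_of q))) (fst (dout q)) > 0"

text \<open>The finite, combinatorial form of a coloring: \<open>k b\<close> is the color of the
  piece that starts at \<open>b\<close>, and \<open>k (prev b)\<close> that of the piece ending
  there.\<close>

definition piece_coloring :: "('g, 'h) monoid_scheme => (space => 'g) => bool" where
 "piece_coloring G k \<longleftrightarrow> (\<forall>b\<in>brk. k b \<in> carrier G) \<and> (\<forall>b\<in>brk. \<not> under b --> k b = k (prev b)) \<and>
   (\<forall>q. under q --> (if positive q then k (over_of q) \<otimes>\<^bsub>G\<^esub> k q = k (prev q) \<otimes>\<^bsub>G\<^esub> k (over_of q)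
    else k q \<otimes>\<^bsub>G\<^esub> k (over_of q) = k (over_of q) \<otimes>\<^bsub>G\<^esub> k (prev q)))"

lemma left_dir_positive: "left_dir q = (if positive q then dout q else - dout q)" by (simp add: left_dir_def positive_def)

lemma piece_coloring_of_coloring:
 fixes G (structure)
 assumes c: "coloring G c"
 shows "piece_coloring G (piece_val c)" "\<And>b. b \<in> brk ==> \<not> under b ==> c b = piece_val c b"
proof -
 note pw = coloring_piecewise[OF c]
 have near: "c b = piece_val c b \<and> c b = piece_val c (prev b)" if b: "b \<in> brk" "\<not> under b" for b
 proof -
  have bK: "b \<in> K" by (rule brk_K[OF b(1)])
  obtain e where e: "e > 0" "\<forall>q\<in>K. dist q b < e --> c q = c b" using c bK b(2) unfolding coloring_def by meson
  obtain e' where e': "e' > 0" "\<forall>t. 0 < t \<and> t < e' --> b + t *\<^sub>R dout b \<in> K - brk \<and> b - t *\<^sub>R din b \<in> K - brk \<and>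
   c (b + t *\<^sub>R dout b) = piece_val c b \<and> c (b - t *\<^sub>R din b) = piece_val c (prev b)"
   using piece_val_near[OF pw b(1)] by (elim exE conjE) (rule that)
  have n: "norm (dout b) > 0" "norm (din b) > 0" using dirs_nonzero[OF bK] by auto
  define t where "t = min e' (min (e / norm (dout b)) (e / norm (din b))) / 2"
  have t: "0 < t" using e(1) e'(1) n by (simp add: t_def)
  have "2 * t \<le> e'" "2 * t \<le> e / norm (dout b)" "2 * t \<le> e / norm (din b)" by (auto simp: t_def)
  then have "t < e'" "t < e / norm (dout b)" "t < e / norm (din b)" using t by linarith+
  then have "dist (b + t *\<^sub>R dout b) b < e" "dist (b - t *\<^sub>R din b) b < e" and te: "0 < t \<and> t < e'"
   using n t by (auto simp: dist_norm field_simps)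
  then show ?thesis using e(2) e'(2)[rule_format, OF te] by (metis DiffD1)
 qed
 show "c b = piece_val c b" if "b \<in> brk" "\<not> under b" for b by (rule conjunct1[OF near[OF that]])
 show "piece_coloring G (piece_val c)" unfolding piece_coloring_def
 proof (intro conjI ballI impI allI)
  fix b assume b: "b \<in> brk"
  obtain p where "p \<in> K - brk" "prev p = b" using piece_point[OF b] by blast
  then show "piece_val c b \<in> carrier G" using piece_val_eq[OF pw, of p] c by (simp add: coloring_def)
  show "piece_val c b = piece_val c (prev b)" if "\<not> under b" using near[OF b that] by (elim conjE) (rule trans[OF sym])
 next
  fix q assume q: "under q"
  then obtain p where o: "over p q" unfolding under_def by blast
  note od = over_dirs[OF o]
  have qb: "q \<in> brk" by (rule under_brk[OF q])
  obtain e w0 w1 where w: "e > 0" "c (over_of q) \<otimes> w1 = w0 \<otimes> c (over_of q)"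
   "\<forall>t. 0 < t \<and> t < e --> c (q + t *\<^sub>R left_dir q) = w1 \<and> c (q - t *\<^sub>R left_dir q) = w0"
   using c q unfolding coloring_def by meson
  obtain e' where e': "e' > 0" "\<forall>t. 0 < t \<and> t < e' --> q + t *\<^sub>R dout q \<in> K - brk \<and> q - t *\<^sub>R din q \<in> K - brk \<and>
   c (q + t *\<^sub>R dout q) = piece_val c q \<and> c (q - t *\<^sub>R din q) = piece_val c (prev q)"
   using piece_val_near[OF pw qb] by (elim exE conjE) (rule that)
  define t where "t = min e e' / 2"
  have t: "0 < t \<and> t < e" "0 < t \<and> t < e'" using w(1) e'(1) by (auto simp: t_def min_def)
  have co: "c (over_of q) = piece_val c (over_of q)" using near[of p] over_brk[OF o] over_not_under[OF o] over_of_eq[OF o] by simp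
  have r: "c (q + t *\<^sub>R dout q) = piece_val c q" "c (q - t *\<^sub>R dout q) = piece_val c (prev q)"
   using e'(2)[rule_format, OF t(2)] od(2) by simp_all
  show "if positive q then piece_val c (over_of q) \<otimes> piece_val c q = piece_val c (prev q) \<otimes> piece_val c (over_of q)
    else piece_val c q \<otimes> piece_val c (over_of q) = piece_val c (over_of q) \<otimes> piece_val c (prev q)"
   using w(2) w(3)[rule_format, OF t(1)] r unfolding left_dir_positive co by (auto split: if_splits)
 qed
qed

definition color_of :: "(space => 'g) => space => 'g" where
 "color_of k p = k (if p \<in> brk then p else prev p)"

lemma color_of_local:
 assumes p: "p \<in> K"
 shows "\<exists>e>0. \<forall>q\<in>K. q \<noteq> p --> dist q p < e --> color_of k q = color_of k p \<or> color_of k q = k (prev p)"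
proof -
 obtain e1 where e1: "e1 > 0" "\<forall>t. 0 < t \<and> t < e1 --> p + t *\<^sub>R dout p \<notin> brk \<and>
  prev (p + t *\<^sub>R dout p) = (if p \<in> brk then p else prev p)" using prev_out[OF p] by blast
 obtain e2 where e2: "e2 > 0" "\<forall>t. 0 < t \<and> t < e2 --> p - t *\<^sub>R din p \<notin> brk \<and> prev (p - t *\<^sub>R din p) = prev p"
  using prev_in[OF p] by blast
 obtain e3 where e3: "e3 > 0" "\<forall>q\<in>K. dist q p < e3 --> (\<exists>t\<ge>0. q = p + t *\<^sub>R dout p \<or> q = p - t *\<^sub>R din p)"
  using germ_nbhd[OF p] by blast
 have n: "norm (dout p) > 0" "norm (din p) > 0" using dirs_nonzero[OF p] by auto
 show ?thesis
 proof (intro exI[of _ "min e3 (min (e1 * norm (dout p)) (e2 * norm (din p)))"] conjI ballI impI)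
  show "0 < min e3 (min (e1 * norm (dout p)) (e2 * norm (din p)))" using e1(1) e2(1) e3(1) n by simp
  fix q assume q: "q \<in> K" "q \<noteq> p" "dist q p < min e3 (min (e1 * norm (dout p)) (e2 * norm (din p)))"
  then obtain t where t: "t \<ge> 0" "q = p + t *\<^sub>R dout p \<or> q = p - t *\<^sub>R din p" using e3(2) by (metis min_less_iff_conj)
  then have t0: "t > 0" using q(2) by (cases "t = 0") auto
  from t(2) show "color_of k q = color_of k p \<or> color_of k q = k (prev p)"
  proof
   assume qe: "q = p + t *\<^sub>R dout p"
   then have "t * norm (dout p) < e1 * norm (dout p)" using q(3) t0 by (simp add: dist_norm)
   then have "0 < t \<and> t < e1" using n t0 by simp
   then show ?thesis using e1(2) qe by (simp add: color_of_def)
  next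
   assume qe: "q = p - t *\<^sub>R din p"
   then have "t * norm (din p) < e2 * norm (din p)" using q(3) t0 by (simp add: dist_norm)
   then have "0 < t \<and> t < e2" using n t0 by simp
   then show ?thesis using e2(2) qe by (simp add: color_of_def)
  qed
 qed
qed

lemma color_of_near:
 assumes q: "q \<in> brk"
 obtains e where "e > 0" "\<And>t. 0 < t ==> t < e ==> color_of k (q + t *\<^sub>R dout q) = k q \<and> color_of k (q - t *\<^sub>R din q) = k (prev q)"
proof -
 obtain e where e: "e > 0" "\<And>t. 0 < t ==> t < e ==> q + t *\<^sub>R dout q \<in> K - brk \<and> q - t *\<^sub>R din q \<in> K - brk \<and>
  prev (q + t *\<^sub>R dout q) = (if q \<in> brk then q else prev q) \<and> prev (q - t *\<^sub>R din q) = prev q"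
  by (rule prev_near[OF brk_K[OF q]]) (rule that; assumption)
 then show ?thesis using q by (intro that[of e]) (simp_all add: color_of_def)
qed

lemma coloring_color_of:
 fixes G (structure)
 assumes k: "piece_coloring G k"
 shows "coloring G (color_of k)"
proof -
 have kc: "k b \<in> carrier G" if "b \<in> brk" for b using k that by (simp add: piece_coloring_def)
 have kp: "k b = k (prev b)" if "b \<in> brk" "\<not> under b" for b using k that unfolding piece_coloring_def by blast
 show ?thesis unfolding coloring_def
 proof (intro conjI ballI allI impI)
  show "color_of k p \<in> carrier G" if "p \<in> K" for p using kc prev_brk[OF that] by (simp add: color_of_def)
 next
  fix p assume p: "p \<in> K" "\<not> under p"
  have kpp: "k (prev p) = color_of k p" using kp[of p] p by (simp add: color_of_def)
  obtain e where e: "e > 0" "\<forall>q\<in>K. q \<noteq> p --> dist q p < e --> color_of k q = color_of k p \<or> color_of k q = k (prev p)"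
   using color_of_local[OF p(1), of k] by (elim exE conjE) (rule that)
  show "\<exists>e>0. \<forall>q\<in>K. dist q p < e --> color_of k q = color_of k p"
  proof (intro exI[of _ e] conjI ballI impI e(1))
   fix q assume "q \<in> K" "dist q p < e"
   then show "color_of k q = color_of k p" using e(2) kpp by (cases "q = p") auto
  qed
 next
  fix q assume q: "under q"
  then obtain p where o: "over p q" unfolding under_def by blast
  note od = over_dirs[OF o]
  have qb: "q \<in> brk" "p \<in> brk" using over_brk[OF o] by auto
  have cq: "color_of k q = k q" "color_of k (over_of q) = k (over_of q)" using qb over_of_eq[OF o] by (simp_all add: color_of_def)
  obtain e where e: "e > 0" "\<And>t. 0 < t ==> t < e ==> color_of k (q + t *\<^sub>R dout q) = k q \<and> color_of k (q - t *\<^sub>R din q) = k (prev q)"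
   by (rule color_of_near[OF qb(1)]) (rule that; assumption)
  have rel: "if positive q then k (over_of q) \<otimes> k q = k (prev q) \<otimes> k (over_of q)
    else k q \<otimes> k (over_of q) = k (over_of q) \<otimes> k (prev q)" using k q unfolding piece_coloring_def by blast
  have car: "k q \<in> carrier G" "k (prev q) \<in> carrier G" using kc qb prev_brk od(7) by auto
  show "\<exists>e>0. \<exists>w0\<in>carrier G. \<exists>w1\<in>carrier G. color_of k (over_of q) \<otimes> w1 = w0 \<otimes> color_of k (over_of q) \<and> (color_of k q = w0 \<or> color_of k q = w1) \<and>
    (\<forall>t. 0 < t \<and> t < e --> color_of k (q + t *\<^sub>R left_dir q) = w1 \<and> color_of k (q - t *\<^sub>R left_dir q) = w0)"
   by (rule crossing_colorsI[where c = "color_of k", OF o e(1) car(2,1) cq(1)])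
    (use rel cq(2) over_of_eq[OF o] e(2) od(2) in \<open>auto simp: positive_def split: if_splits\<close>)
 qed
qed

section \<open>Lifting two-tone colorings\<close>

text \<open>The signs \<open>\<tau>\<close> come from the monodromy of the double cover determined by \<open>\<epsilon>\<close>, evaluated
 on a horizontal plane below the link: \<open>\<tau> b\<close> is the value just to the right of the strand
 following \<open>b\<close>.\<close>

lemma parity:
 assumes eps: "\<And>b. b \<in> brk ==> \<epsilon> b = 1 \<or> \<epsilon> b = (- 1 :: int)" "\<And>b. b \<in> brk ==> \<epsilon> (prev b) = \<epsilon> b"
 obtains \<tau> :: "space => int" where "\<And>b. b \<in> brk ==> \<tau> b = 1 \<or> \<tau> b = - 1"
  "\<And>b. [|b \<in> brk; \<not> under b; \<forall>q. \<not> over b q|] ==> \<tau> (prev b) = \<tau> b"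
  "\<And>p q. [|over p q; positive q|] ==> \<tau> (prev q) = \<tau> p \<and> \<tau> (prev p) = \<tau> p * \<epsilon> q \<and> \<tau> q = \<tau> p * \<epsilon> p"
  "\<And>p q. [|over p q; \<not> positive q|] ==> \<tau> (prev p) = \<tau> q \<and> \<tau> p = \<tau> q * \<epsilon> q \<and> \<tau> (prev q) = \<tau> q * \<epsilon> p"
proof -
 let ?G = sign_group
 have car: "x \<in> carrier ?G \<longleftrightarrow> x = 1 \<or> x = - 1" for x by (auto simp: sign_group_def)
 have mul: "x \<otimes>\<^bsub>?G\<^esub> y = x * y" "\<one>\<^bsub>?G\<^esub> = 1" for x y by (simp_all add: sign_group_def)
 have ub: "q \<in> brk" if "under q" for q by (rule under_brk[OF that])
 \<comment> \<open>In a commutative group the crossing relation says only that colors do not change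
   along a strand, which is the hypothesis on \<open>\<epsilon>\<close>.\<close>
 have "piece_coloring ?G \<epsilon>" unfolding piece_coloring_def using eps ub over_brk over_of_eq by (auto simp: car mul under_def mult.commute)
 then have col: "coloring ?G (color_of \<epsilon>)" by (rule coloring_color_of)
 obtain \<Phi> w R where gr: "groupoid_rep ?G (- K) \<Phi>"
  and pic: "\<And>x. x \<notin> K ==> picture x (R x)"
  and loc: "\<And>x g. [|x \<notin> K; path g; path_image g \<subseteq> ball x (R x)|] ==>
    \<Phi> g = inv\<^bsub>?G\<^esub> (lab ?G (color_of \<epsilon>) w x (pathstart g)) \<otimes>\<^bsub>?G\<^esub> lab ?G (color_of \<epsilon>) w x (pathfinish g)"
  and w: "\<And>q. under q ==> w q \<in> carrier ?G \<and> (\<exists>e>0. \<forall>t. 0 < t \<and> t < e --> color_of \<epsilon> (q - t *\<^sub>R left_dir q) = w q)"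
  by (rule coloring_label[OF group_sign_group col]) (rule that; assumption)
 interpret g: groupoid_rep ?G "- K" \<Phi> by (rule gr)
 obtain H where H: "\<And>p. p \<in> K ==> \<bar>snd p\<bar> < H" using height_bound by blast
 have Hb: "- H < snd p" if "p \<in> K" for p using H[OF that] by linarith
 define C where "C = {x :: space. snd x = - H}"
 have C: "convex C" "C \<subseteq> - K" "\<And>z. (z, - H) \<in> C"
 proof -
  show "convex C" unfolding C_def by (auto simp: convex_def algebra_simps) (metis distrib_right mult_1)
  show "C \<subseteq> - K" unfolding C_def using Hb by fastforce
 qed (simp add: C_def)
 \<comment> \<open>The checkerboard function: it changes sign whenever one passes beneath a strand
   with \<open>\<epsilon> = -1\<close>. It is independent of the path within the plane
   \<open>C\<close>, which is convex and misses the link.\<close>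
 define t where "t z = \<Phi> (linepath (0, - H) (z, - H))" for z
 have tc: "t z \<in> carrier ?G" for z unfolding t_def by (rule g.linepath_closed[OF C(1,2) C(3) C(3)])
 have tc': "t z = 1 \<or> t z = - 1" for z using tc car by blast
 define l where "l z y = lab ?G (color_of \<epsilon>) w (z, - H) (y, - H)" for z y
 have above: "above (z, - H) = {p \<in> K. fst p = z}" for z using Hb by (auto simp: above_def)
 have wq: "w q = \<epsilon> q" if q: "under q" for q
 proof -
  obtain e where e: "e > 0" "\<forall>t. 0 < t \<and> t < e --> color_of \<epsilon> (q - t *\<^sub>R left_dir q) = w q" using w[OF q] by blast
  obtain e1 where e1: "e1 > 0" "\<And>t. 0 < t ==> t < e1 ==> color_of \<epsilon> (q + t *\<^sub>R dout q) = \<epsilon> q \<and> color_of \<epsilon> (q - t *\<^sub>R din q) = \<epsilon> (prev q)"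
   by (rule color_of_near[OF ub[OF q]]) (rule that; assumption)
  obtain p where o: "over p q" using q unfolding under_def by (elim exE)
  define s where "s = min e e1 / 2"
  have s: "0 < s \<and> s < e" "0 < s" "s < e1" using e(1) e1(1) by (auto simp: s_def min_def)
  have "color_of \<epsilon> (q + s *\<^sub>R dout q) = \<epsilon> q" "color_of \<epsilon> (q - s *\<^sub>R dout q) = \<epsilon> q"
   using e1(2)[OF s(2,3)] over_dirs(2)[OF o] eps(2)[OF ub[OF q]] by simp_all
  then show ?thesis using e(2)[rule_format, OF s(1)] by (auto simp: left_dir_def split: if_splits)
 qed
 have cb: "color_of \<epsilon> b = \<epsilon> b" if "b \<in> brk" for b using that by (simp add: color_of_def)
 have lx: "l z z = 1" for z
 proof -
  have "(z, - H) \<notin> K" using C by blast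
  then show ?thesis
  proof (cases rule: above_cases)
   case none then show ?thesis unfolding l_def by (simp add: lab_none mul)
  next
   case (one p)
   then have "fst p = z" using above by blast
   then show ?thesis unfolding l_def lab_one[OF one] using bend_ray(1)[of 0] by (simp add: mul)
  next
   case (two p q)
   then have "fst p = z" "fst q = z" using above by blast+
   then show ?thesis unfolding l_def lab_two[OF two] using bend_ray(1)[of 0] by (simp add: mul)
  qed
 qed
 have near: "\<exists>e>0. \<forall>y. dist y z < e --> t y = t z * l z y" for z
 proof -
  have zK: "(z, - H) \<notin> K" using C by blast
  note pz = pic[OF zK]
  show ?thesis
  proof (intro exI[of _ "R (z, - H)"] conjI allI impI)
   show "0 < R (z, - H)" using pz by (simp add: picture_def)
   fix y assume y: "dist y z < R (z, - H)"
   have "t y = t z \<otimes>\<^bsub>?G\<^esub> \<Phi> (linepath (z, - H) (y, - H))"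
    unfolding t_def by (rule g.convex_join[OF C(1,2) C(3) C(3) C(3), symmetric])
   moreover have yb: "(y, - H) \<in> ball (z, - H) (R (z, - H))" using y by (simp add: dist_Pair_Pair dist_commute)
   have "\<Phi> (linepath (z, - H) (y, - H)) = inv\<^bsub>?G\<^esub> (l z z) \<otimes>\<^bsub>?G\<^esub> l z y"
    unfolding l_def using loc[OF zK, of "linepath (z, - H) (y, - H)"] yb picture_def pz by (simp add: closed_segment_subset convex_ball)
   ultimately show "t y = t z * l z y" unfolding lx by (simp add: mul inv_sign_group car)
  qed
 qed
 have dist_small: "\<exists>e'>0. \<forall>s. 0 < s \<and> s < e' --> dist (z + s *\<^sub>R d) z < e \<and> dist (z - s *\<^sub>R d) z < e"
  if "e > 0" for e and z d :: complex
 proof (intro exI[of _ "e / (norm d + 1)"] conjI allI impI)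
  show "0 < e / (norm d + 1)" using that by (simp add: add_nonneg_pos)
  fix s assume s: "0 < s \<and> s < e / (norm d + 1)"
  then have "s * (norm d + 1) < e" by (simp add: pos_less_divide_eq add_nonneg_pos)
  then have "s * norm d < e" using s by (simp add: distrib_left)
  then show "dist (z + s *\<^sub>R d) z < e" "dist (z - s *\<^sub>R d) z < e" using s by (simp_all add: dist_norm)
 qed
 have l_one: "l (fst p) y = (if bl p (y, - H) then \<epsilon> p else 1)" if "p \<in> brk" "above (fst p, - H) = {p}" "\<not> under p" for p y
  unfolding l_def lab_one[OF that(2,3)] using cb[OF that(1)] by (simp add: mul)
 \<comment> \<open>Directly beneath a strand \<open>t\<close> has the value belonging to its right
   side, because labels count a strand only for points strictly to its left.\<close>
 define f where "f p = t (fst p)" for p :: space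
 have single: "above (fst p, - H) = {p} \<and> \<not> under p" if "p \<in> K" "\<not> under p" "\<forall>q. \<not> over p q" for p
 proof -
  have "q = p" if q: "q \<in> K" "fst q = fst p" for q
  proof (rule ccontr)
   assume "q \<noteq> p"
   then have "snd q < snd p \<or> snd p < snd q" using q(2) by (metis linorder_less_linear prod.expand)
   then have "over p q \<or> over q p" unfolding over_def using q \<open>p \<in> K\<close> by auto
   then show False using \<open>\<not> under p\<close> \<open>\<forall>q. \<not> over p q\<close> unfolding under_def by blast
  qed
  then show ?thesis unfolding above using that by blast
 qed
 have pw: "piecewise f" unfolding piecewise_def
 proof
  fix p assume p: "p \<in> K - brk"
  then have nu: "p \<in> K" "\<not> under p" "\<forall>q. \<not> over p q" using ub over_brk by blast+
  note s = conjunct1[OF single[OF nu]] conjunct2[OF single[OF nu]]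
  obtain e where e: "e > 0" "\<forall>y. dist y (fst p) < e --> t y = t (fst p) * l (fst p) y" using near by blast
  obtain e' where e': "e' > 0" "\<forall>q\<in>K. dist q p < e' --> (\<exists>t\<ge>0. q = p + t *\<^sub>R dout p \<or> q = p - t *\<^sub>R din p)"
   using germ_nbhd[OF nu(1)] by blast
  show "\<exists>e>0. \<forall>q\<in>K. dist q p < e --> f q = f p"
  proof (intro exI[of _ "min e e'"] conjI ballI impI)
   fix q assume q: "q \<in> K" "dist q p < min e e'"
   then obtain r where r: "r \<ge> 0" "q = p + r *\<^sub>R dout p \<or> q = p - r *\<^sub>R din p" using e'(2) by (meson min_less_iff_conj)
   then have "\<not> bl p (fst q, - H)" using bend_ray(1,3)[OF r(1)] by auto
   then have "l (fst p) (fst q) = 1" unfolding l_def lab_one[OF s] by (simp add: mul)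
   moreover have "dist (fst q) (fst p) < e" using q dist_fst_le[of q p] by linarith
   ultimately show "f q = f p" unfolding f_def using e(2) by simp
  qed (use e e' in simp)
 qed
 define \<tau> where "\<tau> = piece_val f"
 have key: "\<exists>s>0. \<tau> b = t (fst b) * l (fst b) (fst b + s *\<^sub>R fst (dout b)) \<and>
   \<tau> (prev b) = t (fst b) * l (fst b) (fst b - s *\<^sub>R fst (din b))" if b: "b \<in> brk" for b
 proof -
  obtain e where e: "e > 0" "\<forall>y. dist y (fst b) < e --> t y = t (fst b) * l (fst b) y" using near by blast
  obtain e1 where e1: "e1 > 0" "\<forall>s. 0 < s \<and> s < e1 --> dist (fst b + s *\<^sub>R fst (dout b)) (fst b) < e \<and> dist (fst b - s *\<^sub>R fst (dout b)) (fst b) < e"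
   using dist_small[OF e(1), of "fst b" "fst (dout b)"] by (elim exE conjE) (rule that)
  obtain e2 where e2: "e2 > 0" "\<forall>s. 0 < s \<and> s < e2 --> dist (fst b + s *\<^sub>R fst (din b)) (fst b) < e \<and> dist (fst b - s *\<^sub>R fst (din b)) (fst b) < e"
   using dist_small[OF e(1), of "fst b" "fst (din b)"] by (elim exE conjE) (rule that)
  obtain e3 where e3: "e3 > 0" "\<forall>s. 0 < s \<and> s < e3 --> b + s *\<^sub>R dout b \<in> K - brk \<and> b - s *\<^sub>R din b \<in> K - brk \<and>
   f (b + s *\<^sub>R dout b) = piece_val f b \<and> f (b - s *\<^sub>R din b) = piece_val f (prev b)"
   using piece_val_near[OF pw b] by (elim exE conjE) (rule that)
  define s where "s = min e1 (min e2 e3) / 2"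
  have s: "0 < s \<and> s < e1" "0 < s \<and> s < e2" "0 < s \<and> s < e3" using e1(1) e2(1) e3(1) by (auto simp: s_def min_def)
  have "f (b + s *\<^sub>R dout b) = \<tau> b" "f (b - s *\<^sub>R din b) = \<tau> (prev b)" unfolding \<tau>_def using e3(2)[rule_format, OF s(3)] by blast+
  then have "\<tau> b = t (fst b) * l (fst b) (fst b + s *\<^sub>R fst (dout b))" "\<tau> (prev b) = t (fst b) * l (fst b) (fst b - s *\<^sub>R fst (din b))"
   unfolding f_def using e(2) e1(2)[rule_format, OF s(1)] e2(2)[rule_format, OF s(2)] by simp_all
  then show ?thesis using s(1) by blast
 qed
 \<comment> \<open>Near a crossing \<open>t\<close> is its value at the crossing times 1,
   \<open>\<epsilon> p\<close>, \<open>\<epsilon> q\<close> or their product, according to the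
   quadrant. For each of the four half-strands only the side relative to the other strand
   matters.\<close>
 have cross4: "(positive q --> \<tau> (prev q) = \<tau> p \<and> \<tau> (prev p) = \<tau> p * \<epsilon> q \<and> \<tau> q = \<tau> p * \<epsilon> p) \<and>
   (\<not> positive q --> \<tau> (prev p) = \<tau> q \<and> \<tau> p = \<tau> q * \<epsilon> q \<and> \<tau> (prev q) = \<tau> q * \<epsilon> p)" if o: "over p q" for p q
 proof -
  note od = over_dirs[OF o]
  have b: "p \<in> brk" "q \<in> brk" using over_brk[OF o] by auto
  have ab: "above (fst p, - H) = {p, q}" 
  proof -
   have "x = p \<or> x = q" if "x \<in> K" "fst x = fst p" for x using fibre_le_2[of p q x] od(5-8) that by metis
   then show ?thesis unfolding above using od(5-7) by (intro subset_antisym subsetI; elim insertE CollectE) auto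
  qed
  let ?a = "fst (dout p)" and ?b = "fst (dout q)"
  have L: "l (fst p) (fst p + v) = (if cross ?b v > 0 then \<epsilon> q else 1) * (if cross ?a v > 0 then \<epsilon> p else 1)" for v
   unfolding l_def lab_two[OF ab o] wq[OF over_under[OF o]] cb[OF b(1)] using od by (simp add: mul)
  obtain s where s: "s > 0" "\<tau> p = t (fst p) * l (fst p) (fst p + s *\<^sub>R ?a)" "\<tau> (prev p) = t (fst p) * l (fst p) (fst p + - (s *\<^sub>R ?a))"
   using key[OF b(1)] unfolding od(1) by auto
  obtain r where r: "r > 0" "\<tau> q = t (fst p) * l (fst p) (fst p + r *\<^sub>R ?b)" "\<tau> (prev q) = t (fst p) * l (fst p) (fst p + - (r *\<^sub>R ?b))"
   using key[OF b(2)] unfolding od(2) od(5) by auto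
  have pos: "positive q \<longleftrightarrow> cross ?a ?b > 0" unfolding positive_def over_of_eq[OF o] ..
  have sq: "\<epsilon> q * \<epsilon> q = 1" "\<epsilon> p * \<epsilon> p = 1" using eps(1) b by fastforce+
  show ?thesis using s r od(3) unfolding L pos by (auto simp: cross_commute[of ?b ?a] zero_less_mult_iff mult_less_0_iff sq mult.assoc not_less)
 qed
 show ?thesis
 proof (rule that[of \<tau>])
  fix b assume b: "b \<in> brk"
  have bK: "b \<in> K" by (rule brk_K[OF b])
  obtain p where "p \<in> K - brk" "prev p = b" using piece_point[OF b] by blast
  then have "\<tau> b = f p" unfolding \<tau>_def using piece_val_eq[OF pw, of p] by simp
  then show "\<tau> b = 1 \<or> \<tau> b = - 1" using tc' by (simp add: f_def)
  assume nc: "\<not> under b" "\<forall>q. \<not> over b q"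
  note s = conjunct1[OF single[OF bK nc]]
  obtain s where s': "s > 0" "\<tau> b = t (fst b) * l (fst b) (fst b + s *\<^sub>R fst (dout b))" "\<tau> (prev b) = t (fst b) * l (fst b) (fst b - s *\<^sub>R fst (din b))"
   using key[OF b] by (elim exE conjE) (rule that)
  show "\<tau> (prev b) = \<tau> b" unfolding s' l_one[OF b s nc(1)] using bend_ray(1,3)[of s] s'(1) by simp
 next
  fix p q assume o: "over p q"
  show "\<tau> (prev q) = \<tau> p \<and> \<tau> (prev p) = \<tau> p * \<epsilon> q \<and> \<tau> q = \<tau> p * \<epsilon> p" if "positive q"
   using cross4[OF o] that by simp
  show "\<tau> (prev p) = \<tau> q \<and> \<tau> p = \<tau> q * \<epsilon> q \<and> \<tau> (prev q) = \<tau> q * \<epsilon> p" if "\<not> positive q"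
   using cross4[OF o] that by simp
 qed
qed

lemma coloring_value:
 assumes c: "coloring G c" and p: "p \<in> K"
 shows "\<exists>b\<in>brk. c p = piece_val c b"
proof (cases "p \<in> brk")
 case False
 then show ?thesis using piece_val_eq[OF coloring_piecewise[OF c], of p] prev_brk[OF p] p by (intro bexI[of _ "prev p"]) auto
next
 case True
 show ?thesis
 proof (cases "under p")
  case False
  then show ?thesis using piece_coloring_of_coloring(2)[OF c True] True by blast
 next
  case u: True
  obtain e w0 w1 where w: "e > 0" "c p = w0 \<or> c p = w1"
   "\<forall>t. 0 < t \<and> t < e --> c (p + t *\<^sub>R left_dir p) = w1 \<and> c (p - t *\<^sub>R left_dir p) = w0"
   using c[unfolded coloring_def, THEN conjunct2, THEN conjunct2, rule_format, OF u] by (elim exE bexE conjE) (rule that; assumption)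
  obtain e' where e': "e' > 0" "\<forall>t. 0 < t \<and> t < e' --> p + t *\<^sub>R dout p \<in> K - brk \<and> p - t *\<^sub>R din p \<in> K - brk \<and>
   c (p + t *\<^sub>R dout p) = piece_val c p \<and> c (p - t *\<^sub>R din p) = piece_val c (prev p)"
   using piece_val_near[OF coloring_piecewise[OF c] True] by (elim exE conjE) (rule that)
  obtain q where o: "over q p" using u unfolding under_def by (elim exE)
  define t where "t = min e e' / 2"
  have t: "0 < t \<and> t < e" "0 < t \<and> t < e'" using w(1) e'(1) by (auto simp: t_def min_def)
  have "c p = piece_val c p \<or> c p = piece_val c (prev p)" using w(2) w(3)[rule_format, OF t(1)] e'(2)[rule_format, OF t(2)] over_dirs(2)[OF o]
   by (auto simp: left_dir_def split: if_splits)
  then show ?thesis using True prev_brk[OF p] by blast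
 qed
qed

text \<open>A breakpoint that takes part in a crossing is the under or the over point of exactly one
  crossing, so the sum can be regrouped by crossings.\<close>

lemma sum_over_crossings:
 fixes f :: "space => int"
 assumes "\<And>b. [|b \<in> brk; \<not> under b; \<forall>q. \<not> over b q|] ==> f b = 0"
 shows "sum f (brk) = (\<Sum>q\<in>{q. under q}. f q + f (over_of q))"
proof -
 have fin: "finite (brk)" by (rule finite_brk)
 have sub: "{q. under q} \<subseteq> brk" using under_brk by blast
 have finu: "finite {q. under q}" by (rule finite_subset[OF sub fin])
 have ov: "over (over_of q) q" if "under q" for q using that over_of_eq unfolding under_def by blast
 have inj: "inj_on over_of {q. under q}"
 proof (rule inj_onI)
  fix q q' assume q: "q \<in> {q. under q}" "q' \<in> {q. under q}" "over_of q = over_of q'"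
  then have o: "over (over_of q) q" "over (over_of q) q'" using ov[of q] ov[of q'] by simp_all
  then show "q = q'" using fibre_le_2[of "over_of q" q q'] unfolding over_def by force
 qed
 have sub2: "over_of ` {q. under q} \<subseteq> brk" using ov over_brk by blast
 have dis: "{q. under q} \<inter> over_of ` {q. under q} = {}" using ov over_not_under by blast
 have "sum f (brk) = sum f ({q. under q} \<union> over_of ` {q. under q})"
 proof (rule sum.mono_neutral_right[OF fin])
  show "\<forall>b\<in>brk - ({q. under q} \<union> over_of ` {q. under q}). f b = 0"
  proof
   fix b assume b: "b \<in> brk - ({q. under q} \<union> over_of ` {q. under q})"
   have "\<not> over b q" for q
   proof
    assume "over b q"
    then have "b = over_of q" "under q" using over_of_eq over_under by auto
    then show False using b by blast
   qed
   then show "f b = 0" using b assms by blast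
  qed
 qed (use sub sub2 in blast)
 also have "\<dots> = sum f {q. under q} + sum f (over_of ` {q. under q})" by (rule sum.union_disjoint) (use finu dis in auto)
 also have "sum f (over_of ` {q. under q}) = (\<Sum>q\<in>{q. under q}. f (over_of q))" using sum.reindex[OF inj] by simp
 finally show ?thesis by (simp add: sum.distrib)
qed

lemma sum_telescope:
 fixes f :: "space => int"
 shows "(\<Sum>b\<in>brk. f b - f (prev b)) = 0"
proof -
 have "sum f (brk) = (\<Sum>b\<in>brk. f (prev b))" using sum.reindex[OF prev_inj_on, of f] prev_image by simp
 then show ?thesis by (simp add: sum_subtractf)
qed

text \<open>Rotations get the colour \<open>b\<^sup>s, b\<^sup>-\<^sup>s\<close> and reflections the colours \<open>a b\<^sup>x\<close> with integers
 \<open>s, x\<close>.  There is one linear equation per breakpoint on a reflection component, so one unknown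
 more than equations; moreover one equation is redundant, which allows to normalize one \<open>x\<close> to \<open>0\<close>.\<close>

lemma two_tone_lift:
 assumes c: "coloring (dihedral m) c" and m: "odd m" "3 \<le> m"
  and ne: "\<And>p. p \<in> K ==> c p \<noteq> (False, 0)" and r: "\<exists>p\<in>K. fst (c p)" "\<exists>p\<in>K. \<not> fst (c p)" and n: "n \<ge> 1"
 obtains c' where "coloring (dihedral n) c'" "generate (dihedral n) (c' ` K) = carrier (dihedral n)"
proof -
 let ?B = "brk" and ?pr = "prev"
 define \<kappa> where "\<kappa> = piece_val c"
 define R where "R b \<longleftrightarrow> fst (\<kappa> b)" for b
 define k where "k b = snd (\<kappa> b)" for b
 have \<kappa>: "\<kappa> b = (R b, k b)" for b by (simp add: R_def k_def)
 \<comment> \<open>The half of the residues in which the exponent lies. As \<open>m\<close> is odd,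
   a nonzero \<open>k\<close> and \<open>m - k\<close> are in different halves, so inverting a
   rotation flips this sign.\<close>
 define \<sigma> where "\<sigma> b = (if 2 * k b < int m then 1 else - 1 :: int)" for b
 define sg where "sg q = (if positive q then 1 else - 1 :: int)" for q
 have pc: "piece_coloring (dihedral m) \<kappa>" unfolding \<kappa>_def by (rule piece_coloring_of_coloring(1)[OF c])
 have pB: "?pr b \<in> ?B" if "b \<in> ?B" for b by (rule prev_brk[OF brk_K[OF that]])
 have ob: "p \<in> ?B" "q \<in> ?B" if "over p q" for p q using over_brk[OF that] by auto
 have kr: "0 \<le> k b" "k b < int m" if "b \<in> ?B" for b using pc that \<kappa>[of b] unfolding piece_coloring_def by (auto simp: carrier_dihedral)
 have k0: "k b \<noteq> 0" if b: "b \<in> ?B" "\<not> R b" for b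
 proof -
  obtain p where p: "p \<in> K - ?B" "?pr p = b" using piece_point[OF b(1)] by blast
  then have "\<kappa> b = c p" unfolding \<kappa>_def using piece_val_eq[OF coloring_piecewise[OF c] p(1)] by simp
  then show ?thesis using ne[of p] p(1) \<kappa>[of b] b(2) by auto
 qed
 have nc: "\<kappa> (?pr b) = \<kappa> b" if "b \<in> ?B" "\<not> under b" for b using pc that unfolding piece_coloring_def by metis
 have nc': "R (?pr b) = R b" "\<sigma> (?pr b) = \<sigma> b" if "b \<in> ?B" "\<not> under b" for b
  using nc[OF that] by (simp_all add: R_def k_def \<sigma>_def)
 have rel: "if positive q then \<kappa> p \<otimes>\<^bsub>dihedral m\<^esub> \<kappa> q = \<kappa> (?pr q) \<otimes>\<^bsub>dihedral m\<^esub> \<kappa> p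
   else \<kappa> q \<otimes>\<^bsub>dihedral m\<^esub> \<kappa> p = \<kappa> p \<otimes>\<^bsub>dihedral m\<^esub> \<kappa> (?pr q)" if "over p q" for p q
  using pc over_under[OF that] over_of_eq[OF that] unfolding piece_coloring_def by metis
 have Rq: "R (?pr q) = R q" if "over p q" for p q using rel[OF that] unfolding \<kappa> mult_dihedral by (auto split: if_splits)
 have Rp: "R (?pr b) = R b" if "b \<in> ?B" for b using Rq nc'(1)[OF that] unfolding under_def by blast
 \<comment> \<open>Under a reflection the exponents before and after add up to a multiple of
   \<open>m\<close>; both lie strictly between 0 and \<open>m\<close>, so the sum is
   \<open>m\<close>. Under a rotation the exponent does not change.\<close>
 have \<sigma>q: "\<sigma> (?pr q) = (if R p then - \<sigma> q else \<sigma> q)" if o: "over p q" and q: "\<not> R q" for p q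
 proof -
  have b: "0 \<le> k q" "k q < int m" "0 \<le> k (?pr q)" "k (?pr q) < int m" "k q \<noteq> 0" "k (?pr q) \<noteq> 0"
   using kr ob[OF o] pB k0 q Rq[OF o] by auto
  have q': "\<not> R (?pr q)" using q Rq[OF o] by simp
  show ?thesis
  proof (cases "R p")
   case True
   have "[k p + k q = k p - k (?pr q)] (mod int m)" using rel[OF o] True q q' unfolding \<kappa> mult_dihedral cong_def
    by (auto split: if_splits simp: add.commute) (metis add_diff_cancel_left' diff_diff_eq2 mod_diff_right_eq)?
   then have "[k q + k (?pr q) = 0] (mod int m)" by (simp add: cong_iff_dvd_diff algebra_simps)
   then have "int m dvd k q + k (?pr q)" by (simp add: cong_0_iff)
   then obtain j where j: "k q + k (?pr q) = int m * j" by (elim dvdE)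
   have "0 < k q + k (?pr q)" "k q + k (?pr q) < int m * 2" using b by auto
   then have "int m * 0 < int m * j" "int m * j < int m * 2" unfolding j by (simp_all only: mult_zero_right)
   moreover have "int m > 0" using m(2) by simp
   ultimately have "0 < j" "j < 2" using mult_less_cancel_left_pos by blast+
   then have "j = 1" by simp
   then have "k q + k (?pr q) = int m" using j by simp
   moreover have "2 * k q \<noteq> int m" using m(1) by presburger
   ultimately show ?thesis using True by (auto simp: \<sigma>_def)
  next
   case False
   have "[k q = k (?pr q)] (mod int m)" using rel[OF o] False q q' unfolding \<kappa> mult_dihedral
    by (auto split: if_splits simp: cong_def[symmetric] add.commute cong_add_lcancel cong_add_rcancel)
   then have "k q = k (?pr q)" using b by (simp add: cong_def)
   then show ?thesis using False by (simp add: \<sigma>_def)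
  qed
 qed
 define \<epsilon> where "\<epsilon> b = (if R b then - 1 else 1 :: int)" for b
 have \<epsilon>: "\<epsilon> b = 1 \<or> \<epsilon> b = - 1" "b \<in> ?B ==> \<epsilon> (?pr b) = \<epsilon> b" for b using Rp by (simp_all add: \<epsilon>_def)
 obtain \<tau> :: "space => int" where \<tau>: "\<And>b. b \<in> ?B ==> \<tau> b = 1 \<or> \<tau> b = - 1"
  "\<And>b. [|b \<in> ?B; \<not> under b; \<forall>q. \<not> over b q|] ==> \<tau> (?pr b) = \<tau> b"
  "\<And>p q. [|over p q; positive q|] ==> \<tau> (?pr q) = \<tau> p \<and> \<tau> (?pr p) = \<tau> p * \<epsilon> q \<and> \<tau> q = \<tau> p * \<epsilon> p"
  "\<And>p q. [|over p q; \<not> positive q|] ==> \<tau> (?pr p) = \<tau> q \<and> \<tau> p = \<tau> q * \<epsilon> q \<and> \<tau> (?pr q) = \<tau> q * \<epsilon> p"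
  by (rule parity[of \<epsilon>, OF \<epsilon>], assumption) (rule that; assumption)
 \<comment> \<open>The exponent that the relation at \<open>b\<close> forces on the reflection piece
   starting there. The index \<open>None\<close> stands for the common rotation exponent,
   \<open>Some b\<close> for the piece starting at \<open>b\<close>. The over strand, too, enters
   through its incoming piece, so that only incoming values occur in the cancellation at a
   crossing.\<close>
 define pred where "pred b x = (if under b then if R (over_of b) then 2 * x (Some (?pr (over_of b))) - x (Some (?pr b))
   else x (Some (?pr b)) + 2 * sg b * \<sigma> (over_of b) * x None else x (Some (?pr b)))" for b and x :: "space option => int"
 define BR where "BR = {b \<in> ?B. R b}"
 have finB: "finite ?B" "finite BR" using finite_brk by (auto simp: BR_def)
 have redundant: "(\<Sum>b\<in>BR. \<tau> b * (x (Some b) - pred b x)) = 0" for x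
 proof -
  \<comment> \<open>Bookkeeping for the dependency: telescoping \<open>F\<close> replaces each
    \<open>x (Some b)\<close> by the value of the incoming piece, and telescoping \<open>T\<close>
    shows that the rotation terms \<open>V\<close> add up to zero. What remains,
    \<open>W b + x None * V b\<close>, cancels crossing by crossing by the rules for
    \<open>\<tau>\<close> and \<open>\<sigma>\<close>.\<close>
  define V where "V b = (if R b then 0 else \<sigma> b * \<tau> b - \<sigma> (?pr b) * \<tau> (?pr b))" for b
  define W where "W b = (if R b then \<tau> (?pr b) * x (Some (?pr b)) - \<tau> b * pred b x else 0)" for b
  define F where "F b = (if R b then \<tau> b * x (Some b) else 0)" for b
  define T where "T b = (if R b then 0 else \<sigma> b * \<tau> b)" for b
  have "sum V ?B = (\<Sum>b\<in>?B. T b - T (?pr b))" by (rule sum.cong) (use Rp in \<open>simp_all add: V_def T_def\<close>)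
  then have V0: "sum V ?B = 0" using sum_telescope[of T] by simp
  have "W b + x None * V b = 0" if "b \<in> ?B" "\<not> under b" "\<forall>q. \<not> over b q" for b
   using that \<tau>(2)[OF that] nc'[OF that(1,2)] by (simp add: W_def V_def pred_def)
  then have "(\<Sum>b\<in>?B. W b + x None * V b) = (\<Sum>q\<in>{q. under q}. (W q + x None * V q) + (W (over_of q) + x None * V (over_of q)))"
   by (rule sum_over_crossings)
  also have "\<dots> = 0"
  proof (rule sum.neutral, rule ballI)
   fix q assume "q \<in> {q. under q}"
   then have u: "under q" by simp
   then obtain p where o: "over p q" unfolding under_def by (elim exE)
   have np: "\<not> under p" by (rule over_not_under[OF o])
   note defs = over_of_eq[OF o] W_def V_def pred_def sg_def nc'(2)[OF ob(1)[OF o] np] u np \<epsilon>_def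
   have s: "R q \<or> \<sigma> (?pr q) = (if R p then - \<sigma> q else \<sigma> q)" using \<sigma>q[OF o] by blast
   show "(W q + x None * V q) + (W (over_of q) + x None * V (over_of q)) = 0"
   proof (cases "positive q")
    case True
    have t: "\<tau> (?pr q) = \<tau> p" "\<tau> (?pr p) = \<tau> p * \<epsilon> q" "\<tau> q = \<tau> p * \<epsilon> p" using \<tau>(3)[OF o True] by simp_all
    show ?thesis using s by (cases "R p"; cases "R q") (simp_all add: defs True t, simp_all add: algebra_simps)?
   next
    case False
    have t: "\<tau> (?pr p) = \<tau> q" "\<tau> p = \<tau> q * \<epsilon> q" "\<tau> (?pr q) = \<tau> q * \<epsilon> p" using \<tau>(4)[OF o False] by simp_all
    show ?thesis using s by (cases "R p"; cases "R q") (simp_all add: defs False t, simp_all add: algebra_simps)?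
   qed
  qed
  finally have "sum W ?B = 0" using V0 by (simp add: sum.distrib flip: sum_distrib_left)
  then have "(\<Sum>b\<in>?B. W b + (F b - F (?pr b))) = 0" using sum_telescope[of F] by (simp add: sum.distrib)
  moreover have "W b + (F b - F (?pr b)) = (if R b then \<tau> b * (x (Some b) - pred b x) else 0)" if "b \<in> ?B" for b
   using Rp[OF that] by (simp add: W_def F_def algebra_simps)
  ultimately have "(\<Sum>b\<in>?B. if R b then \<tau> b * (x (Some b) - pred b x) else 0) = 0" by simp
  then show ?thesis unfolding BR_def using finB(1) by (simp add: sum.inter_filter)
 qed
 obtain b0 where b0: "b0 \<in> ?B" "R b0" using r(1) coloring_value[OF c] unfolding R_def \<kappa>_def by metis
 obtain t0 where t0: "t0 \<in> ?B" "\<not> R t0" using r(2) coloring_value[OF c] unfolding R_def \<kappa>_def by metis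
 \<comment> \<open>The equation at the reflection breakpoint \<open>b0\<close> is replaced by the
   normalization \<open>x (Some b0) = 0\<close>. This keeps the number of equations at
   \<open>card BR\<close>, against one unknown more.\<close>
 define L where "L b x = (if b = b0 then x (Some b0) else x (Some b) - pred b x)" for b and x :: "space option => int"
 define J where "J = insert None (Some ` BR)"
 have "card BR < card J" "finite J" using finB by (auto simp: J_def card_insert_if card_image)
 moreover have "L b (\<lambda>j. r * u j + v j) = r * L b u + L b v" for b u v r by (simp add: L_def pred_def algebra_simps)
 ultimately obtain x where x: "\<And>b. b \<in> BR ==> L b x = 0" "Gcd (x ` J) = 1" using int_functionals_kernel[OF finB(2), of J L] by blast
 have x0: "x (Some b0) = 0" using x(1)[of b0] b0 by (simp add: L_def BR_def)
 \<comment> \<open>At \<open>b0\<close> the omitted equation is regained: all other terms of the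
   dependency vanish, and \<open>\<tau> b0\<close> is a sign.\<close>
 have e: "x (Some b) = pred b x" if "b \<in> BR" for b
 proof (cases "b = b0")
  case False
  then show ?thesis using x(1)[OF that] by (simp add: L_def)
 next
  case True
  have "(\<Sum>b\<in>BR - {b0}. \<tau> b * (x (Some b) - pred b x)) = 0"
  proof (rule sum.neutral, rule ballI)
   fix b assume "b \<in> BR - {b0}"
   then show "\<tau> b * (x (Some b) - pred b x) = 0" using x(1)[of b] by (simp add: L_def)
  qed
  then have "\<tau> b0 * (x (Some b0) - pred b0 x) = 0"
   using redundant[of x] sum.remove[OF finB(2), of b0 "\<lambda>b. \<tau> b * (x (Some b) - pred b x)"] b0 by (simp add: BR_def)
  then show ?thesis using \<tau>(1)[OF b0(1)] True by auto
 qed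
 define \<kappa>' where "\<kappa>' b = (R b, (if R b then x (Some b) else \<sigma> b * x None) mod int n)" for b
 have n0: "int n > 0" using n by simp
 have "piece_coloring (dihedral n) \<kappa>'" unfolding piece_coloring_def
 proof (intro conjI ballI impI allI)
  fix b assume b: "b \<in> ?B"
  show "\<kappa>' b \<in> carrier (dihedral n)" using n0 by (simp add: \<kappa>'_def carrier_dihedral)
  assume "\<not> under b"
  then show "\<kappa>' b = \<kappa>' (?pr b)" using nc'[OF b] e[of b] b by (auto simp: \<kappa>'_def pred_def BR_def)
 next
  fix q assume u: "under q"
  then obtain p where o: "over p q" unfolding under_def by (elim exE)
  have np: "\<not> under p" by (rule over_not_under[OF o])
  have xp: "R p ==> x (Some p) = x (Some (?pr p))" using e[of p] ob[OF o] np by (auto simp: pred_def BR_def)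
  have xq: "R q ==> x (Some q) = pred q x" using e[of q] ob[OF o] by (auto simp: BR_def)
  show "if positive q then \<kappa>' (over_of q) \<otimes>\<^bsub>dihedral n\<^esub> \<kappa>' q = \<kappa>' (?pr q) \<otimes>\<^bsub>dihedral n\<^esub> \<kappa>' (over_of q)
   else \<kappa>' q \<otimes>\<^bsub>dihedral n\<^esub> \<kappa>' (over_of q) = \<kappa>' (over_of q) \<otimes>\<^bsub>dihedral n\<^esub> \<kappa>' (?pr q)"
   unfolding over_of_eq[OF o] \<kappa>'_def mult_dihedral_mod Rq[OF o] using xp xq \<sigma>q[OF o] u
   by (cases "R p"; cases "R q") (auto simp: pred_def over_of_eq[OF o] sg_def add.commute)
 qed
 then have "coloring (dihedral n) (color_of \<kappa>')" by (rule coloring_color_of)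
 moreover have "generate (dihedral n) (color_of \<kappa>' ` K) = carrier (dihedral n)"
 proof (rule generate_dihedral_rotations[OF n])
  have img: "\<kappa>' b \<in> color_of \<kappa>' ` K" if "b \<in> ?B" for b
   using brk_K[OF that] that by (intro image_eqI[of _ _ b]) (auto simp: color_of_def)
  show "color_of \<kappa>' ` K \<subseteq> carrier (dihedral n)" using calculation by (auto simp: coloring_def)
  show "(True, 0) \<in> color_of \<kappa>' ` K" using img[OF b0(1)] b0(2) x0 by (simp add: \<kappa>'_def)
  let ?F = "insert (\<sigma> t0 * x None) (x ` Some ` BR)"
  show "finite ?F" using finB by simp
  have "Gcd ?F = Gcd (x ` J)" by (simp add: J_def \<sigma>_def)
  then show "Gcd ?F = 1" using x(2) by simp
  fix a assume "a \<in> ?F"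
  then consider "a = \<sigma> t0 * x None" | b where "b \<in> BR" "a = x (Some b)" by blast
  then show "(True, a mod int n) \<in> color_of \<kappa>' ` K \<or> (False, a mod int n) \<in> color_of \<kappa>' ` K"
  proof cases
   case 1 then show ?thesis using img[OF t0(1)] t0(2) by (simp add: \<kappa>'_def)
  next
   case (2 b) then show ?thesis using img[of b] by (simp add: \<kappa>'_def BR_def)
  qed
 qed
 ultimately show ?thesis by (rule that)
qed

end

section \<open>Generic shears\<close>

text \<open>Shearing and then projecting vertically is projecting the original link along a tilted
  line of sight; \<open>w\<close> parametrizes the tilt.\<close>

definition shear :: "complex => space => space" where
 "shear w p = (fst p + snd p *\<^sub>R w, snd p)"

lemma shear_simps [simp]: "fst (shear w p) = fst p + snd p *\<^sub>R w" "snd (shear w p) = snd p" by (simp_all add: shear_def)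

lemma linear_shear: "linear (shear w)" by (rule linearI) (simp_all add: shear_def algebra_simps)

lemma shear_shear: "shear v (shear w p) = shear (w + v) p" by (simp add: shear_def algebra_simps)

lemma shear_0 [simp]: "shear 0 p = p" by (simp add: shear_def)

lemma inj_shear: "inj (shear w)" by (rule inj_on_inverseI[of _ "shear (- w)"]) (simp add: shear_shear)

text \<open>Affine functions of the shear parameter: the cross products of sheared edge vectors.\<close>

definition aff :: "space => space => complex => real" where
 "aff a b w = cross (fst (shear w a)) (fst (shear w b))"

lemma aff_commute: "aff b a w = - aff a b w" unfolding aff_def by (rule cross_commute)

lemma aff_eq: "aff a b w = cross (fst a) (fst b) + cross (snd b *\<^sub>R fst a - snd a *\<^sub>R fst b) w"
 by (simp add: aff_def cross_add cross_diff cross_commute[of w] algebra_simps)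

lemma open_aff: "open {w. aff a b w \<noteq> 0}" unfolding aff_eq by (intro open_Collect_neq continuous_intros)

text \<open>An affine function of \<open>w\<close> that vanishes identically has vanishing constant
  and linear parts, and these two together express parallelism in space.\<close>

lemma aff_eq_0_parallel:
 assumes "\<And>w. aff a b w = 0" "b \<noteq> 0"
 obtains s where "a = s *\<^sub>R b"
proof -
 have c: "cross (fst a) (fst b) = 0" using assms(1)[of 0] by (simp add: aff_eq)
 define d where "d = snd b *\<^sub>R fst a - snd a *\<^sub>R fst b"
 have "cross d w = 0" for w using assms(1)[of w] c by (simp add: aff_eq d_def)
 from this[of 1] this[of \<i>] have d: "d = 0" by (simp add: cross_def complex_eq_iff)
 show ?thesis
 proof (cases "snd b = 0")
  case False
  have "snd b *\<^sub>R fst a = snd a *\<^sub>R fst b" using d by (simp add: d_def)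
  then have "fst a = (snd a / snd b) *\<^sub>R fst b" using False
   by (metis (no_types, lifting) divide_inverse_commute scaleR_scaleR left_inverse scaleR_one)
  then show ?thesis using that[of "snd a / snd b"] False by (simp add: prod_eq_iff)
 next
  case True
  then have fb: "fst b \<noteq> 0" using assms(2) by (simp add: prod_eq_iff)
  then have "snd a = 0" using d True by (simp add: d_def)
  moreover obtain s where "fst a = s *\<^sub>R fst b" using cross_eq_0_parallel[of "fst b" "fst a"] fb c by (auto simp: cross_commute[of "fst b"])
  ultimately show ?thesis using that[of s] True by (simp add: prod_eq_iff)
 qed
qed

text \<open>On the line from a zero \<open>w\<close> to \<open>w0\<close> the affine function
  vanishes only at \<open>w\<close>, so nonzeros lie arbitrarily close to \<open>w\<close>.\<close>

lemma dense_aff: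
 assumes "aff a b w0 \<noteq> 0"
 shows "closure {w. aff a b w \<noteq> 0} = UNIV"
proof -
 have "w \<in> closure {w. aff a b w \<noteq> 0}" for w
 proof (cases "aff a b w = 0")
  case True
  have "aff a b (w + t *\<^sub>R (w0 - w)) = (1 - t) * aff a b w + t * aff a b w0" for t by (simp add: aff_eq cross_add cross_diff algebra_simps)
  then have line: "aff a b (w + t *\<^sub>R (w0 - w)) = t * aff a b w0" for t using True by simp
  show ?thesis unfolding closure_approachable
  proof (intro allI impI)
   fix e :: real assume e: "e > 0"
   have ne: "w0 \<noteq> w" using True assms by auto
   define t where "t = e / (2 * norm (w0 - w))"
   have t: "t > 0" "t * norm (w0 - w) < e" using e ne by (auto simp: t_def)
   have "aff a b (w + t *\<^sub>R (w0 - w)) \<noteq> 0" using line[of t] t assms by simp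
   moreover have "dist (w + t *\<^sub>R (w0 - w)) w < e" using t by (simp add: dist_norm)
   ultimately show "\<exists>y\<in>{w. aff a b w \<noteq> 0}. dist y w < e" by blast
  qed
 next
  case False
  then show ?thesis by (intro subsetD[OF closure_subset]) simp
 qed
 then show ?thesis by (intro equalityI subsetI UNIV_I)
qed

lemma shear_param_exists:
 fixes Q :: "'i => complex set"
 assumes "finite I" "\<And>i. i \<in> I ==> open (Q i)" "\<And>i. i \<in> I ==> closure (Q i) = UNIV"
 shows "closure (\<Inter>i\<in>I. Q i) = UNIV"
proof -
 have "UNIV \<subseteq> closure (\<Inter>(Q ` I))" by (rule Baire) (use assms in \<open>auto simp: countable_finite\<close>)
 then show ?thesis by auto
qed

lemma collinear_shear_inj:
 assumes "b = s *\<^sub>R d" "fst (shear w d) \<noteq> 0" "fst (shear w b) = 0"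
 shows "b = 0"
proof -
 have "s *\<^sub>R fst (shear w d) = 0" using assms(1,3) by (simp add: algebra_simps)
 then show ?thesis using assms by simp
qed

text \<open>Two points of sheared segments over the same point of the plane.\<close>

definition meet :: "complex => space => space => bool" where
 "meet w p q \<longleftrightarrow> fst (shear w p) = fst (shear w q)"

lemma meet_diff: "meet w p q \<longleftrightarrow> fst (shear w (p - q)) = 0" by (simp add: meet_def algebra_simps)

lemma meet_height: "meet w p q ==> p \<noteq> q ==> snd p \<noteq> snd q" by (auto simp: meet_def prod_eq_iff)

text \<open>\<open>good w a d b e\<close>: the lines \<open>a + \<real> d\<close> and \<open>b + \<real> e\<close> have sheared projections that are
 transversal or disjoint.\<close>

definition good :: "complex => space => space => space => space => bool" where
 "good w a d b e \<longleftrightarrow> aff d e w \<noteq> 0 \<or> aff (b - a) d w \<noteq> 0"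

text \<open>If the projected directions were parallel, a common point would force the projected
  lines to coincide, which the second alternative of \<open>good\<close> excludes.\<close>

lemma good_meet:
 assumes g: "good w a d b e" and d: "fst (shear w d) \<noteq> 0"
  and m: "meet w (a + s *\<^sub>R d) (b + t *\<^sub>R e)"
 shows "aff d e w \<noteq> 0"
proof
 assume z: "aff d e w = 0"
 have "aff (b - a) d w = - t * aff e d w"
 proof -
  have "fst (shear w (b - a)) = s *\<^sub>R fst (shear w d) - t *\<^sub>R fst (shear w e)" using m by (simp add: meet_def algebra_simps)
  then show ?thesis unfolding aff_def by (simp add: cross_diff)
 qed
 also have "\<dots> = 0" using z aff_commute[of e d w] by simp
 finally show False using g z by (simp add: good_def)
qed

lemma meet_unique:
 assumes c: "aff d e w \<noteq> 0" and m: "meet w (a + s *\<^sub>R d) (b + t *\<^sub>R e)" "meet w (a + s' *\<^sub>R d) (b + t' *\<^sub>R e)"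
 shows "s = s'" "t = t'"
proof -
 have eq: "(s - s') *\<^sub>R fst (shear w d) = (t - t') *\<^sub>R fst (shear w e)"
 proof -
  have f: "fst (shear w (x + r *\<^sub>R y)) = fst (shear w x) + r *\<^sub>R fst (shear w y)" for x r y by (simp add: algebra_simps)
  have "(fst (shear w a) + s *\<^sub>R fst (shear w d)) - (fst (shear w a) + s' *\<^sub>R fst (shear w d)) =
    (fst (shear w b) + t *\<^sub>R fst (shear w e)) - (fst (shear w b) + t' *\<^sub>R fst (shear w e))" using m unfolding meet_def f by (simp only:)
  then show ?thesis by (simp only: scaleR_diff_left add_diff_cancel_left)
 qed
 have "(s - s') * aff d e w = cross ((s - s') *\<^sub>R fst (shear w d)) (fst (shear w e))" by (simp add: aff_def)
 also have "\<dots> = 0" unfolding eq by simp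
 finally show "s = s'" using c by simp
 have "(t - t') * aff d e w = cross (fst (shear w d)) ((t - t') *\<^sub>R fst (shear w e))" by (simp add: aff_def)
 also have "\<dots> = 0" unfolding eq[symmetric] by simp
 finally show "t = t'" using c by simp
qed

lemma dense_good:
 assumes d: "d \<noteq> 0" "e \<noteq> 0" and nc: "\<not> (\<exists>s. b - a = s *\<^sub>R d) \<or> \<not> (\<exists>s. e = s *\<^sub>R d)"
 shows "open {w. good w a d b e}" "closure {w. good w a d b e} = UNIV"
proof -
 have u: "{w. good w a d b e} = {w. aff d e w \<noteq> 0} \<union> {w. aff (b - a) d w \<noteq> 0}" by (auto simp: good_def)
 show "open {w. good w a d b e}" unfolding u by (intro open_Un open_aff)
 have "(\<exists>w. aff d e w \<noteq> 0) \<or> (\<exists>w. aff (b - a) d w \<noteq> 0)"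
 proof (rule ccontr)
  assume "\<not> ?thesis"
  then have z: "\<And>w. aff d e w = 0" "\<And>w. aff (b - a) d w = 0" by auto
  obtain s where "b - a = s *\<^sub>R d" using aff_eq_0_parallel[OF z(2) d(1)] by blast
  moreover have "aff e d w = 0" for w using z(1)[of w] aff_commute[of e d w] by simp
  then obtain s' where "e = s' *\<^sub>R d" using aff_eq_0_parallel d(1) by blast
  ultimately show False using nc by blast
 qed
 then show "closure {w. good w a d b e} = UNIV" unfolding u closure_Un using dense_aff by blast
qed

text \<open>No point of the plane is met by three segments: a triple point over \<open>p\<^sub>1, p\<^sub>2, p\<^sub>3\<close> is destroyed by
 tilting the line of sight through \<open>p\<^sub>1\<close> along the second segment.\<close>

definition triple :: "(space \<times> space) => (space \<times> space) => (space \<times> space) => complex set" where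
 "triple A B C = {w. \<exists>s\<in>{0..1}. \<exists>t\<in>{0..1}. \<exists>r\<in>{0..1}.
   meet w (fst A + s *\<^sub>R snd A) (fst B + t *\<^sub>R snd B) \<and> meet w (fst A + s *\<^sub>R snd A) (fst C + r *\<^sub>R snd C)}"

text \<open>The parameters of the three points run through a compact cube, so projecting a closed
  condition to \<open>w\<close> gives a closed set.\<close>

lemma closed_triple: "closed (triple A B C)"
proof -
 let ?I = "{0..1::real}"
 let ?T = "{x. \<exists>w s t r. x = ((s, t, r), w) \<and> meet w (fst A + s *\<^sub>R snd A) (fst B + t *\<^sub>R snd B) \<and>
   meet w (fst A + s *\<^sub>R snd A) (fst C + r *\<^sub>R snd C)}"
 have "closed {x :: (real \<times> real \<times> real) \<times> complex.
   fst (shear (snd x) (fst A + fst (fst x) *\<^sub>R snd A)) = fst (shear (snd x) (fst B + fst (snd (fst x)) *\<^sub>R snd B)) \<and>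
   fst (shear (snd x) (fst A + fst (fst x) *\<^sub>R snd A)) = fst (shear (snd x) (fst C + snd (snd (fst x)) *\<^sub>R snd C))}"
  unfolding shear_simps by (intro closed_Collect_conj closed_Collect_eq continuous_intros)
 then have "closed {w. \<exists>x. x \<in> ?I \<times> ?I \<times> ?I \<and> (x, w) \<in> {x :: (real \<times> real \<times> real) \<times> complex.
   fst (shear (snd x) (fst A + fst (fst x) *\<^sub>R snd A)) = fst (shear (snd x) (fst B + fst (snd (fst x)) *\<^sub>R snd B)) \<and>
   fst (shear (snd x) (fst A + fst (fst x) *\<^sub>R snd A)) = fst (shear (snd x) (fst C + snd (snd (fst x)) *\<^sub>R snd C))}}"
  by (intro closed_compact_projection compact_Times) auto
 moreover have "triple A B C = {w. \<exists>x. x \<in> ?I \<times> ?I \<times> ?I \<and> (x, w) \<in> {x :: (real \<times> real \<times> real) \<times> complex.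
   fst (shear (snd x) (fst A + fst (fst x) *\<^sub>R snd A)) = fst (shear (snd x) (fst B + fst (snd (fst x)) *\<^sub>R snd B)) \<and>
   fst (shear (snd x) (fst A + fst (fst x) *\<^sub>R snd A)) = fst (shear (snd x) (fst C + snd (snd (fst x)) *\<^sub>R snd C))}}"
  unfolding triple_def meet_def by (rule Collect_cong) (simp only: split_paired_Ex mem_Times_iff mem_Collect_eq fst_conv snd_conv, blast)
 ultimately show ?thesis by simp
qed

lemma triple_destroy:
 assumes c: "aff dA dB w \<noteq> 0" "aff dA dC w \<noteq> 0" "aff dB dC w \<noteq> 0"
  and m: "meet w (a + s *\<^sub>R dA) (b + t *\<^sub>R dB)" "meet w (a + s *\<^sub>R dA) (c + r *\<^sub>R dC)"
  and h: "a + s *\<^sub>R dA \<noteq> c + r *\<^sub>R dC" and e: "e > 0"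
 shows "\<exists>v. dist v w < e \<and> v \<notin> triple (a, dA) (b, dB) (c, dC)"
proof -
 define p1 where "p1 = a + s *\<^sub>R dA"
 define p2 where "p2 = b + t *\<^sub>R dB"
 define p3 where "p3 = c + r *\<^sub>R dC"
 define u where "u = fst (shear w dB)"
 have "open ({v. aff dA dB v \<noteq> 0} \<inter> {v. aff dA dC v \<noteq> 0})" by (intro open_Int open_aff)
 moreover have "w \<in> {v. aff dA dB v \<noteq> 0} \<inter> {v. aff dA dC v \<noteq> 0}" using c(1,2) by simp
 ultimately
 obtain e' where e': "e' > 0" "ball w e' \<subseteq> {v. aff dA dB v \<noteq> 0} \<inter> {v. aff dA dC v \<noteq> 0}" by (rule openE)
 have u0: "u \<noteq> 0" using c(1) by (auto simp: aff_def u_def)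
 define x where "x = min e e' / (2 * norm u)"
 have x0: "x > 0" using e e'(1) u0 by (simp add: x_def)
 have "x * norm u = min e e' / 2" using u0 by (simp add: x_def)
 then have xs: "x * norm u < e" "x * norm u < e'" using e e'(1) by auto
 \<comment> \<open>Tilting along the projected second segment moves its point over itself, so it is
   still met at the same parameter of the first segment. The third point is displaced along
   \<open>u\<close> by a nonzero amount, since its height differs from that of the first; meeting it
   again would make the second and third segments parallel in projection.\<close>
 define v where "v = w + x *\<^sub>R u"
 have dv: "dist v w < e" "v \<in> ball w e'" using xs x0 by (auto simp: v_def dist_norm)
 have cv: "aff dA dB v \<noteq> 0" "aff dA dC v \<noteq> 0" using e'(2) dv(2) by auto
 have sb: "fst (shear v dB) = (1 + x * snd dB) *\<^sub>R u" by (simp add: v_def u_def algebra_simps)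
 have "v \<notin> triple (a, dA) (b, dB) (c, dC)"
 proof
  assume "v \<in> triple (a, dA) (b, dB) (c, dC)"
  then obtain s' t' r' where m': "meet v (a + s' *\<^sub>R dA) (b + t' *\<^sub>R dB)" "meet v (a + s' *\<^sub>R dA) (c + r' *\<^sub>R dC)"
   by (auto simp: triple_def)
  have h12: "fst (shear v (p1 - p2)) = (snd (p1 - p2) * x) *\<^sub>R u"
   using m(1) unfolding meet_diff p1_def[symmetric] p2_def[symmetric] by (simp add: v_def algebra_simps)
  have h13: "fst (shear v (p1 - p3)) = (snd (p1 - p3) * x) *\<^sub>R u"
   using m(2) unfolding meet_diff p1_def[symmetric] p3_def[symmetric] by (simp add: v_def algebra_simps)
  have d1: "fst (shear v (p1 - p2)) = (s - s') *\<^sub>R fst (shear v dA) - (t - t') *\<^sub>R fst (shear v dB)"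
   using m'(1) unfolding meet_diff p1_def p2_def by (simp add: algebra_simps) 
  have "cross (fst (shear v dB)) ((s - s') *\<^sub>R fst (shear v dA)) = 0"
   using d1 h12 unfolding sb by (metis (no_types, lifting) cross_diff(1) cross_simps(1,6,7) diff_eq_eq add.commute diff_self mult_zero_right add_0)
  then have s: "s = s'" using cv(1) aff_commute[of dB dA v] by (simp add: aff_def)
  have d2: "fst (shear v (p1 - p3)) = - ((r - r') *\<^sub>R fst (shear v dC))"
   using m'(2) s unfolding meet_diff p1_def p3_def by (simp add: algebra_simps)
  have n: "snd (p1 - p3) \<noteq> 0" using meet_height[OF m(2) h] by (simp add: p1_def p3_def)
  have k: "cross (fst (shear v dC)) u = 0"
  proof -
   have "(snd (p1 - p3) * x) * cross (fst (shear v dC)) u = cross (fst (shear v dC)) (fst (shear v (p1 - p3)))" unfolding h13 by simp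
   also have "\<dots> = 0" unfolding d2 by simp
   finally show ?thesis using n x0 by simp
  qed
  have "cross (fst (shear v dC)) u = cross (fst (shear w dC)) u" by (simp add: v_def cross_add algebra_simps)
  then have "aff dB dC w = 0" using k by (simp add: aff_def u_def cross_commute[of "fst dB + snd dB *\<^sub>R w"])
  then show False using c(3) by simp
 qed
 then show ?thesis using dv(1) by blast
qed

definition generic :: "complex set => bool" where
 "generic Q \<longleftrightarrow> open Q \<and> closure Q = UNIV"

lemma generic_INT:
 assumes "finite I" "\<And>i. i \<in> I ==> generic (Q i)"
 shows "generic (\<Inter>i\<in>I. Q i)" using assms shear_param_exists[of I Q] by (simp add: generic_def open_INT)

lemma generic_Int: "generic A ==> generic B ==> generic (A \<inter> B)"
 using generic_INT[of UNIV "\<lambda>b. if b then A else B"] by (simp add: UNIV_bool Int_commute)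

lemma generic_UNIV: "generic UNIV" by (simp add: generic_def)

lemma generic_nonvertical:
 assumes "d \<noteq> 0"
 shows "generic {w. fst (shear w d) \<noteq> 0}"
proof (cases "snd d = 0")
 case True
 then have "fst d \<noteq> 0" using assms by (simp add: prod_eq_iff)
 then show ?thesis using True by (simp add: generic_UNIV)
next
 case False
 have "fst (shear w d) = 0 \<longleftrightarrow> w = - ((1 / snd d) *\<^sub>R fst d)" for w
 proof -
  have "fst (shear w d) = snd d *\<^sub>R (w + (1 / snd d) *\<^sub>R fst d)" using False by (simp add: scaleR_add_right)
  then show ?thesis using False by (simp add: eq_neg_iff_add_eq_0)
 qed
 then have "{w. fst (shear w d) \<noteq> 0} = - {- ((1 / snd d) *\<^sub>R fst d)}" by blast
 then show ?thesis by (simp add: generic_def open_Compl closure_complement)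
qed

definition seg :: "space \<times> space => space set" where
 "seg A = (\<lambda>t. fst A + t *\<^sub>R snd A) ` {0..1}"

definition collinear2 :: "space \<times> space => space \<times> space => bool" where
 "collinear2 A B \<longleftrightarrow> (\<exists>s. fst B - fst A = s *\<^sub>R snd A) \<and> (\<exists>s. snd B = s *\<^sub>R snd A)"

abbreviation good2 :: "complex => space \<times> space => space \<times> space => bool" where
 "good2 w A B \<equiv> good w (fst A) (snd A) (fst B) (snd B)"

text \<open>Openness is \<open>closed_triple\<close>. For density, first move slightly to a tilt at
  which the three segments are in good mutual position, then remove a remaining triple point by
  \<open>triple_destroy\<close>.\<close>

lemma generic_no_triple:
 assumes d: "snd A \<noteq> 0" "snd B \<noteq> 0" "snd C \<noteq> 0"
  and nc: "\<not> collinear2 A B" "\<not> collinear2 A C" "\<not> collinear2 B C"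
  and dis: "seg A \<inter> seg C = {}"
 shows "generic (- triple A B C)"
proof -
 let ?G = "{w. good2 w A B} \<inter> ({w. good2 w A C} \<inter> ({w. good2 w B C} \<inter> ({w. fst (shear w (snd A)) \<noteq> 0} \<inter> {w. fst (shear w (snd B)) \<noteq> 0})))"
 have gg: "generic {w. good2 w X Y}" if "snd X \<noteq> 0" "snd Y \<noteq> 0" "\<not> collinear2 X Y" for X Y
  unfolding generic_def using that by (intro conjI dense_good) (auto simp: collinear2_def)
 have G: "generic ?G" by (intro generic_Int gg generic_nonvertical d nc)
 have "w \<in> closure (- triple A B C)" for w unfolding closure_approachable
 proof (intro allI impI)
  fix e :: real assume "e > 0"
  have "w \<in> closure ?G" using G unfolding generic_def by simp
  then obtain v where v: "v \<in> ?G" "dist v w < e / 2" using \<open>e > 0\<close> unfolding closure_approachable by (meson half_gt_zero)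
  show "\<exists>y\<in>- triple A B C. dist y w < e"
  proof (cases "v \<in> triple A B C")
   case False
   then show ?thesis using v(2) \<open>e > 0\<close> by (intro bexI[of _ v]) auto
  next
   case True
   then obtain s t r where m: "s \<in> {0..1}" "r \<in> {0..1}" "meet v (fst A + s *\<^sub>R snd A) (fst B + t *\<^sub>R snd B)"
    "meet v (fst A + s *\<^sub>R snd A) (fst C + r *\<^sub>R snd C)" unfolding triple_def by blast
   have m': "meet v (fst B + t *\<^sub>R snd B) (fst C + r *\<^sub>R snd C)" using m(3,4) unfolding meet_def by simp
   have g: "good2 v A B" "good2 v A C" "good2 v B C" "fst (shear v (snd A)) \<noteq> 0" "fst (shear v (snd B)) \<noteq> 0" using v(1) by simp_all
   have "fst A + s *\<^sub>R snd A \<in> seg A" "fst C + r *\<^sub>R snd C \<in> seg C" using m(1,2) by (auto simp: seg_def)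
   then have "fst A + s *\<^sub>R snd A \<noteq> fst C + r *\<^sub>R snd C" using dis by (metis disjoint_iff)
   then obtain u where "dist u v < e / 2" "u \<notin> triple A B C"
    using triple_destroy[OF good_meet[OF g(1,4) m(3)] good_meet[OF g(2,4) m(4)] good_meet[OF g(3,5) m'] m(3,4) _ half_gt_zero[OF \<open>e > 0\<close>]] by auto
   then show ?thesis using v(2) dist_triangle_half_r[of u v e w] dist_triangle[of u w v] by (intro bexI[of _ u]) auto
  qed
 qed
 then show ?thesis using closed_triple by (auto simp: generic_def open_Compl)
qed

lemma generic_if: "(\<not> Q ==> generic A) ==> generic {w. Q \<or> w \<in> A}" by (cases Q) (simp_all add: generic_UNIV)

lemma generic_shear:
 assumes S: "finite S" "\<And>A. A \<in> S ==> snd A \<noteq> 0"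
 obtains w where "\<And>A. A \<in> S ==> fst (shear w (snd A)) \<noteq> 0"
  "\<And>A B. [|A \<in> S; B \<in> S; \<not> collinear2 A B|] ==> good2 w A B"
  "\<And>A B. [|A \<in> S; B \<in> S; \<nexists>s. fst B - fst A = s *\<^sub>R snd A|] ==> aff (fst B - fst A) (snd A) w \<noteq> 0"
  "\<And>A B C. [|A \<in> S; B \<in> S; C \<in> S; \<not> collinear2 A B; \<not> collinear2 A C; \<not> collinear2 B C; seg A \<inter> seg C = {}|] ==> w \<notin> triple A B C"
proof -
 let ?N = "\<Inter>A\<in>S. {w. fst (shear w (snd A)) \<noteq> 0}"
 let ?G = "\<Inter>(A, B)\<in>S \<times> S. {w. collinear2 A B \<or> w \<in> {w. good2 w A B}}"
 let ?V = "\<Inter>(A, B)\<in>S \<times> S. {w. (\<exists>s. fst B - fst A = s *\<^sub>R snd A) \<or> w \<in> {w. aff (fst B - fst A) (snd A) w \<noteq> 0}}"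
 let ?T = "\<Inter>(A, B, C)\<in>S \<times> S \<times> S. {w. \<not> (\<not> collinear2 A B \<and> \<not> collinear2 A C \<and> \<not> collinear2 B C \<and> seg A \<inter> seg C = {}) \<or> w \<in> - triple A B C}"
 have "generic ?N" by (intro generic_INT S generic_nonvertical)
 moreover have "generic ?G"
 proof (rule generic_INT)
  fix X assume "X \<in> S \<times> S"
  then obtain A B where X: "X = (A, B)" "A \<in> S" "B \<in> S" by blast
  have "generic {w. good2 w A B}" if "\<not> collinear2 A B"
   unfolding generic_def using that S(2) X by (intro conjI dense_good) (auto simp: collinear2_def)
  then show "generic (case X of (A, B) => {w. collinear2 A B \<or> w \<in> {w. good2 w A B}})" unfolding X prod.case by (rule generic_if)
 qed (use S in simp)
 moreover have "generic ?V"
 proof (rule generic_INT)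
  fix X assume "X \<in> S \<times> S"
  then obtain A B where X: "X = (A, B)" "A \<in> S" "B \<in> S" by blast
  have "generic {w. aff (fst B - fst A) (snd A) w \<noteq> 0}" if n: "\<nexists>s. fst B - fst A = s *\<^sub>R snd A"
  proof -
   obtain w0 where "aff (fst B - fst A) (snd A) w0 \<noteq> 0" using n aff_eq_0_parallel[OF _ S(2)[OF X(2)]] by metis
   then show ?thesis unfolding generic_def using open_aff dense_aff by blast
  qed
  then show "generic (case X of (A, B) => {w. (\<exists>s. fst B - fst A = s *\<^sub>R snd A) \<or> w \<in> {w. aff (fst B - fst A) (snd A) w \<noteq> 0}})"
   unfolding X prod.case by (rule generic_if)
 qed (use S in simp)
 moreover have "generic ?T"
 proof (rule generic_INT)
  fix X assume "X \<in> S \<times> S \<times> S"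
  then obtain A B C where X: "X = (A, B, C)" "A \<in> S" "B \<in> S" "C \<in> S" by blast
  show "generic (case X of (A, B, C) => {w. \<not> (\<not> collinear2 A B \<and> \<not> collinear2 A C \<and> \<not> collinear2 B C \<and> seg A \<inter> seg C = {}) \<or> w \<in> - triple A B C})"
   unfolding X prod.case by (rule generic_if) (use generic_no_triple S(2) X in simp)
 qed (use S in simp)
 ultimately have "generic (?N \<inter> (?G \<inter> (?V \<inter> ?T)))" by (intro generic_Int)
 then have "?N \<inter> (?G \<inter> (?V \<inter> ?T)) \<noteq> {}" unfolding generic_def using closure_empty by (metis UNIV_not_empty)
 then obtain w where w: "w \<in> ?N" "w \<in> ?G" "w \<in> ?V" "w \<in> ?T" unfolding ex_in_conv[symmetric] by (elim exE IntE)
 show ?thesis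
 proof (rule that[of w])
  show "fst (shear w (snd A)) \<noteq> 0" if "A \<in> S" for A using w(1) that by blast
  show "good2 w A B" if "A \<in> S" "B \<in> S" "\<not> collinear2 A B" for A B using INT_D[OF w(2), of "(A, B)"] that by simp
  show "aff (fst B - fst A) (snd A) w \<noteq> 0" if "A \<in> S" "B \<in> S" "\<nexists>s. fst B - fst A = s *\<^sub>R snd A" for A B
   using INT_D[OF w(3), of "(A, B)"] that by simp
  show "w \<notin> triple A B C" if "A \<in> S" "B \<in> S" "C \<in> S" "\<not> collinear2 A B" "\<not> collinear2 A C" "\<not> collinear2 B C" "seg A \<inter> seg C = {}" for A B C
   using INT_D[OF w(4), of "(A, B, C)"] that by simp
 qed
qed

text \<open>Distinct points of two segments over the same point of the plane rule out collinearity,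
  since no segment is vertical. The projected lines then meet only once, so a common point in space
  would force \<open>p = q\<close>.\<close>

lemma two_points_meet:
 assumes g: "\<not> collinear2 A B ==> good2 w A B" and v: "fst (shear w (snd A)) \<noteq> 0"
  and p: "p = fst A + s *\<^sub>R snd A" and q: "q = fst B + t *\<^sub>R snd B" and m: "meet w p q" "p \<noteq> q"
 shows "\<not> collinear2 A B" "aff (snd A) (snd B) w \<noteq> 0" "seg A \<inter> seg B = {}"
proof -
 show nc: "\<not> collinear2 A B"
 proof
  assume "collinear2 A B"
  then obtain r u where ru: "fst B - fst A = r *\<^sub>R snd A" "snd B = u *\<^sub>R snd A" unfolding collinear2_def by blast
  have "fst B = fst A + r *\<^sub>R snd A" using ru(1) by (metis add.commute diff_add_cancel)
  then have "p - q = (s - (r + t * u)) *\<^sub>R snd A" unfolding p q ru(2) by (simp add: scaleR_diff_left scaleR_add_left)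
  then have "p - q = 0" by (rule collinear_shear_inj[OF _ v]) (use m(1) in \<open>simp only: meet_diff\<close>)
  then show False using m(2) by simp
 qed
 have m': "meet w (fst A + s *\<^sub>R snd A) (fst B + t *\<^sub>R snd B)" using m(1) unfolding p q .
 show c: "aff (snd A) (snd B) w \<noteq> 0" by (rule good_meet[OF g[OF nc] v m'])
 show "seg A \<inter> seg B = {}"
 proof (rule ccontr)
  assume "seg A \<inter> seg B \<noteq> {}"
  then obtain x where "x \<in> seg A" "x \<in> seg B" by blast
  then obtain s' t' where "x = fst A + s' *\<^sub>R snd A" "x = fst B + t' *\<^sub>R snd B" unfolding seg_def by (elim imageE)
  then have e: "fst A + s' *\<^sub>R snd A = fst B + t' *\<^sub>R snd B" by simp
  then have m2: "meet w (fst A + s' *\<^sub>R snd A) (fst B + t' *\<^sub>R snd B)" by (simp add: meet_def)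
  note u = meet_unique[OF c m' m2]
  have "p = q" unfolding p q u by (rule e)
  then show False using m(2) by simp
 qed
qed

lemma card_le_2:
 assumes "\<And>x y z. [|x \<in> S; y \<in> S; z \<in> S|] ==> x = y \<or> y = z \<or> x = z"
 shows "finite S \<and> card S \<le> 2"
proof (rule ccontr)
 assume "\<not> (finite S \<and> card S \<le> 2)"
 then have "\<exists>T\<subseteq>S. card T = 3"
 proof (cases "finite S")
  case True
  then have "3 \<le> card S" using \<open>\<not> (finite S \<and> card S \<le> 2)\<close> by simp
  then show ?thesis using obtain_subset_with_card_n by metis
 next
  case False
  then show ?thesis using infinite_arbitrarily_large by metis
 qed
 then obtain x y z where "{x, y, z} \<subseteq> S" "x \<noteq> y" "y \<noteq> z" "x \<noteq> z" by (metis card_3_iff)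
 then show False using assms[of x y z] by simp
qed

lemma vertex_map: "vs \<noteq> [] ==> vertex (map f vs) i = f (vertex vs i)" by (simp add: vertex_def)

lemma edge_map:
 assumes "vs \<noteq> []" "linear f"
 shows "edge (map f vs) i = f ` edge vs i" using assms by (simp add: edge_def vertex_map closed_segment_linear_image)

lemma polygon_set_map:
 assumes "vs \<noteq> []" "linear f"
 shows "polygon_set (map f vs) = f ` polygon_set vs" using edge_map[OF assms] by (simp add: polygon_set_def image_UN)

lemma simple_polygon_nonempty: "simple_polygon vs ==> vs \<noteq> []" by (auto simp: simple_polygon_def)

lemma link_set_map:
 assumes "polygonal_link P" "linear f"
 shows "link_set (map f ` P) = f ` link_set P"
proof -
 have "polygon_set (map f vs) = f ` polygon_set vs" if "vs \<in> P" for vs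
  using polygon_set_map[OF simple_polygon_nonempty assms(2)] assms(1) that by (simp add: polygonal_link_def)
 then show ?thesis by (simp add: link_set_def image_UN)
qed

lemma simple_polygon_map:
 assumes vs: "simple_polygon vs" and f: "linear f" "inj f"
 shows "simple_polygon (map f vs)"
proof -
 note ne = simple_polygon_nonempty[OF vs]
 have "edge (map f vs) i \<inter> edge (map f vs) j =
   {v. (v = vertex (map f vs) j \<and> j = Suc i mod length (map f vs)) \<or>
     (v = vertex (map f vs) i \<and> i = Suc j mod length (map f vs))}"
  if "i < length vs" "j < length vs" "i \<noteq> j" for i j
 proof -
  have "edge vs i \<inter> edge vs j = {v. (v = vertex vs j \<and> j = Suc i mod length vs) \<or>
     (v = vertex vs i \<and> i = Suc j mod length vs)}" using vs that unfolding simple_polygon_def by simp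
  then have "f ` edge vs i \<inter> f ` edge vs j = f ` {v. (v = vertex vs j \<and> j = Suc i mod length vs) \<or>
     (v = vertex vs i \<and> i = Suc j mod length vs)}" by (simp add: image_Int[OF f(2), symmetric])
  then show ?thesis unfolding edge_map[OF ne f(1)] vertex_map[OF ne] length_map by blast
 qed
 moreover have "distinct (map f vs)" "3 \<le> length (map f vs)" using vs f(2) by (auto simp: simple_polygon_def distinct_map inj_on_def)
 ultimately show ?thesis unfolding simple_polygon_def by simp
qed

lemma polygonal_link_map:
 assumes P: "polygonal_link P" and f: "linear f" "inj f"
 shows "polygonal_link (map f ` P)" unfolding polygonal_link_def
proof (intro conjI ballI)
 show "finite (map f ` P)" "map f ` P \<noteq> {}" using P by (simp_all add: polygonal_link_def)
 show "simple_polygon vs" if vs: "vs \<in> map f ` P" for vs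
 proof -
  obtain us where "us \<in> P" "vs = map f us" using vs by (rule imageE)
  then show ?thesis using simple_polygon_map[OF _ f] P by (simp add: polygonal_link_def)
 qed
 show "pairwise (\<lambda>vs ws. disjnt (polygon_set vs) (polygon_set ws)) (map f ` P)"
 proof (rule pairwiseI)
  fix vs ws assume "vs \<in> map f ` P" "ws \<in> map f ` P" "vs \<noteq> ws"
  then obtain us ts where u: "us \<in> P" "ts \<in> P" "vs = map f us" "ws = map f ts" "us \<noteq> ts" by blast
  then have "disjnt (polygon_set us) (polygon_set ts)" "us \<noteq> []" "ts \<noteq> []"
   using P simple_polygon_nonempty by (auto simp: polygonal_link_def pairwise_def)
  then show "disjnt (polygon_set vs) (polygon_set ws)" unfolding u by (simp add: polygon_set_map f(1) disjnt_def image_Int[OF f(2), symmetric])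
 qed
qed

text \<open>The genericity conditions yield regular position: absence of triples bounds the fibres,
  two edges contribute at most one double point, and a vertex meets the line of an edge in
  projection only if it lies on that line in space.\<close>

lemma regular_shear:
 assumes P: "polygonal_link P"
 obtains w where "diagram (map (shear w) ` P)"
proof -
 define S where "S = (\<Union>vs\<in>P. (\<lambda>i. (vertex vs i, edge_dir vs i)) ` {..<length vs})"
 have fin: "finite S" using P by (simp add: S_def polygonal_link_def)
 have nz: "snd A \<noteq> 0" if "A \<in> S" for A using that edge_dir_nonzero[OF P] by (auto simp: S_def)
 obtain w where N: "\<And>A. A \<in> S ==> fst (shear w (snd A)) \<noteq> 0"
  and G: "\<And>A B. [|A \<in> S; B \<in> S; \<not> collinear2 A B|] ==> good2 w A B"
  and V: "\<And>A B. [|A \<in> S; B \<in> S; \<nexists>s. fst B - fst A = s *\<^sub>R snd A|] ==> aff (fst B - fst A) (snd A) w \<noteq> 0"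
  and T: "\<And>A B C. [|A \<in> S; B \<in> S; C \<in> S; \<not> collinear2 A B; \<not> collinear2 A C; \<not> collinear2 B C; seg A \<inter> seg C = {}|] ==> w \<notin> triple A B C"
  by (rule generic_shear[OF fin nz], assumption) (rule that; assumption)
 let ?P = "map (shear w) ` P"
 have edge: "edge vs i = seg (vertex vs i, edge_dir vs i)" for vs i
  by (auto simp: edge_def seg_def closed_segment_image_interval edge_dir_def algebra_simps)
 have K: "link_set P = (\<Union>A\<in>S. seg A)" unfolding link_set_def polygon_set_def S_def edge by simp
 have pt: "\<exists>A\<in>S. \<exists>t\<in>{0..1}. p = fst A + t *\<^sub>R snd A" if "p \<in> link_set P" for p
  using that unfolding K seg_def by blast
 have two: "\<exists>A\<in>S. \<exists>B\<in>S. \<exists>s\<in>{0..1}. \<exists>t\<in>{0..1}. p = fst A + s *\<^sub>R snd A \<and> q = fst B + t *\<^sub>R snd B" if "p \<in> link_set P" "q \<in> link_set P" for p q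
  using pt[OF that(1)] pt[OF that(2)] by blast
 have KP: "link_set ?P = shear w ` link_set P" by (rule link_set_map[OF P linear_shear])
 have fib: "fibre ?P z = shear w ` {p \<in> link_set P. fst (shear w p) = z}" for z unfolding fibre_def KP by blast
 have no3: "x = y \<or> y = z \<or> x = z" if x: "x \<in> link_set P" "y \<in> link_set P" "z \<in> link_set P" "meet w x y" "meet w x z" for x y z
 proof (rule ccontr)
  assume "\<not> (x = y \<or> y = z \<or> x = z)"
  then have ne: "x \<noteq> y" "x \<noteq> z" "y \<noteq> z" by auto
  obtain A s where A: "A \<in> S" "s \<in> {0..1}" "x = fst A + s *\<^sub>R snd A" using pt[OF x(1)] by (elim bexE)
  obtain B t where B: "B \<in> S" "t \<in> {0..1}" "y = fst B + t *\<^sub>R snd B" using pt[OF x(2)] by (elim bexE)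
  obtain C r where C: "C \<in> S" "r \<in> {0..1}" "z = fst C + r *\<^sub>R snd C" using pt[OF x(3)] by (elim bexE)
  have yz: "meet w y z" using x(4,5) by (simp only: meet_def)
  note AB = two_points_meet[OF G[OF A(1) B(1)] N[OF A(1)] A(3) B(3) x(4) ne(1)]
  note AC = two_points_meet[OF G[OF A(1) C(1)] N[OF A(1)] A(3) C(3) x(5) ne(2)]
  note BC = two_points_meet[OF G[OF B(1) C(1)] N[OF B(1)] B(3) C(3) yz ne(3)]
  have "w \<in> triple A B C" unfolding triple_def using A B C x(4,5) by blast
  then show False using T[OF A(1) B(1) C(1) AB(1) AC(1) BC(1) AC(3)] by simp
 qed
 have "finite (fibre ?P z) \<and> card (fibre ?P z) \<le> 2" for z
 proof (rule card_le_2)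
  fix a b c assume "a \<in> fibre ?P z" "b \<in> fibre ?P z" "c \<in> fibre ?P z"
  then obtain x y v where "a = shear w x" "b = shear w y" "c = shear w v" "x \<in> link_set P" "y \<in> link_set P" "v \<in> link_set P"
   "fst (shear w x) = z" "fst (shear w y) = z" "fst (shear w v) = z" unfolding fib by blast
  then show "a = b \<or> b = c \<or> a = c" using no3[of x y v] unfolding meet_def by metis
 qed
 moreover have "finite {z. card (fibre ?P z) = 2}"
 proof -
  define Z where "Z A B = {z. \<exists>s t. fst A + s *\<^sub>R snd A \<noteq> fst B + t *\<^sub>R snd B \<and> meet w (fst A + s *\<^sub>R snd A) (fst B + t *\<^sub>R snd B) \<and>
   z = fst (shear w (fst A + s *\<^sub>R snd A))}" for A B
  have one: "finite (Z A B)" if AB: "A \<in> S" "B \<in> S" for A B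
  proof -
   have "z = z'" if z: "z \<in> Z A B" "z' \<in> Z A B" for z z'
   proof -
    obtain s t where 1: "fst A + s *\<^sub>R snd A \<noteq> fst B + t *\<^sub>R snd B" "meet w (fst A + s *\<^sub>R snd A) (fst B + t *\<^sub>R snd B)"
     "z = fst (shear w (fst A + s *\<^sub>R snd A))" using z(1) unfolding Z_def by blast
    obtain s' t' where 2: "meet w (fst A + s' *\<^sub>R snd A) (fst B + t' *\<^sub>R snd B)"
     "z' = fst (shear w (fst A + s' *\<^sub>R snd A))" using z(2) unfolding Z_def by blast
    have "aff (snd A) (snd B) w \<noteq> 0" by (rule two_points_meet(2)[OF G[OF AB] N[OF AB(1)] refl refl 1(2,1)])
    then have "s = s'" by (rule meet_unique(1)[OF _ 1(2) 2(1)])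
    then show ?thesis unfolding 1(3) 2(2) by simp
   qed
   then have "Z A B \<subseteq> {} \<or> (\<exists>z. Z A B \<subseteq> {z})" by blast
   then show ?thesis using finite_subset by blast
  qed
  have "{z. card (fibre ?P z) = 2} \<subseteq> (\<Union>A\<in>S. \<Union>B\<in>S. Z A B)"
  proof
   fix z assume "z \<in> {z. card (fibre ?P z) = 2}"
   then have "card (fibre ?P z) = 2" by simp
   then obtain a b where ab: "fibre ?P z = {a, b}" "a \<noteq> b" unfolding card_2_iff by (elim exE conjE)
   have "a \<in> fibre ?P z" "b \<in> fibre ?P z" unfolding ab(1) by simp_all
   then obtain p q where pq: "p \<in> {p \<in> link_set P. fst (shear w p) = z}" "a = shear w p"
    "q \<in> {p \<in> link_set P. fst (shear w p) = z}" "b = shear w q" unfolding fib by (elim imageE)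
   then have p: "p \<in> link_set P" "q \<in> link_set P" "fst (shear w p) = z" "fst (shear w q) = z" by simp_all
   have p5: "p \<noteq> q" using ab(2) unfolding pq(2,4) by (rule contrapos_nn) simp
   obtain A B s t where AB: "A \<in> S" "B \<in> S" "p = fst A + s *\<^sub>R snd A" "q = fst B + t *\<^sub>R snd B"
    using two[OF p(1,2)] by (elim bexE conjE) (rule that; assumption)
   have "z \<in> Z A B" unfolding Z_def mem_Collect_eq using p(3,4) p5 unfolding AB meet_def by (intro exI[of _ s] exI[of _ t]) simp
   then show "z \<in> (\<Union>A\<in>S. \<Union>B\<in>S. Z A B)" using AB(1,2) by blast
  qed
  then show ?thesis by (rule finite_subset) (use fin one in simp)
 qed
 moreover have "fibre ?P (fst v) = {v}" if v: "vs' \<in> ?P" "v \<in> set vs'" for vs' v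
 proof -
  obtain vs where vs: "vs \<in> P" "vs' = map (shear w) vs" using v(1) by (rule imageE)
  obtain x where x: "x \<in> set vs" "v = shear w x" using v(2) unfolding vs by auto
  then obtain i where i: "i < length vs" "x = vs ! i" by (metis in_set_conv_nth)
  define B where "B = (vertex vs i, edge_dir vs i)"
  have B: "B \<in> S" "x = fst B" using i vs by (auto simp: B_def S_def vertex_def)
  have xK: "x \<in> link_set P" unfolding K using B by (intro UN_I[OF B(1)]) (auto simp: seg_def intro: image_eqI[of _ _ 0])
  have "q = x" if q: "q \<in> link_set P" "fst (shear w q) = fst (shear w x)" for q
  proof -
   obtain A t where A: "A \<in> S" "t \<in> {0..1}" "q = fst A + t *\<^sub>R snd A" using pt[OF q(1)] by (elim bexE)
   have f: "fst (shear w (x - fst A)) = t *\<^sub>R fst (shear w (snd A))" using q(2) unfolding A(3) by (simp add: algebra_simps)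
   \<comment> \<open>The vertex lies on the line of the edge already in space. As the edge is not
     vertical after the shear, equal projections then mean equal points.\<close>
   have "\<exists>s. fst B - fst A = s *\<^sub>R snd A"
   proof (rule ccontr)
    assume "\<nexists>s. fst B - fst A = s *\<^sub>R snd A"
    from V[OF A(1) B(1) this] show False using f B(2) by (simp add: aff_def del: shear_simps)
   qed
   then obtain s where s: "x - fst A = s *\<^sub>R snd A" using B(2) by auto
   then have "s *\<^sub>R fst (shear w (snd A)) = t *\<^sub>R fst (shear w (snd A))" using f by (simp add: algebra_simps)
   then have "s = t" using N[OF A(1)] by (simp del: shear_simps)
   then show ?thesis unfolding A(3) using s by (metis add.commute diff_add_cancel)
  qed
  then have "{p \<in> link_set P. fst (shear w p) = fst v} = {x}" using xK unfolding x(2) by blast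
  then show ?thesis unfolding fib by (simp add: x(2))
 qed
 ultimately have "regular_position ?P" unfolding regular_position_def by blast
 then show ?thesis using that polygonal_link_map[OF P linear_shear inj_shear] unfolding diagram_def by blast
qed

section \<open>Shears as ambient isotopies\<close>

lemma ambient_isotopicE:
 assumes "ambient_isotopic A B"
 obtains H :: "real \<times> (space \<times> real) => space \<times> real" where "continuous_on ({0..1} \<times> S3) H" "\<And>t. t \<in> {0..1} ==> \<exists>g. homeomorphism S3 S3 (\<lambda>x. H (t, x)) g"
  "\<forall>x\<in>S3. H (0, x) = x" "(\<lambda>x. H (1, x)) ` A = B"
proof -
 obtain H :: "real \<times> (space \<times> real) => space \<times> real" where "continuous_on ({0..1} \<times> S3) H \<and> (\<forall>t\<in>{0..1}. Ex (homeomorphism S3 S3 (\<lambda>x. H (t, x)))) \<and>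
   (\<forall>x\<in>S3. H (0, x) = x) \<and> (\<lambda>x. H (1, x)) ` A = B" using assms unfolding ambient_isotopic_def by (rule exE) (rule that)
 then show ?thesis by (intro that[of H]) simp_all
qed

lemma ambient_isotopic_trans:
 assumes "ambient_isotopic A B" "ambient_isotopic B C"
 shows "ambient_isotopic A C"
proof -
 obtain H :: "real \<times> (space \<times> real) => space \<times> real" where H: "continuous_on ({0..1} \<times> S3) H" "\<And>t. t \<in> {0..1} ==> \<exists>g. homeomorphism S3 S3 (\<lambda>x. H (t, x)) g"
  "\<forall>x\<in>S3. H (0, x) = x" "(\<lambda>x. H (1, x)) ` A = B" by (rule ambient_isotopicE[OF assms(1)]) (rule that; assumption)
 obtain G :: "real \<times> (space \<times> real) => space \<times> real" where G: "continuous_on ({0..1} \<times> S3) G" "\<And>t. t \<in> {0..1} ==> \<exists>g. homeomorphism S3 S3 (\<lambda>x. G (t, x)) g"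
  "\<forall>x\<in>S3. G (0, x) = x" "(\<lambda>x. G (1, x)) ` B = C" by (rule ambient_isotopicE[OF assms(2)]) (rule that; assumption)
 have HS: "H (t, x) \<in> S3" if tx: "t \<in> {0..1}" "x \<in> S3" for t x
 proof -
  obtain g where "homeomorphism S3 S3 (\<lambda>x. H (t, x)) g" using H(2)[OF tx(1)] by (rule exE)
  from homeomorphism_image1[OF this] show ?thesis using tx(2) by blast
 qed
 define F where "F p = G (fst p, H p)" for p
 show ?thesis unfolding ambient_isotopic_def
 proof (intro exI[of _ F] conjI ballI)
  show "continuous_on ({0..1} \<times> S3) F" unfolding F_def by (rule continuous_on_compose2[OF G(1), of _ "\<lambda>p. (fst p, H p)"])
    (use HS in \<open>auto intro!: continuous_intros H(1) simp del: split_paired_All\<close>)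
  fix t :: real assume t: "t \<in> {0..1}"
  obtain g1 where g1: "homeomorphism S3 S3 (\<lambda>x. H (t, x)) g1" using H(2)[OF t] by (rule exE)
  obtain g2 where g2: "homeomorphism S3 S3 (\<lambda>x. G (t, x)) g2" using G(2)[OF t] by (rule exE)
  show "\<exists>g. homeomorphism S3 S3 (\<lambda>x. F (t, x)) g" using homeomorphism_compose[OF g1 g2] by (auto simp: F_def comp_def)
 next
  show "F (0, x) = x" if "x \<in> S3" for x using H(3) G(3) that by (simp add: F_def)
  show "(\<lambda>x. F (1, x)) ` A = C" unfolding F_def H(4)[symmetric] G(4)[symmetric] by (simp add: image_image)
 qed
qed

definition shear_S3 :: "complex => space \<times> real => space \<times> real" where
 "shear_S3 v x = (if x = infty then infty else to_S3 (shear v (from_S3 x)))"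

lemma infty_S3: "infty \<in> S3" by (simp add: S3_iff infty_def)

lemma norm_shear: "norm (shear v x) \<le> (1 + norm v) * norm x"
proof -
 have "norm (shear v x) = norm (x + (snd x *\<^sub>R v, 0))" by (cases x) (simp add: shear_def)
 also have "\<dots> \<le> norm x + norm (snd x *\<^sub>R v, 0 :: real)" by (rule norm_triangle_ineq)
 also have "norm (snd x *\<^sub>R v, 0 :: real) = \<bar>snd x\<bar> * norm v" by (simp add: norm_Pair)
 also have "norm x + \<bar>snd x\<bar> * norm v \<le> norm x + norm x * norm v"
  using norm_snd_le[of "snd x" "fst x"] by (intro add_left_mono mult_right_mono) auto
 finally show ?thesis by (simp add: algebra_simps)
qed

text \<open>A shear distorts the distance to the point at infinity by a bounded factor only.\<close>

lemma dist_shear_S3: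
 assumes "x \<in> S3"
 shows "dist (shear_S3 v x) infty \<le> (1 + norm v) * dist x infty"
proof (cases "x = infty")
 case False
 define y where "y = from_S3 x"
 have x: "x = to_S3 y" using to_from_S3[OF assms False] by (simp add: y_def)
 have "norm y = norm (shear (- v) (shear v y))" by (simp add: shear_shear)
 also have "\<dots> \<le> (1 + norm v) * norm (shear v y)" using norm_shear[of "- v"] by simp
 finally have "(norm y)\<^sup>2 \<le> ((1 + norm v) * norm (shear v y))\<^sup>2" by (intro power_mono) auto
 moreover have "1 \<le> (1 + norm v)\<^sup>2" by (rule one_le_power) simp
 ultimately have "(norm y)\<^sup>2 + 1 \<le> (1 + norm v)\<^sup>2 * ((norm (shear v y))\<^sup>2 + 1)"
  unfolding power_mult_distrib distrib_left mult_1_right by (rule add_mono)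
 then have "4 / ((norm (shear v y))\<^sup>2 + 1) \<le> (1 + norm v)\<^sup>2 * (4 / ((norm y)\<^sup>2 + 1))"
  using norm_sq_pos[of y] norm_sq_pos[of "shear v y"] by (simp add: field_simps)
 then have "(dist (shear_S3 v x) infty)\<^sup>2 \<le> ((1 + norm v) * dist x infty)\<^sup>2"
  unfolding power_mult_distrib using False dist_infty[of y] dist_infty[of "shear v y"] by (simp add: shear_S3_def flip: y_def x)
 then show ?thesis by (rule power2_le_imp_le) simp
qed (simp add: shear_S3_def)

lemma shear_S3_in: "x \<in> S3 ==> shear_S3 v x \<in> S3" by (simp add: shear_S3_def to_S3_in_S3 infty_S3)

text \<open>Away from infinity this is a composition of continuous maps; at infinity the bound of
  \<open>dist_shear_S3\<close> gives convergence, uniformly enough in the shear parameter.\<close>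

lemma continuous_shear_S3: "continuous_on (UNIV \<times> S3) (\<lambda>p. shear_S3 (fst p) (snd p))" unfolding continuous_on_eq_continuous_within
proof
 fix p :: "complex \<times> (space \<times> real)" assume p: "p \<in> UNIV \<times> S3"
 show "continuous (at p within UNIV \<times> S3) (\<lambda>p. shear_S3 (fst p) (snd p))"
 proof (cases "snd p = infty")
  case False
  have "continuous_on (UNIV \<times> (S3 - {infty})) (\<lambda>p. to_S3 (shear (fst p) (from_S3 (snd p))))" unfolding shear_def
   by (intro continuous_on_compose2[OF continuous_to_S3[of UNIV]] continuous_intros
    continuous_on_compose2[OF continuous_from_S3, of _ snd] subset_UNIV) auto
  moreover have "continuous_on (UNIV \<times> (S3 - {infty})) (\<lambda>p. shear_S3 (fst p) (snd p)) \<longleftrightarrow>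
    continuous_on (UNIV \<times> (S3 - {infty})) (\<lambda>p. to_S3 (shear (fst p) (from_S3 (snd p))))"
   by (rule continuous_on_cong) (auto simp: shear_S3_def)
  ultimately have "continuous_on (UNIV \<times> (S3 - {infty})) (\<lambda>p. shear_S3 (fst p) (snd p))" by (rule iffD2[rotated])
  then have "continuous (at p within UNIV \<times> (S3 - {infty})) (\<lambda>p. shear_S3 (fst p) (snd p))"
   unfolding continuous_on_eq_continuous_within by (rule bspec) (use p False in \<open>simp add: mem_Times_iff\<close>)
  moreover have "at p within UNIV \<times> S3 = at p within UNIV \<times> (S3 - {infty})"
   by (rule at_within_nhd[of _ "UNIV \<times> - {infty}"]) (use False in \<open>auto simp: mem_Times_iff intro: open_Times\<close>)
  ultimately show ?thesis by simp
 next
  case True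
  have v: "shear_S3 (fst p) (snd p) = infty" using True by (simp add: shear_S3_def)
  have "((\<lambda>q. dist (shear_S3 (fst q) (snd q)) infty) \<longlongrightarrow> 0) (at p within UNIV \<times> S3)"
  proof (rule tendsto_sandwich[of "\<lambda>_. 0"])
   show "\<forall>\<^sub>F q in at p within UNIV \<times> S3. dist (shear_S3 (fst q) (snd q)) infty \<le> (1 + norm (fst q)) * dist (snd q) infty"
    unfolding eventually_at_filter by (intro always_eventually) (auto simp del: split_paired_All simp: mem_Times_iff dist_shear_S3)
   have "((\<lambda>q. (1 + norm (fst q)) * dist (snd q) infty) \<longlongrightarrow> (1 + norm (fst p)) * dist (snd p) infty) (at p within UNIV \<times> S3)"
    by (intro tendsto_intros)
   then show "((\<lambda>q. (1 + norm (fst q)) * dist (snd q) infty) \<longlongrightarrow> 0) (at p within UNIV \<times> S3)" using True by simp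
  qed auto
  then show ?thesis unfolding continuous_within v by (subst tendsto_dist_iff)
 qed
qed

lemma shear_S3_shear_S3: "x \<in> S3 ==> shear_S3 v (shear_S3 w x) = shear_S3 (w + v) x" by (simp add: shear_S3_def to_S3_ne_infty shear_shear)

lemma shear_S3_0: "x \<in> S3 ==> shear_S3 0 x = x" by (simp add: shear_S3_def to_from_S3)

lemma shear_S3_to_S3: "shear_S3 v (to_S3 x) = to_S3 (shear v x)" by (simp add: shear_S3_def to_S3_ne_infty)

lemma ambient_isotopic_shear: "ambient_isotopic (to_S3 ` shear w ` M) (to_S3 ` M)" unfolding ambient_isotopic_def
proof (intro exI[of _ "\<lambda>(t, x). shear_S3 (- (t *\<^sub>R w)) x"] conjI ballI)
 have "continuous_on S3 (\<lambda>x. shear_S3 (fst (v, x)) (snd (v, x)))" for v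
  by (rule continuous_on_compose2[OF continuous_shear_S3]) (intro continuous_intros, auto)
 then have c: "continuous_on S3 (shear_S3 v)" for v by simp
 show "continuous_on ({0..1} \<times> S3) (\<lambda>(t, x). shear_S3 (- (t *\<^sub>R w)) x)" unfolding case_prod_beta
  by (rule continuous_on_compose2[OF continuous_shear_S3, of _ "\<lambda>p. (- (fst p *\<^sub>R w), snd p)", simplified])
   (auto intro!: continuous_intros)
 fix t :: real
 have "homeomorphism S3 S3 (shear_S3 (- (t *\<^sub>R w))) (shear_S3 (t *\<^sub>R w))" by (rule homeomorphismI[OF c c])
   (simp_all add: shear_S3_in image_subset_iff shear_S3_shear_S3 shear_S3_0 del: split_paired_All)
 then show "\<exists>g. homeomorphism S3 S3 (\<lambda>x. case (t, x) of (t, x) => shear_S3 (- (t *\<^sub>R w)) x) g" by auto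
next
 show "(case (0, x) of (t, x) => shear_S3 (- (t *\<^sub>R w)) x) = x" if "x \<in> S3" for x using that by (simp add: shear_S3_0)
 show "(\<lambda>x. case (1, x) of (t, x) => shear_S3 (- (t *\<^sub>R w)) x) ` to_S3 ` shear w ` M = to_S3 ` M"
  by (simp add: image_image shear_S3_to_S3 shear_shear)
qed

lemma link_has_diagram:
 assumes "is_link L"
 obtains P where "diagram_of P L"
proof -
 obtain P where P: "polygonal_link P" "ambient_isotopic (to_S3 ` link_set P) L" using assms unfolding is_link_def by blast
 obtain w where w: "diagram (map (shear w) ` P)" using regular_shear[OF P(1)] by blast
 have "ambient_isotopic (to_S3 ` link_set (map (shear w) ` P)) L"
  unfolding link_set_map[OF P(1) linear_shear] by (rule ambient_isotopic_trans[OF ambient_isotopic_shear P(2)])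
 then show ?thesis using w that unfolding diagram_of_def by blast
qed

section \<open>Sub-links\<close>

text \<open>Among finitely many disjoint closed sets each one is also relatively open in the union,
  so a component cannot leave it.\<close>

lemma components_disjoint_union:
 assumes "finite F" "\<And>A. A \<in> F ==> closed A \<and> connected A \<and> A \<noteq> {}" "disjoint F"
 shows "F \<subseteq> components (\<Union>F)"
proof
 fix A assume A: "A \<in> F"
 then obtain x where x: "x \<in> A" using assms(2) by blast
 let ?D = "connected_component_set (\<Union>F) x"
 have "A \<subseteq> ?D" by (rule connected_component_maximal) (use A x assms(2) in auto)
 moreover have "?D \<subseteq> A"
 proof -
  have "closed A" "closed (\<Union>(F - {A}))" using assms A by (auto intro: closed_Union)
  moreover have "A \<inter> \<Union>(F - {A}) \<inter> ?D = {}" using assms(3) A by (auto simp: disjoint_def)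
  moreover have "?D \<subseteq> A \<union> \<Union>(F - {A})" using connected_component_subset[of "\<Union>F" x] A by blast
  ultimately have "A \<inter> ?D = {} \<or> \<Union>(F - {A}) \<inter> ?D = {}"
   using connected_closed[of ?D] connected_connected_component[of "\<Union>F" x] by blast
  then show ?thesis using \<open>A \<subseteq> ?D\<close> x connected_component_subset[of "\<Union>F" x] by blast
 qed
 ultimately have "A = ?D" by blast
 then show "A \<in> components (\<Union>F)" unfolding components_def using A x by blast
qed

lemma connected_polygon_set:
 assumes "vs \<noteq> []"
 shows "connected (polygon_set vs)"
proof -
 have "connected (\<Union>i<Suc k. edge vs i)" for k
 proof (induction k)
  case 0
  then show ?case by (simp add: edge_def lessThan_Suc)
 next
  case (Suc k)
  have "vertex vs (Suc k) \<in> edge vs k" "vertex vs (Suc k) \<in> edge vs (Suc k)" by (simp_all add: edge_def)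
  then have "(\<Union>i<Suc k. edge vs i) \<inter> edge vs (Suc k) \<noteq> {}" by blast
  then have "connected ((\<Union>i<Suc k. edge vs i) \<union> edge vs (Suc k))" using Suc by (intro connected_Un) (simp_all add: edge_def)
  then show ?case by (simp add: lessThan_Suc Un_commute)
 qed
 from this[of "length vs - 1"] show ?thesis using assms unfolding polygon_set_def by simp
qed

lemma polygon_set_nonempty: "vs \<noteq> [] ==> polygon_set vs \<noteq> {}" by (auto simp: polygon_set_def edge_def)

lemma diagram_subset:
 assumes D: "diagram P" and S: "P' \<subseteq> P" "P' \<noteq> {}"
 shows "diagram P'"
proof -
 have fin: "finite (fibre P z)" "card (fibre P z) \<le> 2" for z using D by (auto simp: diagram_def regular_position_def)
 have sub: "link_set P' \<subseteq> link_set P" using S(1) by (auto simp: link_set_def)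
 then have f: "fibre P' z \<subseteq> fibre P z" for z by (auto simp: fibre_def)
 have pl: "polygonal_link P'" using D S pairwise_subset unfolding diagram_def polygonal_link_def by (metis finite_subset subset_iff)
 have c: "card (fibre P' z) \<le> card (fibre P z)" for z by (rule card_mono[OF fin(1) f])
 have "finite (fibre P' z) \<and> card (fibre P' z) \<le> 2" for z using finite_subset[OF f fin(1)] order_trans[OF c fin(2)] by simp
 moreover have "{z. card (fibre P' z) = 2} \<subseteq> {z. card (fibre P z) = 2}"
 proof (rule Collect_mono, rule impI)
  fix z assume "card (fibre P' z) = 2"
  then show "card (fibre P z) = 2" using c[of z] fin(2)[of z] by simp
 qed
 then have "finite {z. card (fibre P' z) = 2}" by (rule finite_subset) (use D in \<open>simp add: diagram_def regular_position_def\<close>)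
 moreover have "fibre P' (fst v) = {v}" if "vs \<in> P'" "v \<in> set vs" for vs v
 proof -
  have "fibre P (fst v) = {v}" using D that S(1) unfolding diagram_def regular_position_def by blast
  moreover have "v \<in> link_set P'" using that pl
   by (auto simp: link_set_def polygon_set_def in_set_conv_nth edge_def vertex_def intro!: bexI[of _ vs])
  then have "v \<in> fibre P' (fst v)" by (simp add: fibre_def)
  ultimately show ?thesis using f[of "fst v"] by (auto simp del: split_paired_All)
 qed
 ultimately show ?thesis using pl unfolding diagram_def regular_position_def by blast
qed

text \<open>The final homeomorphism of the isotopy carries the polygons of the diagram to the
  components of the link, so a choice of polygons is a choice of components.\<close>

lemma sublink_of_subset:
 assumes D: "diagram P" and S: "P' \<subseteq> P" "P' \<noteq> {}" and iso: "ambient_isotopic (to_S3 ` link_set P) L"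
 obtains M where "sublink M L" "diagram_of P' M"
proof -
 obtain H :: "real \<times> (space \<times> real) => space \<times> real" where H: "continuous_on ({0..1} \<times> S3) H" "\<And>t. t \<in> {0..1} ==> \<exists>g. homeomorphism S3 S3 (\<lambda>x. H (t, x)) g"
  "\<forall>x\<in>S3. H (0, x) = x" "(\<lambda>x. H (1, x)) ` to_S3 ` link_set P = L" by (rule ambient_isotopicE[OF iso]) (rule that; assumption)
 have "\<exists>g. homeomorphism S3 S3 (\<lambda>x. H (1, x)) g" by (rule H(2)) simp
 then obtain g where g: "homeomorphism S3 S3 (\<lambda>x. H (1, x)) g" by (rule exE)
 define \<phi> where "\<phi> x = H (1, to_S3 x)" for x
 have cont: "continuous_on A \<phi>" for A
  unfolding \<phi>_def by (rule continuous_on_compose2[OF homeomorphism_cont1[OF g] continuous_to_S3]) (auto simp: to_S3_in_S3)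
 have inj: "inj \<phi>"
 proof (rule injI)
  fix x y assume "\<phi> x = \<phi> y"
  then have "to_S3 x = to_S3 y" unfolding \<phi>_def using homeomorphism_apply1[OF g to_S3_in_S3] by metis
  then show "x = y" by (metis from_to_S3)
 qed
 have P: "finite P" "\<And>vs. vs \<in> P ==> vs \<noteq> []" "pairwise (\<lambda>vs ws. disjnt (polygon_set vs) (polygon_set ws)) P"
  using D simple_polygon_nonempty by (auto simp: diagram_def polygonal_link_def)
 define C where "C vs = \<phi> ` polygon_set vs" for vs
 have L: "L = \<Union>(C ` P)" unfolding H(4)[symmetric] C_def link_set_def \<phi>_def by blast
 have "C ` P \<subseteq> components (\<Union>(C ` P))"
 proof (rule components_disjoint_union)
  show "finite (C ` P)" using P(1) by simp
  show "closed A \<and> connected A \<and> A \<noteq> {}" if A: "A \<in> C ` P" for A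
  proof -
   obtain vs where vs: "vs \<in> P" "A = C vs" using A by blast
   have "compact (polygon_set vs)" unfolding polygon_set_def edge_def by (intro compact_UN) auto
   then have "compact A" "connected A" unfolding vs(2) C_def
    using connected_polygon_set[OF P(2)[OF vs(1)]] cont by (auto intro: compact_continuous_image connected_continuous_image)
   then show ?thesis using polygon_set_nonempty[OF P(2)[OF vs(1)]] vs(2) compact_imp_closed by (simp add: C_def)
  qed
  show "disjoint (C ` P)"
  proof (rule disjointI)
   fix A B assume "A \<in> C ` P" "B \<in> C ` P" "A \<noteq> B"
   then obtain vs ws where v: "vs \<in> P" "ws \<in> P" "A = C vs" "B = C ws" "vs \<noteq> ws" by blast
   then have "polygon_set vs \<inter> polygon_set ws = {}" using P(3) by (auto simp: pairwise_def disjnt_def)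
   then show "A \<inter> B = {}" unfolding v C_def by (simp add: image_Int[OF inj, symmetric])
  qed
 qed
 then have "C ` P' \<subseteq> components L" unfolding L using S(1) by blast
 then have "sublink (\<Union>(C ` P')) L" unfolding sublink_def using S(2) by (intro exI[of _ "C ` P'"]) simp
 moreover have "(\<lambda>x. H (1, x)) ` to_S3 ` link_set P' = \<Union>(C ` P')" unfolding C_def link_set_def \<phi>_def by blast
 then have "ambient_isotopic (to_S3 ` link_set P') (\<Union>(C ` P'))" unfolding ambient_isotopic_def using H(1-3) by (intro exI[of _ H]) simp
 then have "diagram_of P' (\<Union>(C ` P'))" unfolding diagram_of_def using diagram_subset[OF D S] by simp
 ultimately show ?thesis by (rule that)
qed

context strands
begin

lemma coloring_near_under:
 assumes c: "coloring G c" and q: "under q"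
 obtains e w0 w1 where "e > 0" "w0 \<in> carrier G" "w1 \<in> carrier G"
  "c (over_of q) \<otimes>\<^bsub>G\<^esub> w1 = w0 \<otimes>\<^bsub>G\<^esub> c (over_of q)" "\<And>y. [|y \<in> K; dist y q < e|] ==> c y = w0 \<or> c y = w1"
proof -
 obtain p where o: "over p q" using q unfolding under_def by (elim exE)
 note od = over_dirs[OF o]
 obtain e w0 w1 where w: "e > 0" "w0 \<in> carrier G" "w1 \<in> carrier G" "c (over_of q) \<otimes>\<^bsub>G\<^esub> w1 = w0 \<otimes>\<^bsub>G\<^esub> c (over_of q)"
  "c q = w0 \<or> c q = w1" "\<forall>t. 0 < t \<and> t < e --> c (q + t *\<^sub>R left_dir q) = w1 \<and> c (q - t *\<^sub>R left_dir q) = w0"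
  using c[unfolded coloring_def, THEN conjunct2, THEN conjunct2, rule_format, OF q] by (elim exE bexE conjE) (rule that; assumption)
 obtain e' where e': "e' > 0" "\<forall>y\<in>K. dist y q < e' --> (\<exists>t\<ge>0. y = q + t *\<^sub>R dout q \<or> y = q - t *\<^sub>R din q)"
  using germ_nbhd[OF od(7)] by blast
 have n: "norm (dout q) > 0" using dirs_nonzero(1)[OF od(7)] by auto
 show ?thesis
 proof (rule that[of "min e' (e * norm (dout q))" w0 w1])
  show "0 < min e' (e * norm (dout q))" using w(1) e'(1) n by simp
  fix y assume y: "y \<in> K" "dist y q < min e' (e * norm (dout q))"
  then obtain t where t: "t \<ge> 0" "y = q + t *\<^sub>R dout q \<or> y = q - t *\<^sub>R dout q" using e'(2) unfolding od(2) by (meson min_less_iff_conj)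
  then have "t * norm (dout q) < e * norm (dout q)" using y(2) by (auto simp: dist_norm)
  then have "t < e" using n by simp
  then show "c y = w0 \<or> c y = w1"
  proof (cases "t = 0")
   case False
   then have "c (q + t *\<^sub>R left_dir q) = w1" "c (q - t *\<^sub>R left_dir q) = w0" using w(6) t(1) \<open>t < e\<close> by auto
   then show ?thesis using t(2) unfolding left_dir_def by (auto split: if_splits)
  qed (use t w(5) in auto)
 qed (use w in auto)
qed

text \<open>A property of colors that the crossing relation preserves cannot change along a
  connected part of the link. It is applied to the property of being the identity.\<close>

lemma coloring_invariant:
 assumes c: "coloring G c" and S: "connected S" "S \<subseteq> K"
  and inv: "\<And>x w0 w1. [|x \<in> carrier G; w0 \<in> carrier G; w1 \<in> carrier G; x \<otimes>\<^bsub>G\<^esub> w1 = w0 \<otimes>\<^bsub>G\<^esub> x|] ==> Q w0 = Q w1"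
 shows "(\<lambda>p. Q (c p)) constant_on S"
proof (rule locally_constant_on_connected[OF S(1)])
 fix a assume a: "a \<in> S"
 have aK: "a \<in> K" using a S(2) by blast
 have "\<exists>e>0. \<forall>y\<in>K. dist y a < e --> Q (c y) = Q (c a)"
 proof (cases "under a")
  case False
  then obtain e where "e > 0" "\<forall>y\<in>K. dist y a < e --> c y = c a" using c aK unfolding coloring_def by blast
  then show ?thesis by (intro exI[of _ e]) simp
 next
  case True
  obtain e w0 w1 where w: "e > 0" "w0 \<in> carrier G" "w1 \<in> carrier G"
   "c (over_of a) \<otimes>\<^bsub>G\<^esub> w1 = w0 \<otimes>\<^bsub>G\<^esub> c (over_of a)" "\<And>y. [|y \<in> K; dist y a < e|] ==> c y = w0 \<or> c y = w1"
   by (rule coloring_near_under[OF c True]) (rule that; assumption)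
  obtain p where o: "over p a" using True unfolding under_def by (elim exE)
  have "c (over_of a) \<in> carrier G" using c over_dirs(6)[OF o] over_of_eq[OF o] by (simp add: coloring_def)
  then have "Q w0 = Q w1" using inv w by blast
  then show ?thesis using w(1,5) aK w(5)[of a] by (intro exI[of _ e]) (metis dist_self)
 qed
 then show "\<exists>e>0. \<forall>x\<in>S. dist x a < e --> Q (c x) = Q (c a)" using S(2) by (elim exE conjE) (intro exI conjI ballI impI; blast)
qed

end

text \<open>Components coloured by the identity may be erased from the diagram.\<close>

lemma coloring_erase:
 fixes G (structure)
 assumes G: "group G" and D: "diagram P" and S: "P' \<subseteq> P" "P' \<noteq> {}"
  and c: "strands.coloring (link_set P) (out_dir P) G c"
  and one: "\<And>p. [|p \<in> link_set P; p \<notin> link_set P'|] ==> c p = \<one>"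
 shows "strands.coloring (link_set P') (out_dir P') G c"
proof -
 interpret group G by (rule G)
 have D': "diagram P'" by (rule diagram_subset[OF D S])
 have pl: "polygonal_link P" "polygonal_link P'" using D D' by (auto simp: diagram_def)
 interpret A: strands "link_set P" "out_dir P" "in_dir P" by (rule strands_diagram[OF D])
 interpret B: strands "link_set P'" "out_dir P'" "in_dir P'" by (rule strands_diagram[OF D'])
 have sub: "link_set P' \<subseteq> link_set P" using S(1) by (auto simp: link_set_def)
 have ov: "B.over p q \<longleftrightarrow> A.over p q \<and> p \<in> link_set P' \<and> q \<in> link_set P'" for p q
  unfolding A.over_def B.over_def using sub by blast
 have dir: "out_dir P' p = out_dir P p" if p: "p \<in> link_set P'" for p
 proof -
  obtain vs i t where h: "on_edge P' vs i t p" "0 \<le> t" "t < 1" by (rule on_edge_out_exists[OF pl(2) p])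
  then have "on_edge P vs i t p" using S(1) unfolding on_edge_def by blast
  then show ?thesis using out_dir_eq[OF pl(1) _ h(2,3)] out_dir_eq[OF pl(2) h] by simp
 qed
 show ?thesis unfolding B.coloring_def
 proof (intro conjI ballI allI impI)
  show "c p \<in> carrier G" if "p \<in> link_set P'" for p using c sub that unfolding A.coloring_def by blast
 next
  fix p assume p: "p \<in> link_set P'" "\<not> B.under p"
  have pP: "p \<in> link_set P" using p(1) sub by blast
  show "\<exists>e>0. \<forall>q\<in>link_set P'. dist q p < e --> c q = c p"
  proof (cases "A.under p")
   case False
   then have "\<exists>e>0. \<forall>q\<in>link_set P. dist q p < e --> c q = c p" using c pP unfolding A.coloring_def by blast
   then show ?thesis using sub by (elim exE conjE) (intro exI conjI ballI impI, assumption, blast)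
  next
   case True
   then obtain a where a: "A.over a p" unfolding A.under_def by (elim exE)
   \<comment> \<open>A point that was under in \<open>P\<close> but not in \<open>P'\<close> had its
     over strand erased. That strand has color 1, so the relation gives \<open>w0 = w1\<close> and
     the color does not change there.\<close>
   have "a \<notin> link_set P'" using p a ov unfolding B.under_def by blast
   then have ca: "c (A.over_of p) = \<one>" using one A.over_dirs(6)[OF a] A.over_of_eq[OF a] by simp
   obtain e w0 w1 where w: "e > 0" "w0 \<in> carrier G" "w1 \<in> carrier G"
    "c (A.over_of p) \<otimes> w1 = w0 \<otimes> c (A.over_of p)" "\<And>y. [|y \<in> link_set P; dist y p < e|] ==> c y = w0 \<or> c y = w1"
    by (rule A.coloring_near_under[OF c True]) (rule that; assumption)
   have "w0 = w1" using w(2-4) unfolding ca by simp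
   then have "c y = w0" if "y \<in> link_set P" "dist y p < e" for y using w(5)[OF that] by simp
   then show ?thesis using w(1) sub pP by (intro exI[of _ e]) (metis dist_self subsetD)
  qed
 next
  fix q assume "B.under q"
  then obtain p where o: "B.over p q" unfolding B.under_def by (elim exE)
  then have o': "A.over p q" and pq: "p \<in> link_set P'" "q \<in> link_set P'" using ov by blast+
  have eq: "B.over_of q = A.over_of q" using A.over_of_eq[OF o'] B.over_of_eq[OF o] by simp
  have "A.over_of q \<in> link_set P'" using A.over_of_eq[OF o'] pq by simp
  then have l: "B.left_dir q = A.left_dir q" unfolding A.left_dir_def B.left_dir_def eq by (simp only: dir pq(2))
  show "\<exists>e>0. \<exists>w0\<in>carrier G. \<exists>w1\<in>carrier G. c (B.over_of q) \<otimes> w1 = w0 \<otimes> c (B.over_of q) \<and> (c q = w0 \<or> c q = w1) \<and>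
    (\<forall>t. 0 < t \<and> t < e --> c (q + t *\<^sub>R B.left_dir q) = w1 \<and> c (q - t *\<^sub>R B.left_dir q) = w0)"
   unfolding eq l by (rule c[unfolded A.coloring_def, THEN conjunct2, THEN conjunct2, rule_format, OF A.over_under[OF o']])
 qed
qed

section \<open>Colorings and homomorphisms onto dihedral groups\<close>

text \<open>Separates the base point \<open>y0\<close>, where loops with prescribed values are
  known, from the base point \<open>x0\<close> of the fundamental group.\<close>

lemma epi_of_loops:
 fixes G (structure)
 assumes rep: "groupoid_rep G X \<Phi>" and X: "path_connected X" "x0 \<in> X" "y0 \<in> X"
  and A: "\<And>a. a \<in> A ==> \<exists>g\<in>loops X y0. \<Phi> g = a" and gen: "generate G A = carrier G"
 shows "\<exists>f. f \<in> epi (fundamental_group X x0) G"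
proof -
 interpret R: groupoid_rep G X \<Phi> by (rule rep)
 obtain b where b: "path b" "path_image b \<subseteq> X" "pathstart b = x0" "pathfinish b = y0" using X unfolding path_connected_def by blast
 \<comment> \<open>Carrying a loop from \<open>y0\<close> to \<open>x0\<close> along
   \<open>b\<close> conjugates its value by \<open>\<Phi> b\<close>; the constant gauge
   \<open>k\<close> undoes this.\<close>
 define k where "k = inv (\<Phi> b)"
 have k: "k \<in> carrier G" unfolding k_def using R.closed[OF b(1,2)] by simp
 define \<Psi> where "\<Psi> g = k \<otimes> \<Phi> g \<otimes> inv k" for g
 have "groupoid_rep G X \<Psi>" unfolding \<Psi>_def by (rule R.gauge[of "\<lambda>_. k"]) (rule k)
 then interpret S: groupoid_rep G X \<Psi> .
 obtain f where f: "f \<in> hom (fundamental_group X x0) G" "\<And>g. g \<in> loops X x0 ==> f (path_class X g) = \<Psi> g"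
  by (rule S.induced_hom[OF X(2)]) (rule that; assumption)
 interpret h: group_hom "fundamental_group X x0" G f
  by (intro group_hom.intro group_hom_axioms.intro group_fundamental_group X(2) f(1) R.group_axioms)
 have "A \<subseteq> f ` carrier (fundamental_group X x0)"
 proof
  fix a assume "a \<in> A"
  then obtain g where g: "g \<in> loops X y0" "\<Phi> g = a" using A by blast
  then have gp: "path g" "path_image g \<subseteq> X" "pathstart g = y0" "pathfinish g = y0" by (auto simp: loops_def)
  define l where "l = b +++ (g +++ reversepath b)"
  have l: "l \<in> loops X x0" using b gp by (simp add: l_def loops_def path_image_join)
  have a: "a \<in> carrier G" using R.closed[OF gp(1,2)] g(2) by simp
  have B: "\<Phi> b \<in> carrier G" by (rule R.closed[OF b(1,2)])
  have "\<Phi> l = \<Phi> b \<otimes> (a \<otimes> inv (\<Phi> b))" unfolding l_def using b gp g(2) by (simp add: R.join R.reverse path_image_join)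
  then have "\<Psi> l = a" unfolding \<Psi>_def k_def using a B by (simp add: R.m_assoc[symmetric]) (simp add: R.m_assoc)
  then show "a \<in> f ` carrier (fundamental_group X x0)"
   using f(2)[OF l] l by (intro image_eqI[of _ _ "path_class X l"]) (simp_all add: fundamental_group_def)
 qed
 then have "carrier G \<subseteq> f ` carrier (fundamental_group X x0)" using R.generate_subgroup_incl[OF _ h.img_is_subgroup] gen by blast
 then show ?thesis using f(1) h.hom_closed unfolding epi_def by (intro exI[of _ f]) blast
qed

lemma path_compose_into:
 assumes "continuous_on A f" "f ` A \<subseteq> B" "path g" "path_image g \<subseteq> A"
 shows "path (f \<circ> g)" "path_image (f \<circ> g) \<subseteq> B" using path_continuous_image[OF assms(3) continuous_on_subset[OF assms(1,4)]]
  order_trans[OF image_mono[OF assms(4), of f] assms(2)] by (simp_all add: path_image_compose)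

lemma diagram_complement:
 assumes P: "diagram_of P L"
 obtains h k where "homeomorphism (S3 - to_S3 ` link_set P) (S3 - L) h k" "path_connected (- link_set P)"
  "path_connected (S3 - L)"
proof -
 have D: "diagram P" using P by (simp add: diagram_of_def)
 interpret strands "link_set P" "out_dir P" "in_dir P" by (rule strands_diagram[OF D])
 obtain H :: "real \<times> (space \<times> real) => space \<times> real" where H: "\<And>t. t \<in> {0..1} ==> \<exists>g. homeomorphism S3 S3 (\<lambda>x. H (t, x)) g"
  "(\<lambda>x. H (1, x)) ` to_S3 ` link_set P = L" using P unfolding diagram_of_def by (elim conjE ambient_isotopicE) (rule that; assumption)
 have "\<exists>g. homeomorphism S3 S3 (\<lambda>x. H (1, x)) g" by (rule H(1)) simp
 then obtain k where k: "homeomorphism S3 S3 (\<lambda>x. H (1, x)) k" by (rule exE)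
 have inj: "inj_on (\<lambda>x. H (1, x)) S3" by (rule inj_on_inverseI) (rule homeomorphism_apply1[OF k])
 have sub: "to_S3 ` link_set P \<subseteq> S3" using to_S3_in_S3 by blast
 have "(\<lambda>x. H (1, x)) ` (S3 - to_S3 ` link_set P) = S3 - L"
  unfolding inj_on_image_set_diff[OF inj _ sub, of S3, OF Diff_subset] H(2) homeomorphism_image1[OF k] ..
 then have h: "homeomorphism (S3 - to_S3 ` link_set P) (S3 - L) (\<lambda>x. H (1, x)) k" by (intro homeomorphism_of_subsets[OF k]) auto
 have pc: "path_connected (- link_set P)" by (rule path_connected_complement)
 have "path_connected (S3 - to_S3 ` link_set P)" by (rule path_connected_complement_S3[OF compact_K pc])
 then have "path_connected (S3 - L)" using path_connected_continuous_image[OF homeomorphism_cont1[OF h]] homeomorphism_image1[OF h] by simp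
 then show ?thesis by (rule that[OF h pc])
qed

text \<open>The coloring lifted to \<open>D_n\<close> becomes a representation in space, then on the
  sphere, then on the complement of \<open>L\<close>. Its generating colors are realized by loops,
  since meridian paths can be closed up inside the top region at no cost.\<close>

lemma two_tone_epi:
 assumes m: "odd m" "3 \<le> m" and tt: "two_tone_colorable m L" and x0: "x0 \<in> S3 - L" and n: "n \<ge> 1"
 shows "\<exists>f. f \<in> epi (fundamental_group (S3 - L) x0) (dihedral n)"
proof -
 let ?G = "dihedral n"
 obtain P \<Gamma> where P: "diagram_of P L" "dihedral_coloring m P \<Gamma>" "two_tone m P \<Gamma>"
  using tt unfolding two_tone_colorable_def by (elim exE conjE)
 have D: "diagram P" using P(1) by (simp add: diagram_of_def)
 interpret strands "link_set P" "out_dir P" "in_dir P" by (rule strands_diagram[OF D])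
 let ?K = "link_set P"
 obtain c where c: "coloring (dihedral m) c" "c ` ?K = \<Gamma> ` diagram_arcs P" by (rule coloring_of_arcs[OF D P(2)])
 have ne: "c p \<noteq> (False, 0)" if "p \<in> ?K" for p using P(3) c(2) that unfolding two_tone_def one_dihedral by (metis imageI)
 have r1: "\<exists>p\<in>?K. fst (c p)"
 proof -
  obtain i where "reflection m i \<in> c ` ?K" using P(3) unfolding two_tone_def c(2) by blast
  then obtain p where "reflection m i = c p" "p \<in> ?K" by (rule imageE)
  then show ?thesis using reflection_eq[of m i] by (metis fst_conv)
 qed
 have r2: "\<exists>p\<in>?K. \<not> fst (c p)"
 proof -
  obtain i where "rotation m i \<in> c ` ?K" using P(3) unfolding two_tone_def c(2) by blast
  then obtain p where "rotation m i = c p" "p \<in> ?K" by (rule imageE)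
  then show ?thesis using rotation_eq[of m i] by (metis fst_conv)
 qed
 obtain c' where c': "coloring ?G c'" "generate ?G (c' ` ?K) = carrier ?G"
  by (rule two_tone_lift[OF D c(1) m _ r1 r2 n], erule ne) (rule that; assumption)
 obtain \<Phi> where \<Phi>: "groupoid_rep ?G (- ?K) \<Phi>" "\<And>g. [|path g; path_image g \<subseteq> top_region|] ==> \<Phi> g = \<one>\<^bsub>?G\<^esub>"
  "\<And>p. p \<in> ?K ==> \<exists>g. path g \<and> path_image g \<subseteq> - ?K \<and> pathstart g \<in> top_region \<and> pathfinish g \<in> top_region \<and> \<Phi> g = c' p"
  by (rule coloring_rep[OF group_dihedral[OF n] c'(1)]) (rule that; assumption)
 interpret R: groupoid_rep ?G "- ?K" \<Phi> by (rule \<Phi>(1))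
 obtain \<Psi> where \<Psi>: "groupoid_rep ?G (S3 - to_S3 ` ?K) \<Psi>" "\<And>g. [|path g; path_image g \<subseteq> - ?K|] ==> \<Psi> (to_S3 \<circ> g) = \<Phi> g"
  by (rule extend_rep[OF compact_K \<Phi>(1)]) (rule that; assumption)
 interpret S: groupoid_rep ?G "S3 - to_S3 ` ?K" \<Psi> by (rule \<Psi>(1))
 obtain h k where hk: "homeomorphism (S3 - to_S3 ` ?K) (S3 - L) h k" "path_connected (S3 - L)"
  by (rule diagram_complement[OF P(1)]) (rule that; assumption)
 have rep: "groupoid_rep ?G (S3 - L) (\<lambda>g. \<Psi> (k \<circ> g))"
  by (rule S.pullback[OF homeomorphism_cont2[OF hk(1)]]) (use homeomorphism_image2[OF hk(1)] in blast)
 have Ksub: "to_S3 ` (- ?K) \<subseteq> S3 - to_S3 ` ?K" using to_S3_in_S3 from_to_S3 by (auto simp del: split_paired_All) (metis from_to_S3)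
 obtain y0 where y0: "y0 \<in> top_region" using top_region_nonempty by blast
 have y: "h (to_S3 y0) \<in> S3 - L" using y0 top_region_subset Ksub homeomorphism_image1[OF hk(1)] by blast
 show ?thesis
 proof (rule epi_of_loops[OF rep hk(2) x0 y _ c'(2)])
  fix a assume "a \<in> c' ` ?K"
  then obtain p where p: "p \<in> ?K" "a = c' p" by blast
  obtain g where g: "path g" "path_image g \<subseteq> - ?K" "pathstart g \<in> top_region" "pathfinish g \<in> top_region" "\<Phi> g = a"
   using \<Phi>(3)[OF p(1)] p(2) by blast
  have pct: "path_connected top_region" by (rule simply_connected_imp_path_connected[OF simply_connected_top_region])
  obtain g1 where g1: "path g1" "path_image g1 \<subseteq> top_region" "pathstart g1 = y0" "pathfinish g1 = pathstart g"
   using pct y0 g(3) unfolding path_connected_def by blast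
  obtain g2 where g2: "path g2" "path_image g2 \<subseteq> top_region" "pathstart g2 = pathfinish g" "pathfinish g2 = y0"
   using pct y0 g(4) unfolding path_connected_def by blast
  have sub: "path_image g1 \<subseteq> - ?K" "path_image g2 \<subseteq> - ?K" using g1(2) g2(2) top_region_subset by blast+
  define l where "l = g1 +++ (g +++ g2)"
  have l: "path l" "path_image l \<subseteq> - ?K" "pathstart l = y0" "pathfinish l = y0" using g g1 g2 sub by (simp_all add: l_def path_image_join)
  have "a \<in> carrier ?G" using c'(1) p by (simp add: coloring_def)
  then have "\<Phi> l = a" unfolding l_def using g g1 g2 sub \<Phi>(2)[OF g1(1,2)] \<Phi>(2)[OF g2(1,2)] by (simp add: R.join path_image_join)
  have tl: "path (to_S3 \<circ> l)" "path_image (to_S3 \<circ> l) \<subseteq> S3 - to_S3 ` ?K"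
   by (rule path_compose_into[OF continuous_to_S3 Ksub l(1,2)])+
  have eq: "k (h x) = x" if "x \<in> path_image (to_S3 \<circ> l)" for x using homeomorphism_apply1[OF hk(1)] that tl(2) by blast
  have "path (h \<circ> (to_S3 \<circ> l))" "path_image (h \<circ> (to_S3 \<circ> l)) \<subseteq> S3 - L"
   by (rule path_compose_into[OF homeomorphism_cont1[OF hk(1)] equalityD1[OF homeomorphism_image1[OF hk(1)]] tl])+
  then have lo: "h \<circ> (to_S3 \<circ> l) \<in> loops (S3 - L) (h (to_S3 y0))"
   using l(3,4) by (simp add: loops_def pathstart_compose pathfinish_compose)
  have "homotopic_paths (S3 - to_S3 ` ?K) (to_S3 \<circ> l) (k \<circ> (h \<circ> (to_S3 \<circ> l)))"
   using eq by (intro homotopic_paths_eq tl) (simp add: path_image_def)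
  then have "\<Psi> (k \<circ> (h \<circ> (to_S3 \<circ> l))) = \<Psi> (to_S3 \<circ> l)" by (rule S.homotopic[symmetric])
  also have "\<dots> = a" using \<Psi>(2)[OF l(1,2)] \<open>\<Phi> l = a\<close> by simp
  finally show "\<exists>g\<in>loops (S3 - L) (h (to_S3 y0)). \<Psi> (k \<circ> g) = a" using lo by (rule bexI)
 qed
qed

text \<open>The colors generate because every element of \<open>G\<close> is the value of a loop
  based in the top region, and by \<open>coloring_of_rep\<close> and \<open>generation_S3\<close>
  such values lie in the subgroup generated by the colors.\<close>

lemma coloring_of_epi:
 fixes G (structure)
 assumes G: "group G" and P: "diagram_of P L" and x0: "x0 \<in> S3 - L" and f: "f \<in> epi (fundamental_group (S3 - L) x0) G"
 obtains c where "strands.coloring (link_set P) (out_dir P) G c" "generate G (c ` link_set P) = carrier G"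
proof -
 let ?K = "link_set P"
 interpret G: group G by (rule G)
 have D: "diagram P" using P by (simp add: diagram_of_def)
 interpret strands ?K "out_dir P" "in_dir P" by (rule strands_diagram[OF D])
 obtain h k where hk: "homeomorphism (S3 - to_S3 ` ?K) (S3 - L) h k" "path_connected (- ?K)" "path_connected (S3 - L)"
  by (rule diagram_complement[OF P]) (rule that; assumption)
 have Ksub: "to_S3 ` (- ?K) \<subseteq> S3 - to_S3 ` ?K" using to_S3_in_S3 from_to_S3 by (auto simp del: split_paired_All) (metis from_to_S3)
 have fh: "f \<in> hom (fundamental_group (S3 - L) x0) G" "f ` carrier (fundamental_group (S3 - L) x0) = carrier G" using f by (auto simp: epi_def)
 obtain \<Phi> where \<Phi>: "groupoid_rep G (S3 - L) \<Phi>" "\<And>g. g \<in> loops (S3 - L) x0 ==> f (path_class (S3 - L) g) = \<Phi> g"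
  by (rule hom_imp_groupoid_rep[OF G hk(3) x0 fh(1)]) (rule that; assumption)
 interpret R: groupoid_rep G "S3 - L" \<Phi> by (rule \<Phi>(1))
 have "groupoid_rep G (S3 - to_S3 ` ?K) (\<lambda>g. \<Phi> (h \<circ> g))"
  by (rule R.pullback[OF homeomorphism_cont1[OF hk(1)]]) (use homeomorphism_image1[OF hk(1)] in blast)
 then interpret R1: groupoid_rep G "S3 - to_S3 ` ?K" "\<lambda>g. \<Phi> (h \<circ> g)" .
 have "groupoid_rep G (- ?K) (\<lambda>g. \<Phi> (h \<circ> (to_S3 \<circ> g)))" by (rule R1.pullback[OF continuous_to_S3]) (use Ksub in blast)
 then interpret R2: groupoid_rep G "- ?K" "\<lambda>g. \<Phi> (h \<circ> (to_S3 \<circ> g))" .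
 obtain \<kappa> where \<kappa>: "\<And>x. \<kappa> x \<in> carrier G"
  "\<And>g. [|path g; path_image g \<subseteq> top_region|] ==> \<kappa> (pathstart g) \<otimes> \<Phi> (h \<circ> (to_S3 \<circ> g)) \<otimes> inv (\<kappa> (pathfinish g)) = \<one>"
  by (rule R2.trivialize[OF simply_connected_top_region top_region_subset]) (rule that; assumption)
 \<comment> \<open>After the gauge by \<open>\<kappa>\<close> the representation is trivial on the
   top region, as \<open>strand_rep\<close> requires; \<open>from_S3\<close> translates end points
   on the sphere back to space.\<close>
 define \<Psi> where "\<Psi> g = \<kappa> (from_S3 (pathstart g)) \<otimes> \<Phi> (h \<circ> g) \<otimes> inv (\<kappa> (from_S3 (pathfinish g)))" for g
 have "groupoid_rep G (S3 - to_S3 ` ?K) \<Psi>" unfolding \<Psi>_def by (rule R1.gauge) (rule \<kappa>(1))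
 then interpret S: groupoid_rep G "S3 - to_S3 ` ?K" \<Psi> .
 have "groupoid_rep G (- ?K) (\<lambda>g. \<Psi> (to_S3 \<circ> g))" by (rule S.pullback[OF continuous_to_S3]) (use Ksub in blast)
 then interpret S2: groupoid_rep G "- ?K" "\<lambda>g. \<Psi> (to_S3 \<circ> g)" .
 interpret strand_rep ?K "out_dir P" "in_dir P" G "\<lambda>g. \<Psi> (to_S3 \<circ> g)"
  by unfold_locales (simp add: \<Psi>_def pathstart_compose pathfinish_compose \<kappa>(2))
 obtain c where c: "coloring G c"
  "\<And>H g. [|subgroup H G; c ` ?K \<subseteq> H; path g; path_image g \<subseteq> - ?K; pathstart g \<in> top_region; pathfinish g \<in> top_region|]
   ==> \<Psi> (to_S3 \<circ> g) \<in> H" by (rule coloring_of_rep) (rule that; assumption)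
 have cK: "c ` ?K \<subseteq> carrier G" using c(1) unfolding coloring_def by blast
 define H where "H = generate G (c ` ?K)"
 have H: "subgroup H G" unfolding H_def by (rule G.generate_is_subgroup[OF cK])
 have cH: "c ` ?K \<subseteq> H" unfolding H_def by (intro subsetI generate.incl)
 have all: "\<Psi> g \<in> H" if "path g" "path_image g \<subseteq> S3 - to_S3 ` ?K" "pathstart g \<in> to_S3 ` top_region" "pathfinish g \<in> to_S3 ` top_region" for g
  using c(2)[OF H cH] by (intro generation_S3[OF compact_K S.groupoid_rep_axioms H top_region_subset dense_top _ that])
 have "carrier G \<subseteq> H"
 proof
  fix a assume a: "a \<in> carrier G"
  obtain y0 where y0: "y0 \<in> top_region" using top_region_nonempty by blast
  have ys: "to_S3 y0 \<in> S3 - to_S3 ` ?K" using y0 top_region_subset Ksub by blast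
  have kx: "k x0 \<in> S3 - to_S3 ` ?K" using x0 homeomorphism_image2[OF hk(1)] by blast
  have "path_connected (S3 - to_S3 ` ?K)" by (rule path_connected_complement_S3[OF compact_K hk(2)])
  then obtain b where b: "path b" "path_image b \<subseteq> S3 - to_S3 ` ?K" "pathstart b = to_S3 y0" "pathfinish b = k x0"
   using ys kx unfolding path_connected_def by blast
  \<comment> \<open>Carrying a loop from \<open>k x0\<close> to the top region along
    \<open>b\<close> conjugates its value by \<open>B\<close>. To reach \<open>a\<close>, a loop
    with value \<open>inv B \<otimes> a \<otimes> B\<close> is therefore taken, which exists by
    surjectivity.\<close>
  define B where "B = \<kappa> y0 \<otimes> \<Phi> (h \<circ> b)"
  have B: "B \<in> carrier G" unfolding B_def using \<kappa>(1) R1.closed[OF b(1,2)] by simp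
  have "inv B \<otimes> a \<otimes> B \<in> carrier G" using a B by simp
  then obtain X where X: "X \<in> carrier (fundamental_group (S3 - L) x0)" "inv B \<otimes> a \<otimes> B = f X"
   unfolding fh(2)[symmetric] by (rule imageE)
  then obtain l where l: "l \<in> loops (S3 - L) x0" "inv B \<otimes> a \<otimes> B = \<Phi> l"
   using \<Phi>(2) unfolding fundamental_group_def by auto
  then have lp: "path l" "path_image l \<subseteq> S3 - L" "pathstart l = x0" "pathfinish l = x0" by (auto simp: loops_def)
  have kl: "path (k \<circ> l)" "path_image (k \<circ> l) \<subseteq> S3 - to_S3 ` ?K"
   by (rule path_compose_into[OF homeomorphism_cont2[OF hk(1)] equalityD1[OF homeomorphism_image2[OF hk(1)]] lp(1,2)])+
  have "homotopic_paths (S3 - L) l (h \<circ> (k \<circ> l))"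
  proof (rule homotopic_paths_eq[OF lp(1,2)])
   fix t :: real assume "t \<in> {0..1}"
   then have "l t \<in> path_image l" unfolding path_image_def by (rule imageI)
   from subsetD[OF lp(2) this] show "l t = (h \<circ> (k \<circ> l)) t" using homeomorphism_apply2[OF hk(1), of "l t"] by simp
  qed
  then have hkl: "\<Phi> (h \<circ> (k \<circ> l)) = \<Phi> l" by (rule R.homotopic[symmetric])
  define g where "g = b +++ ((k \<circ> l) +++ reversepath b)"
  have pe: "pathstart (k \<circ> l) = k x0" "pathfinish (k \<circ> l) = k x0" using lp by (simp_all add: pathstart_compose pathfinish_compose)
  have g: "path g" "path_image g \<subseteq> S3 - to_S3 ` ?K" "pathstart g = to_S3 y0" "pathfinish g = to_S3 y0"
   using b kl pe by (simp_all add: g_def path_image_join)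
  have Bb: "\<Phi> (h \<circ> b) \<in> carrier G" by (rule R1.closed[OF b(1,2)])
  have "\<Phi> (h \<circ> g) = \<Phi> (h \<circ> b) \<otimes> (\<Phi> l \<otimes> inv (\<Phi> (h \<circ> b)))"
   unfolding g_def using b kl pe R1.join R1.reverse[OF b(1,2)] hkl by (simp add: path_image_join)
  then have "\<Psi> g = B \<otimes> \<Phi> l \<otimes> inv B"
   unfolding \<Psi>_def g(3,4) B_def using Bb \<kappa>(1)[of y0] R.closed[OF lp(1,2)] by (simp add: G.m_assoc G.inv_mult_group)
  also have "\<dots> = a" unfolding l(2)[symmetric] using a B by (simp add: G.m_assoc[symmetric]) (simp add: G.m_assoc)
  finally have "\<Psi> g = a" .
  moreover have "\<Psi> g \<in> H" by (rule all[OF g(1,2)]) (use g(3,4) y0 in auto)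
  ultimately show "a \<in> H" by simp
 qed
 then have "generate G (c ` ?K) = carrier G" using subgroup.subset[OF H] unfolding H_def by blast
 then show ?thesis by (rule that[OF c(1)])
qed

lemma arc_color_image_eq:
 assumes D: "diagram P" and c: "strands.coloring (link_set P) (out_dir P) G c"
 shows "arc_color c ` diagram_arcs P = c ` link_set P"
proof
 interpret strands "link_set P" "out_dir P" "in_dir P" by (rule strands_diagram[OF D])
 show "arc_color c ` diagram_arcs P \<subseteq> c ` link_set P" by (rule arc_color_image[OF D c])
 show "c ` link_set P \<subseteq> arc_color c ` diagram_arcs P"
 proof
  fix a assume "a \<in> c ` link_set P"
  then obtain q where q: "q \<in> link_set P" "a = c q" by (rule imageE)
  obtain b where b: "b \<in> brk P" "c q = piece_val P c b" using coloring_value[OF D c q(1)] by blast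
  obtain p where p: "p \<in> link_set P - brk P" "prev P p = b" by (rule piece_point[OF D b(1)])
  have "\<not> under p" using p(1) under_brk[OF D] by blast
  moreover have "c p = a" using piece_val_eq[OF D coloring_piecewise[OF D c] p(1)] p(2) b(2) q(2) by simp
  ultimately show "a \<in> arc_color c ` diagram_arcs P" using arc_color_image_not_under[OF D c, of p] p(1) by simp
 qed
qed

text \<open>If all colors are reflections, the crossing relation says that twice the over exponent
  is the sum of the two under exponents, for either sign of the crossing; this is Fox's condition.
  If a rotation occurs, it stands next to a reflection and no color is the identity.\<close>

lemma fox_or_two_tone:
 assumes P: "diagram_of P L" and c: "strands.coloring (link_set P) (out_dir P) (dihedral n) c" and n: "n \<ge> 1"
  and refl: "\<exists>p\<in>link_set P. fst (c p)" and one: "\<And>p. p \<in> link_set P ==> c p \<noteq> (False, 0)"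
  and two: "\<exists>p\<in>link_set P. \<exists>q\<in>link_set P. c p \<noteq> c q"
 shows "two_tone_colorable n L \<or> fox_colorable n L"
proof -
 let ?K = "link_set P"
 have D: "diagram P" using P by (simp add: diagram_of_def)
 interpret strands ?K "out_dir P" "in_dir P" by (rule strands_diagram[OF D])
 note img = arc_color_image_eq[OF D c]
 have car: "0 \<le> snd (c p)" "snd (c p) < int n" if "p \<in> ?K" for p
  using c that unfolding coloring_def carrier_dihedral by (auto simp: mem_Times_iff)
 have ex: "\<exists>i. snd (c p) = int i \<and> i < n" if "p \<in> ?K" for p using car[OF that] by (intro exI[of _ "nat (snd (c p))"]) auto
 show ?thesis
 proof (cases "\<forall>p\<in>?K. fst (c p)")
  case False
  then obtain p where p: "p \<in> ?K" "\<not> fst (c p)" by blast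
  obtain j where j: "snd (c p) = int j" "j < n" using ex[OF p(1)] by blast
  have j0: "j \<noteq> 0" using one[OF p(1)] p(2) j(1) by (metis of_nat_0 prod.collapse)
  have rot: "rotation n j = c p" using j p(2) by (simp add: rotation_eq prod_eq_iff)
  obtain q where q: "q \<in> ?K" "fst (c q)" using refl by blast
  obtain i where i: "snd (c q) = int i" "i < n" using ex[OF q(1)] by blast
  have ref: "reflection n i = c q" using i q(2) by (simp add: reflection_eq prod_eq_iff)
  have "two_tone n P (arc_color c)" unfolding two_tone_def img one_dihedral
  proof (intro conjI)
   show "(False, 0) \<notin> c ` ?K" using one by (metis imageE)
   show "\<exists>i\<in>{0..<n}. reflection n i \<in> c ` ?K" by (rule bexI[of _ i]) (use i q(1) in \<open>simp_all add: ref\<close>)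
   show "\<exists>j\<in>{1..<n}. rotation n j \<in> c ` ?K" by (rule bexI[of _ j]) (use j j0 p(1) in \<open>simp_all add: rot\<close>)
  qed
  then show ?thesis using P dihedral_coloring_arc_color[OF D c] unfolding two_tone_colorable_def by blast
 next
  case True
  define \<Gamma> where "\<Gamma> A = nat (snd (arc_color c A))" for A
  have arc: "\<exists>k<n. arc_color c A = (True, int k) \<and> \<Gamma> A = k" if "A \<in> diagram_arcs P" for A
  proof -
   have "arc_color c A \<in> c ` ?K" unfolding img[symmetric] using that by (rule imageI)
   then obtain p where p: "arc_color c A = c p" "p \<in> ?K" by (rule imageE)
   obtain i where i: "snd (c p) = int i" "i < n" using ex[OF p(2)] by blast
   show ?thesis using i p(1) True p(2) by (intro exI[of _ i]) (simp add: \<Gamma>_def prod_eq_iff)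
  qed
  have "[2 * \<Gamma> x = \<Gamma> y + \<Gamma> z] (mod n)" if ca: "crossing_arcs P u v x y z" for u v x y z
  proof -
   have xyz: "x \<in> diagram_arcs P" "y \<in> diagram_arcs P" "z \<in> diagram_arcs P" using ca by (auto simp: crossing_arcs_def)
   obtain a where a: "arc_color c x = (True, int a)" "\<Gamma> x = a" using arc[OF xyz(1)] by blast
   obtain b where b: "arc_color c y = (True, int b)" "\<Gamma> y = b" using arc[OF xyz(2)] by blast
   obtain d where d: "arc_color c z = (True, int d)" "\<Gamma> z = d" using arc[OF xyz(3)] by blast
   have "(- int a + int d) mod int n = (- int b + int a) mod int n \<or> (- int d + int a) mod int n = (- int a + int b) mod int n"
    using crossing_arcs_color[OF D c ca] unfolding a(1) b(1) d(1) mult_dihedral by auto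
   then have "[2 * int a = int b + int d] (mod int n)" unfolding cong_def[symmetric] cong_iff_dvd_diff by (auto simp: algebra_simps dvd_diff_commute)
   then have "[int (2 * a) = int (b + d)] (mod int n)" by simp
   then show ?thesis unfolding a(2) b(2) d(2) cong_int_iff .
  qed
  moreover have "\<Gamma> ` diagram_arcs P \<subseteq> {0..<n}" using arc by fastforce
  ultimately have fc: "fox_coloring n P \<Gamma>" unfolding fox_coloring_def by blast
  obtain p q where pq: "p \<in> ?K" "q \<in> ?K" "c p \<noteq> c q" using two by blast
  have "c p \<in> arc_color c ` diagram_arcs P" "c q \<in> arc_color c ` diagram_arcs P" unfolding img using pq by blast+
  then obtain A B where AB: "A \<in> diagram_arcs P" "B \<in> diagram_arcs P" "c p = arc_color c A" "c q = arc_color c B" by (elim imageE)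
  have "\<Gamma> A \<noteq> \<Gamma> B"
  proof
   assume e: "\<Gamma> A = \<Gamma> B"
   have "arc_color c A = (True, int (\<Gamma> A))" "arc_color c B = (True, int (\<Gamma> B))" using arc[OF AB(1)] arc[OF AB(2)] by auto
   then show False using pq(3) unfolding AB(3,4) e by simp
  qed
  then have "fox_colorable n L" unfolding fox_colorable_def using P fc AB(1,2) by blast
  then show ?thesis ..
 qed
qed

text \<open>The rotations form a proper subgroup, and so does the group of order two generated by
  one reflection.\<close>

lemma generate_dihedral_small:
 assumes n: "n \<ge> 3" and gen: "generate (dihedral n) S = carrier (dihedral n)"
 shows "\<exists>s\<in>S. fst s" "\<not> (\<exists>r. S \<subseteq> {(False, 0), (True, r)})"
proof -
 let ?G = "dihedral n"
 interpret group ?G by (rule group_dihedral) (use n in simp)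
 have S: "S \<subseteq> carrier ?G" unfolding gen[symmetric] by (intro subsetI generate.incl)
 show "\<exists>s\<in>S. fst s"
 proof (rule ccontr)
  assume no: "\<not> ?thesis"
  have "\<not> fst x" if "x \<in> generate ?G S" for x using that
  proof (induction rule: generate.induct)
   case (inv h)
   then have "\<not> fst h" using no by blast
   then obtain l where l: "h = (False, l)" by (cases h) simp
   have "h \<in> carrier ?G" using S inv(1) by (rule subsetD)
   then have "inv\<^bsub>?G\<^esub> h \<otimes>\<^bsub>?G\<^esub> h = (False, 0)" using l_inv one_dihedral by metis
   then show ?case unfolding l by (cases "inv\<^bsub>?G\<^esub> (False, l)") (simp add: mult_dihedral)
  next
   case (eng h1 h2)
   then obtain a b where "h1 = (False, a)" "h2 = (False, b)" by (metis prod.collapse)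
   then show ?case by (simp add: mult_dihedral)
  qed (use no in \<open>auto simp: one_dihedral\<close>)
  moreover have "(True, 0) \<in> generate ?G S" unfolding gen using n by (simp add: carrier_dihedral)
  ultimately show False by fastforce
 qed
 show "\<not> (\<exists>r. S \<subseteq> {(False, 0), (True, r)})"
 proof
  assume "\<exists>r. S \<subseteq> {(False, 0), (True, r)}"
  then obtain r where r: "S \<subseteq> {(False, 0), (True, r)}" by blast
  then have Tr: "(True, r) \<in> S" using \<open>\<exists>s\<in>S. fst s\<close> by auto
  let ?H = "{(False, 0), (True, r)}"
  have rc: "(True, r) \<in> carrier ?G" using Tr S by blast
  have "(True, r) \<otimes>\<^bsub>?G\<^esub> (True, r) = \<one>\<^bsub>?G\<^esub>" by (simp add: mult_dihedral one_dihedral)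
  then have inv: "inv\<^bsub>?G\<^esub> (True, r) = (True, r)" using rc by (simp add: inv_equality)
  have "subgroup ?H ?G" using rc inv one_closed inv_one by (intro subgroup.intro) (auto simp: one_dihedral mult_dihedral carrier_dihedral)
  then have "carrier ?G \<subseteq> ?H" using generate_subgroup_incl[OF r] gen by blast
  moreover have "(True, 0) \<in> carrier ?G" "(True, 1) \<in> carrier ?G" using n by (auto simp: carrier_dihedral)
  ultimately have "(True, 0) \<in> ?H" "(True, 1) \<in> ?H" by blast+
  then show False by simp
 qed
qed

text \<open>By \<open>coloring_invariant\<close> a polygon is colored by the identity everywhere or
  nowhere, so erasing polygons removes exactly the identity colors. The colors left are not all
  equal, since otherwise the original ones would be the identity and one reflection, which do not
  generate \<open>D_n\<close>.\<close>

lemma epi_sublink: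
 assumes L: "is_link L" and x0: "x0 \<in> S3 - L" and n: "n \<ge> 3"
  and f: "f \<in> epi (fundamental_group (S3 - L) x0) (dihedral n)"
 shows "\<exists>M. sublink M L \<and> (two_tone_colorable n M \<or> fox_colorable n M)"
proof -
 let ?G = "dihedral n"
 have G: "group ?G" by (rule group_dihedral) (use n in simp)
 interpret group ?G by (rule G)
 obtain P where P: "diagram_of P L" by (rule link_has_diagram[OF L])
 have D: "diagram P" and iso: "ambient_isotopic (to_S3 ` link_set P) L" using P by (auto simp: diagram_of_def)
 interpret strands "link_set P" "out_dir P" "in_dir P" by (rule strands_diagram[OF D])
 obtain c where c: "coloring ?G c" "generate ?G (c ` link_set P) = carrier ?G" by (rule coloring_of_epi[OF G P x0 f])
 have cc: "c p \<in> carrier ?G" if "p \<in> link_set P" for p using c(1) that by (simp add: coloring_def)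
 define P' where "P' = {vs \<in> P. \<exists>p\<in>polygon_set vs. c p \<noteq> (False, 0)}"
 have S: "P' \<subseteq> P" by (auto simp: P'_def)
 have link: "link_set P' \<subseteq> link_set P" using S by (auto simp: link_set_def)
 have removed: "c p = (False, 0)" if "p \<in> link_set P" "p \<notin> link_set P'" for p using that unfolding link_set_def P'_def by blast
 have kept: "c p \<noteq> (False, 0)" if p: "p \<in> link_set P'" for p
 proof -
  obtain vs where vs: "vs \<in> P'" "p \<in> polygon_set vs" using p by (auto simp: link_set_def)
  then obtain q where q: "q \<in> polygon_set vs" "c q \<noteq> (False, 0)" by (auto simp: P'_def simp del: split_paired_Ex)
  have "vs \<noteq> []" using D vs(1) S simple_polygon_nonempty unfolding diagram_def polygonal_link_def by blast
  then have "(\<lambda>p. c p = \<one>\<^bsub>?G\<^esub>) constant_on polygon_set vs"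
  proof (intro coloring_invariant[OF c(1) connected_polygon_set, of vs "\<lambda>w. w = \<one>\<^bsub>?G\<^esub>"])
   show "polygon_set vs \<subseteq> link_set P" using vs(1) S by (auto simp: link_set_def)
   fix x w0 w1 assume "x \<in> carrier ?G" "w0 \<in> carrier ?G" "w1 \<in> carrier ?G" "x \<otimes>\<^bsub>?G\<^esub> w1 = w0 \<otimes>\<^bsub>?G\<^esub> x"
   then show "(w0 = \<one>\<^bsub>?G\<^esub>) = (w1 = \<one>\<^bsub>?G\<^esub>)" by (metis l_cancel_one r_cancel_one l_one r_one)
  qed
  then have "(c p = \<one>\<^bsub>?G\<^esub>) = (c q = \<one>\<^bsub>?G\<^esub>)" using vs(2) q(1) unfolding constant_on_def by metis
  then show ?thesis using q(2) unfolding one_dihedral by simp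
 qed
 have sub: "c ` link_set P \<subseteq> insert (False, 0) (c ` link_set P')" using removed by blast
 have "\<exists>s\<in>c ` link_set P. fst s" by (rule generate_dihedral_small(1)[OF n c(2)])
 then obtain p where p: "p \<in> link_set P" "fst (c p)" by blast
 have p': "p \<in> link_set P'" using removed[OF p(1)] p(2) by fastforce
 then have ne: "P' \<noteq> {}" by (auto simp: link_set_def)
 obtain M where M: "sublink M L" "diagram_of P' M" by (rule sublink_of_subset[OF D S ne iso])
 have c': "strands.coloring (link_set P') (out_dir P') ?G c" by (rule coloring_erase[OF G D S ne c(1)]) (simp add: removed one_dihedral)
 have "\<exists>p\<in>link_set P'. \<exists>q\<in>link_set P'. c p \<noteq> c q"
 proof (rule ccontr)
  assume "\<not> ?thesis"
  then have "c q = c p" if "q \<in> link_set P'" for q using p' that by metis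
  then have "c ` link_set P' \<subseteq> {c p}" by blast
  then have "c ` link_set P \<subseteq> {(False, 0), c p}" by (rule order_trans[OF sub insert_mono])
  moreover obtain r where "c p = (True, r)" using p(2) by (metis prod.collapse)
  ultimately have "c ` link_set P \<subseteq> {(False, 0), (True, r)}" by simp
  then show False using generate_dihedral_small(2)[OF n c(2)] by blast
 qed
 then have "two_tone_colorable n M \<or> fox_colorable n M" using p(2) p' kept n by (intro fox_or_two_tone[OF M(2) c']) auto
 then show ?thesis using M(1) by blast
qed

theorem corollary1p4:
  fixes L :: "(space \<times> real) set" and x0 :: "space \<times> real"
  assumes "is_link L" and "x0 \<in> S3 - L"
  shows "((\<exists>m. odd m \<and> 3 \<le> m \<and> two_tone_colorable m L) \<longrightarrow>
            (\<forall>n\<ge>3. \<exists>f. f \<in> epi (fundamental_group (S3 - L) x0) (dihedral n))) \<and>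
         (\<forall>n\<ge>3. (\<exists>f. f \<in> epi (fundamental_group (S3 - L) x0) (dihedral n)) \<longrightarrow>
            (\<exists>K. sublink K L \<and> (two_tone_colorable n K \<or> fox_colorable n K)))"
proof (intro conjI allI impI)
  fix n :: nat assume "\<exists>m. odd m \<and> 3 \<le> m \<and> two_tone_colorable m L" and n: "n \<ge> 3"
  then obtain m where "odd m" "3 \<le> m" "two_tone_colorable m L" by blast
  then show "\<exists>f. f \<in> epi (fundamental_group (S3 - L) x0) (dihedral n)"
    by (rule two_tone_epi) (use assms(2) n in auto)
next
  fix n :: nat assume n: "n \<ge> 3" and "\<exists>f. f \<in> epi (fundamental_group (S3 - L) x0) (dihedral n)"
  then obtain f where "f \<in> epi (fundamental_group (S3 - L) x0) (dihedral n)" by blast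
  then show "\<exists>K. sublink K L \<and> (two_tone_colorable n K \<or> fox_colorable n K)"
    by (rule epi_sublink[OF assms n])
qed

end
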